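(* The nonsymmetric topological operads $\mathcal Z$ and $\mathrm{As}_{S^1}\rtimes S^1$ are homotopy equivalent.
   Context: Nonsymmetric (ns) operads are given by partial compositions $\circ_i$; here components of arity $n\ge2$ are considered. Two ns topological operads are homotopy equivalent if they are connected by morphisms of ns operads that are homotopy equivalences in each arity. The operad $\mathrm{As}_{S^1}\rtimes S^1$. $\mathrm{As}_{S^1}(n)=(S^1)^{n-1}$ with $(m_1,\dots,m_{n_1-1})\circ_i(m_{n_1},\dots,m_{n_1+n_2-2})=(m_1,\dots,m_{i-1},m_{n_1},\dots,m_{n_1+n_2-2},m_i,\dots,m_{n_1-1})$. The group $S^1$ acts diagonally on each component. $(\mathrm{As}_{S^1}\rtimes S^1)(n)=\mathrm{As}_{S^1}(n)\times(S^1)^n$, with composition $\gamma((a,\underline g),(b_1,\underline h^1),\dots,(b_k,\underline h^k))=(\gamma_{\mathrm{As}_{S^1}}(a,g_1b_1,\dots,g_kb_k),g_1\underline h^1,\dots,g_k\underline h^k)$, where $g_i\underline h^i=(g_ih^i_1,\dots,g_ih^i_{n_i})$. Complex brick operad $\mathcal B_{\mathbb C}$. For $i$ in a finite totally ordered set $I$, $p(i),s(i)$ are the immediate predecessor and successor. $G(I)$ is the complex vector space with basis $e_{u,v}$, $(u,v)$ pairs of consecutive elements of $I$; $G(a,b)=G([a,b])\subset G(I)$. A point of $\mathcal B_{\mathbb C}(I)$ is a collection of subspaces $V_{i,j}\subset G(I)$ for all proper nonempty intervals $[i,j]\subsetneq I$ with $\dim V_{i,j}=\#[i,j]$; $V_{i,j}\subset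 V_{p(i),j}$ and $V_{i,j}\subset V_{i,s(j)}$ whenever the larger interval exists and is proper; $V_{\min I,j}=G(\min I,s(j))$; $V_{i,\max I}=G(p(i),\max I)$. For disjoint $I,J$ and $i\in I$, $I\sqcup_iJ$ is $(I\setminus\{i\})\sqcup J$ with $J$ inserted in place of $i$; $f\colon G(I)\oplus G(J)\to G(I\sqcup_iJ)$ is the linear isomorphism with $e_{p(i),i}\mapsto e_{p(i),\min J}$, $e_{i,s(i)}\mapsto e_{\max J,s(i)}$ and preserving the indices of other basis vectors. The composition $V^1\circ_{I,i}^JV^2$ has $(a,b)$-component: $f(V^1_{a,b})$ if $a,b\in I$, $a\le b<i$ or $i<a\le b$; $f(V^2_{a,b})$ if $a\le b$ in $J$, $(a,b)\ne(\min J,\max J)$; $f(V^1_{a,p(i)}\oplus G(\min J,s(b)))$ if $a\in I$, $a<i$, $b\in J$, $b<\max J$; $f(V^1_{s(i),b}\oplus G(p(a),\max J))$ if $a\in J$, $a>\min J$, $b\in I$, $i<b$; $f(V^1_{i,i}\oplus G(J))$ if $(a,b)=(\min J,\max J)$; $f(V^1_{a,i}\oplus G(J))$ if $a\in I$, $a<i$, $b=\max J$; $f(V^1_{i,b}\oplus G(J))$ if $b\in I$, $b>i$, $a=\min J$; $f(V^1_{a,b}\oplus G(J))$ if $a,b\in I$, $a<i<b$. The operad $\mathcal Z$. Let $\underline n=\{1<\dots<n\}$, and put $V_{l,r}=0$ if $l>r$. For $1\le l<r\le n$, $(l,r)\neq(1,n)$, let $D_{l,r}\subset\mathcal B_{\mathbb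 C}(\underline n)$ be the divisor of all $\{V_{i,j}\}$ with $V_{l,l}=G(l,l+1)$ and $V_{r,r}=G(r-1,r)$. The $D_{l,r}$ are the components of the boundary divisor, which has normal crossings; the normal bundle of $D_{l,r}$ is $(V_{l,r}/G(l,r))\otimes(G(l,r)/V_{l+1,r-1})^*$. Let $\mathcal B^{\mathrm{or}}(\underline n)$ be the real oriented blow-up of $\mathcal B_{\mathbb C}(\underline n)$ along the boundary divisor (pointwise: along each $D_{l,r}$ one additionally chooses a unit vector in its normal bundle). $\mathcal Z(\underline n)$ is the total space of the $(S^1)^{n+1}$-bundle over $\mathcal B^{\mathrm{or}}(\underline n)$ given by additionally choosing unit vectors in each of the complex lines $V_{1,1},\dots,V_{n,n}$ and $(G(\underline n)/V_{2,n-1})^*$. The composition $\circ_{I,i}^J\colon\mathcal Z(I)\times\mathcal Z(J)\to\mathcal Z(I\sqcup_iJ)$ is the composition of $\mathcal B_{\mathbb C}$ on underlying points; the tensor product of the chosen unit vectors in $V^1_{i,i}$ and $(G(J)/V^2_{s(\min J),p(\max J)})^*$ gives the unit normal vector to the divisor which contains the image; all the other unit vectors are canonically identified with the corresponding ones for $I\sqcup_iJ$.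
   Formalization: D_{l,r} is taken to be the actual boundary component: V_{l,k}=G(l,k+1) for l≤k<r and V_{k,r}=G(k-1,r) for l<k≤r; the two stated equations alone give a reducible set (for n=4, D_{1,3} and D_{2,4} would both contain D_{2,3}), contradicting "components" with normal crossings. *)

theory Defs
  imports "HOL-Analysis.Analysis" "HOL-Library.Function_Algebras"
begin

section \<open>Nonsymmetric topological operads concentrated in arities at least two\<close>

text \<open>
  \<open>pcomp P n m i x y\<close> is $x \circ_i y$ for $x$ of arity $n$ and $y$ of arity $m$. Only the components
  of arity at least two are part of the structure, so there is no unit.
\<close>

record 'a ns_operad =
  component :: "nat \<Rightarrow> 'a topology"
  pcomp :: "nat \<Rightarrow> nat \<Rightarrow> nat \<Rightarrow> 'a \<Rightarrow> 'a \<Rightarrow> 'a"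

definition ns_top_operad :: "'a ns_operad \<Rightarrow> bool" where
  "ns_top_operad P \<longleftrightarrow>
     (\<forall>n\<ge>2. \<forall>m\<ge>2. \<forall>i\<in>{1..n}.
        continuous_map (prod_topology (component P n) (component P m)) (component P (n + m - 1))
          (\<lambda>(x, y). pcomp P n m i x y)) \<and>
     (\<forall>l\<ge>2. \<forall>m\<ge>2. \<forall>n\<ge>2. \<forall>x\<in>topspace (component P l). \<forall>y\<in>topspace (component P m).
        \<forall>z\<in>topspace (component P n).
        (\<forall>i\<in>{1..l}. \<forall>j\<in>{1..m}.
           pcomp P (l + m - 1) n (i + j - 1) (pcomp P l m i x y) z =
           pcomp P l (m + n - 1) i x (pcomp P m n j y z)) \<and>
        (\<forall>i\<in>{1..l}. \<forall>k\<in>{i<..l}.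
           pcomp P (l + m - 1) n (k + m - 1) (pcomp P l m i x y) z =
           pcomp P (l + n - 1) m i (pcomp P l n k x z) y))"

definition ns_operad_morphism ::
    "'a ns_operad \<Rightarrow> 'b ns_operad \<Rightarrow> (nat \<Rightarrow> 'a \<Rightarrow> 'b) \<Rightarrow> bool" where
  "ns_operad_morphism P Q f \<longleftrightarrow>
     (\<forall>n\<ge>2. continuous_map (component P n) (component Q n) (f n)) \<and>
     (\<forall>n\<ge>2. \<forall>m\<ge>2. \<forall>i\<in>{1..n}. \<forall>x\<in>topspace (component P n). \<forall>y\<in>topspace (component P m).
        f (n + m - 1) (pcomp P n m i x y) = pcomp Q n m i (f n x) (f m y))"

definition homotopy_equivalence_map :: "'a topology \<Rightarrow> 'b topology \<Rightarrow> ('a \<Rightarrow> 'b) \<Rightarrow> bool" where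
  "homotopy_equivalence_map X Y f \<longleftrightarrow> continuous_map X Y f \<and>
     (\<exists>g. continuous_map Y X g \<and> homotopic_with (\<lambda>_. True) X X (g \<circ> f) id \<and>
          homotopic_with (\<lambda>_. True) Y Y (f \<circ> g) id)"

definition ns_operad_weq :: "'a ns_operad \<Rightarrow> 'b ns_operad \<Rightarrow> bool" where
  "ns_operad_weq P Q \<longleftrightarrow> ns_top_operad P \<and> ns_top_operad Q \<and>
     (\<exists>f. ns_operad_morphism P Q f \<and>
          (\<forall>n\<ge>2. homotopy_equivalence_map (component P n) (component Q n) (f n)))"

text \<open>
  Two operads are homotopy equivalent if a zigzag of morphisms as above connects them. HOL cannot
  quantify over the types of the intermediate operads; they are taken on the two types at hand.
\<close>

fun ns_operad_weq_step :: "'a ns_operad + 'b ns_operad \<Rightarrow> 'a ns_operad + 'b ns_operad \<Rightarrow> bool" where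
  "ns_operad_weq_step (Inl P) (Inl Q) = ns_operad_weq P Q"
| "ns_operad_weq_step (Inl P) (Inr Q) = ns_operad_weq P Q"
| "ns_operad_weq_step (Inr P) (Inl Q) = ns_operad_weq P Q"
| "ns_operad_weq_step (Inr P) (Inr Q) = ns_operad_weq P Q"

definition homotopy_equivalent_ns_operads :: "'a ns_operad \<Rightarrow> 'b ns_operad \<Rightarrow> bool" where
  "homotopy_equivalent_ns_operads P Q \<longleftrightarrow> ns_top_operad P \<and> ns_top_operad Q \<and>
     equivclp ns_operad_weq_step (Inl P) (Inr Q)"


section \<open>The operad \<open>As\<close> of the circle and its semidirect product with the circle\<close>

definition circle :: "complex topology" where
  "circle = top_of_set (sphere 0 1)"

definition As_S1 :: "(nat \<Rightarrow> complex) ns_operad" where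
  "As_S1 =
    \<lparr>component = (\<lambda>n. product_topology (\<lambda>_. circle) {1..<n}),
     pcomp = (\<lambda>n m i a b. \<lambda>k\<in>{1..<n + m - 1}.
       if k < i then a k else if k < i + m - 1 then b (k - i + 1) else a (k - (m - 1)))\<rparr>"

definition diagonal_action :: "nat \<Rightarrow> complex \<Rightarrow> (nat \<Rightarrow> complex) \<Rightarrow> nat \<Rightarrow> complex" where
  "diagonal_action n g b = (\<lambda>k\<in>{1..<n}. g * b k)"

text \<open>
  The partial composition $(a,g)\circ_i(b,h)$ is the total composition in which every input of
  $(a,g)$ except the $i$-th receives the unit.
\<close>

definition semidirect_S1 ::
    "(nat \<Rightarrow> complex \<Rightarrow> 'a \<Rightarrow> 'a) \<Rightarrow> 'a ns_operad \<Rightarrow> ('a \<times> (nat \<Rightarrow> complex)) ns_operad" where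
  "semidirect_S1 act P =
    \<lparr>component = (\<lambda>n. prod_topology (component P n) (product_topology (\<lambda>_. circle) {1..n})),
     pcomp = (\<lambda>n m i (a, g) (b, h).
       (pcomp P n m i a (act m (g i) b),
        \<lambda>k\<in>{1..n + m - 1}.
          if k < i then g k else if k < i + m then g i * h (k - i + 1) else g (k - (m - 1))))\<rparr>"

definition As_S1_semidirect_S1 :: "((nat \<Rightarrow> complex) \<times> (nat \<Rightarrow> complex)) ns_operad" where
  "As_S1_semidirect_S1 = semidirect_S1 diagonal_action As_S1"


section \<open>Complex subspaces, unit vectors in quotient lines and in their duals\<close>

text \<open>
  The vector $e_{k,k+1}$ is the $k$-th unit vector of \<open>nat \<Rightarrow> complex\<close>. All spaces $G(a,b)$ carry the
  Hermitian inner product for which these vectors are orthonormal.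
\<close>

type_synonym cvec = "nat \<Rightarrow> complex"
type_synonym cmat = "nat \<Rightarrow> nat \<Rightarrow> complex"

global_interpretation cvec: vector_space "(\<lambda>c x k. c * x k) :: complex \<Rightarrow> cvec \<Rightarrow> cvec"
  by unfold_locales (auto simp: fun_eq_iff algebra_simps)

definition G :: "nat \<Rightarrow> nat \<Rightarrow> cvec set" where
  "G a b = {x. \<forall>k. k \<notin> {a..<b} \<longrightarrow> x k = 0}"

definition hdot :: "cvec \<Rightarrow> cvec \<Rightarrow> complex" where
  "hdot x y = (\<Sum>k | x k \<noteq> 0. cnj (x k) * y k)"

text \<open>For $U \subseteq W$, the quotient $W/U$ is represented by the orthogonal complement of $U$ in $W$,
  and $(W/U)^*$ by the functionals that vanish on $U$ and on the orthogonal complement of $W$;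
  the covector \<open>c\<close> is the functional $x \mapsto \sum_k c_k x_k$.\<close>

definition unit_quot :: "cvec set \<Rightarrow> cvec set \<Rightarrow> cvec set" where
  "unit_quot W U = {w \<in> W. (\<forall>x\<in>U. hdot x w = 0) \<and> hdot w w = 1}"

definition unit_quot_dual :: "cvec set \<Rightarrow> cvec set \<Rightarrow> cvec set" where
  "unit_quot_dual W U = (\<lambda>w k. cnj (w k)) ` unit_quot W U"

definition tensor :: "cvec \<Rightarrow> cvec \<Rightarrow> cmat" where
  "tensor w c = (\<lambda>a b. w a * c b)"

definition unit_tensors :: "cvec set \<Rightarrow> cvec set \<Rightarrow> cmat set" where
  "unit_tensors A C = {tensor w c | w c. w \<in> A \<and> c \<in> C}"

definition mat_apply :: "cmat \<Rightarrow> cvec \<Rightarrow> cvec" where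
  "mat_apply u x = (\<lambda>a. \<Sum>b | x b \<noteq> 0. u a b * x b)"

definition orth_proj :: "cvec set \<Rightarrow> cvec \<Rightarrow> cvec" where
  "orth_proj W x = (THE y. y \<in> W \<and> (\<forall>w\<in>W. hdot w (\<lambda>k. x k - y k) = 0))"

text \<open>Grassmannians are topologised by identifying a subspace with the matrix of its orthogonal
  projection.\<close>

definition proj_mat :: "cvec set \<Rightarrow> cmat" where
  "proj_mat W = (\<lambda>a b. orth_proj W (\<lambda>k. if k = b then 1 else 0) a)"


section \<open>Complex brick manifolds\<close>

definition proper_interval :: "nat \<Rightarrow> nat \<Rightarrow> nat \<Rightarrow> bool" where
  "proper_interval n i j \<longleftrightarrow> 1 \<le> i \<and> i \<le> j \<and> j \<le> n \<and> (i, j) \<noteq> (1, n)"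

type_synonym brick = "nat \<Rightarrow> nat \<Rightarrow> cvec set"

text \<open>The value \<open>{0}\<close> outside of the proper intervals incorporates the convention $V_{l,r} = 0$ for
  $l > r$; at all other places it only makes the family a function of the data.\<close>

definition brick_manifold :: "nat \<Rightarrow> brick set" where
  "brick_manifold n = {V.
     (\<forall>i j. proper_interval n i j \<longrightarrow>
        V i j \<subseteq> G 1 n \<and> cvec.subspace (V i j) \<and> cvec.dim (V i j) = j - i + 1) \<and>
     (\<forall>i j. proper_interval n i j \<and> proper_interval n (i - 1) j \<longrightarrow> V i j \<subseteq> V (i - 1) j) \<and>
     (\<forall>i j. proper_interval n i j \<and> proper_interval n i (j + 1) \<longrightarrow> V i j \<subseteq> V i (j + 1)) \<and>
     (\<forall>j. proper_interval n 1 j \<longrightarrow> V 1 j = G 1 (j + 1)) \<and>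
     (\<forall>i. proper_interval n i n \<longrightarrow> V i n = G (i - 1) n) \<and>
     (\<forall>i j. \<not> proper_interval n i j \<longrightarrow> V i j = {0})}"

text \<open>
  The set \<open>I \<squnion>\<^sub>i J\<close> for \<open>I = {1..n}\<close> and \<open>J = {1..m}\<close> is renumbered as \<open>{1..n + m - 1}\<close>: the elements
  of \<open>J\<close> are at the places \<open>i, \<dots>, i + m - 1\<close> and an element \<open>a > i\<close> of \<open>I\<close> is at the place \<open>a + m - 1\<close>.
  \<open>ins_left i m\<close> and \<open>ins_right i m\<close> are the restrictions of the isomorphism $f$ to $G(I)$ and $G(J)$.
\<close>

definition ins_left :: "nat \<Rightarrow> nat \<Rightarrow> cvec \<Rightarrow> cvec" where
  "ins_left i m x = (\<lambda>k. if k < i then x k else if k < i + m - 1 then 0 else x (k - (m - 1)))"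

definition ins_right :: "nat \<Rightarrow> nat \<Rightarrow> cvec \<Rightarrow> cvec" where
  "ins_right i m y = (\<lambda>k. if i \<le> k \<and> k < i + m - 1 then y (k - i + 1) else 0)"

definition ins_sum :: "nat \<Rightarrow> nat \<Rightarrow> cvec set \<Rightarrow> cvec set \<Rightarrow> cvec set" where
  "ins_sum i m A B = {\<lambda>k. ins_left i m x k + ins_right i m y k | x y. x \<in> A \<and> y \<in> B}"

definition brick_comp :: "nat \<Rightarrow> nat \<Rightarrow> nat \<Rightarrow> brick \<Rightarrow> brick \<Rightarrow> brick" where
  "brick_comp n m i V W = (\<lambda>a b.
     let M = i + m - 1;                \<comment> \<open>the place of \<open>max J\<close>\<close>
         up = (\<lambda>c. c - (m - 1));       \<comment> \<open>from the places above \<open>M\<close> to \<open>I\<close>\<close>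
         loc = (\<lambda>c. c - i + 1)         \<comment> \<open>from the places of \<open>J\<close> to \<open>J\<close>\<close>
     in if \<not> proper_interval (n + m - 1) a b then {0}
        else if b < i then ins_left i m ` V a b
        else if M < a then ins_left i m ` V (up a) (up b)
        else if a = i \<and> b = M then ins_sum i m (V i i) (G 1 m)
        else if i \<le> a \<and> b \<le> M then ins_right i m ` W (loc a) (loc b)
        else if a < i \<and> b < M then ins_sum i m (V a (i - 1)) (G 1 (loc b + 1))
        else if i < a then ins_sum i m (V (i + 1) (up b)) (G (loc a - 1) m)
        else if a < i \<and> b = M then ins_sum i m (V a i) (G 1 m)
        else if a = i then ins_sum i m (V i (up b)) (G 1 m)
        else ins_sum i m (V a (up b)) (G 1 m))"


section \<open>Boundary divisors and the real oriented blow-up\<close>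

definition divisor_index :: "nat \<Rightarrow> nat \<Rightarrow> nat \<Rightarrow> bool" where
  "divisor_index n l r \<longleftrightarrow> 1 \<le> l \<and> l < r \<and> r \<le> n \<and> (l, r) \<noteq> (1, n)"

text \<open>
  For \<open>k = l\<close> in the first and \<open>k = r\<close> in the second condition one obtains $V_{l,l} = G(l,l+1)$ and
  $V_{r,r} = G(r-1,r)$, which hold on the divisor and give all of it if \<open>r = l + 1\<close>. They do not suffice
  in general: for \<open>n = 4\<close>, \<open>(l, r) = (2, 4)\<close> they also hold on the whole divisor for \<open>(2, 3)\<close>. The
  remaining conditions select the irreducible component of the boundary, which is the image of
  the composition $\circ_l$ of arities \<open>n - (r - l)\<close> and \<open>r - l + 1\<close>.
\<close>

definition brick_divisor :: "nat \<Rightarrow> nat \<Rightarrow> nat \<Rightarrow> brick set" where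
  "brick_divisor n l r = {V \<in> brick_manifold n.
     (\<forall>k. l \<le> k \<and> k < r \<longrightarrow> V l k = G l (k + 1)) \<and>
     (\<forall>k. l < k \<and> k \<le> r \<longrightarrow> V k r = G (k - 1) r)}"

definition unit_normals :: "brick \<Rightarrow> nat \<Rightarrow> nat \<Rightarrow> cmat set" where
  "unit_normals V l r =
     unit_tensors (unit_quot (V l r) (G l r)) (unit_quot_dual (G l r) (V (l + 1) (r - 1)))"

text \<open>
  The divisor \<open>brick_divisor n l r\<close> is the zero locus of the section of the line bundle
  $\mathrm{Hom}(V_{l,r-1}/V_{l+1,r-1}, V_{l,r}/V_{l+1,r})$ given by the map $s$ induced by the inclusion
  $V_{l,r-1} \subseteq V_{l,r}$. On the divisor $V_{l,r-1} = G(l,r) = V_{l+1,r}$, so that the bundle restricts to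
  the normal bundle. The oriented blow-up along the divisor is therefore the closed set of all \<open>(V, u)\<close>
  with \<open>u\<close> in the unit circle bundle and $s \in \mathbb{R}_{\ge 0} u$: over the divisor \<open>u\<close> is an arbitrary
  unit normal vector, and elsewhere \<open>u = section_direction V l r\<close>.
\<close>

definition section_direction :: "brick \<Rightarrow> nat \<Rightarrow> nat \<Rightarrow> cmat" where
  "section_direction V l r = (THE u.
     u \<in> unit_tensors (unit_quot (V l r) (V (l + 1) r))
                      (unit_quot_dual (V l (r - 1)) (V (l + 1) (r - 1))) \<and>
     (\<exists>t>0. \<forall>x\<in>V l (r - 1). (\<lambda>k. x k - complex_of_real t * mat_apply u x k) \<in> V (l + 1) r))"


section \<open>The operad \<open>\<Z>\<close>\<close>

text \<open>
  A point is a quadruple \<open>(V, u, v, \<phi>)\<close>: \<open>u l r\<close> is the direction for the divisor \<open>(l, r)\<close>, \<open>v k\<close> is the unit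
  vector of $V_{k,k}$, and \<open>\<phi>\<close> is the unit vector of $(G(\underline n)/V_{2,n-1})^*$.
\<close>

type_synonym zpoint = "brick \<times> (nat \<Rightarrow> nat \<Rightarrow> cmat) \<times> (nat \<Rightarrow> cvec) \<times> cvec"

definition Z_points :: "nat \<Rightarrow> zpoint set" where
  "Z_points n = {(V, u, v, \<phi>). V \<in> brick_manifold n \<and>
     (\<forall>l r. if \<not> divisor_index n l r then u l r = 0
            else if V \<in> brick_divisor n l r then u l r \<in> unit_normals V l r
            else u l r = section_direction V l r) \<and>
     (\<forall>k. if k \<in> {1..n} then v k \<in> unit_quot (V k k) {0} else v k = 0) \<and>
     \<phi> \<in> unit_quot_dual (G 1 n) (V 2 (n - 1))}"

definition Z_coords ::
    "zpoint \<Rightarrow> (nat \<Rightarrow> nat \<Rightarrow> cmat) \<times> (nat \<Rightarrow> nat \<Rightarrow> cmat) \<times> (nat \<Rightarrow> cvec) \<times> cvec" where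
  "Z_coords = (\<lambda>(V, u, v, \<phi>). (\<lambda>i j. proj_mat (V i j), u, v, \<phi>))"

definition Z_space :: "nat \<Rightarrow> zpoint topology" where
  "Z_space n = pullback_topology (Z_points n) Z_coords euclidean"

definition map_tensor :: "(cvec \<Rightarrow> cvec) \<Rightarrow> cmat \<Rightarrow> cmat" where
  "map_tensor f u = (\<lambda>a b. f (\<lambda>a'. f (\<lambda>b'. u a' b') b) a)"

text \<open>
  For a pair \<open>(l, r)\<close> that comes neither from \<open>I\<close> nor from \<open>J\<close> (the last case for \<open>u\<close>), the composite
  is never in the divisor, so that the direction is determined by the underlying point.
\<close>

definition Z_comp :: "nat \<Rightarrow> nat \<Rightarrow> nat \<Rightarrow> zpoint \<Rightarrow> zpoint \<Rightarrow> zpoint" where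
  "Z_comp n m i = (\<lambda>(V1, u1, v1, \<phi>1) (V2, u2, v2, \<phi>2).
     let M = i + m - 1;
         loc = (\<lambda>c. c - i + 1);
         red = (\<lambda>c. if c < i then c else if c \<le> M then i else c - (m - 1));
         V = brick_comp n m i V1 V2
     in (V,
         \<lambda>l r. if \<not> divisor_index (n + m - 1) l r then 0
           else if l = i \<and> r = M then tensor (ins_left i m (v1 i)) (ins_right i m \<phi>2)
           else if i \<le> l \<and> r \<le> M then map_tensor (ins_right i m) (u2 (loc l) (loc r))
           else if (l \<le> i \<or> M < l) \<and> (r < i \<or> M \<le> r)
             then map_tensor (ins_left i m) (u1 (red l) (red r))
           else section_direction V l r,
         \<lambda>k. if k < i then ins_left i m (v1 k)
           else if k \<le> M then ins_right i m (v2 (loc k))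
           else ins_left i m (v1 (k - (m - 1))),
         ins_left i m \<phi>1))"

definition Z_operad :: "zpoint ns_operad" where
  "Z_operad = \<lparr>component = Z_space, pcomp = Z_comp\<rparr>"

end

theory Submission
  imports Defs
begin

text \<open>
  A point of the brick manifold is given by unit functionals c(p,q) with kernel V(p+1,q), supported
  on the coordinates p, ..., q - 1 and q, where 0 and n are the two boundary coordinates. The inclusions
  between the subspaces say that the restrictions of c(p,q) to the two maximal subintervals are multiples
  of c(p+1,q) and c(p,q-1). Explicit unit vectors \<open>wvec\<close> of V(p+1,q) orthogonal to V(p+2,q) trivialize
  all lines that occur in the blow-up. After a change of the phases of the c(p,q), which is unique once
  the top functional is the prescribed one, the unit normal vectors are the tensor products of these
  vectors, and the coefficients of proportionality become nonnegative. Then the k-th coordinates of all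
  c(p,q) have the same phase a(k), and only their absolute values, a compatible family of
  nonnegative unit vectors on the intervals in \<open>{1..n - 1}\<close>, remain. With K(n - 1) denoting the compact
  space of these families, Z(n) is homeomorphic to the product of K(n - 1), the torus of the a(k), and the
  torus given by the vectors v(k). In these coordinates the composition of Z is the composition of the
  semidirect product on the tori and a restriction or collapse of intervals on K. Hence the
  projection to the tori is a morphism of operads, and it remains to contract K: K(N + 1) is homeomorphic
  to \<open>K(N) \<times> [0, N]\<close>, where the second coordinate is the sum over i of the squared last entries of the
  vectors on the intervals \<open>{i..N + 1}\<close> with \<open>i \<le> N\<close>.
\<close>

section \<open>Covectors and hyperplanes\<close>

text \<open>The phases can be normalized because the counts agree: there are as many intervals
  \<open>1 \<le> p \<le> q \<le> n - 1\<close>, each with one free phase, as there are boundary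
  divisors together with the one top functional. The normalization is useful because the section
  that cuts out a divisor becomes a single number, \<open>overlap\<close>, once the quotient lines
  are trivialized by \<open>wvec\<close>, and this number links the proportionality factors of
  neighbouring intervals. Hence nonnegativity of all \<open>overlap\<close>s, which is what the
  normalized unit normal vectors say, spreads from the boundary rows, where the factors are known,
  to every interval. The circle action in the semidirect product originates at the node of a
  composition. The unit normal vector there is the tensor of \<open>v i\<close> and the top covector
  of the inserted point, so a rotation of \<open>v i\<close> rotates it, and after normalization
  this rotation has to be carried by all phases of the inserted block. Both homeomorphisms are
  continuous bijections from compact to Hausdorff spaces; thus neither the normalization of phases
  nor the reconstruction of a family has to be written as a continuous function.\<close>

definition axis_vec :: "nat \<Rightarrow> cvec" where
  "axis_vec j = (\<lambda>k. if k = j then 1 else 0)"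

lemma axis_vec_in_G: "p \<le> j \<Longrightarrow> j < r \<Longrightarrow> axis_vec j \<in> G p r"
  by (auto simp: axis_vec_def G_def)

lemma subspace_G: "cvec.subspace (G p r)"
  by (auto simp: cvec.subspace_def G_def)

lemma sum_cvec_apply: "(\<Sum>j\<in>A. (f j :: cvec)) k = (\<Sum>j\<in>A. f j k)"
  by (induction A rule: infinite_finite_induct) auto

lemma cvec_expansion: "x \<in> G p r \<Longrightarrow> x = (\<Sum>j\<in>{p..<r}. (\<lambda>k. x j * axis_vec j k))"
  by (rule ext) (auto simp: sum_cvec_apply axis_vec_def G_def if_distrib[of "\<lambda>t. _ * t"] sum.delta cong: if_cong)

lemma G_subset_span: "G p r \<subseteq> cvec.span (axis_vec ` {p..<r})"
proof
  fix x assume "x \<in> G p r"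
  have "(\<Sum>j\<in>{p..<r}. (\<lambda>k. x j * axis_vec j k)) \<in> cvec.span (axis_vec ` {p..<r})"
    by (intro cvec.span_sum cvec.span_scale cvec.span_base imageI)
  then show "x \<in> cvec.span (axis_vec ` {p..<r})"
    using cvec_expansion[OF \<open>x \<in> G p r\<close>] by simp
qed

lemma inj_axis_vec: "inj axis_vec"
proof (rule injI)
  fix i j assume "axis_vec i = axis_vec j"
  then have "axis_vec i i = axis_vec j i" by simp
  then show "i = j" by (simp add: axis_vec_def split: if_splits)
qed

text \<open>Evaluation at the coordinate \<open>j\<close> isolates the coefficient of
  \<open>b j\<close> in a linear relation, since on \<open>A\<close> the family is dual to the
  coordinates.\<close>

lemma independent_triangular:
  assumes "finite A" and "\<And>j. j \<in> A \<Longrightarrow> b j j = 1"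
    and "\<And>j k. j \<in> A \<Longrightarrow> k \<in> A \<Longrightarrow> j \<noteq> k \<Longrightarrow> b j k = 0"
  shows "cvec.independent (b ` A)" "card (b ` A) = card A"
proof -
  have inj: "inj_on b A"
  proof (rule inj_onI)
    fix i j assume "i \<in> A" "j \<in> A" "b i = b j"
    then show "i = j" using assms(2)[of i] assms(3)[of j i] by auto
  qed
  show "card (b ` A) = card A" using inj by (rule card_image)
  show "cvec.independent (b ` A)"
  proof (rule cvec.independent_if_scalars_zero)
    show "finite (b ` A)" using assms(1) by simp
    fix f x assume s: "(\<Sum>x\<in>b ` A. (\<lambda>k. f x * x k)) = 0" and "x \<in> b ` A"
    then obtain j where j: "j \<in> A" "x = b j" by blast
    have "0 = (\<Sum>x\<in>b ` A. (\<lambda>k. f x * x k)) j" by (simp add: s)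
    also have "\<dots> = (\<Sum>i\<in>A. f (b i) * b i j)"
      by (simp add: sum_cvec_apply sum.reindex[OF inj])
    also have "\<dots> = (\<Sum>i\<in>A. if i = j then f (b j) else 0)"
      using assms j by (intro sum.cong) auto
    finally show "f x = 0" using j assms(1) by simp
  qed
qed

lemma independent_axis_vecs: "cvec.independent (axis_vec ` {p..<r})"
  by (rule independent_triangular) (auto simp: axis_vec_def)

lemma dim_G: "cvec.dim (G p r) = r - p"
proof -
  have "card (axis_vec ` {p..<r}) = cvec.dim (G p r)"
    by (rule cvec.basis_card_eq_dim) (auto simp: axis_vec_in_G G_subset_span independent_axis_vecs)
  then show ?thesis using card_image[OF inj_on_subset[OF inj_axis_vec subset_UNIV], of "{p..<r}"] by simp
qed

lemma hdot_eq_sum: "finite A \<Longrightarrow> (\<And>k. k \<notin> A \<Longrightarrow> x k = 0) \<Longrightarrow> hdot x y = (\<Sum>k\<in>A. cnj (x k) * y k)"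
  unfolding hdot_def by (rule sum.mono_neutral_left) auto

lemma hdot_G: "x \<in> G p (Suc q) \<Longrightarrow> hdot x y = (\<Sum>k=p..q. cnj (x k) * y k)"
  by (rule hdot_eq_sum) (auto simp: G_def)

lemma mat_apply_eq_sum:
  "finite A \<Longrightarrow> (\<And>k. k \<notin> A \<Longrightarrow> x k = 0) \<Longrightarrow> mat_apply u x = (\<lambda>a. \<Sum>b\<in>A. u a b * x b)"
  unfolding mat_apply_def by (rule ext, rule sum.mono_neutral_left) auto

lemma hdot_self_G_eq_0: "x \<in> G p (Suc q) \<Longrightarrow> hdot x x = 0 \<longleftrightarrow> x = 0"
proof
  assume x: "x \<in> G p (Suc q)" and "hdot x x = 0"
  then have "(\<Sum>k=p..q. complex_of_real ((cmod (x k))\<^sup>2)) = 0"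
    unfolding hdot_G[OF x] by (simp only: complex_norm_square mult.commute)
  then have "(\<Sum>k=p..q. (cmod (x k))\<^sup>2) = 0"
    by (metis of_real_sum of_real_eq_0_iff)
  then have "\<forall>k\<in>{p..q}. x k = 0" by (simp add: sum_nonneg_eq_0_iff)
  then show "x = 0" using x by (fastforce simp: G_def fun_eq_iff)
qed (simp add: hdot_def)

section \<open>Hyperplanes of unit covectors and their orthogonal projections\<close>

definition unit_covec :: "nat \<Rightarrow> nat \<Rightarrow> cvec \<Rightarrow> bool" where
  "unit_covec p q c \<longleftrightarrow> c \<in> G p (Suc q) \<and> (\<Sum>k=p..q. c k * cnj (c k)) = 1"

text \<open>The pairing is bilinear and not Hermitian, as for a functional. The normal vector is
  therefore the complex conjugate of \<open>c\<close>, which explains the conjugates in all formulas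
  below.\<close>

definition hyperplane :: "nat \<Rightarrow> nat \<Rightarrow> cvec \<Rightarrow> cvec set" where
  "hyperplane p q c = {x \<in> G p (Suc q). (\<Sum>k=p..q. c k * x k) = 0}"

lemma unit_covec_nonzero: "unit_covec p q c \<Longrightarrow> \<exists>k\<in>{p..q}. c k \<noteq> 0"
  unfolding unit_covec_def by (metis (no_types, lifting) mult_zero_left sum.neutral zero_neq_one)

lemma subspace_hyperplane: "cvec.subspace (hyperplane p q c)"
  unfolding cvec.subspace_def hyperplane_def G_def
  by (auto simp: sum.distrib distrib_left sum_distrib_left[symmetric] mult.left_commute)

lemma hyperplane_subset_G: "hyperplane p q c \<subseteq> G p (Suc q)"
  by (auto simp: hyperplane_def)

text \<open>For a coordinate \<open>j\<close> with \<open>c j \<noteq> 0\<close>, the equation can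
  be solved for the \<open>j\<close>-th entry. The vectors \<open>b i\<close> with
  \<open>i \<noteq> j\<close>, which are \<open>axis_vec i\<close> corrected at \<open>j\<close>,
  then form a basis.\<close>

lemma dim_hyperplane:
  assumes "unit_covec p q c" shows "cvec.dim (hyperplane p q c) = q - p"
proof -
  obtain j where j: "j \<in> {p..q}" "c j \<noteq> 0" using unit_covec_nonzero[OF assms] by blast
  define b where "b i = (\<lambda>k. if k = i then 1 else if k = j then - c i / c j else 0)" for i
  define A where "A = {p..q} - {j}"
  have fA: "finite A" by (simp add: A_def)
  have ind: "cvec.independent (b ` A)" "card (b ` A) = card A"
    by (rule independent_triangular; auto simp: A_def b_def)+
  have sub: "b ` A \<subseteq> hyperplane p q c"
  proof clarify
    fix i assume i: "i \<in> A"
    have "(\<Sum>k=p..q. c k * b i k) = (\<Sum>k\<in>{i,j}. c k * b i k)"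
      using i j by (intro sum.mono_neutral_right) (auto simp: A_def b_def)
    also have "\<dots> = 0" using i j by (auto simp: A_def b_def)
    finally show "b i \<in> hyperplane p q c"
      using i j by (auto simp: hyperplane_def G_def b_def A_def)
  qed
  have "hyperplane p q c \<subseteq> cvec.span (b ` A)"
  proof
    fix x assume x: "x \<in> hyperplane p q c"
    have "x = (\<Sum>i\<in>A. (\<lambda>k. x i * b i k))"
    proof
      fix k
      have s: "c j * x j + (\<Sum>i\<in>A. c i * x i) = 0"
        using x j by (simp add: hyperplane_def A_def sum.remove[of _ j])
      show "x k = (\<Sum>i\<in>A. (\<lambda>k. x i * b i k)) k"
      proof (cases "k = j")
        case True
        have "(\<Sum>i\<in>A. x i * b i j) = (\<Sum>i\<in>A. - (c i * x i) / c j)"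
          by (intro sum.cong) (auto simp: A_def b_def)
        also have "\<dots> = - (\<Sum>i\<in>A. c i * x i) / c j"
          by (simp add: sum_divide_distrib sum_negf)
        also have "\<dots> = x j" using s j by (simp add: field_simps add_eq_0_iff)
        finally show ?thesis using True by (simp add: sum_cvec_apply)
      next
        case False
        have "(\<Sum>i\<in>A. x i * b i k) = (\<Sum>i\<in>A. if i = k then x k else 0)"
          using False by (intro sum.cong) (auto simp: b_def)
        also have "\<dots> = x k" using False x fA by (auto simp: A_def hyperplane_def G_def)
        finally show ?thesis by (simp add: sum_cvec_apply)
      qed
    qed
    moreover have "(\<Sum>i\<in>A. (\<lambda>k. x i * b i k)) \<in> cvec.span (b ` A)"
      by (intro cvec.span_sum cvec.span_scale cvec.span_base imageI)
    ultimately show "x \<in> cvec.span (b ` A)" by simp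
  qed
  from cvec.basis_card_eq_dim[OF sub this ind(1)] ind(2) j show ?thesis by (simp add: A_def)
qed

text \<open>By codimension one, if \<open>axis_vec j\<close> is outside \<open>V\<close>, then every
  \<open>axis_vec i\<close> is congruent modulo \<open>V\<close> to a multiple \<open>t i\<close> of
  it. These multiples are the coefficients of a functional with kernel \<open>V\<close>, which is
  then scaled to norm one.\<close>

lemma subspace_eq_hyperplane:
  assumes "cvec.subspace V" "V \<subseteq> G p (Suc q)" "p \<le> q" "cvec.dim V = q - p"
  shows "\<exists>c. unit_covec p q c \<and> V = hyperplane p q c"
proof -
  obtain B where B: "B \<subseteq> V" "cvec.independent B" "V \<subseteq> cvec.span B" "card B = cvec.dim V"
    using cvec.basis_exists[of V] by blast
  have VB: "V = cvec.span B"
    using B cvec.span_minimal[OF B(1) assms(1)] by auto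
  have bound: "finite S \<and> card S \<le> Suc q - p" if "cvec.independent S" "S \<subseteq> G p (Suc q)" for S
    using cvec.independent_span_bound[OF _ that(1), of "axis_vec ` {p..<Suc q}"] that(2) G_subset_span[of p "Suc q"]
      card_image[OF inj_on_subset[OF inj_axis_vec subset_UNIV], of "{p..<Suc q}"] by fastforce
  have fB: "finite B" using bound B assms by blast
  have "\<exists>j\<in>{p..q}. axis_vec j \<notin> V"
  proof (rule ccontr)
    assume "\<not> ?thesis"
    then have "axis_vec ` {p..<Suc q} \<subseteq> V" by auto
    then have "G p (Suc q) \<subseteq> V"
      using G_subset_span[of p "Suc q"] cvec.span_minimal[OF _ assms(1)] by blast
    then have "V = G p (Suc q)" using assms(2) by blast
    then show False using dim_G[of p "Suc q"] assms(3,4) by simp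
  qed
  then obtain j where j: "j \<in> {p..q}" "axis_vec j \<notin> V" by blast
  have ind1: "cvec.independent (insert (axis_vec j) B)"
    using j VB B cvec.independent_insertI by blast
  have "\<exists>t. (\<lambda>k. axis_vec i k - t * axis_vec j k) \<in> V" if i: "i \<in> {p..q}" for i
  proof (rule ccontr)
    \<comment> \<open>Otherwise the basis \<open>B\<close> could be enlarged by both coordinate
      vectors, which gives more independent vectors than \<open>G p (Suc q)\<close> has
      dimensions.\<close>
    assume no: "\<nexists>t. (\<lambda>k. axis_vec i k - t * axis_vec j k) \<in> V"
    have ni: "axis_vec i \<notin> cvec.span (insert (axis_vec j) B)"
      unfolding cvec.span_breakdown_eq using no VB by (simp add: fun_diff_def)
    then have "cvec.independent (insert (axis_vec i) (insert (axis_vec j) B))"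
      using ind1 cvec.independent_insertI by blast
    moreover have "insert (axis_vec i) (insert (axis_vec j) B) \<subseteq> G p (Suc q)"
      using i j B assms by (auto simp: axis_vec_in_G)
    ultimately have "card (insert (axis_vec i) (insert (axis_vec j) B)) \<le> Suc q - p"
      using bound by blast
    moreover have "axis_vec i \<notin> insert (axis_vec j) B" using ni cvec.span_base by blast
    moreover have "axis_vec j \<notin> B" using j B by blast
    ultimately show False using fB B(4) assms(3,4) by simp
  qed
  then obtain t where t: "\<And>i. i \<in> {p..q} \<Longrightarrow> (\<lambda>k. axis_vec i k - t i * axis_vec j k) \<in> V"
    by metis
  define d where "d = (\<lambda>k. if k \<in> {p..q} then t k else 0)"
  have sub_V: "(\<lambda>k. x k - (\<Sum>i=p..q. d i * x i) * axis_vec j k) \<in> V" if x: "x \<in> G p (Suc q)" for x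
  proof -
    have "(\<Sum>i\<in>{p..q}. (\<lambda>k. x i * (axis_vec i k - t i * axis_vec j k))) \<in> V"
      by (intro cvec.subspace_sum[OF assms(1)] cvec.subspace_scale[OF assms(1)] t)
    also have "(\<Sum>i\<in>{p..q}. (\<lambda>k. x i * (axis_vec i k - t i * axis_vec j k))) =
        (\<lambda>k. x k - (\<Sum>i=p..q. d i * x i) * axis_vec j k)"
    proof
      fix k
      have "x k = (\<Sum>i\<in>{p..q}. x i * axis_vec i k)"
        using fun_cong[OF cvec_expansion[OF x], of k]
        by (simp add: sum_cvec_apply atLeastLessThanSuc_atLeastAtMost)
      then show "(\<Sum>i\<in>{p..q}. (\<lambda>k. x i * (axis_vec i k - t i * axis_vec j k))) k =
          x k - (\<Sum>i=p..q. d i * x i) * axis_vec j k"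
        by (simp add: sum_cvec_apply right_diff_distrib sum_subtractf d_def sum_distrib_right sum_distrib_left mult_ac)
    qed
    finally show ?thesis .
  qed
  have in_V: "x \<in> V \<longleftrightarrow> (\<Sum>i=p..q. d i * x i) = 0" if x: "x \<in> G p (Suc q)" for x
  proof
    assume "x \<in> V"
    from cvec.subspace_diff[OF assms(1) this sub_V[OF x]]
    have *: "(\<lambda>k. (\<Sum>i=p..q. d i * x i) * axis_vec j k) \<in> V" by (simp add: fun_diff_def)
    show "(\<Sum>i=p..q. d i * x i) = 0"
    proof (rule ccontr)
      assume "(\<Sum>i=p..q. d i * x i) \<noteq> 0"
      with cvec.subspace_scale[OF assms(1) *, of "1 / (\<Sum>i=p..q. d i * x i)"] j(2)
      show False by simp
    qed
  next
    assume "(\<Sum>i=p..q. d i * x i) = 0"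
    with sub_V[OF x] show "x \<in> V" by simp
  qed
  define s where "s = sqrt (\<Sum>k=p..q. (cmod (d k))\<^sup>2)"
  have "d j \<noteq> 0"
    using in_V[OF axis_vec_in_G, of j] j by (auto simp: axis_vec_def if_distrib[of "\<lambda>t. _ * t"] cong: if_cong)
  then have "(\<Sum>k=p..q. (cmod (d k))\<^sup>2) > 0"
    using j by (intro sum_pos2[of _ j]) auto
  then have s: "s > 0" "s\<^sup>2 = (\<Sum>k=p..q. (cmod (d k))\<^sup>2)" by (auto simp: s_def)
  define c where "c = (\<lambda>k. d k / s)"
  have "(\<Sum>k=p..q. c k * cnj (c k)) = (\<Sum>k=p..q. of_real ((cmod (d k))\<^sup>2 / s\<^sup>2))"
  proof (intro sum.cong refl)
    fix k
    have "c k * cnj (c k) = d k * cnj (d k) / of_real (s\<^sup>2)"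
      by (simp add: c_def power2_eq_square)
    then show "c k * cnj (c k) = of_real ((cmod (d k))\<^sup>2 / s\<^sup>2)"
      by (simp only: complex_norm_square of_real_divide)
  qed
  also have "\<dots> = of_real ((\<Sum>k=p..q. (cmod (d k))\<^sup>2) / s\<^sup>2)"
    by (simp add: sum_divide_distrib)
  also have "\<dots> = 1" using s(1) by (simp add: s(2)[symmetric] del: of_real_power)
  finally have "unit_covec p q c" by (auto simp: unit_covec_def G_def c_def d_def)
  moreover have "V = hyperplane p q c"
  proof -
    have "(\<Sum>k=p..q. c k * x k) = (\<Sum>k=p..q. d k * x k) / s" for x
      by (simp add: c_def sum_divide_distrib)
    then show ?thesis using in_V assms(2) s by (auto simp: hyperplane_def)
  qed
  ultimately show ?thesis by blast
qed

text \<open>Removing from \<open>y\<close> its component along the conjugate of \<open>c\<close>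
  leaves a vector \<open>z\<close> of the hyperplane that is orthogonal to itself, hence
  zero.\<close>

lemma orthogonal_hyperplane:
  assumes c: "unit_covec p q c" and y: "y \<in> G p (Suc q)"
    and orth: "\<And>x. x \<in> hyperplane p q c \<Longrightarrow> hdot x y = 0"
  shows "\<exists>\<beta>. y = (\<lambda>k. \<beta> * cnj (c k))"
proof -
  define \<beta> where "\<beta> = (\<Sum>k=p..q. c k * y k)"
  define z where "z = (\<lambda>k. y k - \<beta> * cnj (c k))"
  have zG: "z \<in> G p (Suc q)" using c y by (auto simp: z_def unit_covec_def G_def)
  have "(\<Sum>k=p..q. c k * z k) = \<beta> - \<beta> * (\<Sum>k=p..q. c k * cnj (c k))"
    by (simp add: z_def \<beta>_def right_diff_distrib sum_subtractf sum_distrib_left mult_ac)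
  then have 0: "(\<Sum>k=p..q. c k * z k) = 0" using c by (simp add: unit_covec_def)
  then have "hdot z y = 0" using orth zG by (simp add: hyperplane_def)
  moreover have "hdot z z = hdot z y - \<beta> * cnj (\<Sum>k=p..q. c k * z k)"
    using zG by (simp add: hdot_G z_def[THEN fun_cong] right_diff_distrib sum_subtractf sum_distrib_left mult_ac)
  ultimately have "hdot z z = 0" using 0 by simp
  then have "z = 0" using hdot_self_G_eq_0[OF zG] by simp
  then have "y k = \<beta> * cnj (c k)" for k by (simp add: z_def fun_eq_iff)
  then show ?thesis by auto
qed

text \<open>The conjugate of \<open>d\<close> is orthogonal to the hyperplane and thus a multiple of
  its normal vector. Inclusions between the subspaces of a brick become proportionality of covectors
  in this way.\<close>

lemma hyperplane_subset_imp_proportional: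
  assumes "unit_covec p q c" "\<And>x. x \<in> hyperplane p q c \<Longrightarrow> (\<Sum>k=p..q. d k * x k) = 0"
  shows "\<exists>\<alpha>. \<forall>k\<in>{p..q}. d k = \<alpha> * c k"
proof -
  define y where "y = (\<lambda>k. if k \<in> {p..q} then cnj (d k) else 0)"
  have "hdot x y = 0" if "x \<in> hyperplane p q c" for x
  proof -
    have "x \<in> G p (Suc q)" using that by (simp add: hyperplane_def)
    then have "hdot x y = cnj (\<Sum>k=p..q. d k * x k)"
      by (simp add: hdot_G[of x p q] y_def mult_ac)
    then show ?thesis using assms(2)[OF that] by simp
  qed
  moreover have "y \<in> G p (Suc q)" by (auto simp: y_def G_def)
  ultimately obtain \<beta> where "y = (\<lambda>k. \<beta> * cnj (c k))"
    using orthogonal_hyperplane[OF assms(1)] by blast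
  then have "cnj (y k) = cnj \<beta> * c k" for k by simp
  then have "\<forall>k\<in>{p..q}. d k = cnj \<beta> * c k" by (metis complex_cnj_cnj y_def)
  then show ?thesis by blast
qed

lemma hyperplane_scale: "\<kappa> \<noteq> 0 \<Longrightarrow> hyperplane p q (\<lambda>k. \<kappa> * c k) = hyperplane p q c"
  by (simp add: hyperplane_def mult.assoc flip: sum_distrib_left)

lemma orth_proj_hyperplane:
  assumes c: "unit_covec p q c"
  shows "orth_proj (hyperplane p q c) x =
    (\<lambda>k. if k \<in> {p..q} then x k - (\<Sum>j=p..q. c j * x j) * cnj (c k) else 0)" (is "_ = ?y")
  unfolding orth_proj_def
proof (rule the_equality)
  have "(\<Sum>k=p..q. c k * ?y k) = (\<Sum>j=p..q. c j * x j) - (\<Sum>j=p..q. c j * x j) * (\<Sum>k=p..q. c k * cnj (c k))"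
    by (simp add: right_diff_distrib sum_subtractf sum_distrib_left mult_ac)
  then have y: "?y \<in> hyperplane p q c" using c by (auto simp: hyperplane_def G_def unit_covec_def)
  have orth: "hdot w (\<lambda>k. x k - ?y k) = 0" if "w \<in> hyperplane p q c" for w
  proof -
    have "w \<in> G p (Suc q)" using that by (simp add: hyperplane_def)
    then have "hdot w (\<lambda>k. x k - ?y k) = (\<Sum>j=p..q. c j * x j) * cnj (\<Sum>k=p..q. c k * w k)"
      by (simp add: hdot_G[of w p q] sum_distrib_left mult_ac)
    moreover have "(\<Sum>k=p..q. c k * w k) = 0" using that by (simp add: hyperplane_def)
    ultimately show ?thesis by (simp only: complex_cnj_zero mult_zero_right)
  qed
  show "?y \<in> hyperplane p q c \<and> (\<forall>w\<in>hyperplane p q c. hdot w (\<lambda>k. x k - ?y k) = 0)"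
    using y orth by blast
  fix z assume z: "z \<in> hyperplane p q c \<and> (\<forall>w\<in>hyperplane p q c. hdot w (\<lambda>k. x k - z k) = 0)"
  define d where "d = (\<lambda>k. z k - ?y k)"
  have d: "d \<in> hyperplane p q c"
    using cvec.subspace_diff[OF subspace_hyperplane, of z p q c ?y] z y by (simp add: d_def fun_diff_def)
  then have dG: "d \<in> G p (Suc q)" by (simp add: hyperplane_def)
  have "hdot d d = hdot d (\<lambda>k. x k - ?y k) - hdot d (\<lambda>k. x k - z k)"
    unfolding hdot_G[OF dG] sum_subtractf[symmetric] by (intro sum.cong) (simp_all add: d_def algebra_simps)
  then have "hdot d d = 0" using orth[OF d] z d by simp
  then have "d = 0" using hdot_self_G_eq_0[OF dG] by simp
  then show "z = ?y" by (simp add: d_def fun_eq_iff)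
qed

lemma proj_mat_hyperplane:
  assumes "unit_covec p q c"
  shows "proj_mat (hyperplane p q c) =
    (\<lambda>a b. (if a = b \<and> a \<in> {p..q} then 1 else 0) - cnj (c a) * c b)"
proof (intro ext)
  fix a b
  have "c k = 0" if "k \<notin> {p..q}" for k using assms that by (auto simp: unit_covec_def G_def)
  then show "proj_mat (hyperplane p q c) a b = (if a = b \<and> a \<in> {p..q} then 1 else 0) - cnj (c a) * c b"
    unfolding proj_mat_def orth_proj_hyperplane[OF assms]
    by (auto simp: if_distrib[of "\<lambda>t. _ * t"] cong: if_cong)
qed

lemma proj_mat_zero: "proj_mat {0} = (\<lambda>a b. 0)"
proof -
  have "orth_proj {0} x = 0" for x
    unfolding orth_proj_def by (rule the_equality) (auto simp: hdot_def)
  then show ?thesis by (simp add: proj_mat_def)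
qed

text \<open>The projection differs from the identity by the rank one matrix
  \<open>cnj (c a) * c b\<close>, which forgets the phase of \<open>c\<close> but has multiples of
  \<open>c\<close> as its rows.\<close>

lemma hyperplane_eq_if_proj_mat_eq:
  assumes c: "unit_covec p q c" and d: "unit_covec p q d"
    and eq: "proj_mat (hyperplane p q c) = proj_mat (hyperplane p q d)"
  shows "hyperplane p q c = hyperplane p q d"
proof -
  have cd: "cnj (c a) * c b = cnj (d a) * d b" for a b
    using fun_cong[OF fun_cong[OF eq], of a b] by (simp add: proj_mat_hyperplane[OF c] proj_mat_hyperplane[OF d])
  have *: "cnj (c a) * (\<Sum>k=p..q. c k * x k) = cnj (d a) * (\<Sum>k=p..q. d k * x k)" for a x
    by (simp add: sum_distrib_left mult.assoc[symmetric] cd)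
  obtain a a' where "c a \<noteq> 0" "d a' \<noteq> 0"
    using unit_covec_nonzero c d by metis
  then have "(\<Sum>k=p..q. c k * x k) = 0 \<longleftrightarrow> (\<Sum>k=p..q. d k * x k) = 0" for x
    using *[of a x] *[of a' x] by auto
  then show ?thesis by (simp add: hyperplane_def)
qed

section \<open>Brick points from compatible unit covectors\<close>

text \<open>The interval \<open>{p..q}\<close> of coordinates carries the subspace
  \<open>V (Suc p) q\<close>. One-point intervals, whose subspace is zero, are included on purpose:
  the number \<open>c p p p\<close> is a pure phase, and for \<open>0 < p < n\<close> these phases
  become the torus coordinates.\<close>

definition ext_interval :: "nat \<Rightarrow> nat \<Rightarrow> nat \<Rightarrow> bool" where
  "ext_interval n p q \<longleftrightarrow> p \<le> q \<and> q \<le> n \<and> (p, q) \<noteq> (0, n)"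

text \<open>As the covector on the smaller interval has norm one, this inner product is the factor
  of proportionality as soon as the restriction is proportional to it at all, and it is visibly
  continuous.\<close>

definition lcoef :: "(nat \<Rightarrow> nat \<Rightarrow> cvec) \<Rightarrow> nat \<Rightarrow> nat \<Rightarrow> complex" where
  "lcoef c p q = (\<Sum>k=Suc p..q. c p q k * cnj (c (Suc p) q k))"

definition rcoef :: "(nat \<Rightarrow> nat \<Rightarrow> cvec) \<Rightarrow> nat \<Rightarrow> nat \<Rightarrow> complex" where
  "rcoef c p q = (\<Sum>k=p..q-1. c p q k * cnj (c p (q-1) k))"

text \<open>The orthogonal complement of the smaller hyperplane is the plane spanned by
  \<open>axis_vec p\<close> and the conjugate of \<open>c (Suc p) q\<close>. On these two vectors
  \<open>c p q\<close> takes the values \<open>c p q p\<close> and \<open>lcoef c p q\<close>;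
  \<open>wvec\<close> is the resulting solution of \<open>c p q = 0\<close> in the plane.\<close>

definition wvec :: "(nat \<Rightarrow> nat \<Rightarrow> cvec) \<Rightarrow> nat \<Rightarrow> nat \<Rightarrow> cvec" where
  "wvec c p q = (\<lambda>k. if k = p then lcoef c p q
     else if p < k \<and> k \<le> q then - c p q p * cnj (c (Suc p) q k) else 0)"

definition brick_of :: "nat \<Rightarrow> (nat \<Rightarrow> nat \<Rightarrow> cvec) \<Rightarrow> brick" where
  "brick_of n c = (\<lambda>i j. if proper_interval n i j then hyperplane (i - 1) j (c (i - 1) j) else {0})"

lemma hyperplane_coordinate:
  assumes "j \<in> {p..q}" "c j \<noteq> 0" "\<And>k. k \<in> {p..q} \<Longrightarrow> k \<noteq> j \<Longrightarrow> c k = 0"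
  shows "hyperplane p q c = {x \<in> G p (Suc q). x j = 0}"
proof -
  have "(\<Sum>k=p..q. c k * x k) = c j * x j" for x
  proof -
    have "(\<Sum>k=p..q. c k * x k) = (\<Sum>k\<in>{j}. c k * x k)"
      using assms by (intro sum.mono_neutral_right) auto
    then show ?thesis by simp
  qed
  then show ?thesis using assms(2) by (simp add: hyperplane_def)
qed

text \<open>A coordinate hyperplane belongs to a covector concentrated at one coordinate. The
  prescribed subspaces \<open>V 1 j\<close> and \<open>V i n\<close> and the equations of the
  divisors are all of this form, with the coordinate at the left or right end.\<close>

lemma hyperplane_eq_G_left:
  assumes "unit_covec p q c" "p \<le> q"
  shows "hyperplane p q c = G (Suc p) (Suc q) \<longleftrightarrow> (\<forall>k\<in>{Suc p..q}. c k = 0)"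
proof
  assume eq: "hyperplane p q c = G (Suc p) (Suc q)"
  show "\<forall>k\<in>{Suc p..q}. c k = 0"
  proof
    fix k assume "k \<in> {Suc p..q}"
    then have "axis_vec k \<in> hyperplane p q c" unfolding eq by (simp add: axis_vec_in_G)
    then show "c k = 0" using \<open>k \<in> {Suc p..q}\<close>
      by (auto simp: hyperplane_def axis_vec_def if_distrib[of "\<lambda>t. _ * t"] cong: if_cong)
  qed
next
  assume *: "\<forall>k\<in>{Suc p..q}. c k = 0"
  have z: "k \<in> {p..q} \<Longrightarrow> k \<noteq> p \<Longrightarrow> c k = 0" for k using * by auto
  then have "c p \<noteq> 0" using unit_covec_nonzero[OF assms(1)] by metis
  from hyperplane_coordinate[of p p q c, OF _ this z] assms(2)
  have "hyperplane p q c = {x \<in> G p (Suc q). x p = 0}" by auto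
  then show "hyperplane p q c = G (Suc p) (Suc q)"
    by (auto simp: G_def) (metis Suc_leI le_neq_implies_less)
qed

lemma hyperplane_eq_G_right:
  assumes "unit_covec p q c" "p \<le> q"
  shows "hyperplane p q c = G p q \<longleftrightarrow> (\<forall>k\<in>{p..<q}. c k = 0)"
proof
  assume eq: "hyperplane p q c = G p q"
  show "\<forall>k\<in>{p..<q}. c k = 0"
  proof
    fix k assume "k \<in> {p..<q}"
    then have "axis_vec k \<in> hyperplane p q c" unfolding eq by (simp add: axis_vec_in_G)
    then show "c k = 0" using \<open>k \<in> {p..<q}\<close>
      by (auto simp: hyperplane_def axis_vec_def if_distrib[of "\<lambda>t. _ * t"] cong: if_cong)
  qed
next
  assume *: "\<forall>k\<in>{p..<q}. c k = 0"
  have z: "k \<in> {p..q} \<Longrightarrow> k \<noteq> q \<Longrightarrow> c k = 0" for k using * by auto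
  then have "c q \<noteq> 0" using unit_covec_nonzero[OF assms(1)] by metis
  from hyperplane_coordinate[of q p q c, OF _ this z] assms(2)
  have "hyperplane p q c = {x \<in> G p (Suc q). x q = 0}" by auto
  then show "hyperplane p q c = G p q"
    by (auto simp: G_def) (metis less_Suc_eq)
qed

lemma G_empty: "q \<le> p \<Longrightarrow> G p q = {0}"
  by (auto simp: G_def fun_eq_iff)

lemma hyperplane_single: "unit_covec p p c \<Longrightarrow> hyperplane p p c = {0}"
  using hyperplane_eq_G_left[of p p c] by (simp add: G_empty)

lemma hdot_sym: "x \<in> G p (Suc q) \<Longrightarrow> y \<in> G p (Suc q) \<Longrightarrow> hdot y x = cnj (hdot x y)"
  by (simp add: hdot_G[of x p q] hdot_G[of y p q] mult.commute)

lemma G_mono: "p' \<le> p \<Longrightarrow> q \<le> q' \<Longrightarrow> G p q \<subseteq> G p' q'"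
  by (auto simp: G_def)

lemma sum_atLeast_Suc: "p \<le> q \<Longrightarrow> (\<Sum>k=p..q. f k) = f p + (\<Sum>k=Suc p..q. f k)"
  for f :: "nat \<Rightarrow> 'a::comm_monoid_add"
  by (rule sum.atLeast_Suc_atMost)

text \<open>
  \<open>first\<close> and \<open>last\<close> encode the prescribed subspaces \<open>V 1 j\<close> and \<open>V i n\<close>. The sign in
  \<open>first\<close> makes \<open>wvec c 0 q\<close> the complex conjugate of \<open>c 1 q\<close>.
\<close>

locale covec_system =
  fixes n :: nat and c :: "nat \<Rightarrow> nat \<Rightarrow> cvec"
  assumes two_le_n: "2 \<le> n"
    and unit: "ext_interval n p q \<Longrightarrow> unit_covec p q (c p q)"
    and left: "ext_interval n p q \<Longrightarrow> Suc p \<le> k \<Longrightarrow> k \<le> q \<Longrightarrow> c p q k = lcoef c p q * c (Suc p) q k"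
    and right: "ext_interval n p q \<Longrightarrow> p \<le> k \<Longrightarrow> k < q \<Longrightarrow> c p q k = rcoef c p q * c p (q - 1) k"
    and first: "q < n \<Longrightarrow> c 0 q = (\<lambda>k. - axis_vec 0 k)"
    and last: "0 < p \<Longrightarrow> p \<le> n \<Longrightarrow> c p n = axis_vec n"
begin

lemma in_G: "ext_interval n p q \<Longrightarrow> c p q \<in> G p (Suc q)"
  using unit by (simp add: unit_covec_def)

lemma norm_eq_1: "ext_interval n p q \<Longrightarrow> (\<Sum>k=p..q. c p q k * cnj (c p q k)) = 1"
  using unit by (simp add: unit_covec_def)

lemma right': "ext_interval n p q \<Longrightarrow> p < q \<Longrightarrow> p \<le> k \<Longrightarrow> k \<le> q - Suc 0 \<Longrightarrow>
    c p q k = rcoef c p q * c p (q - Suc 0) k"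
  using right[of p q k] by simp

text \<open>The part of \<open>c p q\<close> beyond \<open>p\<close> is \<open>lcoef c p q\<close>
  times a unit covector, so the squared norm splits accordingly.\<close>

lemma norm_left:
  assumes "ext_interval n p q" "p < q"
  shows "c p q p * cnj (c p q p) + lcoef c p q * cnj (lcoef c p q) = 1"
proof -
  have e: "ext_interval n (Suc p) q" using assms by (auto simp: ext_interval_def)
  have "(\<Sum>k=Suc p..q. c p q k * cnj (c p q k)) =
      (\<Sum>k=Suc p..q. lcoef c p q * cnj (lcoef c p q) * (c (Suc p) q k * cnj (c (Suc p) q k)))"
    using left[OF assms(1)] by (intro sum.cong) simp_all
  also have "\<dots> = lcoef c p q * cnj (lcoef c p q)"
    using norm_eq_1[OF e] by (simp flip: sum_distrib_left)
  finally show ?thesis using norm_eq_1[OF assms(1)] assms(2) by (simp add: sum_atLeast_Suc)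
qed

text \<open>One-step proportionalities are composed, first dropping coordinates on the left and then
  on the right. The resulting factor may be zero.\<close>

lemma restrict:
  assumes v: "ext_interval n p q" and "p \<le> p'" "p' \<le> q'" "q' \<le> q"
  shows "\<exists>z. \<forall>k\<in>{p'..q'}. c p q k = z * c p' q' k"
proof -
  have "p' \<le> q \<longrightarrow> (\<exists>z. \<forall>k\<in>{p'..q}. c p q k = z * c p' q k)"
    using \<open>p \<le> p'\<close>
  proof (induction p' rule: dec_induct)
    case base
    show ?case by (intro impI exI[of _ 1]) simp
  next
    case (step m)
    show ?case
    proof
      assume m: "Suc m \<le> q"
      then obtain z where "\<forall>k\<in>{m..q}. c p q k = z * c m q k" using step by auto
      moreover have "ext_interval n m q" using v m step by (auto simp: ext_interval_def)
      ultimately have "\<forall>k\<in>{Suc m..q}. c p q k = (z * lcoef c m q) * c (Suc m) q k"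
        using left[of m q] by simp
      then show "\<exists>z. \<forall>k\<in>{Suc m..q}. c p q k = z * c (Suc m) q k" by blast
    qed
  qed
  then obtain y where y: "\<forall>k\<in>{p'..q}. c p q k = y * c p' q k" using assms by auto
  have "p' \<le> q' \<longrightarrow> (\<exists>z. \<forall>k\<in>{p'..q'}. c p' q k = z * c p' q' k)"
    using \<open>q' \<le> q\<close>
  proof (induction q' rule: inc_induct)
    case base
    show ?case by (intro impI exI[of _ 1]) simp
  next
    case (step m)
    show ?case
    proof
      assume m: "p' \<le> m"
      then obtain z where "\<forall>k\<in>{p'..Suc m}. c p' q k = z * c p' (Suc m) k" using step by auto
      moreover have "ext_interval n p' (Suc m)" using v m step assms by (auto simp: ext_interval_def)
      ultimately have "\<forall>k\<in>{p'..m}. c p' q k = (z * rcoef c p' (Suc m)) * c p' m k"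
        using right[of p' "Suc m"] by simp
      then show "\<exists>z. \<forall>k\<in>{p'..m}. c p' q k = z * c p' m k" by blast
    qed
  qed
  then obtain z where "\<forall>k\<in>{p'..q'}. c p' q k = z * c p' q' k" using assms by auto
  then have "\<forall>k\<in>{p'..q'}. c p q k = (y * z) * c p' q' k" using y assms by simp
  then show ?thesis by blast
qed

text \<open>The default value \<open>{0}\<close> of \<open>brick_of\<close> agrees with the
  hyperplane of a one-point interval, so that such intervals require no separate treatment.\<close>

lemma brick_of_eq:
  "ext_interval n (i - 1) j \<Longrightarrow> 0 < i \<Longrightarrow> brick_of n c i j = hyperplane (i - 1) j (c (i - 1) j)"
  by (cases "i \<le> j")
    (auto simp: brick_of_def proper_interval_def ext_interval_def hyperplane_single[OF unit] le_Suc_eq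
      dest: le_antisym)

lemma brick_of_Suc:
  "ext_interval n p q \<Longrightarrow> brick_of n c (Suc p) q = hyperplane p q (c p q)"
  using brick_of_eq[of "Suc p" q] by simp

lemma hyperplane_mono_left:
  assumes "ext_interval n p q" "p < q"
  shows "hyperplane (Suc p) q (c (Suc p) q) \<subseteq> hyperplane p q (c p q)"
proof
  fix x assume x: "x \<in> hyperplane (Suc p) q (c (Suc p) q)"
  have "(\<Sum>k=Suc p..q. c p q k * x k) = lcoef c p q * (\<Sum>k=Suc p..q. c (Suc p) q k * x k)"
    using left[OF assms(1)] by (simp add: sum_distrib_left mult.assoc)
  then show "x \<in> hyperplane p q (c p q)"
    using x assms(2) by (auto simp: hyperplane_def sum_atLeast_Suc G_def)
qed

lemma hyperplane_mono_right:
  assumes "ext_interval n p q" "p < q"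
  shows "hyperplane p (q - 1) (c p (q - 1)) \<subseteq> hyperplane p q (c p q)"
proof
  fix x assume x: "x \<in> hyperplane p (q - 1) (c p (q - 1))"
  have "(\<Sum>k=p..q-1. c p q k * x k) = rcoef c p q * (\<Sum>k=p..q-1. c p (q-1) k * x k)"
    using right'[OF assms] by (simp add: sum_distrib_left mult.assoc)
  then show "x \<in> hyperplane p q (c p q)"
    using x assms(2) by (cases q) (auto simp: hyperplane_def G_def)
qed

lemma brick_of_first: "proper_interval n 1 j \<Longrightarrow> brick_of n c 1 j = G 1 (j + 1)"
  using hyperplane_eq_G_left[OF unit[of 0 j]] first[of j]
  by (auto simp: brick_of_def proper_interval_def ext_interval_def axis_vec_def)

lemma brick_of_last: "proper_interval n i n \<Longrightarrow> brick_of n c i n = G (i - 1) n"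
  using hyperplane_eq_G_right[OF unit[of "i - 1" n]] last[of "i - 1"]
  by (auto simp: brick_of_def proper_interval_def ext_interval_def axis_vec_def)

lemma brick_of_in_manifold: "brick_of n c \<in> brick_manifold n"
proof -
  have ext: "ext_interval n (i - 1) j" "i - 1 < j" if "proper_interval n i j" for i j
    using that by (auto simp: proper_interval_def ext_interval_def)
  have G: "brick_of n c i j \<subseteq> G 1 n" if "proper_interval n i j" for i j
  proof (cases "i = 1 \<or> j = n")
    case True
    then show ?thesis
    proof
      assume "i = 1"
      then show ?thesis using brick_of_first[of j] that G_mono[of 1 1 "j + 1" n]
        by (auto simp: proper_interval_def)
    next
      assume "j = n"
      moreover have "1 \<le> i - 1" using that \<open>j = n\<close> by (auto simp: proper_interval_def)
      ultimately show ?thesis using brick_of_last[of i] that G_mono[of 1 "i - 1" n n] by auto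
    qed
  next
    case False
    then have "1 \<le> i - 1" using that by (auto simp: proper_interval_def)
    then show ?thesis using False that G_mono[of 1 "i - 1" "Suc j" n] hyperplane_subset_G[of "i - 1" j "c (i - 1) j"]
      by (auto simp: brick_of_def proper_interval_def)
  qed
  have 1: "cvec.dim (brick_of n c i j) = j - i + 1" if "proper_interval n i j" for i j
    using that dim_hyperplane[OF unit[OF ext(1)[OF that]]] by (auto simp: brick_of_def proper_interval_def)
  have 2: "brick_of n c i j \<subseteq> brick_of n c (i - 1) j"
    if "proper_interval n i j" "proper_interval n (i - 1) j" for i j
    using hyperplane_mono_left[of "i - 2" j] ext[OF that(2)] that
    by (auto simp: brick_of_def proper_interval_def Suc_diff_Suc numeral_2_eq_2)
  have 3: "brick_of n c i j \<subseteq> brick_of n c i (j + 1)"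
    if "proper_interval n i j" "proper_interval n i (j + 1)" for i j
    using hyperplane_mono_right[of "i - 1" "j + 1"] ext[OF that(2)] that by (auto simp: brick_of_def)
  have 4: "cvec.subspace (brick_of n c i j)" if "proper_interval n i j" for i j
    using that subspace_hyperplane by (simp add: brick_of_def)
  have 5: "brick_of n c i j = {0}" if "\<not> proper_interval n i j" for i j
    using that by (simp add: brick_of_def)
  show ?thesis unfolding brick_manifold_def using G 1 2 3 4 5 brick_of_first brick_of_last by blast
qed

lemma wvec_in_G: "p \<le> q \<Longrightarrow> wvec c p q \<in> G p (Suc q)"
  by (auto simp: wvec_def G_def)

context
  fixes p q assumes pq: "ext_interval n p q" "p < q"
begin

lemma ext_Suc: "ext_interval n (Suc p) q"
  using pq by (auto simp: ext_interval_def)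

lemma sum_wvec:
  "(\<Sum>k=p..q. f k * wvec c p q k) =
    f p * lcoef c p q - c p q p * (\<Sum>k=Suc p..q. f k * cnj (c (Suc p) q k))"
proof -
  have "(\<Sum>k=Suc p..q. f k * wvec c p q k) = - c p q p * (\<Sum>k=Suc p..q. f k * cnj (c (Suc p) q k))"
    unfolding sum_distrib_left by (intro sum.cong) (auto simp: wvec_def)
  then show ?thesis using pq(2) by (simp add: sum_atLeast_Suc[of p q]) (simp add: wvec_def)
qed

lemma hdot_wvec_right: "x \<in> G p (Suc q) \<Longrightarrow>
    hdot x (wvec c p q) = cnj (x p) * lcoef c p q - c p q p * cnj (\<Sum>k=Suc p..q. c (Suc p) q k * x k)"
  by (simp add: hdot_G[of x p q] sum_wvec mult.commute)

lemma hdot_wvec_left: "x \<in> G p (Suc q) \<Longrightarrow>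
    hdot (wvec c p q) x = x p * cnj (lcoef c p q) - cnj (c p q p) * (\<Sum>k=Suc p..q. c (Suc p) q k * x k)"
  using pq(2) by (simp add: hdot_sym[of x p q "wvec c p q"] wvec_in_G hdot_wvec_right)

lemma wvec_in_hyperplane: "wvec c p q \<in> hyperplane p q (c p q)"
proof -
  have "(\<Sum>k=p..q. c p q k * wvec c p q k) = 0"
    by (simp add: sum_wvec lcoef_def[symmetric])
  then show ?thesis using wvec_in_G pq by (simp add: hyperplane_def)
qed

lemma wvec_orthogonal: "x \<in> hyperplane (Suc p) q (c (Suc p) q) \<Longrightarrow> hdot x (wvec c p q) = 0"
  by (subst hdot_wvec_right) (auto simp: hyperplane_def G_def)

lemma hdot_wvec_self: "hdot (wvec c p q) (wvec c p q) = 1"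
proof -
  have "(\<Sum>k=Suc p..q. c (Suc p) q k * wvec c p q k) =
      - c p q p * (\<Sum>k=Suc p..q. c (Suc p) q k * cnj (c (Suc p) q k))"
    by (simp add: wvec_def sum_distrib_left sum_negf mult_ac)
  then show ?thesis using norm_left[OF pq] norm_eq_1[OF ext_Suc] pq(2)
    by (simp add: hdot_wvec_left wvec_in_G) (simp add: wvec_def mult.commute add.commute)
qed

text \<open>Both assumptions are linear equations in \<open>x p\<close> and in the pairing
  \<open>s\<close> of \<open>x\<close> with the smaller covector. The matrix of this system is
  unitary by \<open>norm_left\<close>, so \<open>x p\<close> and \<open>s\<close> vanish.\<close>

lemma orthogonal_wvec_imp:
  assumes x: "x \<in> hyperplane p q (c p q)" and 0: "hdot (wvec c p q) x = 0"
  shows "x \<in> hyperplane (Suc p) q (c (Suc p) q)"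
proof -
  define s where "s = (\<Sum>k=Suc p..q. c (Suc p) q k * x k)"
  have xG: "x \<in> G p (Suc q)" using x by (simp add: hyperplane_def)
  have "(\<Sum>k=Suc p..q. c p q k * x k) = lcoef c p q * s"
    using left[OF pq(1)] by (simp add: s_def sum_distrib_left mult.assoc)
  then have 1: "c p q p * x p + lcoef c p q * s = 0"
    using x pq(2) by (simp add: hyperplane_def sum_atLeast_Suc)
  have 2: "x p * cnj (lcoef c p q) - cnj (c p q p) * s = 0"
    using 0 hdot_wvec_left[OF xG] by (simp add: s_def)
  have "x p = (c p q p * cnj (c p q p) + lcoef c p q * cnj (lcoef c p q)) * x p"
    using norm_left[OF pq] by simp
  also have "\<dots> = cnj (c p q p) * (c p q p * x p + lcoef c p q * s)
      + lcoef c p q * (x p * cnj (lcoef c p q) - cnj (c p q p) * s)"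
    by (simp add: algebra_simps)
  finally have xp: "x p = 0" using 1 2 by simp
  have "s = (c p q p * cnj (c p q p) + lcoef c p q * cnj (lcoef c p q)) * s"
    using norm_left[OF pq] by simp
  also have "\<dots> = cnj (lcoef c p q) * (c p q p * x p + lcoef c p q * s)
      - c p q p * (x p * cnj (lcoef c p q) - cnj (c p q p) * s)"
    by (simp add: algebra_simps)
  finally have "s = 0" using 1 2 by simp
  moreover have "x \<in> G (Suc p) (Suc q)"
    using xG xp by (auto simp: G_def) (metis Suc_leI le_neq_implies_less)
  ultimately show ?thesis by (simp add: hyperplane_def s_def)
qed

text \<open>Removing from \<open>y\<close> its component along \<open>wvec\<close> leaves a vector
  of the smaller hyperplane by \<open>orthogonal_wvec_imp\<close>. It is orthogonal both to
  \<open>y\<close> and to \<open>wvec\<close>, hence zero.\<close>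

lemma unit_quot_hyperplanes:
  "unit_quot (hyperplane p q (c p q)) (hyperplane (Suc p) q (c (Suc p) q)) =
    {\<lambda>k. \<gamma> * wvec c p q k | \<gamma>. cmod \<gamma> = 1}" (is "?L = ?R")
proof
  have WG: "wvec c p q \<in> G p (Suc q)" using wvec_in_G pq by simp
  show "?R \<subseteq> ?L"
  proof clarify
    fix \<gamma> :: complex assume g: "cmod \<gamma> = 1"
    let ?w = "\<lambda>k. \<gamma> * wvec c p q k"
    have "?w \<in> hyperplane p q (c p q)"
      by (rule cvec.subspace_scale[OF subspace_hyperplane wvec_in_hyperplane])
    moreover have "hdot x ?w = 0" if "x \<in> hyperplane (Suc p) q (c (Suc p) q)" for x
    proof -
      have "hdot x ?w = \<gamma> * hdot x (wvec c p q)" by (simp add: hdot_def sum_distrib_left mult_ac)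
      then show ?thesis using wvec_orthogonal[OF that] by simp
    qed
    moreover have "hdot ?w ?w = \<gamma> * cnj \<gamma> * hdot (wvec c p q) (wvec c p q)"
      using WG cvec.subspace_scale[OF subspace_G WG, of \<gamma>]
      by (simp add: hdot_G[of _ p q] sum_distrib_left mult_ac)
    then have "hdot ?w ?w = 1" using g hdot_wvec_self by (simp flip: complex_norm_square)
    ultimately show "?w \<in> ?L" by (simp add: unit_quot_def)
  qed
  show "?L \<subseteq> ?R"
  proof
    fix y assume y: "y \<in> ?L"
    define \<gamma> where "\<gamma> = hdot (wvec c p q) y"
    define d where "d = (\<lambda>k. y k - \<gamma> * wvec c p q k)"
    have yG: "y \<in> G p (Suc q)" using y by (simp add: unit_quot_def hyperplane_def)
    have dH: "d \<in> hyperplane p q (c p q)"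
      using y cvec.subspace_diff[OF subspace_hyperplane _
          cvec.subspace_scale[OF subspace_hyperplane wvec_in_hyperplane, of \<gamma>], of y]
      by (simp add: d_def unit_quot_def fun_diff_def)
    then have dG: "d \<in> G p (Suc q)" by (simp add: hyperplane_def)
    have "hdot (wvec c p q) d = \<gamma> - \<gamma> * hdot (wvec c p q) (wvec c p q)"
      using WG by (simp add: \<gamma>_def hdot_G[of _ p q] d_def right_diff_distrib sum_subtractf sum_distrib_left mult_ac)
    then have wd: "hdot (wvec c p q) d = 0" by (simp add: hdot_wvec_self)
    then have "d \<in> hyperplane (Suc p) q (c (Suc p) q)" using orthogonal_wvec_imp dH by blast
    then have "hdot d y = 0" using y by (simp add: unit_quot_def)
    moreover have "hdot d d = hdot d y - \<gamma> * hdot d (wvec c p q)"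
      using dG by (simp add: hdot_G[of d p q] d_def[THEN fun_cong, of k for k] right_diff_distrib sum_subtractf sum_distrib_left mult_ac)
    ultimately have "hdot d d = 0" using hdot_sym[OF WG dG] wd by simp
    then have d0: "d = 0" using hdot_self_G_eq_0[OF dG] by simp
    have yw: "y = (\<lambda>k. \<gamma> * wvec c p q k)" using d0 by (simp add: d_def fun_eq_iff)
    have "hdot y y = \<gamma> * cnj \<gamma> * hdot (wvec c p q) (wvec c p q)"
      using WG yG by (simp add: hdot_G[of _ p q]) (simp add: yw sum_distrib_left mult_ac)
    then have "complex_of_real ((cmod \<gamma>)\<^sup>2) = 1"
      using y hdot_wvec_self by (simp add: unit_quot_def complex_norm_square del: of_real_power)
    then have "(cmod \<gamma>)\<^sup>2 = 1" by (metis of_real_1 of_real_eq_iff)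
    then have "cmod \<gamma> = 1" using norm_ge_zero[of \<gamma>] by (auto simp: power2_eq_1_iff)
    then show "y \<in> ?R" using yw by blast
  qed
qed

end

end

section \<open>The blow-up condition\<close>

lemma mem_unit_tensors: "u \<in> unit_tensors A C \<longleftrightarrow> (\<exists>w\<in>A. \<exists>c\<in>C. u = tensor w c)"
  by (auto simp: unit_tensors_def)

lemma unit_tensors_circles:
  "unit_tensors {\<lambda>k. \<gamma> * w k | \<gamma>. cmod \<gamma> = 1} ((\<lambda>w k. cnj (w k)) ` {\<lambda>k. \<gamma> * w' k | \<gamma>. cmod \<gamma> = 1}) =
    {\<lambda>a b. \<gamma> * (w a * cnj (w' b)) | \<gamma>. cmod \<gamma> = 1}" (is "?L = ?R")
proof (rule set_eqI)
  fix u
  have T: "tensor (\<lambda>k. \<alpha> * w k) (\<lambda>k. cnj (\<beta> * w' k)) = (\<lambda>a b. \<alpha> * cnj \<beta> * (w a * cnj (w' b)))" for \<alpha> \<beta>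
    unfolding tensor_def complex_cnj_mult by (simp only: mult_ac)
  have "u \<in> ?L \<longleftrightarrow> (\<exists>\<alpha>\<in>{\<gamma>. cmod \<gamma> = 1}. \<exists>\<beta>\<in>{\<gamma>. cmod \<gamma> = 1}.
      u = (\<lambda>a b. \<alpha> * cnj \<beta> * (w a * cnj (w' b))))"
    by (simp only: mem_unit_tensors setcompr_eq_image image_image bex_simps T)
  also have "\<dots> \<longleftrightarrow> (\<exists>\<gamma>\<in>{\<gamma>. cmod \<gamma> = 1}. u = (\<lambda>a b. \<gamma> * (w a * cnj (w' b))))"
  proof
    assume "\<exists>\<alpha>\<in>{\<gamma>. cmod \<gamma> = 1}. \<exists>\<beta>\<in>{\<gamma>. cmod \<gamma> = 1}. u = (\<lambda>a b. \<alpha> * cnj \<beta> * (w a * cnj (w' b)))"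
    then obtain \<alpha> \<beta> where "cmod \<alpha> = 1" "cmod \<beta> = 1" "u = (\<lambda>a b. \<alpha> * cnj \<beta> * (w a * cnj (w' b)))" by auto
    then show "\<exists>\<gamma>\<in>{\<gamma>. cmod \<gamma> = 1}. u = (\<lambda>a b. \<gamma> * (w a * cnj (w' b)))"
      by (intro bexI[of _ "\<alpha> * cnj \<beta>"]) (simp_all add: norm_mult)
  next
    assume "\<exists>\<gamma>\<in>{\<gamma>. cmod \<gamma> = 1}. u = (\<lambda>a b. \<gamma> * (w a * cnj (w' b)))"
    then obtain \<gamma> where "cmod \<gamma> = 1" "u = (\<lambda>a b. \<gamma> * (w a * cnj (w' b)))" by auto
    then show "\<exists>\<alpha>\<in>{\<gamma>. cmod \<gamma> = 1}. \<exists>\<beta>\<in>{\<gamma>. cmod \<gamma> = 1}. u = (\<lambda>a b. \<alpha> * cnj \<beta> * (w a * cnj (w' b)))"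
      by (intro bexI[of _ \<gamma>] bexI[of _ 1]) simp_all
  qed
  also have "\<dots> \<longleftrightarrow> u \<in> ?R"
    by (simp only: setcompr_eq_image bex_simps image_iff)
  finally show "u \<in> ?L \<longleftrightarrow> u \<in> ?R" .
qed

section \<open>The section that cuts out a divisor, in the trivializations by
  \<open>wvec\<close>\<close>

context covec_system
begin

context
  fixes p q assumes pq: "ext_interval n p q" "Suc p < q"
begin

text \<open>The inclusion of \<open>V (Suc p) (q - 1)\<close> into \<open>V (Suc p) q\<close>
  induces a map between two quotient lines, whose zero locus is the divisor
  \<open>(Suc p, q)\<close>. This is its matrix entry for the unit vectors
  \<open>wvec c p (q - 1)\<close> and \<open>wvec c p q\<close>.\<close>

abbreviation (input) "overlap \<equiv> hdot (wvec c p q) (wvec c p (q - 1))"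

lemma ext_pred: "ext_interval n p (q - 1)" "p < q - 1" "p < q"
  using pq by (auto simp: ext_interval_def)

lemma ext_Suc': "ext_interval n (Suc p) q" "ext_interval n (Suc p) (q - 1)"
  using pq by (auto simp: ext_interval_def)

lemma overlap_eq:
  "overlap = cnj (lcoef c p q) * lcoef c p (q - 1) + cnj (c p q p) * c p (q - 1) p * rcoef c (Suc p) q"
proof -
  have G: "wvec c p (q - 1) \<in> G p (Suc q)"
    using wvec_in_G[of p "q - 1"] ext_pred G_mono[of p p "Suc (q - 1)" "Suc q"] by auto
  have "(\<Sum>k=Suc p..q. c (Suc p) q k * wvec c p (q - 1) k) =
      (\<Sum>k=Suc p..q - 1. c (Suc p) q k * wvec c p (q - 1) k)"
    using pq by (intro sum.mono_neutral_right) (auto simp: wvec_def)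
  also have "\<dots> = - c p (q - 1) p * rcoef c (Suc p) q"
    unfolding rcoef_def sum_distrib_left by (intro sum.cong) (auto simp: wvec_def)
  finally have s: "(\<Sum>k=Suc p..q. c (Suc p) q k * wvec c p (q - 1) k) = - c p (q - 1) p * rcoef c (Suc p) q" .
  have "wvec c p (q - 1) p = lcoef c p (q - 1)" by (simp add: wvec_def)
  then show ?thesis
    unfolding hdot_wvec_left[OF pq(1) ext_pred(3) G] s by (simp add: algebra_simps)
qed

text \<open>In the second equation both sides are the factor between the restriction of
  \<open>c p q\<close> to \<open>{Suc p..q - 1}\<close> and \<open>c (Suc p) (q - 1)\<close>, with
  the two end points dropped in either order.\<close>

lemma relation:
  "c p q p = rcoef c p q * c p (q - 1) p"
  "lcoef c p q * rcoef c (Suc p) q = rcoef c p q * lcoef c p (q - 1)"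
proof -
  note e = ext_Suc'
  show "c p q p = rcoef c p q * c p (q - 1) p"
    by (rule right[OF pq(1)]) (use pq(2) in simp_all)
  obtain k where k: "k \<in> {Suc p..q-1}" "c (Suc p) (q - 1) k \<noteq> 0"
    using unit_covec_nonzero[OF unit[OF e(2)]] by blast
  then have k': "Suc p \<le> k" "p \<le> k" "k \<le> q" "k \<le> q - 1" "k < q" using pq(2) by auto
  have "lcoef c p q * rcoef c (Suc p) q * c (Suc p) (q - 1) k = c p q k"
    unfolding left[OF pq(1) k'(1,3)] right[OF e(1) k'(1,5)] by (rule mult.assoc)
  also have "c p q k = rcoef c p q * lcoef c p (q - 1) * c (Suc p) (q - 1) k"
    unfolding right[OF pq(1) k'(2,5)] left[OF ext_pred(1) k'(1,4)] by (rule mult.assoc[symmetric])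
  finally show "lcoef c p q * rcoef c (Suc p) q = rcoef c p q * lcoef c p (q - 1)"
    using k(2) by simp
qed

text \<open>By \<open>relation\<close> and \<open>norm_left\<close>, \<open>overlap\<close> times
  \<open>rcoef c p q\<close> is \<open>rcoef c (Suc p) q\<close>, so the latter vanishes with
  \<open>overlap\<close>. What remains is that the product of \<open>lcoef c p (q - 1)\<close> and
  the conjugate of \<open>lcoef c p q\<close> vanishes. If \<open>lcoef c p q\<close> is zero, then
  \<open>rcoef c p q\<close> is not, and \<open>relation\<close> gives the claim.\<close>

lemma overlap_eq_0_iff: "overlap = 0 \<longleftrightarrow> lcoef c p (q - 1) = 0 \<and> rcoef c (Suc p) q = 0"
proof
  assume h: "overlap = 0"
  let ?C = "lcoef c p q" and ?C' = "lcoef c p (q - 1)" and ?D = "rcoef c p q" and ?E = "rcoef c (Suc p) q"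
  have CE: "?C * ?E = ?D * ?C'" and cD: "c p q p = ?D * c p (q - 1) p"
    using relation by auto
  have n1: "c p q p * cnj (c p q p) + ?C * cnj ?C = 1" by (rule norm_left[OF pq(1) ext_pred(3)])
  have h2: "cnj ?C * ?C' + cnj (c p q p) * c p (q - 1) p * ?E = 0" using h overlap_eq by simp
  have "?D * (cnj ?C * ?C' + cnj (c p q p) * c p (q - 1) p * ?E) =
      cnj ?C * (?D * ?C') + cnj (c p q p) * (?D * c p (q - 1) p) * ?E"
    by (simp add: algebra_simps)
  also have "\<dots> = (c p q p * cnj (c p q p) + ?C * cnj ?C) * ?E"
    unfolding CE[symmetric] cD[symmetric] by (simp add: algebra_simps)
  finally have E: "?E = 0" using n1 h2 by simp
  then have "?C' = 0 \<or> ?C = 0" using h2 by auto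
  moreover have "?C' = 0" if "?C = 0"
  proof -
    have "c p q p \<noteq> 0" using n1 that by auto
    then have "?D \<noteq> 0" using cD by auto
    then show ?thesis using CE that by simp
  qed
  ultimately show "?C' = 0 \<and> ?E = 0" using E by blast
qed (subst overlap_eq, simp)

text \<open>The conditions for all \<open>k\<close> follow from those for the two largest intervals
  \<open>{p..q - 1}\<close> and \<open>{Suc p..q}\<close>: a covector concentrated at an end point
  restricts to a non-zero multiple of the covector on any smaller interval containing this end
  point.\<close>

lemma in_divisor_iff: "brick_of n c \<in> brick_divisor n (Suc p) q \<longleftrightarrow> overlap = 0"
proof -
  have e: "ext_interval n (Suc p) q" using pq by (auto simp: ext_interval_def)
  have L: "brick_of n c (Suc p) k = G (Suc p) (k + 1) \<longleftrightarrow> (\<forall>j\<in>{Suc p..k}. c p k j = 0)"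
    if "Suc p \<le> k" "k < q" for k
  proof -
    have "ext_interval n p k" using pq that by (auto simp: ext_interval_def)
    then show ?thesis using hyperplane_eq_G_left[OF unit, of p k] brick_of_Suc that by simp
  qed
  have R: "brick_of n c k q = G (k - 1) q \<longleftrightarrow> (\<forall>j\<in>{k-1..<q}. c (k - 1) q j = 0)"
    if "Suc p < k" "k \<le> q" for k
  proof -
    have "ext_interval n (k - 1) q" using pq that by (auto simp: ext_interval_def)
    then show ?thesis using hyperplane_eq_G_right[OF unit, of "k - 1" q] brick_of_eq[of k q] that by simp
  qed
  have "brick_of n c \<in> brick_divisor n (Suc p) q \<longleftrightarrow>
      (\<forall>k. Suc p \<le> k \<and> k < q \<longrightarrow> (\<forall>j\<in>{Suc p..k}. c p k j = 0)) \<and>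
      (\<forall>k. Suc p < k \<and> k \<le> q \<longrightarrow> (\<forall>j\<in>{k-1..<q}. c (k - 1) q j = 0))"
    unfolding brick_divisor_def using brick_of_in_manifold L R by auto
  also have "\<dots> \<longleftrightarrow> lcoef c p (q - 1) = 0 \<and> rcoef c (Suc p) q = 0"
  proof (intro iffI conjI allI impI ballI; (elim conjE)?)
    assume "\<forall>k. Suc p \<le> k \<and> k < q \<longrightarrow> (\<forall>j\<in>{Suc p..k}. c p k j = 0)"
    then have "\<forall>j\<in>{Suc p..q-1}. c p (q-1) j = 0" using pq by auto
    then show "lcoef c p (q - 1) = 0" by (simp add: lcoef_def)
  next
    assume "\<forall>k. Suc p < k \<and> k \<le> q \<longrightarrow> (\<forall>j\<in>{k-1..<q}. c (k - 1) q j = 0)"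
    from this[rule_format, of "Suc (Suc p)"] have "\<forall>j\<in>{Suc p..<q}. c (Suc p) q j = 0" using pq by auto
    then show "rcoef c (Suc p) q = 0" unfolding rcoef_def by (intro sum.neutral ballI) (use pq in auto)
  next
    fix k j assume "lcoef c p (q - 1) = 0" and k: "Suc p \<le> k" "k < q" and j: "j \<in> {Suc p..k}"
    then have 0: "c p (q - 1) i = 0" if "Suc p \<le> i" "i \<le> q - 1" for i
      using left[OF ext_pred(1)] that by simp
    have "p \<le> p" "p \<le> k" "k \<le> q - 1" using k by linarith+
    from restrict[OF ext_pred(1) this]
    obtain z where z: "\<forall>i\<in>{p..k}. c p (q - 1) i = z * c p k i" by blast
    have "c p (q - 1) p \<noteq> 0"
      using 0 unit_covec_nonzero[OF unit[OF ext_pred(1)]] by (metis Suc_leI atLeastAtMost_iff le_neq_implies_less)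
    then have "z \<noteq> 0" using z k by auto
    moreover have "z * c p k j = 0" using z 0[of j] j k by auto
    ultimately show "c p k j = 0" by simp
  next
    fix k j assume "rcoef c (Suc p) q = 0" and k: "Suc p < k" "k \<le> q" and j: "j \<in> {k-1..<q}"
    then have 0: "c (Suc p) q i = 0" if "Suc p \<le> i" "i < q" for i
      using right[OF e] that by simp
    have "Suc p \<le> k - 1" "k - 1 \<le> q" "q \<le> q" using k by linarith+
    from restrict[OF e this]
    obtain z where z: "\<forall>i\<in>{k-1..q}. c (Suc p) q i = z * c (k - 1) q i" by blast
    have "c (Suc p) q q \<noteq> 0"
      using 0 unit_covec_nonzero[OF unit[OF e]] by (metis atLeastAtMost_iff le_neq_implies_less)
    then have "z \<noteq> 0" using z k by auto
    moreover have "z * c (k - 1) q j = 0" using z 0[of j] j k by auto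
    ultimately show "c (k - 1) q j = 0" by simp
  qed
  finally show ?thesis unfolding overlap_eq_0_iff .
qed

lemma unit_tensors_wvec:
  "unit_tensors (unit_quot (brick_of n c (Suc p) q) (brick_of n c (Suc (Suc p)) q))
      (unit_quot_dual (brick_of n c (Suc p) (q - 1)) (brick_of n c (Suc (Suc p)) (q - 1))) =
    {\<lambda>a b. \<gamma> * (wvec c p q a * cnj (wvec c p (q - 1) b)) | \<gamma>. cmod \<gamma> = 1}"
proof -
  note e = ext_Suc'
  show ?thesis
    unfolding unit_quot_dual_def brick_of_Suc[OF e(1)] brick_of_Suc[OF e(2)] brick_of_Suc[OF pq(1)]
      brick_of_Suc[OF ext_pred(1)] unit_quot_hyperplanes[OF pq(1) ext_pred(3)]
      unit_quot_hyperplanes[OF ext_pred(1,2)]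
    by (rule unit_tensors_circles)
qed

text \<open>It suffices to test the generator \<open>wvec c p (q - 1)\<close> of the source line,
  because its complement in the source already lies in the target subspace.\<close>

lemma positive_multiple_iff:
  "(\<forall>x\<in>hyperplane p (q - 1) (c p (q - 1)).
      (\<lambda>k. x k - complex_of_real t * mat_apply (\<lambda>a b. \<gamma> * (wvec c p q a * cnj (wvec c p (q - 1) b))) x k)
        \<in> hyperplane (Suc p) q (c (Suc p) q)) \<longleftrightarrow> overlap = t * \<gamma>" (is "?L \<longleftrightarrow> ?R")
proof -
  let ?w = "wvec c p q" and ?w' = "wvec c p (q - 1)"
  have wG: "?w \<in> G p (Suc q)" and wG': "?w' \<in> G p (Suc (q - 1))"
    using wvec_in_G[of p q] wvec_in_G[of p "q - 1"] ext_pred by auto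
  have wG'': "?w' \<in> G p (Suc q)" using wG' G_mono[of p p "Suc (q - 1)" "Suc q"] by auto
  have app: "mat_apply (\<lambda>a b. \<gamma> * (?w a * cnj (?w' b))) x = (\<lambda>a. \<gamma> * hdot ?w' x * ?w a)"
    if "x \<in> G p (Suc (q - 1))" for x
  proof -
    have "mat_apply (\<lambda>a b. \<gamma> * (?w a * cnj (?w' b))) x =
        (\<lambda>a. \<Sum>b=p..q-1. \<gamma> * (?w a * cnj (?w' b)) * x b)"
      by (rule mat_apply_eq_sum) (use that in \<open>auto simp: G_def\<close>)
    also have "(\<lambda>a. \<Sum>b=p..q-1. \<gamma> * (?w a * cnj (?w' b)) * x b) = (\<lambda>a. \<gamma> * hdot ?w' x * ?w a)"
    proof
      fix a
      have "\<gamma> * (?w a * cnj (?w' b)) * x b = \<gamma> * ?w a * (cnj (?w' b) * x b)" for b by simp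
      then show "(\<Sum>b=p..q-1. \<gamma> * (?w a * cnj (?w' b)) * x b) = \<gamma> * hdot ?w' x * ?w a"
        unfolding hdot_G[OF wG'] by (simp only: sum_distrib_left[symmetric]) (simp add: mult.commute)
    qed
    finally show ?thesis .
  qed
  have hdot_diff: "hdot ?w (\<lambda>k. x k - a * y k) = hdot ?w x - a * hdot ?w y" for x y a
    unfolding hdot_G[OF wG] by (simp add: algebra_simps sum_subtractf sum_distrib_left)
  have hdot_diff': "hdot ?w' (\<lambda>k. x k - a * y k) = hdot ?w' x - a * hdot ?w' y" for x y a
    unfolding hdot_G[OF wG'] by (simp add: algebra_simps sum_subtractf sum_distrib_left)
  have A: "?w \<in> hyperplane p q (c p q)" and A': "?w' \<in> hyperplane p (q - 1) (c p (q - 1))"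
    using wvec_in_hyperplane pq ext_pred by auto
  have self: "hdot ?w ?w = 1" "hdot ?w' ?w' = 1"
    using hdot_wvec_self pq ext_pred by auto
  have A'A: "hyperplane p (q - 1) (c p (q - 1)) \<subseteq> hyperplane p q (c p q)"
    using hyperplane_mono_right[OF pq(1) ext_pred(3)] .
  have e: "ext_interval n (Suc p) q" using pq by (auto simp: ext_interval_def)
  have B'B: "hyperplane (Suc p) (q - 1) (c (Suc p) (q - 1)) \<subseteq> hyperplane (Suc p) q (c (Suc p) q)"
    using hyperplane_mono_right[OF e] pq by simp
  have B0: "hdot ?w x = 0" if "x \<in> hyperplane (Suc p) q (c (Suc p) q)" for x
  proof -
    have "x \<in> G p (Suc q)" using that G_mono[of p "Suc p" "Suc q" "Suc q"] by (auto simp: hyperplane_def)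
    then show ?thesis
      using hdot_sym[OF _ wG, of x] wvec_orthogonal[OF pq(1) ext_pred(3) that] by simp
  qed
  show ?thesis
  proof
    assume ?L
    from bspec[OF this A', unfolded app[OF wG'] self mult_1_right]
    have "(\<lambda>k. ?w' k - t * \<gamma> * ?w k) \<in> hyperplane (Suc p) q (c (Suc p) q)"
      by (simp only: mult.assoc)
    from B0[OF this] show ?R unfolding hdot_diff self by simp
  next
    assume R: ?R
    show ?L
    proof
      fix x assume x: "x \<in> hyperplane p (q - 1) (c p (q - 1))"
      then have xG: "x \<in> G p (Suc (q - 1))" by (simp add: hyperplane_def)
      define b where "b = (\<lambda>k. x k - hdot ?w' x * ?w' k)"
      have "b \<in> hyperplane p (q - 1) (c p (q - 1))"
        unfolding b_def using cvec.subspace_diff[OF subspace_hyperplane x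
            cvec.subspace_scale[OF subspace_hyperplane A', of "hdot ?w' x"]] by (simp add: fun_diff_def)
      moreover have "hdot ?w' b = 0" unfolding b_def hdot_diff' self by simp
      ultimately have "b \<in> hyperplane (Suc p) q (c (Suc p) q)"
        using orthogonal_wvec_imp[OF ext_pred(1,2)] B'B by blast
      then have "hdot ?w b = 0" using B0 by blast
      then have wx: "hdot ?w x = hdot ?w' x * overlap" unfolding b_def hdot_diff by simp
      define d where "d = (\<lambda>k. x k - (overlap * hdot ?w' x) * ?w k)"
      have "d \<in> hyperplane p q (c p q)"
        unfolding d_def using cvec.subspace_diff[OF subspace_hyperplane subsetD[OF A'A x]
            cvec.subspace_scale[OF subspace_hyperplane A, of "overlap * hdot ?w' x"]] by (simp add: fun_diff_def)
      moreover have "hdot ?w d = 0" unfolding d_def hdot_diff self wx by simp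
      ultimately have "d \<in> hyperplane (Suc p) q (c (Suc p) q)"
        using orthogonal_wvec_imp[OF pq(1) ext_pred(3)] by blast
      then show "(\<lambda>k. x k - complex_of_real t * mat_apply (\<lambda>a b. \<gamma> * (?w a * cnj (?w' b))) x k)
          \<in> hyperplane (Suc p) q (c (Suc p) q)"
        unfolding d_def app[OF xG] R by (simp only: mult.assoc)
    qed
  qed
qed

text \<open>One equation covers both cases of the blow-up: on the divisor \<open>overlap\<close> is
  zero and \<gamma> is free, elsewhere \<gamma> is the phase of \<open>overlap\<close>.\<close>

lemma blow_up_direction_iff:
  "(if brick_of n c \<in> brick_divisor n (Suc p) q then u \<in> unit_normals (brick_of n c) (Suc p) q
    else u = section_direction (brick_of n c) (Suc p) q) \<longleftrightarrow>
   (\<exists>\<gamma>. cmod \<gamma> = 1 \<and> overlap = complex_of_real (cmod overlap) * \<gamma> \<and>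
      u = (\<lambda>a b. \<gamma> * (wvec c p q a * cnj (wvec c p (q - 1) b))))"
proof -
  note e = ext_Suc'
  show ?thesis
  proof (cases "brick_of n c \<in> brick_divisor n (Suc p) q")
    case True
    then have h: "overlap = 0" using in_divisor_iff by simp
    from True have "brick_of n c (Suc p) (q - 1) = G (Suc p) q"
      "brick_of n c (Suc (Suc p)) q = G (Suc p) q"
      using pq by (auto simp: brick_divisor_def)
    then have "unit_normals (brick_of n c) (Suc p) q =
        {\<lambda>a b. \<gamma> * (wvec c p q a * cnj (wvec c p (q - 1) b)) | \<gamma>. cmod \<gamma> = 1}"
      using unit_tensors_wvec by (simp add: unit_normals_def)
    then show ?thesis unfolding if_P[OF True] h by auto
  next
    case False
    then have h: "overlap \<noteq> 0" using in_divisor_iff by simp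
    let ?T = "\<lambda>\<gamma> a b. \<gamma> * (wvec c p q a * cnj (wvec c p (q - 1) b))"
    let ?P = "\<lambda>u. u \<in> unit_tensors (unit_quot (brick_of n c (Suc p) q) (brick_of n c (Suc p + 1) q))
          (unit_quot_dual (brick_of n c (Suc p) (q - 1)) (brick_of n c (Suc p + 1) (q - 1))) \<and>
        (\<exists>t>0. \<forall>x\<in>brick_of n c (Suc p) (q - 1).
          (\<lambda>k. x k - complex_of_real t * mat_apply u x k) \<in> brick_of n c (Suc p + 1) q)"
    have mem: "unit_tensors (unit_quot (brick_of n c (Suc p) q) (brick_of n c (Suc p + 1) q))
          (unit_quot_dual (brick_of n c (Suc p) (q - 1)) (brick_of n c (Suc p + 1) (q - 1))) =
        {?T \<gamma> | \<gamma>. cmod \<gamma> = 1}"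
      unfolding Suc_eq_plus1[symmetric] by (rule unit_tensors_wvec)
    have pos: "(\<exists>t>0. \<forall>x\<in>brick_of n c (Suc p) (q - 1).
          (\<lambda>k. x k - complex_of_real t * mat_apply (?T \<gamma>) x k) \<in> brick_of n c (Suc p + 1) q) \<longleftrightarrow>
        (\<exists>t>0. overlap = complex_of_real t * \<gamma>)" for \<gamma>
      unfolding Suc_eq_plus1[symmetric] brick_of_Suc[OF e(1)] brick_of_Suc[OF ext_pred(1)]
        positive_multiple_iff ..
    have P: "?P u \<longleftrightarrow> (\<exists>\<gamma>. cmod \<gamma> = 1 \<and> u = ?T \<gamma> \<and> (\<exists>t>0. overlap = complex_of_real t * \<gamma>))" for u
    proof
      assume u: "?P u"
      then obtain \<gamma> where g: "cmod \<gamma> = 1" "u = ?T \<gamma>" unfolding mem by blast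
      show "\<exists>\<gamma>. cmod \<gamma> = 1 \<and> u = ?T \<gamma> \<and> (\<exists>t>0. overlap = complex_of_real t * \<gamma>)"
        using conjunct2[OF u] unfolding g(2) pos using g(1) by (intro exI[of _ \<gamma>]) simp
    next
      assume "\<exists>\<gamma>. cmod \<gamma> = 1 \<and> u = ?T \<gamma> \<and> (\<exists>t>0. overlap = complex_of_real t * \<gamma>)"
      then obtain \<gamma> where g: "cmod \<gamma> = 1" "u = ?T \<gamma>" "\<exists>t>0. overlap = complex_of_real t * \<gamma>" by blast
      show "?P u" unfolding g(2) pos unfolding mem using g(1,3) by blast
    qed
    have phase: "(\<exists>t>0. overlap = complex_of_real t * \<gamma>) \<longleftrightarrow> \<gamma> = overlap / cmod overlap" if "cmod \<gamma> = 1" for \<gamma>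
    proof
      assume "\<exists>t>0. overlap = complex_of_real t * \<gamma>"
      then obtain t where t: "t > 0" "overlap = complex_of_real t * \<gamma>" by blast
      then have "cmod overlap = t" using that by (simp add: norm_mult)
      then show "\<gamma> = overlap / cmod overlap" using t by simp
    next
      assume "\<gamma> = overlap / cmod overlap"
      then have "overlap = complex_of_real (cmod overlap) * \<gamma>" using h by simp
      then show "\<exists>t>0. overlap = complex_of_real t * \<gamma>" using h zero_less_norm_iff by blast
    qed
    have 1: "cmod (overlap / cmod overlap) = 1" using h by (simp add: norm_divide)
    have "?P u \<longleftrightarrow> u = ?T (overlap / cmod overlap)" for u
      unfolding P using phase 1 by (metis (no_types, lifting))
    then have sd: "section_direction (brick_of n c) (Suc p) q = ?T (overlap / cmod overlap)"
      unfolding section_direction_def by (intro the_equality) blast+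
    have eq: "overlap = complex_of_real (cmod overlap) * \<gamma> \<longleftrightarrow> \<gamma> = overlap / cmod overlap" for \<gamma>
      using h by (auto simp: field_simps)
    show ?thesis unfolding if_not_P[OF False] sd eq using 1 by blast
  qed
qed

end

lemma unit_vectors_line:
  assumes "1 \<le> k" "k \<le> n"
  shows "unit_quot (brick_of n c k k) {0} = {\<lambda>j. \<gamma> * wvec c (k - 1) k j | \<gamma>. cmod \<gamma> = 1}"
proof -
  have e: "ext_interval n (k - 1) k" "ext_interval n k k"
    using assms two_le_n by (auto simp: ext_interval_def)
  then show ?thesis
    using unit_quot_hyperplanes[OF e(1)] hyperplane_single[OF unit[OF e(2)]] brick_of_eq[of k k] assms by simp
qed

text \<open>The normal vectors of the hyperplane \<open>V 2 (n - 1)\<close> are the multiples of the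
  conjugate of \<open>c 1 (n - 1)\<close>, and passing to functionals conjugates back.\<close>

lemma unit_covectors_top:
  "unit_quot_dual (G 1 n) (brick_of n c 2 (n - 1)) = {\<lambda>k. \<gamma> * c 1 (n - 1) k | \<gamma>. cmod \<gamma> = 1}"
proof -
  have e: "ext_interval n 1 (n - 1)" using two_le_n by (auto simp: ext_interval_def)
  have B: "brick_of n c 2 (n - 1) = hyperplane 1 (n - 1) (c 1 (n - 1))"
    using brick_of_Suc[OF e] by (simp add: numeral_2_eq_2)
  have cG: "c 1 (n - 1) \<in> G 1 (Suc (n - 1))" using in_G[OF e] .
  have n: "Suc (n - 1) = n" using two_le_n by simp
  have norm: "(\<Sum>k=1..n-1. (\<gamma> * c 1 (n - 1) k) * cnj (\<gamma> * c 1 (n - 1) k)) = \<gamma> * cnj \<gamma>" for \<gamma>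
  proof -
    have "(\<Sum>k=1..n-1. (\<gamma> * c 1 (n - 1) k) * cnj (\<gamma> * c 1 (n - 1) k)) =
        \<gamma> * cnj \<gamma> * (\<Sum>k=1..n-1. c 1 (n - 1) k * cnj (c 1 (n - 1) k))"
      by (simp add: sum_distrib_left mult_ac)
    then show ?thesis using norm_eq_1[OF e] by simp
  qed
  have mod1: "\<gamma> * cnj \<gamma> = 1 \<longleftrightarrow> cmod \<gamma> = 1" for \<gamma>
    by (metis complex_norm_square norm_ge_zero norm_one of_real_1 of_real_eq_iff one_power2 power2_eq_iff_nonneg)
  have "w \<in> unit_quot (G 1 n) (hyperplane 1 (n - 1) (c 1 (n - 1))) \<longleftrightarrow>
      (\<exists>\<gamma>. cmod \<gamma> = 1 \<and> w = (\<lambda>k. cnj (\<gamma> * c 1 (n - 1) k)))" for w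
  proof
    assume w: "w \<in> unit_quot (G 1 n) (hyperplane 1 (n - 1) (c 1 (n - 1)))"
    then have wG: "w \<in> G 1 (Suc (n - 1))" unfolding n by (simp add: unit_quot_def)
    from w obtain \<beta> where b: "w = (\<lambda>k. \<beta> * cnj (c 1 (n - 1) k))"
      using orthogonal_hyperplane[OF unit[OF e] wG] by (auto simp: unit_quot_def)
    have "hdot w w = cnj (\<Sum>k=1..n-1. (cnj \<beta> * c 1 (n - 1) k) * cnj (cnj \<beta> * c 1 (n - 1) k))"
      unfolding hdot_G[OF wG] by (simp add: b mult_ac)
    then have "cnj \<beta> * cnj (cnj \<beta>) = 1" using w unfolding norm by (simp add: unit_quot_def mult.commute)
    then have "cmod (cnj \<beta>) = 1" unfolding mod1 .
    moreover have "w = (\<lambda>k. cnj (cnj \<beta> * c 1 (n - 1) k))" using b by simp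
    ultimately show "\<exists>\<gamma>. cmod \<gamma> = 1 \<and> w = (\<lambda>k. cnj (\<gamma> * c 1 (n - 1) k))" by blast
  next
    assume "\<exists>\<gamma>. cmod \<gamma> = 1 \<and> w = (\<lambda>k. cnj (\<gamma> * c 1 (n - 1) k))"
    then obtain \<gamma> where g: "cmod \<gamma> = 1" "w = (\<lambda>k. cnj (\<gamma> * c 1 (n - 1) k))" by blast
    have wG: "w \<in> G 1 (Suc (n - 1))" using cG by (auto simp: g G_def)
    have "hdot w w = 1"
      using norm[of \<gamma>] g(1) unfolding hdot_G[OF wG] by (simp add: g(2) mod1[symmetric])
    moreover have "hdot x w = 0" if "x \<in> hyperplane 1 (n - 1) (c 1 (n - 1))" for x
    proof -
      have xG: "x \<in> G 1 (Suc (n - 1))" using that by (simp add: hyperplane_def)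
      have "hdot x w = cnj \<gamma> * cnj (\<Sum>k=1..n-1. c 1 (n - 1) k * x k)"
        unfolding hdot_G[OF xG] by (simp add: g sum_distrib_left mult_ac)
      moreover have "(\<Sum>k=1..n-1. c 1 (n - 1) k * x k) = 0" using that by (simp add: hyperplane_def)
      ultimately show ?thesis by (simp only: complex_cnj_zero mult_zero_right)
    qed
    ultimately show "w \<in> unit_quot (G 1 n) (hyperplane 1 (n - 1) (c 1 (n - 1)))"
      using wG[unfolded n] by (simp add: unit_quot_def)
  qed
  then have "unit_quot (G 1 n) (hyperplane 1 (n - 1) (c 1 (n - 1))) =
      {\<lambda>k. cnj (\<gamma> * c 1 (n - 1) k) | \<gamma>. cmod \<gamma> = 1}" by blast
  then have "(\<lambda>w k. cnj (w k)) ` unit_quot (G 1 n) (hyperplane 1 (n - 1) (c 1 (n - 1))) =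
      (\<lambda>w k. cnj (w k)) ` (\<lambda>\<gamma> k. cnj (\<gamma> * c 1 (n - 1) k)) ` {\<gamma>. cmod \<gamma> = 1}"
    by (simp only: setcompr_eq_image)
  also have "\<dots> = (\<lambda>\<gamma> k. \<gamma> * c 1 (n - 1) k) ` {\<gamma>. cmod \<gamma> = 1}"
    unfolding image_image by simp
  finally show ?thesis unfolding unit_quot_dual_def B by (simp only: setcompr_eq_image)
qed

end

section \<open>Existence and uniqueness of the covectors\<close>

lemma coef_eq:
  assumes "unit_covec p q d" "\<forall>k\<in>{p..q}. x k = z * d k"
  shows "(\<Sum>k=p..q. x k * cnj (d k)) = z"
proof -
  have "(\<Sum>k=p..q. x k * cnj (d k)) = (\<Sum>k=p..q. z * (d k * cnj (d k)))"
    using assms(2) by (intro sum.cong) simp_all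
  also have "\<dots> = z" using assms(1) by (simp add: unit_covec_def flip: sum_distrib_left)
  finally show ?thesis .
qed

lemma unit_covec_axis: "p \<le> j \<Longrightarrow> j \<le> q \<Longrightarrow> unit_covec p q (axis_vec j)"
proof -
  assume "p \<le> j" "j \<le> q"
  moreover have "axis_vec j k * cnj (axis_vec j k) = (if k = j then 1 else 0)" for k
    by (simp add: axis_vec_def)
  ultimately show ?thesis by (simp add: unit_covec_def axis_vec_in_G)
qed

lemma unit_covec_uminus: "unit_covec p q c \<Longrightarrow> unit_covec p q (\<lambda>k. - c k)"
  by (simp add: unit_covec_def G_def)

text \<open>Away from the boundary cases \<open>V i j\<close> is contained in both
  \<open>V 1 j\<close> and \<open>V i n\<close>, whose prescribed values confine it to the
  coordinates \<open>i - 1, ..., j\<close>. There it has codimension one, so a functional exists.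
  The phases of the inner functionals are arbitrary at this stage and are adjusted later.\<close>

lemma brick_eq_brick_of:
  assumes n: "2 \<le> n" and V: "V \<in> brick_manifold n"
  shows "\<exists>c. covec_system n c \<and> V = brick_of n c"
proof -
  note all = V[unfolded brick_manifold_def mem_Collect_eq]
  note Vdef = conjunct1[OF all] conjunct1[OF conjunct2[OF all]]
    conjunct1[OF conjunct2[OF conjunct2[OF all]]]
    conjunct1[OF conjunct2[OF conjunct2[OF conjunct2[OF all]]]]
    conjunct1[OF conjunct2[OF conjunct2[OF conjunct2[OF conjunct2[OF all]]]]]
    conjunct2[OF conjunct2[OF conjunct2[OF conjunct2[OF conjunct2[OF all]]]]]
  have Vsub: "cvec.subspace (V i j)" and Vdim: "cvec.dim (V i j) = j - i + 1" if "proper_interval n i j" for i j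
    using Vdef(1)[rule_format, OF that] by simp_all
  have Vleft: "V i j \<subseteq> V (i - 1) j" if "proper_interval n i j" "proper_interval n (i - 1) j" for i j
    by (rule Vdef(2)[rule_format]) (use that in simp)
  have Vright: "V i j \<subseteq> V i (j + 1)" if "proper_interval n i j" "proper_interval n i (j + 1)" for i j
    by (rule Vdef(3)[rule_format]) (use that in simp)
  have Vfirst: "V 1 j = G 1 (j + 1)" if "proper_interval n 1 j" for j
    by (rule Vdef(4)[rule_format]) (rule that)
  have Vlast: "V i n = G (i - 1) n" if "proper_interval n i n" for i
    by (rule Vdef(5)[rule_format]) (rule that)
  have Vnot: "V i j = {0}" if "\<not> proper_interval n i j" for i j
    by (rule Vdef(6)[rule_format]) (rule that)
  have up: "V i j \<subseteq> V 1 j" if "j < n" "1 \<le> i" "i \<le> j" for i j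
    using that(2,3)
  proof (induction i rule: dec_induct)
    case (step m)
    then show ?case using Vleft[of "Suc m" j] that(1) by (auto simp: proper_interval_def)
  qed simp
  have down: "V i j \<subseteq> V i n" if "1 < i" "i \<le> j" "j \<le> n" for i j
    using that(3,2)
  proof (induction j rule: inc_induct)
    case (step m)
    then show ?case using Vright[of i m] that(1) by (auto simp: proper_interval_def)
  qed simp
  have VG: "V i j \<subseteq> G (i - 1) (Suc j)" if ij: "proper_interval n i j" for i j
  proof (cases "j = n")
    case True
    then show ?thesis using Vlast[of i] ij G_mono[of "i - 1" "i - 1" n "Suc n"] by auto
  next
    case j: False
    then have 1: "V i j \<subseteq> G 1 (Suc j)"
      using up[of j i] Vfirst[of j] ij by (auto simp: proper_interval_def)
    show ?thesis
    proof (cases "i = 1")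
      case True
      then show ?thesis using 1 G_mono[of 0 1 "Suc j" "Suc j"] by auto
    next
      case False
      then have "V i j \<subseteq> G (i - 1) n"
        using down[of i j] Vlast[of i] ij by (auto simp: proper_interval_def)
      then show ?thesis using 1 by (auto simp: G_def)
    qed
  qed
  have "\<exists>d. unit_covec (i - 1) j d \<and> V i j = hyperplane (i - 1) j d" if ij: "proper_interval n i j" for i j
    using subspace_eq_hyperplane[OF Vsub[OF ij] VG[OF ij]] Vdim[OF ij] ij
    by (auto simp: proper_interval_def)
  then obtain d where d: "\<And>i j. proper_interval n i j \<Longrightarrow> unit_covec (i - 1) j (d i j) \<and> V i j = hyperplane (i - 1) j (d i j)"
    by metis
  \<comment> \<open>The rows \<open>p = 0\<close> and \<open>q = n\<close> are prescribed by
    \<open>first\<close> and \<open>last\<close>. For \<open>0 < p = q < n\<close> there is no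
    subspace from which to take a functional, and the phase is provisionally 1.\<close>
  define c where "c p q = (if p = 0 \<and> q < n then (\<lambda>k. - axis_vec 0 k) else if q = n then axis_vec n
      else if p = q then axis_vec p else d (Suc p) q)" for p q
  have c_d: "c p q = d (Suc p) q" if "0 < p" "p < q" "q < n" for p q
    using that by (simp add: c_def)
  have unit: "unit_covec p q (c p q)" if "ext_interval n p q" for p q
    using that d[of "Suc p" q] unit_covec_axis[of p 0 q] unit_covec_uminus[of p q "axis_vec 0"]
      unit_covec_axis[of p n q] unit_covec_axis[of p q q]
    by (auto simp: c_def ext_interval_def proper_interval_def)
  have Veq: "V i j = hyperplane (i - 1) j (c (i - 1) j)" if ij: "proper_interval n i j" for i j
  proof -
    have ext: "ext_interval n (i - 1) j" using ij by (auto simp: proper_interval_def ext_interval_def)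
    consider "i = 1" | "j = n" | "i \<noteq> 1" "j \<noteq> n" by blast
    then show ?thesis
    proof cases
      case 1
      then have pr: "proper_interval n 1 j" and j: "j < n" and ext0: "ext_interval n 0 j"
        using ij by (auto simp: proper_interval_def ext_interval_def)
      have "\<forall>k\<in>{Suc 0..j}. c 0 j k = 0" using j by (simp add: c_def axis_vec_def)
      with hyperplane_eq_G_left[OF unit[OF ext0]] have "hyperplane 0 j (c 0 j) = G (Suc 0) (Suc j)" by simp
      then show ?thesis using Vfirst[OF pr] unfolding 1 by simp
    next
      case 2
      then have pr: "proper_interval n i n" and i: "i - 1 \<le> n" "0 < i - 1" and ext0: "ext_interval n (i - 1) n"
        using ij by (auto simp: proper_interval_def ext_interval_def)
      have "\<forall>k\<in>{i-1..<n}. c (i - 1) n k = 0" using i by (simp add: c_def axis_vec_def)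
      from iffD2[OF hyperplane_eq_G_right[OF unit[OF ext0] i(1)] this] Vlast[OF pr]
      show ?thesis unfolding \<open>j = n\<close> by (rule trans[OF _ sym, rotated])
    next
      case 3
      then have "0 < i - 1" "i - 1 < j" "j < n" and i: "Suc (i - 1) = i"
        using ij by (auto simp: proper_interval_def)
      from c_d[OF this(1-3)] show ?thesis unfolding i using conjunct2[OF d[OF ij]] by (simp only:)
    qed
  qed
  have "covec_system n c"
  proof
    show "2 \<le> n" by (rule n)
    show "unit_covec p q (c p q)" if "ext_interval n p q" for p q by (rule unit[OF that])
    show "c 0 q = (\<lambda>k. - axis_vec 0 k)" if "q < n" for q using that by (simp add: c_def)
    show "c p n = axis_vec n" if "0 < p" "p \<le> n" for p using that by (simp add: c_def)
    show "c p q k = lcoef c p q * c (Suc p) q k"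
      if pq: "ext_interval n p q" and k: "Suc p \<le> k" "k \<le> q" for p q k
    proof -
      have e: "ext_interval n (Suc p) q" using pq k by (auto simp: ext_interval_def)
      have "\<exists>z. \<forall>k\<in>{Suc p..q}. c p q k = z * c (Suc p) q k"
      proof -
        \<comment> \<open>The factor is 0 for \<open>p = 0\<close>, where all entries to the right
          of the coordinate 0 vanish, and 1 for \<open>q = n\<close>, where both covectors are
          \<open>axis_vec n\<close>. In the last case it comes from the inclusion of the
          subspaces.\<close>
        consider "p = 0" "q < n" | "p > 0" "q = n" | "p > 0" "q < n" "Suc p = q" | "p > 0" "q < n" "Suc p < q"
          using pq k by (fastforce simp: ext_interval_def)
        then show ?thesis
        proof cases
          case 1
          then show ?thesis by (intro exI[of _ 0]) (auto simp: c_def axis_vec_def)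
        next
          case 2
          then show ?thesis by (intro exI[of _ 1]) (auto simp: c_def)
        next
          case 3
          then show ?thesis by (intro exI[of _ "c p q q"]) (auto simp: c_def axis_vec_def)
        next
          case 4
          have pr: "proper_interval n (Suc (Suc p)) q" "proper_interval n (Suc p) q"
            using 4 by (auto simp: proper_interval_def)
          show ?thesis
          proof (rule hyperplane_subset_imp_proportional[OF unit[OF e]])
            fix x assume x: "x \<in> hyperplane (Suc p) q (c (Suc p) q)"
            then have "x \<in> hyperplane p q (c p q)"
              using Vleft[of "Suc (Suc p)" q] Veq[OF pr(1)] Veq[OF pr(2)] pr by auto
            moreover have "x p = 0" using x by (auto simp: hyperplane_def G_def)
            ultimately show "(\<Sum>k=Suc p..q. c p q k * x k) = 0"
              using 4 by (simp add: hyperplane_def sum_atLeast_Suc)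
          qed
        qed
      qed
      then obtain z where z: "\<forall>k\<in>{Suc p..q}. c p q k = z * c (Suc p) q k" by blast
      from coef_eq[OF unit[OF e] this] have "lcoef c p q = z" by (simp add: lcoef_def)
      then show ?thesis using z k by simp
    qed
    show "c p q k = rcoef c p q * c p (q - 1) k"
      if pq: "ext_interval n p q" and k: "p \<le> k" "k < q" for p q k
    proof -
      have e: "ext_interval n p (q - 1)" using pq k by (auto simp: ext_interval_def)
      have "\<exists>z. \<forall>k\<in>{p..q - 1}. c p q k = z * c p (q - 1) k"
      proof -
        \<comment> \<open>The boundary factors are exchanged when the right end is dropped: 1 for
          \<open>p = 0\<close>, where both covectors agree, and 0 for \<open>q = n\<close>, where
          the only non-zero entry is lost.\<close>
        consider "p = 0" "q < n" | "p > 0" "q = n" | "p > 0" "q < n" "q = Suc p" | "p > 0" "q < n" "Suc p < q"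
          using pq k by (fastforce simp: ext_interval_def)
        then show ?thesis
        proof cases
          case 1
          then show ?thesis by (intro exI[of _ 1]) (auto simp: c_def)
        next
          case 2
          then show ?thesis using k by (intro exI[of _ 0]) (auto simp: c_def axis_vec_def)
        next
          case 3
          then show ?thesis by (intro exI[of _ "c p q p"]) (auto simp: c_def axis_vec_def)
        next
          case 4
          have pr: "proper_interval n (Suc p) (q - 1)" "proper_interval n (Suc p) q"
            using 4 by (auto simp: proper_interval_def)
          show ?thesis
          proof (rule hyperplane_subset_imp_proportional[OF unit[OF e]])
            fix x assume x: "x \<in> hyperplane p (q - 1) (c p (q - 1))"
            then have "x \<in> hyperplane p q (c p q)"
              using Vright[of "Suc p" "q - 1"] Veq[OF pr(1)] Veq[OF pr(2)] pr 4 by auto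
            moreover have "x q = 0" using x 4 by (auto simp: hyperplane_def G_def)
            ultimately show "(\<Sum>k=p..q - 1. c p q k * x k) = 0"
              using 4 by (cases q) (auto simp: hyperplane_def)
          qed
        qed
      qed
      then obtain z where z: "\<forall>k\<in>{p..q - 1}. c p q k = z * c p (q - 1) k" by blast
      from coef_eq[OF unit[OF e] this] have "rcoef c p q = z" by (simp add: rcoef_def)
      then show ?thesis using z k by auto
    qed
  qed
  moreover have "V = brick_of n c"
    using Veq Vnot by (auto simp: brick_of_def fun_eq_iff)
  ultimately show ?thesis by blast
qed

lemma divisor_index_ext:
  "divisor_index n l r \<longleftrightarrow> 1 \<le> l \<and> ext_interval n (l - 1) r \<and> Suc (l - 1) < r"
  by (auto simp: divisor_index_def ext_interval_def)

lemma (in covec_system) Z_points_iff: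
  "(brick_of n c, u, v, \<phi>) \<in> Z_points n \<longleftrightarrow>
    (\<forall>l r. if divisor_index n l r
      then \<exists>\<gamma>. cmod \<gamma> = 1 \<and>
        hdot (wvec c (l - 1) r) (wvec c (l - 1) (r - 1)) =
          complex_of_real (cmod (hdot (wvec c (l - 1) r) (wvec c (l - 1) (r - 1)))) * \<gamma> \<and>
        u l r = (\<lambda>a b. \<gamma> * (wvec c (l - 1) r a * cnj (wvec c (l - 1) (r - 1) b)))
      else u l r = 0) \<and>
    (\<forall>k. if k \<in> {1..n} then \<exists>\<gamma>. cmod \<gamma> = 1 \<and> v k = (\<lambda>j. \<gamma> * wvec c (k - 1) k j) else v k = 0) \<and>
    (\<exists>\<gamma>. cmod \<gamma> = 1 \<and> \<phi> = (\<lambda>k. \<gamma> * c 1 (n - 1) k))"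
proof -
  let ?V = "brick_of n c"
  have U: "(if \<not> divisor_index n l r then u l r = 0
      else if ?V \<in> brick_divisor n l r then u l r \<in> unit_normals ?V l r
      else u l r = section_direction ?V l r) \<longleftrightarrow>
    (if divisor_index n l r
      then \<exists>\<gamma>. cmod \<gamma> = 1 \<and>
        hdot (wvec c (l - 1) r) (wvec c (l - 1) (r - 1)) =
          complex_of_real (cmod (hdot (wvec c (l - 1) r) (wvec c (l - 1) (r - 1)))) * \<gamma> \<and>
        u l r = (\<lambda>a b. \<gamma> * (wvec c (l - 1) r a * cnj (wvec c (l - 1) (r - 1) b)))
      else u l r = 0)" for l r
  proof (cases "divisor_index n l r")
    case True
    then have 1: "1 \<le> l" and e: "ext_interval n (l - 1) r" "Suc (l - 1) < r"
      using divisor_index_ext[of n l r] by auto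
    have l: "Suc (l - 1) = l" using 1 by simp
    from blow_up_direction_iff[OF e, of "u l r"] show ?thesis
      unfolding l using True by (simp only: if_True not_True_eq_False if_False)
  next
    case False
    then show ?thesis by simp
  qed
  have K: "(if k \<in> {1..n} then v k \<in> unit_quot (?V k k) {0} else v k = 0) \<longleftrightarrow>
      (if k \<in> {1..n} then \<exists>\<gamma>. cmod \<gamma> = 1 \<and> v k = (\<lambda>j. \<gamma> * wvec c (k - 1) k j) else v k = 0)" for k
  proof (cases "k \<in> {1..n}")
    case True
    then have "1 \<le> k" "k \<le> n" by auto
    from unit_vectors_line[OF this] show ?thesis using True by (simp only: if_True mem_Collect_eq) blast
  next
    case False
    then show ?thesis by (simp only: if_False)
  qed
  have P: "\<phi> \<in> unit_quot_dual (G 1 n) (?V 2 (n - 1)) \<longleftrightarrow> (\<exists>\<gamma>. cmod \<gamma> = 1 \<and> \<phi> = (\<lambda>k. \<gamma> * c 1 (n - 1) k))"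
    unfolding unit_covectors_top by blast
  show ?thesis
    unfolding Z_points_def mem_Collect_eq prod.case U K P using brick_of_in_manifold by blast
qed

section \<open>Normalization of the phases\<close>

text \<open>This is the local form of the condition that, for each \<open>k\<close>, the
  \<open>k\<close>-th entries of all covectors have a common phase.\<close>

definition coherent :: "nat \<Rightarrow> (nat \<Rightarrow> nat \<Rightarrow> cvec) \<Rightarrow> bool" where
  "coherent n c \<longleftrightarrow> (\<forall>p q. ext_interval n p q \<and> p < q \<longrightarrow>
     lcoef c p q \<in> \<real>\<^sub>\<ge>\<^sub>0 \<and> rcoef c p q \<in> \<real>\<^sub>\<ge>\<^sub>0)"

lemma unit_phase: "cmod \<kappa> = 1 \<Longrightarrow> \<kappa> * cnj \<kappa> = 1"
  by (metis complex_norm_square of_real_1 one_power2)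

lemma phase_eq_1I: "\<kappa> * cnj \<kappa> = 1 \<Longrightarrow> cmod \<kappa> = 1"
  by (metis complex_norm_square norm_ge_zero norm_one of_real_1 of_real_eq_iff one_power2 power2_eq_iff_nonneg)

context covec_system
begin

text \<open>The factor \<open>rcoef c p q\<close> is moved into both terms of
  \<open>overlap_eq\<close> by \<open>relation\<close>, after which the norm identity applies.
  Nonnegativity of \<open>rcoef\<close> passes in this way from row \<open>p\<close> to row
  \<open>Suc p\<close>.\<close>

lemma overlap_rcoef:
  assumes pq: "ext_interval n p q" "Suc p < q"
  shows "rcoef c (Suc p) q = rcoef c p q * hdot (wvec c p q) (wvec c p (q - 1))"
proof -
  let ?C = "lcoef c p q" and ?C' = "lcoef c p (q - 1)" and ?D = "rcoef c p q" and ?E = "rcoef c (Suc p) q"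
  have CE: "?D * ?C' = ?C * ?E" and cD: "?D * c p (q - 1) p = c p q p"
    using relation[OF pq] by auto
  have n1: "c p q p * cnj (c p q p) + ?C * cnj ?C = 1"
    using pq(2) by (intro norm_left[OF pq(1)]) simp
  have "?D * hdot (wvec c p q) (wvec c p (q - 1)) =
      cnj ?C * (?D * ?C') + cnj (c p q p) * (?D * c p (q - 1) p) * ?E"
    unfolding overlap_eq[OF pq] by (simp add: algebra_simps)
  also have "\<dots> = (c p q p * cnj (c p q p) + ?C * cnj ?C) * ?E"
    unfolding CE cD by (simp add: algebra_simps)
  finally show ?thesis unfolding n1 by simp
qed

text \<open>If \<open>rcoef c p q\<close> vanishes, so does the entry \<open>c p q p\<close>; then
  \<open>lcoef c p q\<close> has modulus one and, being nonnegative, equals 1. This handles the case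
  in which \<open>relation\<close> cannot be solved for \<open>lcoef c p (q - 1)\<close>.\<close>

lemma overlap_lcoef:
  assumes pq: "ext_interval n p q" "Suc p < q" and 0: "rcoef c p q = 0" and "lcoef c p q \<in> \<real>\<^sub>\<ge>\<^sub>0"
  shows "lcoef c p (q - 1) = hdot (wvec c p q) (wvec c p (q - 1))"
proof -
  have c0: "c p q p = 0" using relation(1)[OF pq] 0 by simp
  have "c p q p * cnj (c p q p) + lcoef c p q * cnj (lcoef c p q) = 1"
    using pq(2) by (intro norm_left[OF pq(1)]) simp
  then have "cmod (lcoef c p q) = 1" using c0 phase_eq_1I by simp
  moreover obtain t where "lcoef c p q = of_real t" "t \<ge> 0"
    using assms(4) by (auto elim: nonneg_Reals_cases)
  ultimately have "lcoef c p q = 1" by simp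
  then show ?thesis unfolding overlap_eq[OF pq] c0 by simp
qed

text \<open>Induction on the row \<open>p\<close>. In row 0 the factors are 1 and 0; later,
  \<open>rcoef\<close> is obtained from the preceding row by \<open>overlap_rcoef\<close>, and
  \<open>lcoef\<close> by descending induction on \<open>q\<close> from \<open>q = n\<close>, where
  it is 1.\<close>

lemma coherentI:
  assumes h: "\<And>p q. ext_interval n p q \<Longrightarrow> Suc p < q \<Longrightarrow>
      hdot (wvec c p q) (wvec c p (q - 1)) \<in> \<real>\<^sub>\<ge>\<^sub>0"
  shows "coherent n c"
proof -
  have row: "(\<forall>q. ext_interval n p q \<and> p < q \<longrightarrow> rcoef c p q \<in> \<real>\<^sub>\<ge>\<^sub>0 \<and> lcoef c p q \<in> \<real>\<^sub>\<ge>\<^sub>0)" for p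
  proof (induction p)
    case 0
    have "rcoef c 0 q = 1 \<and> lcoef c 0 q = 0" if "q < n" "0 < q" for q
    proof -
      have "rcoef c 0 q = (\<Sum>k=0..q-1. axis_vec 0 k * cnj (axis_vec 0 k))"
        using that by (auto simp: rcoef_def first)
      also have "\<dots> = 1" using unit_covec_axis[of 0 0 "q - 1"] by (simp add: unit_covec_def)
      finally show ?thesis using that by (auto simp: lcoef_def first axis_vec_def)
    qed
    then show ?case by (auto simp: ext_interval_def)
  next
    case (Suc p)
    have D: "rcoef c (Suc p) q \<in> \<real>\<^sub>\<ge>\<^sub>0" if q: "ext_interval n (Suc p) q" "Suc p < q" for q
    proof (cases "ext_interval n p q")
      case True
      then show ?thesis
        unfolding overlap_rcoef[OF True q(2)] using Suc h[OF True q(2)] q(2)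
        by (intro nonneg_Reals_mult_I) auto
    next
      case False
      \<comment> \<open>Extending an admissible interval to the left leads out of the index set only
        for \<open>(p, q) = (0, n)\<close>.\<close>
      then have qn: "q = n" using q by (auto simp: ext_interval_def)
      have "rcoef c (Suc p) n = 0"
        using q qn by (auto simp: rcoef_def last axis_vec_def intro!: sum.neutral)
      then show ?thesis by (simp add: qn)
    qed
    have C: "lcoef c (Suc p) q \<in> \<real>\<^sub>\<ge>\<^sub>0" if "Suc p < q" "q \<le> n" for q
      using that(2,1)
    proof (induction q rule: inc_induct)
      case base
      have "lcoef c (Suc p) n = (\<Sum>k=Suc (Suc p)..n. axis_vec n k * cnj (axis_vec n k))"
        using base by (simp add: lcoef_def last)
      also have "\<dots> = 1" using unit_covec_axis[of "Suc (Suc p)" n n] base by (simp add: unit_covec_def)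
      finally show ?case by simp
    next
      case (step m)
      have e: "ext_interval n (Suc p) (Suc m)" and m: "Suc (Suc p) < Suc m"
        using step by (auto simp: ext_interval_def)
      have C: "lcoef c (Suc p) (Suc m) \<in> \<real>\<^sub>\<ge>\<^sub>0" using step by simp
      have h': "hdot (wvec c (Suc p) (Suc m)) (wvec c (Suc p) m) \<in> \<real>\<^sub>\<ge>\<^sub>0" using h[OF e m] by simp
      show ?case
      proof (cases "rcoef c (Suc p) (Suc m) = 0")
        case True
        then show ?thesis using overlap_lcoef[OF e m True C] h' by simp
      next
        case False
        have E: "rcoef c (Suc (Suc p)) (Suc m) \<in> \<real>\<^sub>\<ge>\<^sub>0"
          unfolding overlap_rcoef[OF e m] using D[OF e] m h' by (intro nonneg_Reals_mult_I) auto
        have "lcoef c (Suc p) (Suc m) * rcoef c (Suc (Suc p)) (Suc m) =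
            rcoef c (Suc p) (Suc m) * lcoef c (Suc p) m" using relation(2)[OF e m] by simp
        then have "lcoef c (Suc p) m =
            lcoef c (Suc p) (Suc m) * rcoef c (Suc (Suc p)) (Suc m) / rcoef c (Suc p) (Suc m)"
          using False by (simp add: field_simps)
        also have "\<dots> \<in> \<real>\<^sub>\<ge>\<^sub>0"
          using C E D[OF e] m by (intro nonneg_Reals_divide_I nonneg_Reals_mult_I) auto
        finally show ?thesis .
      qed
    qed
    show ?case using C D by (auto simp: ext_interval_def)
  qed
  then show ?thesis by (auto simp: coherent_def)
qed

text \<open>The converse of \<open>coherentI\<close>: both terms of \<open>overlap_eq\<close> are
  nonnegative, since \<open>c p q p\<close> is \<open>c p (q - 1) p\<close> times the nonnegative
  factor \<open>rcoef c p q\<close>.\<close>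

lemma overlap_nonneg:
  assumes "coherent n c" and pq: "ext_interval n p q" "Suc p < q"
  shows "hdot (wvec c p q) (wvec c p (q - 1)) \<in> \<real>\<^sub>\<ge>\<^sub>0"
proof -
  have e: "ext_interval n p (q - 1)" "p < q - 1" "ext_interval n (Suc p) q"
    using pq by (auto simp: ext_interval_def)
  have C: "lcoef c p q \<in> \<real>\<^sub>\<ge>\<^sub>0" "rcoef c p q \<in> \<real>\<^sub>\<ge>\<^sub>0" "lcoef c p (q - 1) \<in> \<real>\<^sub>\<ge>\<^sub>0" "rcoef c (Suc p) q \<in> \<real>\<^sub>\<ge>\<^sub>0"
    using assms e unfolding coherent_def by auto
  have "cnj (c p q p) * c p (q - 1) p = cnj (rcoef c p q) * (cnj (c p (q - 1) p) * c p (q - 1) p)"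
    unfolding relation(1)[OF pq] by simp
  also have "cnj (c p (q - 1) p) * c p (q - 1) p = of_real ((cmod (c p (q - 1) p))\<^sup>2)"
    unfolding complex_norm_square by (rule mult.commute)
  finally have "cnj (c p q p) * c p (q - 1) p \<in> \<real>\<^sub>\<ge>\<^sub>0"
    using C(2) by (auto elim!: nonneg_Reals_cases intro!: nonneg_Reals_mult_I simp del: of_real_power)
  moreover have "cnj (lcoef c p q) \<in> \<real>\<^sub>\<ge>\<^sub>0" using C(1) by (auto elim!: nonneg_Reals_cases)
  ultimately show ?thesis unfolding overlap_eq[OF pq]
    by (intro nonneg_Reals_add_I nonneg_Reals_mult_I[OF _ C(3)] nonneg_Reals_mult_I[OF _ C(4)])
qed

end

section \<open>Changing the covectors by phases, and normal forms of points\<close>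

locale rescaled_system = covec_system +
  fixes c' :: "nat \<Rightarrow> nat \<Rightarrow> cvec" and \<kappa> :: "nat \<Rightarrow> nat \<Rightarrow> complex"
  assumes phase: "ext_interval n p q \<Longrightarrow> cmod (\<kappa> p q) = 1"
    and scaled: "ext_interval n p q \<Longrightarrow> c' p q = (\<lambda>k. \<kappa> p q * c p q k)"
begin

lemma lcoef_scaled:
  assumes "ext_interval n p q" "p < q"
  shows "lcoef c' p q = \<kappa> p q * cnj (\<kappa> (Suc p) q) * lcoef c p q"
proof -
  have "ext_interval n (Suc p) q" using assms by (auto simp: ext_interval_def)
  then show ?thesis using scaled assms by (simp add: lcoef_def sum_distrib_left mult_ac)
qed

lemma rcoef_scaled:
  assumes "ext_interval n p q" "p < q"
  shows "rcoef c' p q = \<kappa> p q * cnj (\<kappa> p (q - 1)) * rcoef c p q"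
proof -
  have "ext_interval n p (q - 1)" using assms by (auto simp: ext_interval_def)
  then show ?thesis using scaled assms by (simp add: rcoef_def sum_distrib_left mult_ac)
qed

text \<open>The entry at \<open>p\<close> scales like \<open>lcoef\<close>, the others like
  \<open>c p q p\<close> times the conjugate of \<open>c (Suc p) q\<close>, and the two factors
  coincide. They govern the effect of a change of phases on the directions.\<close>

lemma wvec_scaled:
  assumes "ext_interval n p q" "p < q"
  shows "wvec c' p q = (\<lambda>k. \<kappa> p q * cnj (\<kappa> (Suc p) q) * wvec c p q k)"
proof -
  have e: "ext_interval n (Suc p) q" using assms by (auto simp: ext_interval_def)
  show ?thesis unfolding wvec_def lcoef_scaled[OF assms] scaled[OF assms(1)] scaled[OF e]
    by (rule ext) simp
qed

lemma brick_of_scaled: "brick_of n c' = brick_of n c"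
proof (intro ext)
  fix i j
  show "brick_of n c' i j = brick_of n c i j"
  proof (cases "proper_interval n i j")
    case True
    then have e: "ext_interval n (i - 1) j" by (auto simp: proper_interval_def ext_interval_def)
    have "\<kappa> (i - 1) j \<noteq> 0" using phase[OF e] by auto
    then show ?thesis using True hyperplane_scale unfolding brick_of_def scaled[OF e] by simp
  qed (simp add: brick_of_def)
qed

lemma covec_system_scaled:
  assumes "\<And>q. q < n \<Longrightarrow> \<kappa> 0 q = 1" "\<And>p. 0 < p \<Longrightarrow> p \<le> n \<Longrightarrow> \<kappa> p n = 1"
  shows "covec_system n c'"
proof
  show "2 \<le> n" by (rule two_le_n)
  show "unit_covec p q (c' p q)" if e: "ext_interval n p q" for p q
  proof -
    have "(\<Sum>k=p..q. c' p q k * cnj (c' p q k)) = \<kappa> p q * cnj (\<kappa> p q) * (\<Sum>k=p..q. c p q k * cnj (c p q k))"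
      unfolding scaled[OF e] by (simp add: sum_distrib_left mult_ac)
    then show ?thesis
      using unit[OF e] unit_phase[OF phase[OF e]] by (simp add: unit_covec_def scaled[OF e] G_def)
  qed
  show "c' p q k = lcoef c' p q * c' (Suc p) q k" if pq: "ext_interval n p q" and k: "Suc p \<le> k" "k \<le> q" for p q k
  proof -
    have e: "ext_interval n (Suc p) q" and "p < q" using pq k by (auto simp: ext_interval_def)
    have "lcoef c' p q * c' (Suc p) q k = \<kappa> p q * (\<kappa> (Suc p) q * cnj (\<kappa> (Suc p) q)) * (lcoef c p q * c (Suc p) q k)"
      unfolding lcoef_scaled[OF pq \<open>p < q\<close>] scaled[OF e] by simp
    then show ?thesis unfolding unit_phase[OF phase[OF e]] left[OF pq k, symmetric] scaled[OF pq] by simp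
  qed
  show "c' p q k = rcoef c' p q * c' p (q - 1) k" if pq: "ext_interval n p q" and k: "p \<le> k" "k < q" for p q k
  proof -
    have e: "ext_interval n p (q - 1)" and "p < q" using pq k by (auto simp: ext_interval_def)
    have "rcoef c' p q * c' p (q - 1) k = \<kappa> p q * (\<kappa> p (q - 1) * cnj (\<kappa> p (q - 1))) * (rcoef c p q * c p (q - 1) k)"
      unfolding rcoef_scaled[OF pq \<open>p < q\<close>] scaled[OF e] by simp
    then show ?thesis unfolding unit_phase[OF phase[OF e]] right[OF pq k, symmetric] scaled[OF pq] by simp
  qed
  show "c' 0 q = (\<lambda>k. - axis_vec 0 k)" if "q < n" for q
  proof -
    have "ext_interval n 0 q" using that by (simp add: ext_interval_def)
    then show ?thesis using scaled assms(1)[OF that] first[OF that] by simp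
  qed
  show "c' p n = axis_vec n" if "0 < p" "p \<le> n" for p
  proof -
    have "ext_interval n p n" using that by (simp add: ext_interval_def)
    then show ?thesis using scaled assms(2)[OF that] last[OF that] by simp
  qed
qed

end

text \<open>The directions and the top functional carry no scalar any more. Only the vectors
  \<open>v\<close> keep free phases; these give the second torus.\<close>

definition normal_form :: "nat \<Rightarrow> (nat \<Rightarrow> nat \<Rightarrow> cvec) \<Rightarrow> zpoint \<Rightarrow> bool" where
  "normal_form n c z \<longleftrightarrow> (case z of (V, u, v, \<phi>) \<Rightarrow> V = brick_of n c \<and>
    u = (\<lambda>l r a b. if divisor_index n l r then wvec c (l - 1) r a * cnj (wvec c (l - 1) (r - 1) b) else 0) \<and>
    (\<forall>k. if k \<in> {1..n} then \<exists>\<gamma>. cmod \<gamma> = 1 \<and> v k = (\<lambda>j. \<gamma> * wvec c (k - 1) k j) else v k = 0) \<and>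
    \<phi> = c 1 (n - 1))"

lemma nonneg_Reals_cmod: "x \<in> \<real>\<^sub>\<ge>\<^sub>0 \<Longrightarrow> x = complex_of_real (cmod x)"
  by (auto elim!: nonneg_Reals_cases)

lemma zero_cmat: "(0 :: cmat) = (\<lambda>a b. 0)"
  by (simp add: fun_eq_iff)

lemma normal_form_in_Z_points:
  assumes "covec_system n c" "coherent n c" "normal_form n c z"
  shows "z \<in> Z_points n"
proof -
  interpret covec_system n c by fact
  obtain V u v \<phi> where z: "z = (V, u, v, \<phi>)" by (metis prod.exhaust)
  note nf = assms(3)[unfolded normal_form_def z prod.case]
  have V: "V = brick_of n c"
    and u: "u = (\<lambda>l r a b. if divisor_index n l r then wvec c (l - 1) r a * cnj (wvec c (l - 1) (r - 1) b) else 0)"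
    and v: "\<forall>k. if k \<in> {1..n} then \<exists>\<gamma>. cmod \<gamma> = 1 \<and> v k = (\<lambda>j. \<gamma> * wvec c (k - 1) k j) else v k = 0"
    and \<phi>: "\<phi> = c 1 (n - 1)"
    using conjunct1[OF nf] conjunct1[OF conjunct2[OF nf]] conjunct1[OF conjunct2[OF conjunct2[OF nf]]]
      conjunct2[OF conjunct2[OF conjunct2[OF nf]]] by this
  show ?thesis unfolding z V Z_points_iff
  proof (intro conjI allI)
    fix l r
    show "if divisor_index n l r
      then \<exists>\<gamma>. cmod \<gamma> = 1 \<and>
        hdot (wvec c (l - 1) r) (wvec c (l - 1) (r - 1)) =
          complex_of_real (cmod (hdot (wvec c (l - 1) r) (wvec c (l - 1) (r - 1)))) * \<gamma> \<and>
        u l r = (\<lambda>a b. \<gamma> * (wvec c (l - 1) r a * cnj (wvec c (l - 1) (r - 1) b)))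
      else u l r = 0"
    proof (cases "divisor_index n l r")
      case True
      then have "ext_interval n (l - 1) r" "Suc (l - 1) < r" unfolding divisor_index_ext by blast+
      from nonneg_Reals_cmod[OF overlap_nonneg[OF assms(2) this]]
      show ?thesis unfolding if_P[OF True] by (intro exI[of _ 1]) (simp add: u True)
    next
      case False
      then show ?thesis by (simp add: u zero_cmat)
    qed
  next
    show "\<exists>\<gamma>. cmod \<gamma> = 1 \<and> \<phi> = (\<lambda>k. \<gamma> * c 1 (n - 1) k)"
      by (intro exI[of _ 1]) (simp add: \<phi>)
  qed (rule v[rule_format])
qed

text \<open>Rescaling by \<kappa> multiplies \<open>wvec c p q\<close> by \<Omega>, the product of
  \<open>\<kappa> p q\<close> and the conjugate of \<open>\<kappa> (Suc p) q\<close>. The ratio of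
  consecutive values of \<Omega> in row \<open>p\<close> has to be the given scalar
  \<open>\<gamma> (Suc p) q\<close>. For \<open>p > 0\<close> the fixed values
  \<open>\<kappa> p n = 1\<close> start a descending recursion in \<open>q\<close> for \<Omega>; for
  \<open>p = 0\<close> the top functional provides the start. Then \<kappa> is found row by
  row.\<close>

lemma normal_form_exists:
  assumes n: "2 \<le> n" and z: "z \<in> Z_points n"
  shows "\<exists>c. covec_system n c \<and> coherent n c \<and> normal_form n c z"
proof -
  obtain V u v \<phi> where z': "z = (V, u, v, \<phi>)" by (metis prod.exhaust)
  have "V \<in> brick_manifold n" using z by (simp add: z' Z_points_def)
  from brick_eq_brick_of[OF n this] obtain c where c: "covec_system n c" "V = brick_of n c" by blast
  interpret covec_system n c by fact
  let ?h = "\<lambda>p r. hdot (wvec c p r) (wvec c p (r - 1))"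
  note zz = z[unfolded z' c(2) Z_points_iff]
  have "\<forall>l r. \<exists>\<gamma>. cmod \<gamma> = 1 \<and> (divisor_index n l r \<longrightarrow> ?h (l - 1) r = complex_of_real (cmod (?h (l - 1) r)) * \<gamma> \<and>
      u l r = (\<lambda>a b. \<gamma> * (wvec c (l - 1) r a * cnj (wvec c (l - 1) (r - 1) b))))"
  proof (intro allI)
    fix l r
    show "\<exists>\<gamma>. cmod \<gamma> = 1 \<and> (divisor_index n l r \<longrightarrow> ?h (l - 1) r = complex_of_real (cmod (?h (l - 1) r)) * \<gamma> \<and>
      u l r = (\<lambda>a b. \<gamma> * (wvec c (l - 1) r a * cnj (wvec c (l - 1) (r - 1) b))))"
    proof (cases "divisor_index n l r")
      case True
      from conjunct1[OF zz, rule_format, of l r, unfolded if_P[OF True]] show ?thesis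
        by (elim exE) (simp only: True simp_thms, blast)
    next
      case False
      then show ?thesis by (intro exI[of _ 1]) simp
    qed
  qed
  then obtain \<gamma> where \<gamma>: "\<And>l r. cmod (\<gamma> l r) = 1"
    and h: "\<And>l r. divisor_index n l r \<Longrightarrow> ?h (l - 1) r = complex_of_real (cmod (?h (l - 1) r)) * \<gamma> l r"
    and u: "\<And>l r. divisor_index n l r \<Longrightarrow> u l r = (\<lambda>a b. \<gamma> l r * (wvec c (l - 1) r a * cnj (wvec c (l - 1) (r - 1) b)))"
    by metis
  obtain \<epsilon> where \<epsilon>: "cmod \<epsilon> = 1" "\<phi> = (\<lambda>k. \<epsilon> * c 1 (n - 1) k)"
    using conjunct2[OF conjunct2[OF zz]] by (elim exE conjE) (rule that)
  \<comment> \<open>The required factor of \<open>wvec c p q\<close> for \<open>p > 0\<close>: it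
    equals 1 at \<open>q = n\<close> and picks up the conjugate of \<open>\<gamma> (Suc p) r\<close>
    whenever the right end moves from \<open>r\<close> to \<open>r - 1\<close>.\<close>
  define \<omega> where "\<omega> p q = (\<Prod>r\<in>{Suc q..n}. cnj (\<gamma> (Suc p) r))" for p q
  \<comment> \<open>Row 1 is determined by the top functional through \<epsilon> and by the
    directions \<open>(1, r)\<close>; each later row is its predecessor divided by \<omega>. The
    value 1 on the boundary preserves \<open>first\<close> and \<open>last\<close>.\<close>
  define \<kappa> where "\<kappa> p q = (if p = 0 \<or> n \<le> q then 1
      else \<epsilon> * (\<Prod>r\<in>{Suc q..n-1}. \<gamma> 1 r) * (\<Prod>j\<in>{1..<p}. cnj (\<omega> j q)))" for p q
  define c' where "c' p q = (\<lambda>k. \<kappa> p q * c p q k)" for p q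
  have \<omega>1: "cmod (\<omega> p q) = 1" for p q by (simp add: \<omega>_def \<gamma> flip: prod_norm)
  have \<kappa>1: "cmod (\<kappa> p q) = 1" for p q
    by (simp add: \<kappa>_def norm_mult \<gamma> \<epsilon> \<omega>1 flip: prod_norm)
  interpret r: rescaled_system n c c' \<kappa>
    by unfold_locales (simp_all add: \<kappa>1 c'_def)
  have sys: "covec_system n c'"
    by (rule r.covec_system_scaled) (simp_all add: \<kappa>_def)
  have \<Omega>: "\<kappa> p q * cnj (\<kappa> (Suc p) q) = \<omega> p q" if "0 < p" "q \<le> n" for p q
  proof (cases "q = n")
    case True
    then show ?thesis by (simp add: \<kappa>_def \<omega>_def)
  next
    case False
    have "\<kappa> (Suc p) q = \<kappa> p q * cnj (\<omega> p q)"
      using False that by (cases p) (simp_all add: \<kappa>_def mult.assoc)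
    then have "\<kappa> p q * cnj (\<kappa> (Suc p) q) = (\<kappa> p q * cnj (\<kappa> p q)) * \<omega> p q" by simp
    then show ?thesis using unit_phase[OF \<kappa>1] by simp
  qed
  \<comment> \<open>The equation that turns the direction \<open>(Suc p, r)\<close> into a tensor
    without scalar. For \<open>p = 0\<close> the values of \<kappa> in row 0 are 1, so that row 1
    alone has to absorb the direction.\<close>
  have key: "\<kappa> p r * cnj (\<kappa> (Suc p) r) * cnj (\<kappa> p (r - 1) * cnj (\<kappa> (Suc p) (r - 1))) = \<gamma> (Suc p) r"
    if e: "ext_interval n p r" "Suc p < r" for p r
  proof (cases "p = 0")
    case True
    then have r: "r \<le> n - 1" "0 < r" "r < n" using e by (auto simp: ext_interval_def)
    define P where "P = \<epsilon> * (\<Prod>i\<in>{Suc r..n-1}. \<gamma> 1 i)"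
    have \<kappa>r: "\<kappa> 1 r = P" using r by (simp add: \<kappa>_def P_def)
    have "{Suc (r - 1)..n-1} = insert r {Suc r..n-1}" using r by auto
    then have "\<kappa> 1 (r - 1) = \<gamma> 1 r * P" using r by (simp add: \<kappa>_def P_def mult_ac)
    moreover have "P * cnj P = 1" using unit_phase[OF \<kappa>1[of 1 r]] unfolding \<kappa>r .
    moreover have "\<kappa> 0 r = 1" "\<kappa> 0 (r - 1) = 1" by (simp_all add: \<kappa>_def)
    ultimately show ?thesis using True \<kappa>r by (simp add: mult_ac)
  next
    case False
    have r: "0 < r" "r \<le> n" "r - 1 \<le> n" using e by (auto simp: ext_interval_def)
    have "{Suc (r - 1)..n} = insert r {Suc r..n}" using r by auto
    then have "\<omega> p (r - 1) = cnj (\<gamma> (Suc p) r) * \<omega> p r" by (simp add: \<omega>_def)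
    then have "\<omega> p r * cnj (\<omega> p (r - 1)) = (\<omega> p r * cnj (\<omega> p r)) * \<gamma> (Suc p) r" by simp
    then show ?thesis using \<Omega>[of p r] \<Omega>[of p "r - 1"] r False unit_phase[OF \<omega>1[of p r]] by simp
  qed
  have "coherent n c'"
  proof (rule covec_system.coherentI[OF sys])
    fix p q assume pq: "ext_interval n p q" "Suc p < q"
    then have e: "ext_interval n p (q - 1)" "p < q - 1" "p < q" by (auto simp: ext_interval_def)
    let ?a = "\<kappa> p q * cnj (\<kappa> (Suc p) q)" and ?b = "\<kappa> p (q - 1) * cnj (\<kappa> (Suc p) (q - 1))"
    have d: "divisor_index n (Suc p) q" using pq by (simp add: divisor_index_ext)
    have G: "wvec c p q \<in> G p (Suc q)" "(\<lambda>k. ?a * wvec c p q k) \<in> G p (Suc q)"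
      using wvec_in_G[of p q] cvec.subspace_scale[OF subspace_G] e by auto
    have "hdot (wvec c' p q) (wvec c' p (q - 1)) = cnj (?a * cnj ?b) * ?h p q"
      unfolding r.wvec_scaled[OF pq(1) e(3)] r.wvec_scaled[OF e(1,2)] hdot_G[OF G(1)] hdot_G[OF G(2)] sum_distrib_left
      by (intro sum.cong) simp_all
    also have "\<dots> = complex_of_real (cmod (?h p q)) * (\<gamma> (Suc p) q * cnj (\<gamma> (Suc p) q))"
      unfolding key[OF pq] using h[OF d] by simp
    finally show "hdot (wvec c' p q) (wvec c' p (q - 1)) \<in> \<real>\<^sub>\<ge>\<^sub>0" unfolding unit_phase[OF \<gamma>] by simp
  qed
  moreover have "normal_form n c' z"
    unfolding normal_form_def z' prod.case
  proof (intro conjI)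
    show "V = brick_of n c'" by (simp add: r.brick_of_scaled c)
    show "u = (\<lambda>l r a b. if divisor_index n l r then wvec c' (l - 1) r a * cnj (wvec c' (l - 1) (r - 1) b) else 0)"
    proof (intro ext)
      fix l r a b
      show "u l r a b = (if divisor_index n l r then wvec c' (l - 1) r a * cnj (wvec c' (l - 1) (r - 1) b) else 0)"
      proof (cases "divisor_index n l r")
        case True
        then have e: "ext_interval n (l - 1) r" "Suc (l - 1) < r" and l: "Suc (l - 1) = l"
          using divisor_index_ext by auto
        then have e': "ext_interval n (l - 1) (r - 1)" "l - 1 < r - 1" "l - 1 < r" by (auto simp: ext_interval_def)
        show ?thesis unfolding if_P[OF True] r.wvec_scaled[OF e(1) e'(3)] r.wvec_scaled[OF e'(1,2)]
          u[OF True] key[OF e, unfolded l, symmetric] l by simp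
      next
        case False
        from conjunct1[OF zz, rule_format, of l r, unfolded if_not_P[OF False]] show ?thesis using False by simp
      qed
    qed
    show "\<phi> = c' 1 (n - 1)"
    proof -
      have "\<kappa> 1 (n - 1) = \<epsilon>" using n by (simp add: \<kappa>_def)
      then show ?thesis by (simp add: \<epsilon> c'_def)
    qed
    show "\<forall>k. if k \<in> {1..n} then \<exists>\<gamma>. cmod \<gamma> = 1 \<and> v k = (\<lambda>j. \<gamma> * wvec c' (k - 1) k j) else v k = 0"
    proof
      fix k
      show "if k \<in> {1..n} then \<exists>\<gamma>. cmod \<gamma> = 1 \<and> v k = (\<lambda>j. \<gamma> * wvec c' (k - 1) k j) else v k = 0"
      proof (cases "k \<in> {1..n}")
        case True
        then have e: "ext_interval n (k - 1) k" "k - 1 < k" using n by (auto simp: ext_interval_def)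
        let ?a = "\<kappa> (k - 1) k * cnj (\<kappa> (Suc (k - 1)) k)"
        have a: "cmod ?a = 1" by (simp add: norm_mult \<kappa>1)
        from conjunct1[OF conjunct2[OF zz], rule_format, of k, unfolded if_P[OF True]]
        obtain \<delta> where d: "cmod \<delta> = 1" "v k = (\<lambda>j. \<delta> * wvec c (k - 1) k j)" by (elim exE conjE) (rule that)
        have "v k = (\<lambda>j. (\<delta> * cnj ?a) * wvec c' (k - 1) k j)"
        proof
          fix j
          have "(\<delta> * cnj ?a) * wvec c' (k - 1) k j = \<delta> * (?a * cnj ?a) * wvec c (k - 1) k j"
            unfolding r.wvec_scaled[OF e] by simp
          then show "v k j = (\<delta> * cnj ?a) * wvec c' (k - 1) k j" unfolding unit_phase[OF a] d mult_1_right by (rule sym)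
        qed
        moreover have "cmod (\<delta> * cnj ?a) = 1" using a d by (simp add: norm_mult)
        ultimately show ?thesis unfolding if_P[OF True] by (intro exI conjI)
      next
        case False
        from conjunct1[OF conjunct2[OF zz], rule_format, of k, unfolded if_not_P[OF False]]
        show ?thesis unfolding if_not_P[OF False] .
      qed
    qed
  qed
  ultimately show ?thesis using sys by blast
qed

text \<open>Covectors with equal kernels differ by phases \<kappa>, and equality of the directions
  makes the factor \<Omega> of \<open>wvec\<close> constant along each row. In row 0 the common top
  functional forces \<open>\<kappa> 1 q = 1\<close>; for \<open>p > 0\<close> the boundary value at
  \<open>q = n\<close> forces \<open>\<Omega> p q = 1\<close>, so that \<kappa> is 1 in the next row
  if it is in row \<open>p\<close>.\<close>

lemma normal_form_unique:
  assumes c: "covec_system n c" "normal_form n c z" and c': "covec_system n c'" "normal_form n c' z"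
    and pq: "ext_interval n p q"
  shows "c' p q = c p q"
proof -
  interpret covec_system n c by fact
  interpret c': covec_system n c' by fact
  obtain V u v \<phi> where z: "z = (V, u, v, \<phi>)" by (metis prod.exhaust)
  note nf = c(2)[unfolded normal_form_def z prod.case] and nf' = c'(2)[unfolded normal_form_def z prod.case]
  have V: "brick_of n c' = brick_of n c"
    using conjunct1[OF nf] conjunct1[OF nf'] by simp
  have u: "(\<lambda>l r a b. if divisor_index n l r then wvec c' (l - 1) r a * cnj (wvec c' (l - 1) (r - 1) b) else 0) =
      (\<lambda>l r a b. if divisor_index n l r then wvec c (l - 1) r a * cnj (wvec c (l - 1) (r - 1) b) else 0)"
    using conjunct1[OF conjunct2[OF nf]] conjunct1[OF conjunct2[OF nf']] by (rule trans[OF sym, rotated])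
  have top: "c' 1 (n - 1) = c 1 (n - 1)"
    using conjunct2[OF conjunct2[OF conjunct2[OF nf]]] conjunct2[OF conjunct2[OF conjunct2[OF nf']]] by simp
  have "\<exists>\<kappa>. cmod \<kappa> = 1 \<and> c' p q = (\<lambda>k. \<kappa> * c p q k)" if e: "ext_interval n p q" for p q
  proof -
    have "hyperplane p q (c' p q) = hyperplane p q (c p q)"
      using brick_of_Suc[OF e] c'.brick_of_Suc[OF e] V by simp
    then have "\<exists>\<kappa>. \<forall>k\<in>{p..q}. c' p q k = \<kappa> * c p q k"
      by (intro hyperplane_subset_imp_proportional[OF unit[OF e]]) (auto simp: hyperplane_def)
    then obtain \<kappa> where k: "\<forall>k\<in>{p..q}. c' p q k = \<kappa> * c p q k" by blast
    have "c' p q k = \<kappa> * c p q k" for k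
      using k in_G[OF e] c'.in_G[OF e] by (cases "k \<in> {p..q}") (auto simp: G_def)
    then have eq: "c' p q = (\<lambda>k. \<kappa> * c p q k)" by blast
    have "(\<Sum>k=p..q. c' p q k * cnj (c' p q k)) = \<kappa> * cnj \<kappa> * (\<Sum>k=p..q. c p q k * cnj (c p q k))"
      unfolding eq sum_distrib_left by (intro sum.cong) simp_all
    then have "\<kappa> * cnj \<kappa> = 1" unfolding norm_eq_1[OF e] c'.norm_eq_1[OF e] by simp
    then show ?thesis using eq phase_eq_1I by blast
  qed
  then obtain \<kappa> where \<kappa>: "\<And>p q. ext_interval n p q \<Longrightarrow> cmod (\<kappa> p q) = 1"
    and c'_eq: "\<And>p q. ext_interval n p q \<Longrightarrow> c' p q = (\<lambda>k. \<kappa> p q * c p q k)"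
    by metis
  interpret r: rescaled_system n c c' \<kappa>
    by unfold_locales (use \<kappa> c'_eq in auto)
  have \<kappa>_eq_1: "\<kappa> p q = 1" if e: "ext_interval n p q" and "c' p q = c p q" for p q
  proof -
    obtain k where "c p q k \<noteq> 0" using unit_covec_nonzero[OF unit[OF e]] by blast
    then show ?thesis using fun_cong[OF c'_eq[OF e], of k] that(2) by simp
  qed
  have \<kappa>0: "\<kappa> 0 q = 1" if "q < n" for q
    by (rule \<kappa>_eq_1) (use that first c'.first in \<open>simp_all add: ext_interval_def\<close>)
  have \<kappa>n: "\<kappa> p n = 1" if "0 < p" "p \<le> n" for p
    by (rule \<kappa>_eq_1) (use that last c'.last in \<open>simp_all add: ext_interval_def\<close>)
  have \<kappa>top: "\<kappa> 1 (n - 1) = 1"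
    by (rule \<kappa>_eq_1) (use top two_le_n in \<open>auto simp: ext_interval_def\<close>)
  define \<Omega> where "\<Omega> p q = \<kappa> p q * cnj (\<kappa> (Suc p) q)" for p q
  have \<Omega>_step: "\<Omega> p (q - 1) = \<Omega> p q" if e: "ext_interval n p q" "Suc p < q" for p q
  proof -
    have e': "ext_interval n p (q - 1)" "p < q - 1" "p < q" "ext_interval n (Suc p) (q - 1)"
      using e by (auto simp: ext_interval_def)
    have d: "divisor_index n (Suc p) q" using e by (simp add: divisor_index_ext)
    have "wvec c p q \<noteq> 0" "wvec c p (q - 1) \<noteq> 0"
      using hdot_wvec_self[OF e(1) e'(3)] hdot_wvec_self[OF e'(1,2)] by (auto simp: hdot_def)
    then obtain a b where ab: "wvec c p q a \<noteq> 0" "wvec c p (q - 1) b \<noteq> 0" by (auto simp: fun_eq_iff)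
    have "wvec c' p q a * cnj (wvec c' p (q - 1) b) = wvec c p q a * cnj (wvec c p (q - 1) b)"
      using fun_cong[OF fun_cong[OF fun_cong[OF fun_cong[OF u, of "Suc p"], of q], of a], of b] d by simp
    then have "\<Omega> p q * cnj (\<Omega> p (q - 1)) * (wvec c p q a * cnj (wvec c p (q - 1) b)) =
        wvec c p q a * cnj (wvec c p (q - 1) b)"
      unfolding r.wvec_scaled[OF e(1) e'(3)] r.wvec_scaled[OF e'(1,2)] \<Omega>_def by (simp add: mult.assoc)
    then have 1: "\<Omega> p q * cnj (\<Omega> p (q - 1)) = 1" using ab by simp
    have "cmod (\<Omega> p (q - 1)) = 1" using \<kappa>[OF e'(1)] \<kappa>[OF e'(4)] by (simp add: \<Omega>_def norm_mult)
    from unit_phase[OF this] 1 show ?thesis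
      by (metis mult.commute mult.left_neutral mult.assoc)
  qed
  have "\<forall>q. ext_interval n p q \<longrightarrow> \<kappa> p q = 1" for p
  proof (induction p)
    case 0
    then show ?case using \<kappa>0 by (auto simp: ext_interval_def)
  next
    case (Suc p)
    show ?case
    proof (cases "p = 0")
      case True
      have "q \<ge> 1 \<longrightarrow> \<kappa> 1 q = 1" if "q \<le> n - 1" for q
        using that
      proof (induction q rule: inc_induct)
        case base
        then show ?case using \<kappa>top by simp
      next
        case (step m)
        show ?case
        proof
          assume m: "1 \<le> m"
          have "\<Omega> 0 (Suc m - 1) = \<Omega> 0 (Suc m)"
            by (rule \<Omega>_step) (use m step in \<open>auto simp: ext_interval_def\<close>)
          then have "cnj (\<kappa> 1 m) = 1" using \<kappa>0[of m] \<kappa>0[of "Suc m"] m step by (simp add: \<Omega>_def)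
          then show "\<kappa> 1 m = 1" by (metis complex_cnj_cnj complex_cnj_one)
        qed
      qed
      moreover have "\<kappa> 1 n = 1" using \<kappa>n[of 1] two_le_n by simp
      ultimately show ?thesis unfolding True One_nat_def[symmetric]
      proof (intro allI impI)
        fix q assume "\<And>q. q \<le> n - 1 \<Longrightarrow> 1 \<le> q \<longrightarrow> \<kappa> 1 q = 1"
          and 1: "\<kappa> 1 n = 1" and e: "ext_interval n 1 q"
        then show "\<kappa> 1 q = 1" by (cases "q = n") (auto simp: ext_interval_def)
      qed
    next
      case False
      have \<Omega>1: "\<Omega> p q = 1" if "q \<le> n" "p < q" for q
        using that
      proof (induction q rule: inc_induct)
        case base
        then show ?case using \<kappa>n[of p] \<kappa>n[of "Suc p"] False by (simp add: \<Omega>_def)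
      next
        case (step m)
        have "\<Omega> p (Suc m - 1) = \<Omega> p (Suc m)"
          by (rule \<Omega>_step) (use False step in \<open>auto simp: ext_interval_def\<close>)
        then show ?case using step by simp
      qed
      show ?thesis
      proof (intro allI impI)
        fix q assume e: "ext_interval n (Suc p) q"
        then have "q \<le> n" "p < q" "ext_interval n p q" using False by (auto simp: ext_interval_def)
        then have "cnj (\<kappa> (Suc p) q) = 1" using \<Omega>1[of q] Suc by (simp add: \<Omega>_def)
        then show "\<kappa> (Suc p) q = 1" by (metis complex_cnj_cnj complex_cnj_one)
      qed
    qed
  qed
  then show ?thesis using c'_eq[OF pq] pq by simp
qed

section \<open>Compatible nonnegative families\<close>

text \<open>Proportionality is encoded by vanishing two-by-two minors, that is, by equations between
  coordinates, so that the set is visibly closed.\<close>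

definition pos_systems :: "nat \<Rightarrow> (nat \<Rightarrow> nat \<Rightarrow> nat \<Rightarrow> real) set" where
  "pos_systems N = {\<mu>.
     (\<forall>p q k. 0 \<le> \<mu> p q k) \<and>
     (\<forall>p q k. \<not> (1 \<le> p \<and> p \<le> k \<and> k \<le> q \<and> q \<le> N) \<longrightarrow> \<mu> p q k = 0) \<and>
     (\<forall>p q. 1 \<le> p \<and> p \<le> q \<and> q \<le> N \<longrightarrow> (\<Sum>k=p..q. (\<mu> p q k)\<^sup>2) = 1) \<and>
     (\<forall>p q k l. 1 \<le> p \<and> q \<le> N \<and> Suc p \<le> k \<and> k \<le> q \<and> Suc p \<le> l \<and> l \<le> q \<longrightarrow>
        \<mu> p q k * \<mu> (Suc p) q l = \<mu> p q l * \<mu> (Suc p) q k) \<and>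
     (\<forall>p q k l. 1 \<le> p \<and> q \<le> N \<and> p \<le> k \<and> k < q \<and> p \<le> l \<and> l < q \<longrightarrow>
        \<mu> p q k * \<mu> p (q - 1) l = \<mu> p q l * \<mu> p (q - 1) k)}"

text \<open>Since \<open>y\<close> has norm one, the factor is the inner product of \<open>x\<close>
  and \<open>y\<close>, which is nonnegative.\<close>

lemma proportional_iff:
  fixes x y :: "nat \<Rightarrow> real"
  assumes "finite A" "\<And>k. 0 \<le> x k" "\<And>k. 0 \<le> y k" "(\<Sum>k\<in>A. (y k)\<^sup>2) = 1"
  shows "(\<forall>k\<in>A. \<forall>l\<in>A. x k * y l = x l * y k) \<longleftrightarrow> (\<exists>z\<ge>0. \<forall>k\<in>A. x k = z * y k)"
proof
  assume xy: "\<forall>k\<in>A. \<forall>l\<in>A. x k * y l = x l * y k"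
  have "x k = (\<Sum>l\<in>A. x l * y l) * y k" if "k \<in> A" for k
  proof -
    have "(\<Sum>l\<in>A. x l * y l) * y k = (\<Sum>l\<in>A. x k * (y l)\<^sup>2)"
      unfolding sum_distrib_right using xy that
      by (intro sum.cong) (auto simp: power2_eq_square)
    also have "\<dots> = x k" using assms(4) by (simp flip: sum_distrib_left)
    finally show ?thesis by simp
  qed
  moreover have "0 \<le> (\<Sum>l\<in>A. x l * y l)" using assms by (intro sum_nonneg) auto
  ultimately show "\<exists>z\<ge>0. \<forall>k\<in>A. x k = z * y k" by blast
qed auto

lemma pos_systemsI:
  assumes nonneg: "\<And>p q k. 0 \<le> \<mu> p q k"
    and zero: "\<And>p q k. \<not> (1 \<le> p \<and> p \<le> k \<and> k \<le> q \<and> q \<le> N) \<Longrightarrow> \<mu> p q k = 0"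
    and unit: "\<And>p q. 1 \<le> p \<Longrightarrow> p \<le> q \<Longrightarrow> q \<le> N \<Longrightarrow> (\<Sum>k=p..q. (\<mu> p q k)\<^sup>2) = 1"
    and left: "\<And>p q. 1 \<le> p \<Longrightarrow> p < q \<Longrightarrow> q \<le> N \<Longrightarrow> \<exists>z. \<forall>k\<in>{Suc p..q}. \<mu> p q k = z * \<mu> (Suc p) q k"
    and right: "\<And>p q. 1 \<le> p \<Longrightarrow> p < q \<Longrightarrow> q \<le> N \<Longrightarrow> \<exists>z. \<forall>k\<in>{p..q-1}. \<mu> p q k = z * \<mu> p (q - 1) k"
  shows "\<mu> \<in> pos_systems N"
  unfolding pos_systems_def
proof (intro CollectI conjI allI impI)
  fix p q k l
  assume a: "1 \<le> p \<and> q \<le> N \<and> Suc p \<le> k \<and> k \<le> q \<and> Suc p \<le> l \<and> l \<le> q"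
  then obtain z where "\<forall>k\<in>{Suc p..q}. \<mu> p q k = z * \<mu> (Suc p) q k" using left[of p q] by auto
  then show "\<mu> p q k * \<mu> (Suc p) q l = \<mu> p q l * \<mu> (Suc p) q k" using a by simp
next
  fix p q k l
  assume a: "1 \<le> p \<and> q \<le> N \<and> p \<le> k \<and> k < q \<and> p \<le> l \<and> l < q"
  then obtain z where z: "\<forall>k\<in>{p..q-1}. \<mu> p q k = z * \<mu> p (q - 1) k" using right[of p q] by auto
  have "k \<in> {p..q-1}" "l \<in> {p..q-1}" using a by auto
  then show "\<mu> p q k * \<mu> p (q - 1) l = \<mu> p q l * \<mu> p (q - 1) k" using z by simp
qed (use nonneg zero unit in auto)

context
  fixes N \<mu> assumes \<mu>: "\<mu> \<in> pos_systems N"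
begin

lemma pos_nonneg: "0 \<le> \<mu> p q k"
  using \<mu> by (simp add: pos_systems_def)

lemma pos_zero: "\<not> (1 \<le> p \<and> p \<le> k \<and> k \<le> q \<and> q \<le> N) \<Longrightarrow> \<mu> p q k = 0"
  using \<mu> unfolding pos_systems_def by blast

lemma pos_unit: "1 \<le> p \<Longrightarrow> p \<le> q \<Longrightarrow> q \<le> N \<Longrightarrow> (\<Sum>k=p..q. (\<mu> p q k)\<^sup>2) = 1"
  using \<mu> unfolding pos_systems_def by blast

lemma pos_left:
  assumes "1 \<le> p" "p < q" "q \<le> N"
  shows "\<exists>z\<ge>0. \<forall>k\<in>{Suc p..q}. \<mu> p q k = z * \<mu> (Suc p) q k"
proof -
  have "\<forall>k\<in>{Suc p..q}. \<forall>l\<in>{Suc p..q}. \<mu> p q k * \<mu> (Suc p) q l = \<mu> p q l * \<mu> (Suc p) q k"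
    using \<mu> assms by (auto simp: pos_systems_def)
  then show ?thesis
    using assms pos_unit[of "Suc p" q]
    by (subst (asm) proportional_iff) (auto simp: pos_nonneg)
qed

lemma pos_right:
  assumes "1 \<le> p" "p < q" "q \<le> N"
  shows "\<exists>z\<ge>0. \<forall>k\<in>{p..q-1}. \<mu> p q k = z * \<mu> p (q - 1) k"
proof -
  have "\<forall>k\<in>{p..q-1}. \<forall>l\<in>{p..q-1}. \<mu> p q k * \<mu> p (q - 1) l = \<mu> p q l * \<mu> p (q - 1) k"
  proof (intro ballI)
    fix k l assume "k \<in> {p..q-1}" "l \<in> {p..q-1}"
    then have "p \<le> k" "k < q" "p \<le> l" "l < q" using assms by auto
    then show "\<mu> p q k * \<mu> p (q - 1) l = \<mu> p q l * \<mu> p (q - 1) k"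
      using \<mu> assms unfolding pos_systems_def by blast
  qed
  then show ?thesis
    using assms pos_unit[of p "q - 1"]
    by (subst (asm) proportional_iff) (auto simp: pos_nonneg)
qed

lemma pos_le_1: "\<mu> p q k \<le> 1"
proof (cases "1 \<le> p \<and> p \<le> k \<and> k \<le> q \<and> q \<le> N")
  case True
  then have "(\<mu> p q k)\<^sup>2 \<le> (\<Sum>k=p..q. (\<mu> p q k)\<^sup>2)" by (intro member_le_sum) auto
  also have "\<dots> = 1" using True by (intro pos_unit) auto
  finally show ?thesis using pos_nonneg by (simp add: power2_le_iff_abs_le abs_le_square_iff power_le_one_iff)
next
  case False
  then show ?thesis using pos_zero by simp
qed

lemma pos_single: "1 \<le> k \<Longrightarrow> k \<le> N \<Longrightarrow> \<mu> k k k = 1"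
  using pos_unit[of k k] pos_nonneg[of k k k] by (simp add: power2_eq_1_iff)

end

text \<open>Tychonoff's theorem for the topology on a function type. It is applied below once for
  each index of a family.\<close>

lemma compact_function_space:
  fixes S :: "'i \<Rightarrow> 'b::topological_space set"
  assumes "\<And>i. compact (S i)"
  shows "compact {f. \<forall>i. f i \<in> S i}"
proof -
  have "compactin (product_topology (\<lambda>i. euclidean) UNIV) (PiE UNIV S)"
    using assms by (simp add: compactin_PiE)
  moreover have "PiE UNIV S = {f. \<forall>i. f i \<in> S i}" by (auto simp: PiE_def Pi_def)
  ultimately show ?thesis by (simp add: euclidean_product_topology)
qed

lemma compact_pos_systems: "compact (pos_systems N)"
proof -
  have cont: "continuous_on UNIV (\<lambda>\<mu>::nat \<Rightarrow> nat \<Rightarrow> nat \<Rightarrow> real. \<mu> p q k)" for p q k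
    by (rule continuous_on_product_then_coordinatewise[OF continuous_on_product_then_coordinatewise[OF
          continuous_on_product_then_coordinatewise[OF continuous_on_id]]])
  have "closed (pos_systems N)"
    unfolding pos_systems_def
    by (intro closed_Collect_conj closed_Collect_all closed_Collect_imp closed_Collect_le closed_Collect_eq
        continuous_intros cont) auto
  moreover define C where "C = {\<mu>::nat \<Rightarrow> nat \<Rightarrow> nat \<Rightarrow> real. \<forall>p. \<mu> p \<in> {f. \<forall>q. f q \<in> {g. \<forall>k. g k \<in> {0..1}}}}"
  have "compact C"
    unfolding C_def
    by (rule compact_function_space, rule compact_function_space, rule compact_function_space, rule compact_Icc)
  moreover have "pos_systems N \<subseteq> C"
  proof
    fix \<mu> assume "\<mu> \<in> pos_systems N"
    then show "\<mu> \<in> C" by (simp add: C_def pos_nonneg pos_le_1)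
  qed
  ultimately show ?thesis using compact_Int_closed[of C "pos_systems N"] by (simp add: Int_absorb1)
qed

section \<open>Covectors with given weights and phases\<close>

definition ext_weight :: "nat \<Rightarrow> (nat \<Rightarrow> nat \<Rightarrow> nat \<Rightarrow> real) \<Rightarrow> nat \<Rightarrow> nat \<Rightarrow> nat \<Rightarrow> real" where
  "ext_weight n \<mu> p q k = (if p = 0 then (if k = 0 then 1 else 0)
     else if q = n then (if k = n then 1 else 0) else \<mu> p q k)"

text \<open>The values -1 at 0 and 1 at \<open>n\<close> are dictated by \<open>first\<close> and
  \<open>last\<close>.\<close>

definition ext_phase :: "nat \<Rightarrow> (nat \<Rightarrow> complex) \<Rightarrow> nat \<Rightarrow> complex" where
  "ext_phase n a k = (if k = 0 then -1 else if k < n then a k else 1)"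

definition covec_of :: "nat \<Rightarrow> (nat \<Rightarrow> nat \<Rightarrow> nat \<Rightarrow> real) \<Rightarrow> (nat \<Rightarrow> complex) \<Rightarrow> nat \<Rightarrow> nat \<Rightarrow> cvec" where
  "covec_of n \<mu> a p q = (\<lambda>k. complex_of_real (ext_weight n \<mu> p q k) * ext_phase n a k)"

definition phases :: "nat \<Rightarrow> (nat \<Rightarrow> complex) \<Rightarrow> bool" where
  "phases n a \<longleftrightarrow> (\<forall>k\<in>{1..<n}. cmod (a k) = 1)"

lemma cmod_ext_phase: "phases n a \<Longrightarrow> cmod (ext_phase n a k) = 1"
  by (auto simp: ext_phase_def phases_def)

context
  fixes n \<mu> assumes n: "2 \<le> n" and \<mu>: "\<mu> \<in> pos_systems (n - 1)"
begin

lemma ext_weight_zero: "ext_interval n p q \<Longrightarrow> k \<notin> {p..q} \<Longrightarrow> ext_weight n \<mu> p q k = 0"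
  using pos_zero[OF \<mu>, of p k q] by (auto simp: ext_weight_def ext_interval_def)

lemma ext_weight_unit:
  assumes "ext_interval n p q" shows "(\<Sum>k=p..q. (ext_weight n \<mu> p q k)\<^sup>2) = 1"
proof -
  have delta: "(\<Sum>k=p..q. (if k = j then 1 else 0 :: real)\<^sup>2) = 1" if "p \<le> j" "j \<le> q" for j
  proof -
    have "(if k = j then 1 else 0 :: real)\<^sup>2 = (if k = j then 1 else 0)" for k by simp
    then show ?thesis using that by simp
  qed
  consider "p = 0" | "0 < p" "q = n" | "0 < p" "q < n" using assms by (fastforce simp: ext_interval_def)
  then show ?thesis
  proof cases
    case 1
    then show ?thesis using delta[of 0] assms by (simp add: ext_weight_def)
  next
    case 2
    then show ?thesis using delta[of n] assms by (simp add: ext_weight_def ext_interval_def)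
  next
    case 3
    then have "1 \<le> p" "p \<le> q" "q \<le> n - 1" using assms by (auto simp: ext_interval_def)
    from pos_unit[OF \<mu> this] show ?thesis using 3 by (simp add: ext_weight_def)
  qed
qed

lemma ext_weight_left:
  assumes "ext_interval n p q" "p < q"
  shows "\<exists>z\<ge>0. \<forall>k\<in>{Suc p..q}. ext_weight n \<mu> p q k = z * ext_weight n \<mu> (Suc p) q k"
proof -
  consider "p = 0" | "0 < p" "q = n" | "0 < p" "q < n" using assms by (fastforce simp: ext_interval_def)
  then show ?thesis
  proof cases
    case 1
    then show ?thesis by (intro exI[of _ 0]) (simp add: ext_weight_def)
  next
    case 2
    then show ?thesis by (intro exI[of _ 1]) (simp add: ext_weight_def)
  next
    case 3
    then have "1 \<le> p" "p < q" "q \<le> n - 1" using assms by auto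
    from pos_left[OF \<mu> this] show ?thesis using 3 by (simp add: ext_weight_def)
  qed
qed

lemma ext_weight_right:
  assumes "ext_interval n p q" "p < q"
  shows "\<exists>z\<ge>0. \<forall>k\<in>{p..q-1}. ext_weight n \<mu> p q k = z * ext_weight n \<mu> p (q - 1) k"
proof -
  consider "p = 0" | "0 < p" "q = n" | "0 < p" "q < n" using assms by (fastforce simp: ext_interval_def)
  then show ?thesis
  proof cases
    case 1
    then show ?thesis by (intro exI[of _ 1]) (simp add: ext_weight_def)
  next
    case 2
    then have "ext_weight n \<mu> p q k = 0" if "k \<in> {p..q-1}" for k
      using that assms(2) by (auto simp: ext_weight_def)
    then show ?thesis by (intro exI[of _ 0]) simp
  next
    case 3
    then have "1 \<le> p" "p < q" "q \<le> n - 1" and q: "q - 1 \<noteq> n" using assms by auto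
    from pos_right[OF \<mu> this(1-3)] show ?thesis using 3 q by (simp add: ext_weight_def)
  qed
qed

context
  fixes a assumes a: "phases n a"
begin

lemma unit_covec_of: assumes "ext_interval n p q" shows "unit_covec p q (covec_of n \<mu> a p q)"
proof -
  have "(\<Sum>k=p..q. covec_of n \<mu> a p q k * cnj (covec_of n \<mu> a p q k)) =
      (\<Sum>k=p..q. complex_of_real ((ext_weight n \<mu> p q k)\<^sup>2) * (ext_phase n a k * cnj (ext_phase n a k)))"
    by (intro sum.cong) (simp_all add: covec_of_def power2_eq_square)
  also have "\<dots> = complex_of_real (\<Sum>k=p..q. (ext_weight n \<mu> p q k)\<^sup>2)"
    unfolding unit_phase[OF cmod_ext_phase[OF a]] by simp
  finally show ?thesis
    using ext_weight_unit[OF assms] ext_weight_zero[OF assms] by (auto simp: unit_covec_def G_def covec_of_def)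
qed

lemma covec_of_left:
  assumes e: "ext_interval n p q" "p < q"
  shows "lcoef (covec_of n \<mu> a) p q \<in> \<real>\<^sub>\<ge>\<^sub>0"
    "k \<in> {Suc p..q} \<Longrightarrow> covec_of n \<mu> a p q k = lcoef (covec_of n \<mu> a) p q * covec_of n \<mu> a (Suc p) q k"
proof -
  obtain z where z: "z \<ge> 0" "\<forall>k\<in>{Suc p..q}. ext_weight n \<mu> p q k = z * ext_weight n \<mu> (Suc p) q k"
    using ext_weight_left[OF e] by blast
  have e': "ext_interval n (Suc p) q" using e by (auto simp: ext_interval_def)
  have *: "\<forall>k\<in>{Suc p..q}. covec_of n \<mu> a p q k = complex_of_real z * covec_of n \<mu> a (Suc p) q k"
    using z by (simp add: covec_of_def)
  from coef_eq[OF unit_covec_of[OF e'] this] have eq: "lcoef (covec_of n \<mu> a) p q = complex_of_real z"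
    by (simp add: lcoef_def)
  show "lcoef (covec_of n \<mu> a) p q \<in> \<real>\<^sub>\<ge>\<^sub>0" using eq z by simp
  show "k \<in> {Suc p..q} \<Longrightarrow> covec_of n \<mu> a p q k = lcoef (covec_of n \<mu> a) p q * covec_of n \<mu> a (Suc p) q k"
    unfolding eq using * by blast
qed

lemma covec_of_right:
  assumes e: "ext_interval n p q" "p < q"
  shows "rcoef (covec_of n \<mu> a) p q \<in> \<real>\<^sub>\<ge>\<^sub>0"
    "k \<in> {p..q-1} \<Longrightarrow> covec_of n \<mu> a p q k = rcoef (covec_of n \<mu> a) p q * covec_of n \<mu> a p (q - 1) k"
proof -
  obtain z where z: "z \<ge> 0" "\<forall>k\<in>{p..q-1}. ext_weight n \<mu> p q k = z * ext_weight n \<mu> p (q - 1) k"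
    using ext_weight_right[OF e] by blast
  have e': "ext_interval n p (q - 1)" using e by (auto simp: ext_interval_def)
  have *: "\<forall>k\<in>{p..q-1}. covec_of n \<mu> a p q k = complex_of_real z * covec_of n \<mu> a p (q - 1) k"
    using z by (simp add: covec_of_def)
  from coef_eq[OF unit_covec_of[OF e'] this] have eq: "rcoef (covec_of n \<mu> a) p q = complex_of_real z"
    by (simp add: rcoef_def)
  show "rcoef (covec_of n \<mu> a) p q \<in> \<real>\<^sub>\<ge>\<^sub>0" using eq z by simp
  show "k \<in> {p..q-1} \<Longrightarrow> covec_of n \<mu> a p q k = rcoef (covec_of n \<mu> a) p q * covec_of n \<mu> a p (q - 1) k"
    unfolding eq using * by blast
qed

lemma covec_system_covec_of: "covec_system n (covec_of n \<mu> a)"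
proof
  show "covec_of n \<mu> a p q k = lcoef (covec_of n \<mu> a) p q * covec_of n \<mu> a (Suc p) q k"
    if "ext_interval n p q" "Suc p \<le> k" "k \<le> q" for p q k
    using that by (intro covec_of_left(2)) auto
  show "covec_of n \<mu> a p q k = rcoef (covec_of n \<mu> a) p q * covec_of n \<mu> a p (q - 1) k"
    if "ext_interval n p q" "p \<le> k" "k < q" for p q k
    using that by (intro covec_of_right(2)) auto
  show "covec_of n \<mu> a 0 q = (\<lambda>k. - axis_vec 0 k)" for q
    by (simp add: covec_of_def ext_weight_def ext_phase_def axis_vec_def fun_eq_iff)
  show "covec_of n \<mu> a p n = axis_vec n" if "0 < p" for p
    using that n by (auto simp: covec_of_def ext_weight_def ext_phase_def axis_vec_def fun_eq_iff)
qed (use n unit_covec_of in auto)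

lemma coherent_covec_of: "coherent n (covec_of n \<mu> a)"
  unfolding coherent_def using covec_of_left(1) covec_of_right(1) by blast

end

end

text \<open>The interval is shrunk to \<open>{k}\<close> one end point at a time, and each step
  contributes a nonnegative factor.\<close>

lemma coherent_positive:
  assumes "covec_system n c" "coherent n c" "ext_interval n p q" "p \<le> k" "k \<le> q"
  shows "\<exists>z\<in>\<real>\<^sub>\<ge>\<^sub>0. c p q k = z * c k k k"
proof -
  interpret covec_system n c by fact
  have "\<exists>z\<in>\<real>\<^sub>\<ge>\<^sub>0. c p q k = z * c k q k"
    using assms(4,3)
  proof (induction p rule: inc_induct)
    case base
    show ?case by (intro bexI[of _ 1]) simp_all
  next
    case (step m)
    have "m < q" "Suc m \<le> k" using step assms(5) by auto
    then have e: "ext_interval n (Suc m) q" using step by (auto simp: ext_interval_def)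
    obtain z where z: "z \<in> \<real>\<^sub>\<ge>\<^sub>0" "c (Suc m) q k = z * c k q k" using step.IH[OF e] by blast
    have "c m q k = lcoef c m q * c (Suc m) q k"
      using step.prems \<open>Suc m \<le> k\<close> assms(5) by (rule left)
    then have "c m q k = (lcoef c m q * z) * c k q k" unfolding z(2) by simp
    moreover have "lcoef c m q \<in> \<real>\<^sub>\<ge>\<^sub>0"
      using assms(2) step.prems \<open>m < q\<close> by (simp add: coherent_def)
    ultimately show ?case using nonneg_Reals_mult_I[OF _ z(1)] by (intro bexI[of _ "lcoef c m q * z"]) auto
  qed
  then obtain z where z: "z \<in> \<real>\<^sub>\<ge>\<^sub>0" "c p q k = z * c k q k" by blast
  have "ext_interval n k q \<Longrightarrow> \<exists>y\<in>\<real>\<^sub>\<ge>\<^sub>0. c k q k = y * c k k k"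
    using assms(5)
  proof (induction q rule: dec_induct)
    case base
    show ?case by (intro bexI[of _ 1]) simp_all
  next
    case (step m)
    have e: "ext_interval n k m" using step by (auto simp: ext_interval_def)
    obtain y where y: "y \<in> \<real>\<^sub>\<ge>\<^sub>0" "c k m k = y * c k k k" using step.IH[OF e] by blast
    have "c k (Suc m) k = rcoef c k (Suc m) * c k (Suc m - 1) k"
      using step.prems by (rule right) (use step in auto)
    then have "c k (Suc m) k = (rcoef c k (Suc m) * y) * c k k k" using y(2) by simp
    moreover have "rcoef c k (Suc m) \<in> \<real>\<^sub>\<ge>\<^sub>0"
      using assms(2) step.prems step.hyps by (simp add: coherent_def)
    ultimately show ?case using nonneg_Reals_mult_I[OF _ y(1)] by (intro bexI[of _ "rcoef c k (Suc m) * y"]) auto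
  qed
  moreover have "ext_interval n k q" using assms by (auto simp: ext_interval_def)
  ultimately obtain y where "y \<in> \<real>\<^sub>\<ge>\<^sub>0" "c k q k = y * c k k k" by blast
  with z show ?thesis by (intro bexI[of _ "z * y"]) auto
qed

text \<open>By \<open>coherent_positive\<close>, a non-zero entry \<open>c p q k\<close> has the
  phase of the one-point covector at \<open>k\<close>, whatever the interval. The absolute values
  inherit proportionality from the covectors and form the family.\<close>

lemma covec_of_surj:
  assumes "covec_system n c" "coherent n c"
  shows "\<exists>\<mu> a. \<mu> \<in> pos_systems (n - 1) \<and> a \<in> ({1..<n} \<rightarrow>\<^sub>E sphere 0 1) \<and>
    (\<forall>p q. ext_interval n p q \<longrightarrow> covec_of n \<mu> a p q = c p q)"
proof -
  interpret covec_system n c by fact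
  define \<mu> where "\<mu> p q k = (if 1 \<le> p \<and> p \<le> k \<and> k \<le> q \<and> q \<le> n - 1 then cmod (c p q k) else 0)" for p q k
  define a where "a = (\<lambda>k\<in>{1..<n}. c k k k)"
  have single: "cmod (c k k k) = 1" if "ext_interval n k k" for k
    using norm_eq_1[OF that] phase_eq_1I by simp
  have a: "a \<in> ({1..<n} \<rightarrow>\<^sub>E sphere 0 1)"
    using single two_le_n by (auto simp: a_def ext_interval_def)
  have cm: "c p q k = complex_of_real (cmod (c p q k)) * c k k k"
    if e: "ext_interval n p q" "p \<le> k" "k \<le> q" for p q k
  proof -
    obtain z where z: "z \<in> \<real>\<^sub>\<ge>\<^sub>0" "c p q k = z * c k k k"
      using coherent_positive[OF assms e] by blast
    have "ext_interval n k k" using e two_le_n by (auto simp: ext_interval_def)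
    then have "cmod (c p q k) = cmod z" using z single by (simp add: norm_mult)
    then show ?thesis using z nonneg_Reals_cmod by simp
  qed
  have ext: "ext_interval n p q" if "1 \<le> p" "p \<le> q" "q \<le> n - 1" for p q
    using that by (auto simp: ext_interval_def)
  have "\<mu> \<in> pos_systems (n - 1)"
  proof (rule pos_systemsI)
    fix p q assume pq: "1 \<le> p" "p \<le> q" "q \<le> n - 1"
    have "complex_of_real (\<Sum>k=p..q. (\<mu> p q k)\<^sup>2) = (\<Sum>k=p..q. c p q k * cnj (c p q k))"
      unfolding of_real_sum using pq by (intro sum.cong) (simp_all add: \<mu>_def flip: complex_norm_square)
    also have "\<dots> = 1" by (rule norm_eq_1[OF ext[OF pq]])
    finally show "(\<Sum>k=p..q. (\<mu> p q k)\<^sup>2) = 1" by (metis of_real_eq_1_iff)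
  next
    fix p q assume pq: "1 \<le> p" "p < q" "q \<le> n - 1"
    then have e: "ext_interval n p q" by (intro ext) auto
    show "\<exists>z. \<forall>k\<in>{Suc p..q}. \<mu> p q k = z * \<mu> (Suc p) q k"
    proof (intro exI ballI)
      fix k assume k: "k \<in> {Suc p..q}"
      have "cmod (c p q k) = cmod (lcoef c p q) * cmod (c (Suc p) q k)"
        using left[OF e, of k] k by (metis atLeastAtMost_iff norm_mult)
      then show "\<mu> p q k = cmod (lcoef c p q) * \<mu> (Suc p) q k" using pq k by (simp add: \<mu>_def)
    qed
    show "\<exists>z. \<forall>k\<in>{p..q-1}. \<mu> p q k = z * \<mu> p (q - 1) k"
    proof (intro exI ballI)
      fix k assume "k \<in> {p..q-1}"
      then have k: "p \<le> k" "k < q" "k \<le> q - 1" using pq by auto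
      have "cmod (c p q k) = cmod (rcoef c p q) * cmod (c p (q - 1) k)"
        using right[OF e k(1,2)] by (metis norm_mult)
      then show "\<mu> p q k = cmod (rcoef c p q) * \<mu> p (q - 1) k" using pq k by (simp add: \<mu>_def)
    qed
  qed (auto simp: \<mu>_def)
  moreover have "covec_of n \<mu> a p q = c p q" if e: "ext_interval n p q" for p q
  proof
    fix k
    consider "p = 0" | "0 < p" "q = n" | "0 < p" "q < n" using e by (fastforce simp: ext_interval_def)
    then show "covec_of n \<mu> a p q k = c p q k"
    proof cases
      case 1
      then have "q < n" using e by (auto simp: ext_interval_def)
      then show ?thesis using 1 first by (simp add: covec_of_def ext_weight_def ext_phase_def axis_vec_def)
    next
      case 2
      then show ?thesis using e last[of p] by (auto simp: covec_of_def ext_weight_def ext_phase_def axis_vec_def ext_interval_def)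
    next
      case 3
      show ?thesis
      proof (cases "k \<in> {p..q}")
        case True
        then have "1 \<le> p" "p \<le> k" "k \<le> q" "q \<le> n - 1" "0 < k" "k < n" using 3 by auto
        then show ?thesis using cm[OF e, of k] 3
          by (simp add: covec_of_def ext_weight_def ext_phase_def \<mu>_def a_def)
      next
        case False
        then show ?thesis using 3 in_G[OF e] by (auto simp: covec_of_def ext_weight_def \<mu>_def G_def)
      qed
    qed
  qed
  ultimately show ?thesis using a by blast
qed

section \<open>The product decomposition of the spaces\<close>

text \<open>The factor \<open>- cnj (ext_phase n a (k - 1))\<close> in the vectors \<open>v\<close>
  makes compositions agree with those of the semidirect product: it cancels the scalar that
  \<open>wvec\<close> acquires at the left end of an inserted block (\<open>wvec_first\<close>). For
  \<open>k = 1\<close> it is 1.\<close>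

definition realize :: "nat \<Rightarrow> (nat \<Rightarrow> nat \<Rightarrow> nat \<Rightarrow> real) \<times> (nat \<Rightarrow> complex) \<times> (nat \<Rightarrow> complex) \<Rightarrow> zpoint" where
  "realize n = (\<lambda>(\<mu>, a, g). let c = covec_of n \<mu> a in
     (brick_of n c,
      \<lambda>l r x y. if divisor_index n l r then wvec c (l - 1) r x * cnj (wvec c (l - 1) (r - 1) y) else 0,
      \<lambda>k. if k \<in> {1..n} then (\<lambda>j. - cnj (ext_phase n a (k - 1)) * g k * wvec c (k - 1) k j) else 0,
      c 1 (n - 1)))"

definition model_space :: "nat \<Rightarrow> ((nat \<Rightarrow> nat \<Rightarrow> nat \<Rightarrow> real) \<times> (nat \<Rightarrow> complex) \<times> (nat \<Rightarrow> complex)) topology" where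
  "model_space n = prod_topology (top_of_set (pos_systems (n - 1))) (component As_S1_semidirect_S1 n)"

lemma component_As_S1_semidirect_S1:
  "component As_S1_semidirect_S1 n =
    prod_topology (product_topology (\<lambda>_. circle) {1..<n}) (product_topology (\<lambda>_. circle) {1..n})"
  by (simp add: As_S1_semidirect_S1_def semidirect_S1_def As_S1_def)

lemma topspace_circle [simp]: "topspace circle = sphere 0 1"
  by (simp add: circle_def)

lemma topspace_model_space:
  "topspace (model_space n) =
    pos_systems (n - 1) \<times> ({1..<n} \<rightarrow>\<^sub>E sphere 0 1) \<times> ({1..n} \<rightarrow>\<^sub>E sphere 0 1)"
  by (simp add: model_space_def component_As_S1_semidirect_S1)

lemma phases_PiE: "a \<in> ({1..<n} \<rightarrow>\<^sub>E sphere 0 1) \<Longrightarrow> phases n a"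
  by (auto simp: phases_def PiE_def Pi_def)

lemma normal_form_realize:
  assumes "phases n a" "g \<in> ({1..n} \<rightarrow>\<^sub>E sphere 0 1)"
  shows "normal_form n (covec_of n \<mu> a) (realize n (\<mu>, a, g))"
  unfolding normal_form_def realize_def Let_def prod.case
proof (intro conjI refl allI)
  fix k
  let ?v = "\<lambda>k. if k \<in> {1..n} then (\<lambda>j. - cnj (ext_phase n a (k - 1)) * g k * wvec (covec_of n \<mu> a) (k - 1) k j) else 0"
  show "if k \<in> {1..n} then \<exists>\<gamma>. cmod \<gamma> = 1 \<and> ?v k = (\<lambda>j. \<gamma> * wvec (covec_of n \<mu> a) (k - 1) k j) else ?v k = 0"
  proof (cases "k \<in> {1..n}")
    case True
    then have "cmod (g k) = 1" using assms(2) by (auto simp: PiE_def Pi_def)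
    then have "cmod (- cnj (ext_phase n a (k - 1)) * g k) = 1"
      using cmod_ext_phase[OF assms(1)] by (simp add: norm_mult)
    then show ?thesis unfolding if_P[OF True] by blast
  next
    case False
    then show ?thesis by (simp only: if_False)
  qed
qed

lemma realize_in_Z_points:
  assumes "2 \<le> n" "x \<in> topspace (model_space n)"
  shows "realize n x \<in> Z_points n"
proof -
  obtain \<mu> a g where x: "x = (\<mu>, a, g)" by (metis prod.exhaust)
  then have h: "\<mu> \<in> pos_systems (n - 1)" "phases n a" "g \<in> ({1..n} \<rightarrow>\<^sub>E sphere 0 1)"
    using assms(2) phases_PiE by (auto simp: topspace_model_space)
  show ?thesis unfolding x
    by (rule normal_form_in_Z_points[OF covec_system_covec_of coherent_covec_of normal_form_realize])
      (use assms(1) h in auto)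
qed

text \<open>Weights are absolute values of entries, and a phase is the entry of a one-point
  covector, whose weight is 1.\<close>

lemma covec_of_inj:
  assumes \<mu>: "\<mu> \<in> pos_systems (n - 1)" "\<mu>' \<in> pos_systems (n - 1)"
    and a: "a \<in> ({1..<n} \<rightarrow>\<^sub>E sphere 0 1)" "a' \<in> ({1..<n} \<rightarrow>\<^sub>E sphere 0 1)"
    and eq: "\<And>p q. ext_interval n p q \<Longrightarrow> covec_of n \<mu> a p q = covec_of n \<mu>' a' p q"
  shows "\<mu> = \<mu>'" "a = a'"
proof -
  have mod: "cmod (covec_of n \<mu> a p q k) = \<mu> p q k"
    if "\<mu> \<in> pos_systems (n - 1)" "a \<in> ({1..<n} \<rightarrow>\<^sub>E sphere 0 1)" "1 \<le> p" "q \<le> n - 1" "1 \<le> q" for \<mu> a p q k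
    using that pos_nonneg[OF that(1)] cmod_ext_phase[OF phases_PiE[OF that(2)]]
    by (auto simp: covec_of_def ext_weight_def norm_mult)
  show \<mu>\<mu>: "\<mu> = \<mu>'"
  proof (intro ext)
    fix p q k
    show "\<mu> p q k = \<mu>' p q k"
    proof (cases "1 \<le> p \<and> p \<le> q \<and> q \<le> n - 1")
      case True
      then have "1 \<le> q" "ext_interval n p q" by (auto simp: ext_interval_def)
      then show ?thesis using mod[OF \<mu>(1) a(1)] mod[OF \<mu>(2) a(2)] eq True by metis
    next
      case False
      then have "\<not> (1 \<le> p \<and> p \<le> k \<and> k \<le> q \<and> q \<le> n - 1)" by auto
      then show ?thesis using pos_zero[OF \<mu>(1)] pos_zero[OF \<mu>(2)] by simp
    qed
  qed
  show "a = a'"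
  proof (rule PiE_ext[OF a])
    fix k assume k: "k \<in> {1..<n}"
    then have "ext_interval n k k" "1 \<le> k" "k \<le> n - 1" by (auto simp: ext_interval_def)
    then show "a k = a' k"
      using fun_cong[OF eq[of k k], of k] pos_single[OF \<mu>(1)] pos_single[OF \<mu>(2)] k
      by (auto simp: covec_of_def ext_weight_def ext_phase_def)
  qed
qed

text \<open>Uniqueness of the normal form recovers the covectors from the point; the rotations are
  then determined because \<open>wvec\<close> and the phases are non-zero.\<close>

lemma inj_on_realize: assumes n: "2 \<le> n" shows "inj_on (realize n) (topspace (model_space n))"
proof (rule inj_onI)
  fix x x' assume x: "x \<in> topspace (model_space n)" and x': "x' \<in> topspace (model_space n)"
    and eq: "realize n x = realize n x'"
  obtain \<mu> a g \<mu>' a' g' where xx: "x = (\<mu>, a, g)" "x' = (\<mu>', a', g')" by (metis prod.exhaust)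
  have h: "\<mu> \<in> pos_systems (n - 1)" "a \<in> ({1..<n} \<rightarrow>\<^sub>E sphere 0 1)" "g \<in> ({1..n} \<rightarrow>\<^sub>E sphere 0 1)"
    and h': "\<mu>' \<in> pos_systems (n - 1)" "a' \<in> ({1..<n} \<rightarrow>\<^sub>E sphere 0 1)" "g' \<in> ({1..n} \<rightarrow>\<^sub>E sphere 0 1)"
    using x x' by (auto simp: topspace_model_space xx)
  note ph = phases_PiE[OF h(2)] phases_PiE[OF h'(2)]
  have cs: "covec_system n (covec_of n \<mu> a)" "covec_system n (covec_of n \<mu>' a')"
    using covec_system_covec_of n h h' ph by auto
  have "covec_of n \<mu>' a' p q = covec_of n \<mu> a p q" if "ext_interval n p q" for p q
    using normal_form_unique[OF cs(1) normal_form_realize[OF ph(1) h(3)] cs(2) _ that]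
      normal_form_realize[OF ph(2) h'(3), of \<mu>'] eq unfolding xx by simp
  from covec_of_inj[OF h'(1) h(1) h'(2) h(2) this] have \<mu>a: "\<mu>' = \<mu>" "a' = a" by auto
  interpret covec_system n "covec_of n \<mu> a" by fact
  have "g = g'"
  proof (rule PiE_ext[OF h(3) h'(3)])
    fix k assume k: "k \<in> {1..n}"
    then have e: "ext_interval n (k - 1) k" "k - 1 < k" using n by (auto simp: ext_interval_def)
    have "\<exists>j. wvec (covec_of n \<mu> a) (k - 1) k j \<noteq> 0"
    proof (rule ccontr)
      assume "\<nexists>j. wvec (covec_of n \<mu> a) (k - 1) k j \<noteq> 0"
      then have "hdot (wvec (covec_of n \<mu> a) (k - 1) k) (wvec (covec_of n \<mu> a) (k - 1) k) = 0"
        by (simp add: hdot_def)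
      with hdot_wvec_self[OF e] show False by (simp only: zero_neq_one)
    qed
    then obtain j where j: "wvec (covec_of n \<mu> a) (k - 1) k j \<noteq> 0" by blast
    have "ext_phase n a (k - 1) \<noteq> 0" using cmod_ext_phase[OF ph(1)] by (metis norm_zero zero_neq_one)
    moreover have "- cnj (ext_phase n a (k - 1)) * g k * wvec (covec_of n \<mu> a) (k - 1) k j =
        - cnj (ext_phase n a (k - 1)) * g' k * wvec (covec_of n \<mu> a) (k - 1) k j"
      using arg_cong[OF eq[unfolded xx \<mu>a], of "\<lambda>z. fst (snd (snd z)) k j"] k
      by (simp add: realize_def Let_def)
    ultimately show "g k = g' k" using j by simp
  qed
  then show "x = x'" by (simp add: xx \<mu>a)
qed

lemma realize_surj:
  assumes n: "2 \<le> n" and z: "z \<in> Z_points n"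
  shows "\<exists>x\<in>topspace (model_space n). realize n x = z"
proof -
  obtain c where c: "covec_system n c" "coherent n c" "normal_form n c z"
    using normal_form_exists[OF n z] by blast
  obtain \<mu> a where \<mu>: "\<mu> \<in> pos_systems (n - 1)" and a: "a \<in> ({1..<n} \<rightarrow>\<^sub>E sphere 0 1)"
    and eq: "\<And>p q. ext_interval n p q \<Longrightarrow> covec_of n \<mu> a p q = c p q"
    using covec_of_surj[OF c(1,2)] by blast
  interpret covec_system n c by fact
  interpret r: rescaled_system n c "covec_of n \<mu> a" "\<lambda>_ _. 1"
    by unfold_locales (simp_all add: eq)
  have w: "wvec (covec_of n \<mu> a) p q = wvec c p q" if "ext_interval n p q" "p < q" for p q
    using r.wvec_scaled[OF that] by simp
  obtain V u v \<phi> where zz: "z = (V, u, v, \<phi>)" by (metis prod.exhaust)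
  note nf = c(3)[unfolded normal_form_def zz prod.case]
  have "\<forall>k. \<exists>\<gamma>. k \<in> {1..n} \<longrightarrow> cmod \<gamma> = 1 \<and> v k = (\<lambda>j. \<gamma> * wvec c (k - 1) k j)"
  proof
    fix k show "\<exists>\<gamma>. k \<in> {1..n} \<longrightarrow> cmod \<gamma> = 1 \<and> v k = (\<lambda>j. \<gamma> * wvec c (k - 1) k j)"
    proof (cases "k \<in> {1..n}")
      case True
      from conjunct1[OF conjunct2[OF conjunct2[OF nf]], rule_format, of k, unfolded if_P[OF True]]
      show ?thesis by blast
    next
      case False
      then show ?thesis by blast
    qed
  qed
  then obtain \<delta> where \<delta>: "\<And>k. k \<in> {1..n} \<Longrightarrow> cmod (\<delta> k) = 1"
    "\<And>k. k \<in> {1..n} \<Longrightarrow> v k = (\<lambda>j. \<delta> k * wvec c (k - 1) k j)" by metis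
  \<comment> \<open>The defining equation of \<open>v\<close> in \<open>realize\<close>, solved for
    the rotation.\<close>
  define g where "g = (\<lambda>k\<in>{1..n}. - ext_phase n a (k - 1) * \<delta> k)"
  note ph = cmod_ext_phase[OF phases_PiE[OF a]]
  have g: "g \<in> ({1..n} \<rightarrow>\<^sub>E sphere 0 1)" using ph \<delta>(1) by (auto simp: g_def norm_mult)
  have "realize n (\<mu>, a, g) = z"
    unfolding realize_def Let_def prod.case zz prod.inject
  proof (intro conjI)
    show "brick_of n (covec_of n \<mu> a) = V" using conjunct1[OF nf] r.brick_of_scaled by simp
    show "(\<lambda>l r x y. if divisor_index n l r then wvec (covec_of n \<mu> a) (l - 1) r x * cnj (wvec (covec_of n \<mu> a) (l - 1) (r - 1) y) else 0) = u"
      unfolding conjunct1[OF conjunct2[OF nf]]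
    proof (intro ext)
      fix l r x y
      show "(if divisor_index n l r then wvec (covec_of n \<mu> a) (l - 1) r x * cnj (wvec (covec_of n \<mu> a) (l - 1) (r - 1) y) else 0) =
        (if divisor_index n l r then wvec c (l - 1) r x * cnj (wvec c (l - 1) (r - 1) y) else 0)"
      proof (cases "divisor_index n l r")
        case True
        then have "ext_interval n (l - 1) r" "l - 1 < r" "ext_interval n (l - 1) (r - 1)" "l - 1 < r - 1"
          by (auto simp: divisor_index_def ext_interval_def)
        then show ?thesis using True w by simp
      qed simp
    qed
    show "(\<lambda>k. if k \<in> {1..n} then (\<lambda>j. - cnj (ext_phase n a (k - 1)) * g k * wvec (covec_of n \<mu> a) (k - 1) k j) else 0) = v"
    proof
      fix k
      show "(if k \<in> {1..n} then (\<lambda>j. - cnj (ext_phase n a (k - 1)) * g k * wvec (covec_of n \<mu> a) (k - 1) k j) else 0) = v k"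
      proof (cases "k \<in> {1..n}")
        case True
        then have e: "ext_interval n (k - 1) k" "k - 1 < k" using n by (auto simp: ext_interval_def)
        have "- cnj (ext_phase n a (k - 1)) * g k = (ext_phase n a (k - 1) * cnj (ext_phase n a (k - 1))) * \<delta> k"
          using True by (simp add: g_def)
        then have "- cnj (ext_phase n a (k - 1)) * g k = \<delta> k" unfolding unit_phase[OF ph] by simp
        then show ?thesis unfolding if_P[OF True] \<delta>(2)[OF True] w[OF e] by simp
      next
        case False
        from conjunct1[OF conjunct2[OF conjunct2[OF nf]], rule_format, of k, unfolded if_not_P[OF False]]
        show ?thesis unfolding if_not_P[OF False] by (rule sym)
      qed
    qed
    have "ext_interval n 1 (n - 1)" using n by (auto simp: ext_interval_def)
    from eq[OF this] show "covec_of n \<mu> a 1 (n - 1) = \<phi>"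
      using conjunct2[OF conjunct2[OF conjunct2[OF nf]]] by simp
  qed
  moreover have "(\<mu>, a, g) \<in> topspace (model_space n)" using \<mu> a g by (simp add: topspace_model_space)
  ultimately show ?thesis by blast
qed

section \<open>Continuity of the parametrization\<close>

lemma continuous_map_mult:
  fixes f g :: "'a \<Rightarrow> 'b::real_normed_algebra"
  assumes "continuous_map X euclidean f" "continuous_map X euclidean g"
  shows "continuous_map X euclidean (\<lambda>x. f x * g x)"
proof -
  have "continuous_map X (prod_topology euclidean euclidean) (\<lambda>x. (f x, g x))"
    using assms by (rule continuous_map_pairedI)
  moreover have "continuous_map (prod_topology euclidean euclidean) euclidean (\<lambda>x::'b \<times> 'b. fst x * snd x)"
    unfolding prod_topology_euclidean by (simp add: continuous_on_mult continuous_on_fst continuous_on_snd)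
  ultimately have "continuous_map X euclidean ((\<lambda>x. fst x * snd x) \<circ> (\<lambda>x. (f x, g x)))"
    by (rule continuous_map_compose)
  then show ?thesis by (simp add: o_def)
qed

lemma continuous_map_euclidean_compose:
  assumes "continuous_map X euclidean f" "continuous_on UNIV h"
  shows "continuous_map X euclidean (\<lambda>x. h (f x))"
  using continuous_map_compose[OF assms(1), of euclidean h] assms(2) by (simp add: o_def)

lemma continuous_map_fun_iff:
  "continuous_map X euclidean f \<longleftrightarrow> (\<forall>i. continuous_map X euclidean (\<lambda>x. f x i))"
  using continuous_map_componentwise_UNIV[of X "\<lambda>_. euclidean" f] by (simp add: euclidean_product_topology)

context
  fixes n :: nat
begin

lemma continuous_map_weight: "continuous_map (model_space n) euclidean (\<lambda>x. complex_of_real (ext_weight n (fst x) p q k))"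
proof -
  have "continuous_map (model_space n) euclidean fst"
    unfolding model_space_def using continuous_map_fst continuous_map_into_fulltopology by blast
  then have "continuous_map (model_space n) euclidean (\<lambda>x. fst x p q k)"
    by (simp add: continuous_map_fun_iff)
  then have "continuous_map (model_space n) euclidean (\<lambda>x. complex_of_real (fst x p q k))"
    by (rule continuous_map_euclidean_compose) (intro continuous_intros)
  then show ?thesis by (cases "p = 0"; cases "q = n") (simp_all add: ext_weight_def)
qed

lemma continuous_map_phase: "continuous_map (model_space n) euclidean (\<lambda>x. ext_phase n (fst (snd x)) k)"
proof (cases "k \<in> {1..<n}")
  case True
  have "continuous_map (model_space n) (product_topology (\<lambda>_. circle) {1..<n}) (\<lambda>x. fst (snd x))"
    unfolding model_space_def component_As_S1_semidirect_S1
    using continuous_map_compose[OF continuous_map_snd continuous_map_fst] by (simp add: o_def)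
  then have "continuous_map (model_space n) circle (\<lambda>x. fst (snd x) k)"
    using True by (rule continuous_map_product_then_coordinatewise)
  then have "continuous_map (model_space n) euclidean (\<lambda>x. fst (snd x) k)"
    unfolding circle_def using continuous_map_into_fulltopology by blast
  then show ?thesis using True by (simp add: ext_phase_def)
next
  case False
  then show ?thesis by (cases "k = 0") (auto simp: ext_phase_def)
qed

lemma continuous_map_rotation:
  assumes "k \<in> {1..n}" shows "continuous_map (model_space n) euclidean (\<lambda>x. snd (snd x) k)"
proof -
  have "continuous_map (model_space n) (product_topology (\<lambda>_. circle) {1..n}) (\<lambda>x. snd (snd x))"
    unfolding model_space_def component_As_S1_semidirect_S1
    using continuous_map_compose[OF continuous_map_snd continuous_map_snd] by (simp add: o_def)
  then have "continuous_map (model_space n) circle (\<lambda>x. snd (snd x) k)"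
    using assms by (rule continuous_map_product_then_coordinatewise)
  then show ?thesis
    unfolding circle_def using continuous_map_into_fulltopology by blast
qed

lemma continuous_map_covec_of:
  "continuous_map (model_space n) euclidean (\<lambda>x. covec_of n (fst x) (fst (snd x)) p q k)"
  unfolding covec_of_def by (intro continuous_map_mult continuous_map_weight continuous_map_phase)

lemma continuous_map_cnj: "continuous_map X euclidean f \<Longrightarrow> continuous_map X euclidean (\<lambda>x. cnj (f x))"
  using continuous_map_euclidean_compose[of X f cnj] continuous_on_cnj[OF continuous_on_id] by blast

lemma continuous_map_wvec:
  "continuous_map (model_space n) euclidean (\<lambda>x. wvec (covec_of n (fst x) (fst (snd x))) p q k)"
proof -
  have "continuous_map (model_space n) euclidean (\<lambda>x. lcoef (covec_of n (fst x) (fst (snd x))) p q)"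
    unfolding lcoef_def
    by (intro continuous_map_sum continuous_map_mult continuous_map_cnj continuous_map_covec_of) auto
  moreover have "continuous_map (model_space n) euclidean
     (\<lambda>x. - covec_of n (fst x) (fst (snd x)) p q p * cnj (covec_of n (fst x) (fst (snd x)) (Suc p) q k))"
    by (intro continuous_map_mult continuous_map_minus continuous_map_cnj continuous_map_covec_of)
  ultimately show ?thesis by (simp add: wvec_def)
qed

end

text \<open>Every coordinate of the target is a polynomial in weights, phases, rotations and their
  conjugates. For the subspaces this is the formula of \<open>proj_mat_hyperplane\<close>.\<close>

lemma continuous_map_realize:
  assumes n: "2 \<le> n"
  shows "continuous_map (model_space n) (Z_space n) (realize n)"
  unfolding Z_space_def
proof (rule continuous_map_pullback')
  show "topspace (model_space n) \<subseteq> realize n -` Z_points n"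
    using realize_in_Z_points[OF n] by blast
  let ?c = "\<lambda>x. covec_of n (fst x) (fst (snd x))"
  have "Z_coords \<circ> realize n = (\<lambda>x. (\<lambda>i j. proj_mat (brick_of n (?c x) i j),
      \<lambda>l r s t. if divisor_index n l r then wvec (?c x) (l - 1) r s * cnj (wvec (?c x) (l - 1) (r - 1) t) else 0,
      \<lambda>k. if k \<in> {1..n} then (\<lambda>j. - cnj (ext_phase n (fst (snd x)) (k - 1)) * snd (snd x) k * wvec (?c x) (k - 1) k j) else 0,
      ?c x 1 (n - 1)))"
    by (simp add: fun_eq_iff Z_coords_def realize_def Let_def split: prod.split)
  moreover have "continuous_map (model_space n) euclidean (\<lambda>x. proj_mat (brick_of n (?c x) i j) a b)" for i j a b
  proof (cases "proper_interval n i j")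
    case True
    then have e: "ext_interval n (i - 1) j" by (auto simp: proper_interval_def ext_interval_def)
    have "continuous_map (model_space n) euclidean
        (\<lambda>x. (if a = b \<and> a \<in> {i-1..j} then 1 else 0) - cnj (?c x (i - 1) j a) * ?c x (i - 1) j b)"
      by (intro continuous_map_diff continuous_map_mult continuous_map_cnj continuous_map_covec_of) auto
    moreover have "(if a = b \<and> a \<in> {i-1..j} then 1 else 0) - cnj (?c x (i - 1) j a) * ?c x (i - 1) j b =
        proj_mat (brick_of n (?c x) i j) a b" if x: "x \<in> topspace (model_space n)" for x
    proof -
      have "unit_covec (i - 1) j (?c x (i - 1) j)"
        using x n phases_PiE by (intro unit_covec_of e) (auto simp: topspace_model_space)
      from proj_mat_hyperplane[OF this] show ?thesis using True by (simp add: brick_of_def)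
    qed
    ultimately show ?thesis by (rule continuous_map_eq)
  next
    case False
    then show ?thesis by (simp add: brick_of_def proj_mat_zero)
  qed
  then have "continuous_map (model_space n) euclidean (\<lambda>x i j. proj_mat (brick_of n (?c x) i j))"
    by (simp add: continuous_map_fun_iff)
  moreover have "continuous_map (model_space n) euclidean
     (\<lambda>x l r s t. if divisor_index n l r then wvec (?c x) (l - 1) r s * cnj (wvec (?c x) (l - 1) (r - 1) t) else 0)"
  proof -
    have "continuous_map (model_space n) euclidean
      (\<lambda>x. if divisor_index n l r then wvec (?c x) (l - 1) r s * cnj (wvec (?c x) (l - 1) (r - 1) t) else 0)" for l r s t
      by (cases "divisor_index n l r")
        (simp_all only: if_True if_False continuous_map_const topspace_euclidean UNIV_I simp_thms
          continuous_map_mult continuous_map_cnj continuous_map_wvec)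
    then show ?thesis by (simp only: continuous_map_fun_iff simp_thms)
  qed
  moreover have "continuous_map (model_space n) euclidean
     (\<lambda>x k. if k \<in> {1..n} then (\<lambda>j. - cnj (ext_phase n (fst (snd x)) (k - 1)) * snd (snd x) k * wvec (?c x) (k - 1) k j) else 0)"
    unfolding continuous_map_fun_iff
  proof (intro allI)
    fix k j
    show "continuous_map (model_space n) euclidean
     (\<lambda>x. (if k \<in> {1..n} then (\<lambda>j. - cnj (ext_phase n (fst (snd x)) (k - 1)) * snd (snd x) k * wvec (?c x) (k - 1) k j) else 0) j)"
    proof (cases "k \<in> {1..n}")
      case True
      show ?thesis unfolding if_P[OF True]
        by (intro continuous_map_mult continuous_map_minus continuous_map_cnj continuous_map_phase
            continuous_map_rotation[OF True] continuous_map_wvec)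
    next
      case False
      show ?thesis unfolding if_not_P[OF False] by simp
    qed
  qed
  moreover have "continuous_map (model_space n) euclidean (\<lambda>x. ?c x 1 (n - 1))"
    unfolding continuous_map_fun_iff[of _ "\<lambda>x. ?c x 1 (n - 1)"] using continuous_map_covec_of by blast
  ultimately show "continuous_map (model_space n) euclidean (Z_coords \<circ> realize n)"
    unfolding prod_topology_euclidean[symmetric] by (simp only: continuous_map_pairedI)
qed

section \<open>The Hausdorff property, compactness and the resulting homeomorphism\<close>

lemma topspace_Z_space: "topspace (Z_space n) = Z_points n"
  by (simp add: Z_space_def topspace_pullback_topology)

lemma inj_on_Z_coords: assumes n: "2 \<le> n" shows "inj_on Z_coords (Z_points n)"
proof (rule inj_onI)
  fix z z' assume z: "z \<in> Z_points n" and z': "z' \<in> Z_points n" and eq: "Z_coords z = Z_coords z'"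
  obtain V u v \<phi> V' u' v' \<phi>' where zz: "z = (V, u, v, \<phi>)" "z' = (V', u', v', \<phi>')" by (metis prod.exhaust)
  have e: "(\<lambda>i j. proj_mat (V i j)) = (\<lambda>i j. proj_mat (V' i j))" "u = u'" "v = v'" "\<phi> = \<phi>'"
    using eq unfolding zz Z_coords_def prod.case prod.inject by blast+
  have "V \<in> brick_manifold n" "V' \<in> brick_manifold n"
    using z z' by (simp_all add: zz Z_points_def)
  then obtain c c' where c: "covec_system n c" "V = brick_of n c" and c': "covec_system n c'" "V' = brick_of n c'"
    using brick_eq_brick_of[OF n] by metis
  have "V i j = V' i j" for i j
  proof (cases "proper_interval n i j")
    case True
    then have ext: "ext_interval n (i - 1) j" by (auto simp: proper_interval_def ext_interval_def)
    have "proj_mat (hyperplane (i - 1) j (c (i - 1) j)) = proj_mat (hyperplane (i - 1) j (c' (i - 1) j))"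
      using fun_cong[OF fun_cong[OF e(1), of i], of j] True by (simp add: c c' brick_of_def)
    from hyperplane_eq_if_proj_mat_eq[OF covec_system.unit[OF c(1) ext] covec_system.unit[OF c'(1) ext] this]
    show ?thesis using True by (simp add: c c' brick_of_def)
  next
    case False
    then show ?thesis by (simp add: c c' brick_of_def)
  qed
  then show "z = z'" using e by (simp add: zz fun_eq_iff)
qed

lemma Hausdorff_Z_space: assumes "2 \<le> n" shows "Hausdorff_space (Z_space n)"
proof (rule Hausdorff_space_injective_preimage[of euclidean _ Z_coords])
  show "continuous_map (Z_space n) euclidean Z_coords"
    unfolding Z_space_def using continuous_map_pullback[of euclidean euclidean id] by simp
qed (simp_all add: Hausdorff_space_euclidean topspace_Z_space inj_on_Z_coords assms)

lemma compact_model_space: "compact_space (model_space n)"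
  using compact_pos_systems by (auto simp: model_space_def component_As_S1_semidirect_S1 circle_def
    compact_space_prod_topology compact_space_product_topology compact_space_subtopology compact_sphere)

text \<open>A continuous bijection from a compact space to a Hausdorff space. The continuity of the
  phase normalization is a consequence.\<close>

lemma homeomorphic_map_realize:
  assumes "2 \<le> n" shows "homeomorphic_map (model_space n) (Z_space n) (realize n)"
proof (rule continuous_imp_homeomorphic_map)
  show "realize n ` topspace (model_space n) = topspace (Z_space n)"
    using realize_in_Z_points realize_surj assms unfolding topspace_Z_space by blast
qed (use assms in \<open>simp_all add: continuous_map_realize compact_model_space Hausdorff_Z_space inj_on_realize\<close>)

section \<open>Compositions in product coordinates\<close>

text \<open>
  The block \<open>{i..<i + m - 1}\<close> of a composition consists of the inserted coordinates. An interval that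
  is not contained in the block collapses to the interval from \<open>lower\<close> to \<open>upper\<close> of its end points.
\<close>

definition lower :: "nat \<Rightarrow> nat \<Rightarrow> nat \<Rightarrow> nat" where
  "lower i m p = (if p < i then p else if p < i + m - 1 then i else p - (m - 1))"

definition upper :: "nat \<Rightarrow> nat \<Rightarrow> nat \<Rightarrow> nat" where
  "upper i m q = (if q < i then q else if q < i + m - 1 then i - 1 else q - (m - 1))"

definition expand :: "nat \<Rightarrow> nat \<Rightarrow> nat \<Rightarrow> nat" where
  "expand i m j = (if j < i then j else j + (m - 1))"

text \<open>An interval inside the block sees the shifted family \<nu>. Any other interval sees a
  degenerate row: weight zero on the block, and elsewhere the weights of the collapsed interval. The
  bound \<open>n + m - 2\<close> is the last inner coordinate in arity
  \<open>n + m - 1\<close>.\<close>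

definition pos_comp :: "nat \<Rightarrow> nat \<Rightarrow> nat \<Rightarrow> (nat \<Rightarrow> nat \<Rightarrow> nat \<Rightarrow> real) \<Rightarrow> (nat \<Rightarrow> nat \<Rightarrow> nat \<Rightarrow> real) \<Rightarrow> nat \<Rightarrow> nat \<Rightarrow> nat \<Rightarrow> real" where
  "pos_comp n m i \<mu> \<nu> = (\<lambda>p q k.
     if \<not> (1 \<le> p \<and> p \<le> k \<and> k \<le> q \<and> q \<le> n + m - 2) then 0
     else if i \<le> p \<and> q < i + m - 1 then \<nu> (p + 1 - i) (q + 1 - i) (k + 1 - i)
     else if i \<le> k \<and> k < i + m - 1 then 0
     else \<mu> (lower i m p) (upper i m q) (lower i m k))"

lemma sum_shift_block:
  fixes f :: "nat \<Rightarrow> 'a::comm_monoid_add"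
  assumes "i \<le> p" "1 \<le> i"
  shows "(\<Sum>k=p..q. f k) = (\<Sum>j=p+1-i..q+1-i. f (j + i - 1))"
  by (rule sum.reindex_bij_witness[of _ "\<lambda>j. j + i - 1" "\<lambda>k. k + 1 - i"]) (use assms in auto)

text \<open>\<open>expand\<close> and \<open>lower\<close> are inverse bijections between the
  coordinates of the collapsed interval and those of \<open>{p..q}\<close> outside the
  block.\<close>

lemma sum_collapse:
  fixes f :: "nat \<Rightarrow> 'a::comm_monoid_add"
  assumes "1 \<le> i" "2 \<le> m" "p \<le> q" "\<not> (i \<le> p \<and> q < i + m - 1)"
    and "\<And>k. i \<le> k \<Longrightarrow> k < i + m - 1 \<Longrightarrow> f k = 0"
  shows "(\<Sum>k=p..q. f k) = (\<Sum>j=lower i m p..upper i m q. f (expand i m j))"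
proof -
  have "(\<Sum>k=p..q. f k) = (\<Sum>k\<in>{p..q} - {i..<i + m - 1}. f k)"
    using assms(5) by (intro sum.mono_neutral_right) auto
  also have "\<dots> = (\<Sum>j=lower i m p..upper i m q. f (expand i m j))"
    by (rule sum.reindex_bij_witness[of _ "expand i m" "lower i m"])
      (use assms in \<open>auto simp: lower_def upper_def expand_def split: if_splits\<close>)
  finally show ?thesis .
qed

lemma lower_expand: "2 \<le> m \<Longrightarrow> lower i m (expand i m j) = j"
  by (auto simp: lower_def expand_def)

lemma expand_not_block: "2 \<le> m \<Longrightarrow> \<not> (i \<le> expand i m j \<and> expand i m j < i + m - 1)"
  by (auto simp: expand_def split: if_splits)

locale block =
  fixes n m i :: nat
  assumes n: "2 \<le> n" and m: "2 \<le> m" and i: "1 \<le> i" "i \<le> n"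
begin

lemma collapse_bounds:
  assumes "1 \<le> p" "p \<le> q" "q \<le> n + m - 2" "\<not> (i \<le> p \<and> q < i + m - 1)"
  shows "1 \<le> lower i m p" "lower i m p \<le> upper i m q" "upper i m q \<le> n - 1"
  using assms n m i by (auto simp: lower_def upper_def)

text \<open>Inside the block the factors of \<nu> are inherited, and those of \<mu> when the dropped
  end point lies outside the block. If a dropped block coordinate leaves an interval that still
  reaches out of the block, the collapsed interval is unchanged and the factor is 1. If the smaller
  interval falls into the block while the larger does not, the larger row vanishes on it and the
  factor is 0.\<close>

lemma pos_comp_in_pos_systems:
  assumes \<mu>: "\<mu> \<in> pos_systems (n - 1)" and \<nu>: "\<nu> \<in> pos_systems (m - 1)"
  shows "pos_comp n m i \<mu> \<nu> \<in> pos_systems (n + m - 1 - 1)"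
proof (rule pos_systemsI)
  let ?\<rho> = "pos_comp n m i \<mu> \<nu>"
  show "0 \<le> ?\<rho> p q k" for p q k
    using pos_nonneg[OF \<mu>] pos_nonneg[OF \<nu>] by (simp add: pos_comp_def)
  show "?\<rho> p q k = 0" if "\<not> (1 \<le> p \<and> p \<le> k \<and> k \<le> q \<and> q \<le> n + m - 1 - 1)" for p q k
    using that by (simp add: pos_comp_def numeral_2_eq_2)
  have inner: "?\<rho> p q k = \<nu> (p + 1 - i) (q + 1 - i) (k + 1 - i)"
    if "i \<le> p" "p \<le> k" "k \<le> q" "q < i + m - 1" "q \<le> n + m - 2" for p q k
    using that i by (simp add: pos_comp_def)
  have outer: "?\<rho> p q k = (if i \<le> k \<and> k < i + m - 1 then 0 else \<mu> (lower i m p) (upper i m q) (lower i m k))"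
    if "1 \<le> p" "p \<le> k" "k \<le> q" "q \<le> n + m - 2" "\<not> (i \<le> p \<and> q < i + m - 1)" for p q k
    unfolding pos_comp_def if_not_P[OF that(5)] using that by (simp only: simp_thms if_False)
  show "(\<Sum>k=p..q. (?\<rho> p q k)\<^sup>2) = 1" if pq: "1 \<le> p" "p \<le> q" "q \<le> n + m - 1 - 1" for p q
  proof (cases "i \<le> p \<and> q < i + m - 1")
    case True
    have "(\<Sum>k=p..q. (?\<rho> p q k)\<^sup>2) = (\<Sum>j=p+1-i..q+1-i. (?\<rho> p q (j + i - 1))\<^sup>2)"
      using True i by (intro sum_shift_block) auto
    also have "\<dots> = (\<Sum>j=p+1-i..q+1-i. (\<nu> (p + 1 - i) (q + 1 - i) j)\<^sup>2)"
    proof (intro sum.cong refl)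
      fix j assume j: "j \<in> {p+1-i..q+1-i}"
      then have "p \<le> j + i - 1" "j + i - 1 \<le> q" "j + i - 1 + 1 - i = j" using True i by auto
      then show "(?\<rho> p q (j + i - 1))\<^sup>2 = (\<nu> (p + 1 - i) (q + 1 - i) j)\<^sup>2"
        using inner[of p "j + i - 1" q] True pq by simp
    qed
    also have "\<dots> = 1" using True pq i by (intro pos_unit[OF \<nu>]) auto
    finally show ?thesis .
  next
    case False
    have "(\<Sum>k=p..q. (?\<rho> p q k)\<^sup>2) = (\<Sum>k=p..q. if i \<le> k \<and> k < i + m - 1 then 0 else (\<mu> (lower i m p) (upper i m q) (lower i m k))\<^sup>2)"
      using outer[of p _ q] False pq by (intro sum.cong) auto
    also have "\<dots> = (\<Sum>j=lower i m p..upper i m q. (\<mu> (lower i m p) (upper i m q) j)\<^sup>2)"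
      by (subst sum_collapse[OF i(1) m pq(2) False])
        (simp_all only: expand_not_block[OF m] lower_expand[OF m] if_False if_True simp_thms)
    also have "\<dots> = 1" using collapse_bounds[OF pq(1,2) _ False] pq by (intro pos_unit[OF \<mu>]) auto
    finally show ?thesis .
  qed
  fix p q assume pq: "1 \<le> p" "p < q" "q \<le> n + m - 1 - 1"
  then have q: "q \<le> n + m - 2" by simp
  show "\<exists>z. \<forall>k\<in>{Suc p..q}. ?\<rho> p q k = z * ?\<rho> (Suc p) q k"
  proof (cases "i \<le> p \<and> q < i + m - 1")
    case True
    then have b: "1 \<le> p + 1 - i" "p + 1 - i < q + 1 - i" "q + 1 - i \<le> m - 1" and S: "Suc (p + 1 - i) = Suc p + 1 - i"
      using pq i by auto
    obtain z where z: "\<forall>k\<in>{Suc (p + 1 - i)..q + 1 - i}. \<nu> (p + 1 - i) (q + 1 - i) k = z * \<nu> (Suc (p + 1 - i)) (q + 1 - i) k"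
      using pos_left[OF \<nu> b] by blast
    show ?thesis
    proof (intro exI[of _ z] ballI)
      fix k assume k: "k \<in> {Suc p..q}"
      then have "k + 1 - i \<in> {Suc (p + 1 - i)..q + 1 - i}" using True by auto
      with z show "?\<rho> p q k = z * ?\<rho> (Suc p) q k"
        using inner[of p k q] inner[of "Suc p" k q] True k q unfolding S by auto
    qed
  next
    case outer_p: False
    show ?thesis
    proof (cases "i \<le> Suc p \<and> q < i + m - 1")
      case True
      then have "?\<rho> p q k = 0" if "k \<in> {Suc p..q}" for k
        using outer[of p k q] outer_p that pq q by auto
      then show ?thesis by (intro exI[of _ 0]) simp
    next
      case outer_Sp: False
      show ?thesis
      proof (cases "i \<le> p \<and> p < i + m - 1")
        case True
        then have "lower i m (Suc p) = lower i m p" using m by (auto simp: lower_def)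
        then have "?\<rho> p q k = ?\<rho> (Suc p) q k" if "k \<in> {Suc p..q}" for k
          using outer[of p k q] outer[of "Suc p" k q] outer_p outer_Sp that pq q by auto
        then show ?thesis by (intro exI[of _ 1]) simp
      next
        case False
        then have S: "lower i m (Suc p) = Suc (lower i m p)" using m by (auto simp: lower_def)
        note b = collapse_bounds[OF pq(1) less_imp_le[OF pq(2)] q outer_p]
        have "1 \<le> Suc p" "Suc p \<le> q" using pq by auto
        from collapse_bounds[OF this q outer_Sp] b(3)
        have b': "lower i m p < upper i m q" unfolding S by simp
        obtain z where z: "\<forall>k\<in>{Suc (lower i m p)..upper i m q}.
            \<mu> (lower i m p) (upper i m q) k = z * \<mu> (Suc (lower i m p)) (upper i m q) k"
          using pos_left[OF \<mu> b(1) b' b(3)] by blast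
        show ?thesis
        proof (intro exI[of _ z] ballI)
          fix k assume k: "k \<in> {Suc p..q}"
          show "?\<rho> p q k = z * ?\<rho> (Suc p) q k"
          proof (cases "i \<le> k \<and> k < i + m - 1")
            case True
            then show ?thesis using outer[of p k q] outer[of "Suc p" k q] outer_p outer_Sp k pq q by auto
          next
            case kB: False
            then have "lower i m k \<in> {Suc (lower i m p)..upper i m q}"
              using k False m by (auto simp: lower_def upper_def)
            with z show ?thesis
              using outer[of p k q] outer[of "Suc p" k q] outer_p outer_Sp k pq q kB unfolding S by auto
          qed
        qed
      qed
    qed
  qed
  show "\<exists>z. \<forall>k\<in>{p..q-1}. ?\<rho> p q k = z * ?\<rho> p (q - 1) k"
  proof (cases "i \<le> p \<and> q < i + m - 1")
    case True
    then have b: "1 \<le> p + 1 - i" "p + 1 - i < q + 1 - i" "q + 1 - i \<le> m - 1" and S: "q + 1 - i - 1 = q - 1 + 1 - i"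
      using pq i by auto
    obtain z where z: "\<forall>k\<in>{p + 1 - i..q + 1 - i - 1}. \<nu> (p + 1 - i) (q + 1 - i) k = z * \<nu> (p + 1 - i) (q + 1 - i - 1) k"
      using pos_right[OF \<nu> b] by blast
    show ?thesis
    proof (intro exI[of _ z] ballI)
      fix k assume "k \<in> {p..q-1}"
      then have k: "p \<le> k" "k < q" "k \<le> q" "k \<le> q - 1" using pq by auto
      then have "k + 1 - i \<in> {p + 1 - i..q + 1 - i - 1}" using True by auto
      moreover have "q - 1 < i + m - 1" "q - 1 \<le> n + m - 2" using True q by auto
      ultimately show "?\<rho> p q k = z * ?\<rho> p (q - 1) k"
        using z inner[of p k q] inner[of p k "q - 1"] True k q unfolding S by auto
    qed
  next
    case outer_q: False
    show ?thesis
    proof (cases "i \<le> p \<and> q - 1 < i + m - 1")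
      case True
      have "?\<rho> p q k = 0" if "k \<in> {p..q-1}" for k
      proof -
        have "p \<le> k" "k \<le> q" "i \<le> k" "k < i + m - 1" using that True pq by auto
        then show ?thesis using outer[of p k q] outer_q pq q by simp
      qed
      then show ?thesis by (intro exI[of _ 0]) simp
    next
      case outer_q1: False
      show ?thesis
      proof (cases "i \<le> q \<and> q < i + m - 1")
        case True
        then have U: "upper i m (q - 1) = upper i m q" using i by (auto simp: upper_def)
        have "?\<rho> p q k = ?\<rho> p (q - 1) k" if "k \<in> {p..q-1}" for k
        proof -
          have "p \<le> k" "k \<le> q" "k \<le> q - 1" "q - 1 \<le> n + m - 2" using that pq q by auto
          then show ?thesis using outer[of p k q] outer[of p k "q - 1"] outer_q outer_q1 pq q U by simp
        qed
        then show ?thesis by (intro exI[of _ 1]) simp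
      next
        case False
        then have S: "upper i m (q - 1) = upper i m q - 1" using m pq i by (auto simp: upper_def)
        note b = collapse_bounds[OF pq(1) less_imp_le[OF pq(2)] q outer_q]
        have q1: "p \<le> q - 1" "q - 1 \<le> n + m - 2" using pq q by auto
        from collapse_bounds[OF pq(1) q1 outer_q1] b(1)
        have b': "lower i m p < upper i m q" unfolding S by simp
        obtain z where z: "\<forall>k\<in>{lower i m p..upper i m q - 1}.
            \<mu> (lower i m p) (upper i m q) k = z * \<mu> (lower i m p) (upper i m q - 1) k"
          using pos_right[OF \<mu> b(1) b' b(3)] by blast
        show ?thesis
        proof (intro exI[of _ z] ballI)
          fix k assume "k \<in> {p..q-1}"
          then have k: "p \<le> k" "k \<le> q" "k \<le> q - 1" "k < q" using pq by auto
          show "?\<rho> p q k = z * ?\<rho> p (q - 1) k"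
          proof (cases "i \<le> k \<and> k < i + m - 1")
            case True
            then show ?thesis using outer[of p k q] outer[of p k "q - 1"] outer_q outer_q1 k pq q q1 by simp
          next
            case kB: False
            then have "lower i m k \<in> {lower i m p..upper i m q - 1}"
              using k False m i by (auto simp: lower_def upper_def)
            with z show ?thesis
              using outer[of p k q] outer[of p k "q - 1"] outer_q outer_q1 k pq q q1 kB unfolding S by auto
          qed
        qed
      qed
    qed
  qed
qed

section \<open>The insertion maps on hyperplanes\<close>

lemma ins_left_not_block: "\<not> (i \<le> k \<and> k < i + m - 1) \<Longrightarrow> ins_left i m x k = x (lower i m k)"
  by (auto simp: ins_left_def lower_def)

lemma ins_left_block: "i \<le> k \<Longrightarrow> k < i + m - 1 \<Longrightarrow> ins_left i m x k = 0"
  by (simp add: ins_left_def)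

lemma ins_left_expand: "ins_left i m x (expand i m j) = x j"
  using m by (auto simp: ins_left_def expand_def)

lemma ins_right_not_block: "\<not> (i \<le> k \<and> k < i + m - 1) \<Longrightarrow> ins_right i m x k = 0"
  by (auto simp: ins_right_def)

lemma ins_right_block: "i \<le> k \<Longrightarrow> k < i + m - 1 \<Longrightarrow> ins_right i m x k = x (k + 1 - i)"
  by (simp add: ins_right_def Suc_diff_le)

lemma hyperplane_ins_right:
  assumes "i \<le> p" "p \<le> q" "q < i + m - 1"
  shows "hyperplane p q (ins_right i m c) = ins_right i m ` hyperplane (p + 1 - i) (q + 1 - i) c"
proof
  have sum: "(\<Sum>k=p..q. ins_right i m c k * x k) = (\<Sum>j=p+1-i..q+1-i. c j * x (j + i - 1))" for x
  proof -
    have "(\<Sum>k=p..q. ins_right i m c k * x k) =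
        (\<Sum>j=p+1-i..q+1-i. ins_right i m c (j + i - 1) * x (j + i - 1))"
      using assms i by (intro sum_shift_block) auto
    also have "\<dots> = (\<Sum>j=p+1-i..q+1-i. c j * x (j + i - 1))"
    proof (intro sum.cong refl)
      fix j assume "j \<in> {p+1-i..q+1-i}"
      then have "i \<le> j + i - 1" "j + i - 1 < i + m - 1" "j + i - 1 + 1 - i = j" using assms i by auto
      then show "ins_right i m c (j + i - 1) * x (j + i - 1) = c j * x (j + i - 1)"
        by (simp add: ins_right_block)
    qed
    finally show ?thesis .
  qed
  show "hyperplane p q (ins_right i m c) \<subseteq> ins_right i m ` hyperplane (p + 1 - i) (q + 1 - i) c"
  proof
    fix x assume x: "x \<in> hyperplane p q (ins_right i m c)"
    define y where "y = (\<lambda>j. if 1 \<le> j then x (j + i - 1) else 0)"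
    have "x = ins_right i m y"
    proof
      fix k
      show "x k = ins_right i m y k"
        using x assms i by (cases "i \<le> k \<and> k < i + m - 1")
          (auto simp: ins_right_block ins_right_not_block y_def hyperplane_def G_def)
    qed
    moreover have "y \<in> G (p + 1 - i) (Suc (q + 1 - i))"
    proof -
      have xG: "x k = 0" if "k < p \<or> q < k" for k using x that by (auto simp: hyperplane_def G_def)
      have "y j = 0" if "j \<notin> {p + 1 - i..<Suc (q + 1 - i)}" for j
      proof (cases "1 \<le> j")
        case True
        then have "j + i - 1 < p \<or> q < j + i - 1" using that assms i by auto
        then show ?thesis using xG True by (simp add: y_def)
      qed (simp add: y_def)
      then show ?thesis by (simp add: G_def)
    qed
    moreover have "(\<Sum>j=p+1-i..q+1-i. c j * y j) = (\<Sum>k=p..q. ins_right i m c k * x k)"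
      unfolding sum using assms by (intro sum.cong) (auto simp: y_def)
    ultimately show "x \<in> ins_right i m ` hyperplane (p + 1 - i) (q + 1 - i) c"
      using x by (auto simp: hyperplane_def)
  qed
  show "ins_right i m ` hyperplane (p + 1 - i) (q + 1 - i) c \<subseteq> hyperplane p q (ins_right i m c)"
  proof clarify
    fix y assume y: "y \<in> hyperplane (p + 1 - i) (q + 1 - i) c"
    have "(\<Sum>k=p..q. ins_right i m c k * ins_right i m y k) = (\<Sum>j=p+1-i..q+1-i. c j * y j)"
      unfolding sum
    proof (intro sum.cong refl)
      fix j assume "j \<in> {p+1-i..q+1-i}"
      then have "i \<le> j + i - 1" "j + i - 1 < i + m - 1" "j + i - 1 + 1 - i = j" using assms i by auto
      then show "c j * ins_right i m y (j + i - 1) = c j * y j" by (simp add: ins_right_block)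
    qed
    moreover have "ins_right i m y k = 0" if "k \<notin> {p..<Suc q}" for k
    proof (cases "i \<le> k \<and> k < i + m - 1")
      case True
      then have "k + 1 - i \<notin> {p + 1 - i..<Suc (q + 1 - i)}" using that assms by auto
      then show ?thesis using y True by (simp add: ins_right_block hyperplane_def G_def)
    next
      case False
      then show ?thesis by (rule ins_right_not_block)
    qed
    then have "ins_right i m y \<in> G p (Suc q)" by (simp add: G_def)
    ultimately show "ins_right i m y \<in> hyperplane p q (ins_right i m c)" using y by (simp add: hyperplane_def)
  qed
qed

text \<open>A covector that vanishes on the block imposes no condition there, so the block
  coordinates in \<open>{p..q}\<close> split off as a free summand. In the numbering of the inserted
  arity they run from \<open>max p i + 1 - i\<close> to \<open>min q (i + m - 2) + 1 - i\<close>;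
  the second argument of \<open>G\<close> is one larger. This single formula is behind most cases of
  \<open>brick_comp\<close>.\<close>

lemma hyperplane_ins_left:
  assumes pq: "p \<le> q" "\<not> (i \<le> p \<and> q < i + m - 1)"
  shows "hyperplane p q (ins_left i m c) = ins_sum i m (hyperplane (lower i m p) (upper i m q) c)
    (G (max p i + 1 - i) (min (Suc q) (i + m - 1) + 1 - i))"
proof
  have sum: "(\<Sum>k=p..q. ins_left i m c k * x k) = (\<Sum>j=lower i m p..upper i m q. c j * x (expand i m j))" for x
    by (subst sum_collapse[OF i(1) m pq]) (simp_all add: ins_left_block ins_left_expand)
  let ?G = "G (max p i + 1 - i) (min (Suc q) (i + m - 1) + 1 - i)"
  show "hyperplane p q (ins_left i m c) \<subseteq> ins_sum i m (hyperplane (lower i m p) (upper i m q) c) ?G"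
  proof
    fix x assume x: "x \<in> hyperplane p q (ins_left i m c)"
    then have xG: "x k = 0" if "\<not> (p \<le> k \<and> k \<le> q)" for k using that by (auto simp: hyperplane_def G_def)
    define y where "y = (\<lambda>j. x (expand i m j))"
    define z where "z = (\<lambda>j. if 1 \<le> j \<and> j < m then x (j + i - 1) else 0)"
    have "x = (\<lambda>k. ins_left i m y k + ins_right i m z k)"
      using m i by (auto simp: fun_eq_iff ins_left_def ins_right_def y_def z_def expand_def)
    moreover have "y \<in> hyperplane (lower i m p) (upper i m q) c"
    proof -
      have "y j = 0" if "j \<notin> {lower i m p..<Suc (upper i m q)}" for j
        unfolding y_def
        by (rule xG) (use that pq m i in \<open>auto simp: lower_def upper_def expand_def split: if_splits\<close>)
      moreover have "(\<Sum>j=lower i m p..upper i m q. c j * y j) = 0"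
        using x unfolding y_def sum[symmetric] by (simp add: hyperplane_def)
      ultimately show ?thesis by (auto simp: hyperplane_def G_def)
    qed
    moreover have "z \<in> ?G"
    proof -
      have "z j = 0" if "j \<notin> {max p i + 1 - i..<min (Suc q) (i + m - 1) + 1 - i}" for j
      proof (cases "1 \<le> j \<and> j < m")
        case True
        then have "\<not> (p \<le> j + i - 1 \<and> j + i - 1 \<le> q)" using that i by auto
        then show ?thesis using xG True by (simp add: z_def)
      qed (auto simp: z_def)
      then show ?thesis by (simp add: G_def)
    qed
    ultimately show "x \<in> ins_sum i m (hyperplane (lower i m p) (upper i m q) c) ?G"
      unfolding ins_sum_def by blast
  qed
  show "ins_sum i m (hyperplane (lower i m p) (upper i m q) c) ?G \<subseteq> hyperplane p q (ins_left i m c)"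
  proof
    fix x assume "x \<in> ins_sum i m (hyperplane (lower i m p) (upper i m q) c) ?G"
    then obtain y z where x: "x = (\<lambda>k. ins_left i m y k + ins_right i m z k)"
      and y: "y \<in> hyperplane (lower i m p) (upper i m q) c" and z: "z \<in> ?G" unfolding ins_sum_def by blast
    have x_expand: "x (expand i m j) = y j" for j
      unfolding x ins_left_expand ins_right_not_block[OF expand_not_block[OF m]] by simp
    have "(\<Sum>k=p..q. ins_left i m c k * x k) = 0"
      unfolding sum x_expand using y by (simp add: hyperplane_def)
    moreover have "x k = 0" if k: "k \<notin> {p..<Suc q}" for k
    proof (cases "i \<le> k \<and> k < i + m - 1")
      case True
      then have "k + 1 - i \<notin> {max p i + 1 - i..<min (Suc q) (i + m - 1) + 1 - i}" using k by auto
      then show ?thesis using True z by (simp add: x ins_left_block ins_right_block G_def)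
    next
      case False
      then have "lower i m k \<notin> {lower i m p..<Suc (upper i m q)}"
        using k pq m i by (auto simp: lower_def upper_def split: if_splits)
      then show ?thesis using False y
        unfolding x ins_left_not_block[OF False] ins_right_not_block[OF False] by (simp add: hyperplane_def G_def)
    qed
    ultimately show "x \<in> hyperplane p q (ins_left i m c)" by (simp add: hyperplane_def G_def)
  qed
qed

lemma ins_sum_empty_block:
  assumes "q < i \<or> i + m - 1 \<le> p" "p \<le> q"
  shows "ins_sum i m A (G (max p i + 1 - i) (min (Suc q) (i + m - 1) + 1 - i)) = ins_left i m ` A"
proof -
  have "G (max p i + 1 - i) (min (Suc q) (i + m - 1) + 1 - i) = {0}"
    using assms by (intro G_empty) auto
  moreover have "ins_right i m 0 = (\<lambda>k. 0)" by (simp add: ins_right_def fun_eq_iff)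
  ultimately show ?thesis by (auto simp: ins_sum_def)
qed

lemma ins_sum_zero: "ins_sum i m {0} B = ins_right i m ` B"
proof -
  have "ins_left i m 0 = (\<lambda>k. 0)" by (simp add: ins_left_def fun_eq_iff)
  then show ?thesis by (auto simp: ins_sum_def)
qed

end

text \<open>If dropping \<open>p\<close> does not change the covector, the larger hyperplane is the
  smaller one plus the coordinate line at \<open>p\<close>, and the whole norm is in
  \<open>lcoef\<close>.\<close>

lemma wvec_last_generic:
  assumes "covec_system n c" "ext_interval n p q" "p < q" "c (Suc p) q = c p q" "c p q p = 0"
  shows "wvec c p q = axis_vec p"
proof -
  interpret s: covec_system n c by fact
  have "lcoef c p q = 1"
    using s.norm_eq_1[OF assms(2)] assms(3-5) by (simp add: sum_atLeast_Suc lcoef_def)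
  then show ?thesis using assms(5) by (auto simp: wvec_def axis_vec_def fun_eq_iff)
qed

section \<open>Covectors and unit vectors of a composite\<close>

locale block_points = block +
  fixes \<mu> \<nu> :: "nat \<Rightarrow> nat \<Rightarrow> nat \<Rightarrow> real" and a b g h :: "nat \<Rightarrow> complex"
  assumes \<mu>: "\<mu> \<in> pos_systems (n - 1)" and \<nu>: "\<nu> \<in> pos_systems (m - 1)"
    and a: "a \<in> ({1..<n} \<rightarrow>\<^sub>E sphere 0 1)" and b: "b \<in> ({1..<m} \<rightarrow>\<^sub>E sphere 0 1)"
    and g: "g \<in> ({1..n} \<rightarrow>\<^sub>E sphere 0 1)" and h: "h \<in> ({1..m} \<rightarrow>\<^sub>E sphere 0 1)"
begin

definition "a' = fst (pcomp As_S1_semidirect_S1 n m i (a, g) (b, h))"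
definition "g' = snd (pcomp As_S1_semidirect_S1 n m i (a, g) (b, h))"

abbreviation "c \<equiv> covec_of n \<mu> a"
abbreviation "d \<equiv> covec_of m \<nu> b"
abbreviation "e \<equiv> covec_of (n + m - 1) (pos_comp n m i \<mu> \<nu>) a'"
abbreviation "\<gamma> \<equiv> g i"

lemma a'_eq: "a' = (\<lambda>k\<in>{1..<n + m - 1}. if k < i then a k
    else if k < i + m - 1 then \<gamma> * b (k + 1 - i) else a (k - (m - 1)))"
proof -
  have "k - i + 1 \<in> {1..<m}" "k - i + 1 = k + 1 - i" if "\<not> k < i" "k < i + m - 1" for k
    using that m by auto
  then show ?thesis
    by (auto simp: a'_def As_S1_semidirect_S1_def semidirect_S1_def As_S1_def diagonal_action_def fun_eq_iff restrict_def)
qed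

lemma g'_eq: "g' = (\<lambda>k\<in>{1..n + m - 1}. if k < i then g k
    else if k < i + m then \<gamma> * h (k + 1 - i) else g (k - (m - 1)))"
  by (auto simp: g'_def As_S1_semidirect_S1_def semidirect_S1_def As_S1_def fun_eq_iff Suc_diff_le)

lemma cmod_values:
  "k \<in> {1..<n} \<Longrightarrow> cmod (a k) = 1" "k \<in> {1..<m} \<Longrightarrow> cmod (b k) = 1"
  "k \<in> {1..n} \<Longrightarrow> cmod (g k) = 1" "k \<in> {1..m} \<Longrightarrow> cmod (h k) = 1"
  using a b g h by (auto simp: PiE_def Pi_def)

lemma \<gamma>: "\<gamma> * cnj \<gamma> = 1"
  using cmod_values(3)[of i] i by (intro unit_phase) simp

lemma a'_in: "a' \<in> ({1..<n + m - 1} \<rightarrow>\<^sub>E sphere 0 1)"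
  unfolding a'_eq
proof (rule restrict_PiE_iff[THEN iffD2], intro ballI)
  fix k assume k: "k \<in> {1..<n + m - 1}"
  have "cmod (if k < i then a k else if k < i + m - 1 then \<gamma> * b (k + 1 - i) else a (k - (m - 1))) = 1"
  proof -
    consider "k < i" | "\<not> k < i" "k < i + m - 1" | "\<not> k < i" "\<not> k < i + m - 1" by blast
    then show ?thesis
    proof cases
      case 1
      then have "k \<in> {1..<n}" using k i by auto
      from cmod_values(1)[OF this] show ?thesis using 1 by simp
    next
      case 2
      then have "k + 1 - i \<in> {1..<m}" by auto
      from cmod_values(2)[OF this] show ?thesis using 2 cmod_values(3)[of i] i by (simp only: if_False if_True norm_mult) simp
    next
      case 3
      then have "k - (m - 1) \<in> {1..<n}" using k i m by auto
      from cmod_values(1)[OF this] show ?thesis using 3 by (simp only: if_False)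
    qed
  qed
  then show "(if k < i then a k else if k < i + m - 1 then \<gamma> * b (k + 1 - i) else a (k - (m - 1))) \<in> sphere 0 1"
    by (simp only: mem_sphere_0)
qed

lemma g'_in: "g' \<in> ({1..n + m - 1} \<rightarrow>\<^sub>E sphere 0 1)"
  unfolding g'_eq
proof (rule restrict_PiE_iff[THEN iffD2], intro ballI)
  fix k assume k: "k \<in> {1..n + m - 1}"
  have "cmod (if k < i then g k else if k < i + m then \<gamma> * h (k + 1 - i) else g (k - (m - 1))) = 1"
  proof -
    consider "k < i" | "\<not> k < i" "k < i + m" | "\<not> k < i" "\<not> k < i + m" by blast
    then show ?thesis
    proof cases
      case 1
      then have "k \<in> {1..n}" using k i by auto
      from cmod_values(3)[OF this] show ?thesis using 1 by simp
    next
      case 2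
      then have "k + 1 - i \<in> {1..m}" by auto
      from cmod_values(4)[OF this] show ?thesis using 2 cmod_values(3)[of i] i by (simp only: if_False if_True norm_mult) simp
    next
      case 3
      then have "k - (m - 1) \<in> {1..n}" using k i m by auto
      from cmod_values(3)[OF this] show ?thesis using 3 by (simp only: if_False)
    qed
  qed
  then show "(if k < i then g k else if k < i + m then \<gamma> * h (k + 1 - i) else g (k - (m - 1))) \<in> sphere 0 1"
    by (simp only: mem_sphere_0)
qed

text \<open>Here the diagonal action in the semidirect product enters: the rotation
  \<open>g i\<close> multiplies all phases of the inserted point.\<close>

lemma ext_phase_block:
  "i \<le> k \<Longrightarrow> k < i + m - 1 \<Longrightarrow> ext_phase (n + m - 1) a' k = \<gamma> * ext_phase m b (k + 1 - i)"
  using i n m by (auto simp: ext_phase_def a'_eq)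

lemma ext_phase_not_block:
  "\<not> (i \<le> k \<and> k < i + m - 1) \<Longrightarrow> ext_phase (n + m - 1) a' k = ext_phase n a (lower i m k)"
  using i n m by (auto simp: ext_phase_def a'_eq lower_def)

lemma covec_inner:
  assumes pq: "i \<le> p" "p \<le> q" "q < i + m - 1"
  shows "e p q = ins_right i m (\<lambda>k. \<gamma> * d (p + 1 - i) (q + 1 - i) k)"
proof
  fix k
  have q: "q \<noteq> n + m - 1" "p \<noteq> 0" "q + 1 - i \<noteq> m" "p + 1 - i \<noteq> 0" "1 \<le> p" "q \<le> n + m - 2"
    using pq i n m by auto
  show "e p q k = ins_right i m (\<lambda>k. \<gamma> * d (p + 1 - i) (q + 1 - i) k) k"
  proof (cases "i \<le> k \<and> k < i + m - 1")
    case True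
    have "pos_comp n m i \<mu> \<nu> p q k = \<nu> (p + 1 - i) (q + 1 - i) (k + 1 - i)"
    proof (cases "p \<le> k \<and> k \<le> q")
      case True
      then show ?thesis using pq q by (simp add: pos_comp_def)
    next
      case False
      then have "\<not> (1 \<le> p + 1 - i \<and> p + 1 - i \<le> k + 1 - i \<and> k + 1 - i \<le> q + 1 - i \<and> q + 1 - i \<le> m - 1)"
        using \<open>i \<le> k \<and> k < i + m - 1\<close> pq by auto
      from pos_zero[OF \<nu> this] False show ?thesis by (auto simp: pos_comp_def)
    qed
    then show ?thesis
      using True q ext_phase_block[of k] by (simp add: covec_of_def ext_weight_def ins_right_block)
  next
    case False
    then have "pos_comp n m i \<mu> \<nu> p q k = 0" using pq by (auto simp: pos_comp_def)
    then show ?thesis unfolding ins_right_not_block[OF False]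
      using q by (simp add: covec_of_def ext_weight_def)
  qed
qed

text \<open>The boundary rows behave like the others, because \<open>lower\<close> fixes 0 and
  \<open>upper\<close> sends \<open>n + m - 1\<close> to \<open>n\<close>; the extended weights
  therefore collapse in the same way as the inner ones.\<close>

lemma covec_outer:
  assumes pq: "ext_interval (n + m - 1) p q" "\<not> (i \<le> p \<and> q < i + m - 1)"
  shows "e p q = ins_left i m (c (lower i m p) (upper i m q))"
proof
  fix k
  show "e p q k = ins_left i m (c (lower i m p) (upper i m q)) k"
  proof (cases "i \<le> k \<and> k < i + m - 1")
    case True
    have "ext_weight (n + m - 1) (pos_comp n m i \<mu> \<nu>) p q k = 0"
      using True pq(2) i n m by (auto simp: ext_weight_def pos_comp_def)
    then show ?thesis using True by (simp add: ins_left_block covec_of_def)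
  next
    case kB: False
    have "ext_weight (n + m - 1) (pos_comp n m i \<mu> \<nu>) p q k = ext_weight n \<mu> (lower i m p) (upper i m q) (lower i m k)"
    proof -
      consider "p = 0" | "p \<noteq> 0" "q = n + m - 1" | "p \<noteq> 0" "q \<noteq> n + m - 1" by blast
      then show ?thesis
      proof cases
        case 1
        then have "lower i m p = 0" "lower i m k = 0 \<longleftrightarrow> k = 0" using kB i m by (auto simp: lower_def)
        then show ?thesis using 1 by (simp add: ext_weight_def)
      next
        case 2
        then have "lower i m p \<noteq> 0" "upper i m q = n" "lower i m k = n \<longleftrightarrow> k = n + m - 1"
          using kB i m n by (auto simp: lower_def upper_def)
        then show ?thesis using 2 by (simp add: ext_weight_def)
      next
        case 3
        then have p: "1 \<le> p" "p \<le> q" "q \<le> n + m - 2" using pq by (auto simp: ext_interval_def)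
        note bd = collapse_bounds[OF p pq(2)]
        have "pos_comp n m i \<mu> \<nu> p q k = \<mu> (lower i m p) (upper i m q) (lower i m k)"
        proof (cases "p \<le> k \<and> k \<le> q")
          case True
          then show ?thesis using p pq(2) kB unfolding pos_comp_def by auto
        next
          case False
          then have "\<not> (1 \<le> lower i m p \<and> lower i m p \<le> lower i m k \<and> lower i m k \<le> upper i m q \<and> upper i m q \<le> n - 1)"
            using kB p pq(2) i m by (auto simp: lower_def upper_def split: if_splits)
          from pos_zero[OF \<mu> this] False show ?thesis by (auto simp: pos_comp_def)
        qed
        moreover have "lower i m p \<noteq> 0" "upper i m q \<noteq> n" using bd n by auto
        ultimately show ?thesis using 3 by (simp add: ext_weight_def)
      qed
    qed
    then show ?thesis
      unfolding ins_left_not_block[OF kB] covec_of_def ext_phase_not_block[OF kB] by (simp only:)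
  qed
qed

lemma systems:
  "covec_system n c" "covec_system m d" "covec_system (n + m - 1) e" "2 \<le> n + m - 1"
proof -
  show N: "2 \<le> n + m - 1" using n m by simp
  show "covec_system n c" "covec_system m d" "covec_system (n + m - 1) e"
    using covec_system_covec_of n m N \<mu> \<nu> a b a'_in phases_PiE pos_comp_in_pos_systems[OF \<mu> \<nu>] by auto
qed

text \<open>Neither of the two intervals lies in the block, so both covectors vanish there, and
  \<open>lcoef\<close> collapses to that of the outer point. As \<open>p\<close> is outside the
  block too, it remains the left end after the collapse.\<close>

lemma wvec_outer:
  assumes pq: "ext_interval (n + m - 1) p q" "p < q" "\<not> (i \<le> p \<and> p < i + m - 1)" "\<not> (i \<le> Suc p \<and> q < i + m - 1)"
  shows "wvec e p q = ins_left i m (wvec c (lower i m p) (upper i m q))"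
proof -
  have o: "ext_interval (n + m - 1) (Suc p) q" "\<not> (i \<le> p \<and> q < i + m - 1)"
    using pq by (auto simp: ext_interval_def)
  have S: "lower i m (Suc p) = Suc (lower i m p)" using pq(3) m by (auto simp: lower_def)
  note ep = covec_outer[OF pq(1) o(2)] and eS = covec_outer[OF o(1) pq(4), unfolded S]
  have lc: "lcoef e p q = lcoef c (lower i m p) (upper i m q)"
    unfolding lcoef_def ep eS
    by (subst sum_collapse[OF i(1) m _ pq(4)]) (use pq(2) in \<open>simp_all add: ins_left_block ins_left_expand S\<close>)
  show ?thesis
  proof
    fix k
    show "wvec e p q k = ins_left i m (wvec c (lower i m p) (upper i m q)) k"
    proof (cases "i \<le> k \<and> k < i + m - 1")
      case True
      then have "k \<noteq> p" using pq(3) by blast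
      then show ?thesis unfolding wvec_def eS using True by (simp add: ins_left_block)
    next
      case False
      have eq: "lower i m k = lower i m p \<longleftrightarrow> k = p"
        and lt: "lower i m p < lower i m k \<and> lower i m k \<le> upper i m q \<longleftrightarrow> p < k \<and> k \<le> q"
        using False pq m i by (auto simp: lower_def upper_def)
      show ?thesis
        unfolding ins_left_not_block[OF False] wvec_def eq lt lc
        unfolding ep eS ins_left_not_block[OF False] ins_left_not_block[OF pq(3)] ..
    qed
  qed
qed

text \<open>The interval starts just left of the block and ends in it, so \<open>e p q\<close> is
  concentrated at \<open>p\<close> with entry \<open>ext_phase n a (i - 1)\<close>, while the
  smaller covector is the inner one rotated by \<gamma>. By the sign in \<open>first\<close>,
  \<open>wvec d 0 _\<close> is the conjugate of the inner covector, and a scalar remains. This is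
  the only case in which \<open>wvec e\<close> acquires a scalar.\<close>

lemma wvec_first:
  assumes pq: "Suc p = i" "i \<le> q" "q < i + m - 1"
  shows "wvec e p q = (\<lambda>k. - ext_phase n a (i - 1) * cnj \<gamma> * ins_right i m (wvec d 0 (q + 1 - i)) k)"
proof -
  have ext: "ext_interval (n + m - 1) p q" and o: "\<not> (i \<le> p \<and> q < i + m - 1)"
    using pq n m i by (auto simp: ext_interval_def)
  have lu: "lower i m p = p" "upper i m q = p" using pq by (auto simp: lower_def upper_def)
  note ep = covec_outer[OF ext o, unfolded lu]
  have eS: "e (Suc p) q = ins_right i m (\<lambda>k. \<gamma> * d 1 (q + 1 - i) k)"
    using covec_inner[of "Suc p" q] pq by simp
  have p: "p = i - 1" "p \<noteq> n" "p < n" using pq i by auto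
  have pp: "c p p p = ext_phase n a (i - 1)"
    using pos_single[OF \<mu>, of p] p by (auto simp: covec_of_def ext_weight_def)
  have epp: "e p q p = ext_phase n a (i - 1)"
    unfolding ep using pq pp by (simp add: ins_left_def)
  have lc: "lcoef e p q = 0"
    unfolding lcoef_def ep using pq by (intro sum.neutral ballI) (auto simp: ins_left_block)
  have d0: "d 0 q' 0 = -1" for q' by (simp add: covec_of_def ext_weight_def ext_phase_def)
  show ?thesis
  proof
    fix k
    show "wvec e p q k = - ext_phase n a (i - 1) * cnj \<gamma> * ins_right i m (wvec d 0 (q + 1 - i)) k"
    proof (cases "i \<le> k \<and> k < i + m - 1")
      case True
      then have k: "k \<noteq> p" "p < k" "0 < k + 1 - i" "k \<le> q \<longleftrightarrow> k + 1 - i \<le> q + 1 - i" using pq by auto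
      show ?thesis
        unfolding wvec_def[of e] epp eS using True k
        by (simp add: ins_right_block) (simp add: wvec_def d0)
    next
      case False
      then have "wvec e p q k = 0" unfolding wvec_def lc using pq by auto
      then show ?thesis by (simp add: ins_right_not_block[OF False])
    qed
  qed
qed

text \<open>Every entry contains \<gamma> once and its conjugate once, so the rotation
  cancels.\<close>

lemma wvec_inner:
  assumes pq: "i \<le> p" "p < q" "q < i + m - 1"
  shows "wvec e p q = ins_right i m (wvec d (p + 1 - i) (q + 1 - i))"
proof -
  have ep: "e p q = ins_right i m (\<lambda>k. \<gamma> * d (p + 1 - i) (q + 1 - i) k)"
    using covec_inner[of p q] pq by simp
  have S: "Suc p + 1 - i = Suc (p + 1 - i)" using pq by simp
  have eS: "e (Suc p) q = ins_right i m (\<lambda>k. \<gamma> * d (Suc (p + 1 - i)) (q + 1 - i) k)"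
    using covec_inner[of "Suc p" q] pq unfolding S by simp
  have gg: "\<gamma> * x * cnj (\<gamma> * y) = x * cnj y" for x y
  proof -
    have "\<gamma> * x * cnj (\<gamma> * y) = (\<gamma> * cnj \<gamma>) * (x * cnj y)" by simp
    then show ?thesis unfolding \<gamma> by simp
  qed
  have lc: "lcoef e p q = lcoef d (p + 1 - i) (q + 1 - i)"
  proof -
    have "lcoef e p q = (\<Sum>k=Suc p..q. ins_right i m (\<lambda>k. d (p + 1 - i) (q + 1 - i) k * cnj (d (Suc (p + 1 - i)) (q + 1 - i) k)) k)"
      unfolding lcoef_def ep eS using pq by (intro sum.cong refl) (simp add: ins_right_block gg del: complex_cnj_mult)
    also have "\<dots> = (\<Sum>j=Suc p+1-i..q+1-i. ins_right i m (\<lambda>k. d (p + 1 - i) (q + 1 - i) k * cnj (d (Suc (p + 1 - i)) (q + 1 - i) k)) (j + i - 1))"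
      using pq i by (intro sum_shift_block) auto
    also have "\<dots> = lcoef d (p + 1 - i) (q + 1 - i)"
      unfolding lcoef_def S
    proof (intro sum.cong refl)
      fix j assume "j \<in> {Suc (p + 1 - i)..q + 1 - i}"
      then have "i \<le> j + i - 1" "j + i - 1 < i + m - 1" "j + i - 1 + 1 - i = j" using pq i by auto
      then show "ins_right i m (\<lambda>k. d (p + 1 - i) (q + 1 - i) k * cnj (d (Suc (p + 1 - i)) (q + 1 - i) k)) (j + i - 1) =
        d (p + 1 - i) (q + 1 - i) j * cnj (d (Suc (p + 1 - i)) (q + 1 - i) j)"
        by (simp add: ins_right_block)
    qed
    finally show ?thesis .
  qed
  show ?thesis
  proof
    fix k
    show "wvec e p q k = ins_right i m (wvec d (p + 1 - i) (q + 1 - i)) k"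
    proof (cases "i \<le> k \<and> k < i + m - 1")
      case True
      then have eq: "k = p \<longleftrightarrow> k + 1 - i = p + 1 - i"
        and lt: "p < k \<and> k \<le> q \<longleftrightarrow> p + 1 - i < k + 1 - i \<and> k + 1 - i \<le> q + 1 - i" using pq by auto
      have ppB: "i \<le> p" "p < i + m - 1" using pq by auto
      have gg': "- (\<gamma> * x) * cnj (\<gamma> * y) = - x * cnj y" for x y using gg[of x y] by simp
      show ?thesis
        unfolding ins_right_block[OF conjunct1[OF True] conjunct2[OF True]] wvec_def eq lt lc
        unfolding ep eS ins_right_block[OF conjunct1[OF True] conjunct2[OF True]] ins_right_block[OF ppB] gg' ..
    next
      case False
      then have "wvec e p q k = 0" using pq by (auto simp: wvec_def)
      then show ?thesis by (simp add: ins_right_not_block[OF False])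
    qed
  qed
qed

text \<open>\<open>p\<close> and \<open>Suc p\<close> both collapse to \<open>i\<close>, so dropping
  \<open>p\<close> does not change the covector.\<close>

lemma wvec_last:
  assumes pq: "ext_interval (n + m - 1) p q" "i \<le> p" "p < i + m - 1" "i + m - 1 \<le> q"
  shows "wvec e p q = axis_vec p"
proof -
  have o: "ext_interval (n + m - 1) (Suc p) q" "\<not> (i \<le> p \<and> q < i + m - 1)" "\<not> (i \<le> Suc p \<and> q < i + m - 1)"
    and S: "lower i m (Suc p) = lower i m p"
    using pq m by (auto simp: ext_interval_def lower_def)
  note ep = covec_outer[OF pq(1) o(2)]
  have "e (Suc p) q = e p q" unfolding ep covec_outer[OF o(1,3)] S ..
  moreover have "e p q p = 0" unfolding ep by (rule ins_left_block[OF pq(2,3)])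
  moreover have "p < q" using pq by simp
  ultimately show ?thesis by (intro wvec_last_generic[OF systems(3) pq(1)])
qed

lemma wvec_top:
  assumes "1 \<le> p" "p < m"
  shows "wvec d p m = axis_vec p"
  by (rule wvec_last_generic[OF systems(2)])
    (use assms covec_system.last[OF systems(2)] in \<open>auto simp: ext_interval_def axis_vec_def\<close>)

lemma ins_right_axis: "1 \<le> p \<Longrightarrow> p < m \<Longrightarrow> ins_right i m (axis_vec p) = axis_vec (p + i - 1)"
  using i by (auto simp: ins_right_def axis_vec_def fun_eq_iff)

text \<open>The case \<open>q = i + m - 1\<close> is the right boundary coordinate of the inserted
  arity. There the unit vectors of the composite and of the inserted point are both coordinate
  vectors.\<close>

lemma wvec_block:
  assumes pq: "i \<le> p" "p < q" "q \<le> i + m - 1"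
  shows "wvec e p q = ins_right i m (wvec d (p + 1 - i) (q + 1 - i))"
proof (cases "q < i + m - 1")
  case True
  then show ?thesis using wvec_inner pq by simp
next
  case False
  then have q: "q = i + m - 1" "q + 1 - i = m" using pq i by auto
  have "ext_interval (n + m - 1) p q" using pq q i n m by (auto simp: ext_interval_def)
  then have "wvec e p q = axis_vec p" using wvec_last[of p q] pq q by simp
  moreover have p: "1 \<le> p + 1 - i" "p + 1 - i < m" "p + 1 - i + i - 1 = p" using pq q by auto
  ultimately show ?thesis unfolding q(2) wvec_top[OF p(1,2)] ins_right_axis[OF p(1,2)] p(3) by simp
qed

end

section \<open>Bricks and normal directions of a composite\<close>

context block_points
begin

abbreviation "N \<equiv> n + m - 1"
abbreviation "M \<equiv> i + m - 1"

lemma proper_interval_pred: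
  "proper_interval k x y \<Longrightarrow> ext_interval k (x - 1) y \<and> 0 < x \<and> x \<le> y \<and> y \<le> k"
  by (auto simp: proper_interval_def ext_interval_def)

lemma brick_of_outer:
  assumes xy: "proper_interval N x y" "\<not> (i < x \<and> y < M)"
  shows "brick_of N e x y = ins_sum i m (hyperplane (lower i m (x - 1)) (upper i m y) (c (lower i m (x - 1)) (upper i m y)))
    (G (max (x - 1) i + 1 - i) (min (Suc y) M + 1 - i))"
proof -
  have ext: "ext_interval N (x - 1) y" and x: "0 < x" "x \<le> y" using proper_interval_pred[OF xy(1)] by auto
  have o: "\<not> (i \<le> x - 1 \<and> y < M)" using xy(2) x by auto
  show ?thesis unfolding brick_of_def if_P[OF xy(1)] covec_outer[OF ext o]
    using x o by (intro hyperplane_ins_left) auto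
qed

lemma brick_of_hyperplane: "0 < x \<Longrightarrow> ext_interval n (x - 1) y \<Longrightarrow> hyperplane (x - 1) y (c (x - 1) y) = brick_of n c x y"
  using covec_system.brick_of_eq[OF systems(1)] by simp

text \<open>The position of \<open>x\<close> and \<open>y\<close> relative to the block selects the
  case of \<open>brick_comp\<close>. In each case \<open>lower\<close>, \<open>upper\<close> and the
  free summand of \<open>hyperplane_ins_left\<close> are evaluated for the coordinate interval
  \<open>{x - 1..y}\<close>, which carries the subspace with indices \<open>x\<close> and
  \<open>y\<close>.\<close>

lemma brick_of_comp: "brick_of N e = brick_comp n m i (brick_of n c) (brick_of m d)"
proof (intro ext)
  fix x y
  show "brick_of N e x y = brick_comp n m i (brick_of n c) (brick_of m d) x y"
  proof (cases "proper_interval N x y")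
    case False
    then show ?thesis by (simp add: brick_of_def brick_comp_def Let_def)
  next
    case xy: True
    have x: "0 < x" "x \<le> y" "y \<le> N" and ext: "ext_interval N (x - 1) y" using proper_interval_pred[OF xy] by auto
    have xyN: "x \<noteq> 1 \<or> y \<noteq> N" using xy by (auto simp: proper_interval_def)
    have single: "hyperplane k k (c k k) = {0}" if "k \<le> n" for k
      using that n by (intro hyperplane_single covec_system.unit[OF systems(1)]) (auto simp: ext_interval_def)
    have comp: "brick_comp n m i (brick_of n c) (brick_of m d) x y =
       (if y < i then ins_left i m ` brick_of n c x y
        else if M < x then ins_left i m ` brick_of n c (x - (m - 1)) (y - (m - 1))
        else if x = i \<and> y = M then ins_sum i m (brick_of n c i i) (G 1 m)
        else if i \<le> x \<and> y \<le> M then ins_right i m ` brick_of m d (x - i + 1) (y - i + 1)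
        else if x < i \<and> y < M then ins_sum i m (brick_of n c x (i - 1)) (G 1 (y - i + 1 + 1))
        else if i < x then ins_sum i m (brick_of n c (i + 1) (y - (m - 1))) (G (x - i + 1 - 1) m)
        else if x < i \<and> y = M then ins_sum i m (brick_of n c x i) (G 1 m)
        else if x = i then ins_sum i m (brick_of n c i (y - (m - 1))) (G 1 m)
        else ins_sum i m (brick_of n c x (y - (m - 1))) (G 1 m))"
      unfolding brick_comp_def Let_def by (rule if_not_P) (use xy in blast)
    have "x < i \<or> x = i \<or> i < x \<and> x \<le> M \<or> M < x" "y < i \<or> i \<le> y \<and> y < M \<or> y = M \<or> M < y"
      by linarith+
    then consider (below) "y < i" | (above) "M < x" | (node) "x = i" "y = M"
      | (left) "x = i" "i \<le> y" "y < M" | (right) "i < x" "x \<le> M" "y = M" | (inner) "i < x" "y < M"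
      | (crossl) "x < i" "i \<le> y" "y < M" | (crossr) "i < x" "x \<le> M" "M < y"
      | (ends) "x < i" "y = M" | (starts) "x = i" "M < y" | (over) "x < i" "M < y"
      by blast
    then show ?thesis
    proof cases
      case below
      have o: "\<not> (i < x \<and> y < M)" and e: "ext_interval n (x - 1) y" using below x i by (auto simp: ext_interval_def)
      have lu: "lower i m (x - 1) = x - 1" "upper i m y = y" using below x by (auto simp: lower_def upper_def)
      show ?thesis
        unfolding brick_of_outer[OF xy o] lu brick_of_hyperplane[OF x(1) e] comp if_P[OF below]
        using below x by (intro ins_sum_empty_block) auto
    next
      case above
      have o: "\<not> (i < x \<and> y < M)" and e: "ext_interval n (x - (m - 1) - 1) (y - (m - 1))" "0 < x - (m - 1)"
        using above x i xyN m by (auto simp: ext_interval_def)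
      have lu: "lower i m (x - 1) = x - (m - 1) - 1" "upper i m y = y - (m - 1)"
        using above x i by (auto simp: lower_def upper_def)
      have "\<not> y < i" using above x m by auto
      then show ?thesis
        unfolding brick_of_outer[OF xy o] lu brick_of_hyperplane[OF e(2,1)] comp if_P[OF above]
        using above x by (simp only: if_False) (intro ins_sum_empty_block, auto)
    next
      case node
      have o: "\<not> (i < x \<and> y < M)" and e: "ext_interval n (i - 1) i" "0 < i" using node i n by (auto simp: ext_interval_def)
      have lu: "lower i m (x - 1) = i - 1" "upper i m y = i" using node x m by (auto simp: lower_def upper_def)
      have G: "max (x - 1) i + 1 - i = 1" "min (Suc y) M + 1 - i = m" using node i by auto
      have "\<not> y < i" "\<not> M < x" using node m by auto
      then show ?thesis
        unfolding brick_of_outer[OF xy o] lu brick_of_hyperplane[OF e(2,1)] G comp using node by simp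
    next
      \<comment> \<open>The collapsed interval is the single coordinate \<open>i - 1\<close> and
        contributes zero. Only the free summand remains, and it is the prescribed first subspace of
        the inserted brick.\<close>
      case left
      have o: "\<not> (i < x \<and> y < M)" using left by auto
      have lu: "lower i m (x - 1) = i - 1" "upper i m y = i - 1" using left x m by (auto simp: lower_def upper_def)
      have G: "max (x - 1) i + 1 - i = 1" "min (Suc y) M + 1 - i = y - i + 1 + 1" and loc: "x - i + 1 = 1"
        using left i by auto
      have "proper_interval m 1 (y - i + 1)" using left i m by (auto simp: proper_interval_def)
      from covec_system.brick_of_first[OF systems(2) this]
      have d1: "brick_of m d 1 (y - i + 1) = G 1 (y - i + 1 + 1)" .
      have "i - 1 \<le> n" "\<not> y < i" "\<not> M < x" "\<not> (x = i \<and> y = M)" "i \<le> x \<and> y \<le> M" using left m i by auto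
      then show ?thesis
        unfolding brick_of_outer[OF xy o] lu single[OF \<open>i - 1 \<le> n\<close>] G comp ins_sum_zero loc d1 by (simp only: if_True if_False simp_thms)
    next
      case right
      have o: "\<not> (i < x \<and> y < M)" using right by auto
      have lu: "lower i m (x - 1) = i" "upper i m y = i" using right x m by (auto simp: lower_def upper_def)
      have G: "max (x - 1) i + 1 - i = x - i + 1 - 1" "min (Suc y) M + 1 - i = m" and loc: "y - i + 1 = m"
        using right i m by auto
      have "proper_interval m (x - i + 1) m" using right i m by (auto simp: proper_interval_def)
      from covec_system.brick_of_last[OF systems(2) this]
      have d1: "brick_of m d (x - i + 1) m = G (x - i + 1 - 1) m" .
      have "\<not> y < i" "\<not> M < x" "\<not> (x = i \<and> y = M)" "i \<le> x \<and> y \<le> M" using right m i by auto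
      then show ?thesis
        unfolding brick_of_outer[OF xy o] lu single[OF i(2)] G comp ins_sum_zero loc d1 by (simp only: if_True if_False simp_thms)
    next
      case inner
      have b: "i \<le> x - 1" "x - 1 \<le> y" "x - 1 + 1 - i = x - i + 1 - 1" "y + 1 - i = y - i + 1" using inner x by auto
      have e: "ext_interval m (x - i + 1 - 1) (y - i + 1)" "0 < x - i + 1" using inner x i m by (auto simp: ext_interval_def)
      \<comment> \<open>The rotation of the inner covector is a non-zero scalar and does not affect
        the hyperplane.\<close>
      have g0: "\<gamma> \<noteq> 0" using \<gamma> by auto
      have "\<not> y < i" "\<not> M < x" "\<not> (x = i \<and> y = M)" "i \<le> x \<and> y \<le> M" using inner x by auto
      then show ?thesis
        unfolding brick_of_def[of N] if_P[OF xy] covec_inner[OF b(1,2) inner(2)] hyperplane_ins_right[OF b(1,2) inner(2)]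
          hyperplane_scale[OF g0] comp covec_system.brick_of_eq[OF systems(2) e] b(3,4)
        by (simp only: if_True if_False simp_thms)
    next
      case crossl
      have o: "\<not> (i < x \<and> y < M)" and e: "ext_interval n (x - 1) (i - 1)" using crossl x i by (auto simp: ext_interval_def)
      have lu: "lower i m (x - 1) = x - 1" "upper i m y = i - 1" using crossl x by (auto simp: lower_def upper_def)
      have G: "max (x - 1) i + 1 - i = 1" "min (Suc y) M + 1 - i = y - i + 1 + 1" using crossl by auto
      have "\<not> y < i" "\<not> M < x" "\<not> (x = i \<and> y = M)" "\<not> (i \<le> x \<and> y \<le> M)" "x < i \<and> y < M" using crossl by auto
      then show ?thesis
        unfolding brick_of_outer[OF xy o] lu brick_of_hyperplane[OF x(1) e] G comp by (simp only: if_True if_False simp_thms)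
    next
      case crossr
      have o: "\<not> (i < x \<and> y < M)" and e: "ext_interval n (i + 1 - 1) (y - (m - 1))" "0 < i + 1"
        using crossr x i by (auto simp: ext_interval_def)
      have lu: "lower i m (x - 1) = i + 1 - 1" "upper i m y = y - (m - 1)" using crossr x by (auto simp: lower_def upper_def)
      have G: "max (x - 1) i + 1 - i = x - i + 1 - 1" "min (Suc y) M + 1 - i = m" using crossr i by auto
      have "\<not> y < i" "\<not> M < x" "\<not> (x = i \<and> y = M)" "\<not> (i \<le> x \<and> y \<le> M)" "\<not> (x < i \<and> y < M)" using crossr by auto
      then show ?thesis
        unfolding brick_of_outer[OF xy o] lu brick_of_hyperplane[OF e(2,1)] G comp
        using crossr(1) by (simp only: if_True if_False simp_thms)
    next
      case ends
      have o: "\<not> (i < x \<and> y < M)" and e: "ext_interval n (x - 1) i" using ends x i xyN by (auto simp: ext_interval_def)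
      have lu: "lower i m (x - 1) = x - 1" "upper i m y = i" using ends x m by (auto simp: lower_def upper_def)
      have G: "max (x - 1) i + 1 - i = 1" "min (Suc y) M + 1 - i = m" using ends i by auto
      have "\<not> y < i" "\<not> M < x" "\<not> (x = i \<and> y = M)" "\<not> (i \<le> x \<and> y \<le> M)" "\<not> (x < i \<and> y < M)" "\<not> i < x" "x < i \<and> y = M"
        using ends m by auto
      then show ?thesis
        unfolding brick_of_outer[OF xy o] lu brick_of_hyperplane[OF x(1) e] G comp by (simp only: if_True if_False simp_thms)
    next
      case starts
      have o: "\<not> (i < x \<and> y < M)" and e: "ext_interval n (i - 1) (y - (m - 1))" "0 < i"
        using starts x i xyN by (auto simp: ext_interval_def)
      have lu: "lower i m (x - 1) = i - 1" "upper i m y = y - (m - 1)" using starts x by (auto simp: lower_def upper_def)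
      have G: "max (x - 1) i + 1 - i = 1" "min (Suc y) M + 1 - i = m" using starts i by auto
      have "\<not> y < i" "\<not> M < x" "\<not> (x = i \<and> y = M)" "\<not> (i \<le> x \<and> y \<le> M)" "\<not> (x < i \<and> y < M)" "\<not> i < x" "\<not> (x < i \<and> y = M)"
        using starts m by auto
      then show ?thesis
        unfolding brick_of_outer[OF xy o] lu brick_of_hyperplane[OF e(2,1)] G comp
        using starts(1) by (simp only: if_True if_False simp_thms)
    next
      case over
      have o: "\<not> (i < x \<and> y < M)" and e: "ext_interval n (x - 1) (y - (m - 1))"
        using over x i xyN by (auto simp: ext_interval_def)
      have lu: "lower i m (x - 1) = x - 1" "upper i m y = y - (m - 1)" using over x by (auto simp: lower_def upper_def)
      have G: "max (x - 1) i + 1 - i = 1" "min (Suc y) M + 1 - i = m" using over i by auto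
      have "\<not> y < i" "\<not> M < x" "\<not> (x = i \<and> y = M)" "\<not> (i \<le> x \<and> y \<le> M)" "\<not> (x < i \<and> y < M)" "\<not> i < x" "\<not> (x < i \<and> y = M)" "x \<noteq> i"
        using over m by auto
      then show ?thesis
        unfolding brick_of_outer[OF xy o] lu brick_of_hyperplane[OF x(1) e] G comp by (simp only: if_True if_False simp_thms)
    qed
  qed
qed

lemma top_comp: "e 1 (N - 1) = ins_left i m (c 1 (n - 1))"
proof -
  have ext: "ext_interval N 1 (N - 1)" and o: "\<not> (i \<le> 1 \<and> N - 1 < M)"
    using n m i by (auto simp: ext_interval_def)
  have lu: "lower i m 1 = 1" "upper i m (N - 1) = n - 1" using n m i by (auto simp: lower_def upper_def)
  show ?thesis using covec_outer[OF ext o] unfolding lu .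
qed

lemma map_tensor_right: "map_tensor (ins_right i m) (\<lambda>x y. w x * cnj (w' y)) = (\<lambda>x y. ins_right i m w x * cnj (ins_right i m w' y))"
  by (auto simp: map_tensor_def ins_right_def fun_eq_iff)

lemma map_tensor_left: "map_tensor (ins_left i m) (\<lambda>x y. w x * cnj (w' y)) = (\<lambda>x y. ins_left i m w x * cnj (ins_left i m w' y))"
  by (auto simp: map_tensor_def ins_left_def fun_eq_iff)

lemma cmod_\<alpha>: "ext_phase n a k * cnj (ext_phase n a k) = 1"
  using cmod_ext_phase[OF phases_PiE[OF a]] by (rule unit_phase)

lemma scalar_mult_phases: "(\<lambda>x y. (- ext_phase n a k * cnj \<gamma> * w x) * cnj (- ext_phase n a k * cnj \<gamma> * w' y)) = (\<lambda>x y. w x * cnj (w' y))"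
proof (intro ext)
  fix x y
  have "(- ext_phase n a k * cnj \<gamma> * w x) * cnj (- ext_phase n a k * cnj \<gamma> * w' y) =
      (ext_phase n a k * cnj (ext_phase n a k)) * (\<gamma> * cnj \<gamma>) * (w x * cnj (w' y))" by simp
  then show "(- ext_phase n a k * cnj \<gamma> * w x) * cnj (- ext_phase n a k * cnj \<gamma> * w' y) = w x * cnj (w' y)"
    unfolding cmod_\<alpha> \<gamma> by simp
qed

text \<open>The second unit vector carries the scalar of \<open>wvec_first\<close>. Its conjugate is
  exactly the factor of \<open>wvec\<close> in the vector \<open>v i\<close> of
  \<open>realize\<close>; moving it to the left factor of the tensor turns the normalized direction
  into the one prescribed for the composition.\<close>

lemma normal_node:
  "(\<lambda>x y. wvec e (i - 1) M x * cnj (wvec e (i - 1) (M - 1) y)) =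
    tensor (ins_left i m (\<lambda>j. - cnj (ext_phase n a (i - 1)) * \<gamma> * wvec c (i - 1) i j)) (ins_right i m (d 1 (m - 1)))"
proof -
  have int: "ext_interval N (i - 1) M" and o: "i - 1 < M" "\<not> (i \<le> i - 1 \<and> i - 1 < M)" "\<not> (i \<le> Suc (i - 1) \<and> M < M)"
    using n m i by (auto simp: ext_interval_def)
  have lu: "lower i m (i - 1) = i - 1" "upper i m M = i" using i m by (auto simp: lower_def upper_def)
  note w1 = wvec_outer[OF int o, unfolded lu]
  have f: "Suc (i - 1) = i" "i \<le> M - 1" "M - 1 < i + m - 1" and Mi: "M - 1 + 1 - i = m - 1" using i m by auto
  note w2 = wvec_first[OF f, unfolded Mi]
  show ?thesis
  proof (intro ext)
    fix x y
    \<comment> \<open>Because \<open>first\<close> has the entry -1, conjugating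
      \<open>wvec d 0 (m - 1)\<close> gives the top functional of the inserted point.\<close>
    have r: "cnj (ins_right i m (wvec d 0 (m - 1)) y) = ins_right i m (d 1 (m - 1)) y"
    proof (cases "i \<le> y \<and> y < i + m - 1")
      case True
      then have "0 < y + 1 - i" "y + 1 - i \<le> m - 1" by auto
      moreover have "d 0 (m - 1) 0 = -1" by (simp add: covec_of_def ext_weight_def ext_phase_def)
      ultimately show ?thesis using True by (simp add: ins_right_block wvec_def)
    next
      case False
      then show ?thesis by (simp add: ins_right_not_block[OF False])
    qed
    have l: "ins_left i m (\<lambda>j. z * w j) x = z * ins_left i m w x" for z w by (simp add: ins_left_def)
    show "wvec e (i - 1) M x * cnj (wvec e (i - 1) (M - 1) y) =
      tensor (ins_left i m (\<lambda>j. - cnj (ext_phase n a (i - 1)) * \<gamma> * wvec c (i - 1) i j)) (ins_right i m (d 1 (m - 1))) x y"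
      unfolding w1 w2 tensor_def l complex_cnj_mult r by simp
  qed
qed

lemma divisor_index_bounds: "divisor_index k l r \<longleftrightarrow> 1 \<le> l \<and> l < r \<and> r \<le> k \<and> (l \<noteq> 1 \<or> r \<noteq> k)"
  by (auto simp: divisor_index_def)

text \<open>For \<open>l = i\<close> both unit vectors carry the same scalar of modulus one from
  \<open>wvec_first\<close>. It cancels, since the second vector enters conjugated.\<close>

lemma normal_right:
  assumes lr: "divisor_index N l r" "\<not> (l = i \<and> r = M)" "i \<le> l" "r \<le> M"
  shows "(\<lambda>x y. wvec e (l - 1) r x * cnj (wvec e (l - 1) (r - 1) y)) =
    map_tensor (ins_right i m) (\<lambda>x y. wvec d (l - i + 1 - 1) (r - i + 1) x * cnj (wvec d (l - i + 1 - 1) (r - i + 1 - 1) y))"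
proof (cases "l = i")
  case True
  have lt: "l < r" using lr by (simp add: divisor_index_bounds)
  have f: "Suc (l - 1) = i" "i \<le> r" "r < i + m - 1" "i \<le> r - 1" "r - 1 < i + m - 1"
    and eq: "r + 1 - i = r - i + 1" "r - 1 + 1 - i = r - i + 1 - 1" "l - i + 1 - 1 = 0" using True lt lr i by auto
  show ?thesis
    unfolding map_tensor_right wvec_first[OF f(1,2,3)] wvec_first[OF f(1,4,5)] scalar_mult_phases eq ..
next
  case False
  have lt: "l < r" using lr by (simp add: divisor_index_bounds)
  have f: "i \<le> l - 1" "l - 1 < r" "r \<le> i + m - 1" "l - 1 < r - 1" "r - 1 \<le> i + m - 1"
    and eq: "l - 1 + 1 - i = l - i + 1 - 1" "r + 1 - i = r - i + 1" "r - 1 + 1 - i = r - i + 1 - 1" using False lt lr by auto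
  show ?thesis
    unfolding map_tensor_right wvec_block[OF f(1,2,3)] wvec_block[OF f(1,4,5)] eq ..
qed

text \<open>\<open>red\<close> renumbers elements of the index set, while \<open>lower\<close> and
  \<open>upper\<close> renumber the coordinates between them. For pairs that come from the outer
  point the two agree after the shift from \<open>l\<close> to \<open>l - 1\<close>.\<close>

lemma normal_left:
  assumes lr: "divisor_index N l r" "\<not> (i \<le> l \<and> r \<le> M)" "l \<le> i \<or> M < l" "r < i \<or> M \<le> r"
  defines "red \<equiv> \<lambda>c. if c < i then c else if c \<le> M then i else c - (m - 1)"
  shows "(\<lambda>x y. wvec e (l - 1) r x * cnj (wvec e (l - 1) (r - 1) y)) =
      map_tensor (ins_left i m) (\<lambda>x y. wvec c (red l - 1) (red r) x * cnj (wvec c (red l - 1) (red r - 1) y))"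
    "divisor_index n (red l) (red r)"
proof -
  have b: "1 \<le> l" "l < r" "r \<le> N" "l \<noteq> 1 \<or> r \<noteq> N" using lr by (auto simp: divisor_index_bounds)
  show "divisor_index n (red l) (red r)"
    using b lr(2-4) n m i unfolding divisor_index_bounds red_def by (auto split: if_splits)
  have e1: "ext_interval N (l - 1) r" "l - 1 < r" "\<not> (i \<le> l - 1 \<and> l - 1 < i + m - 1)" "\<not> (i \<le> Suc (l - 1) \<and> r < i + m - 1)"
    using b lr(2-4) by (auto simp: ext_interval_def)
  have e2: "ext_interval N (l - 1) (r - 1)" "l - 1 < r - 1" "\<not> (i \<le> l - 1 \<and> l - 1 < i + m - 1)" "\<not> (i \<le> Suc (l - 1) \<and> r - 1 < i + m - 1)"
    using b lr(2-4) by (auto simp: ext_interval_def)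
  have lu: "lower i m (l - 1) = red l - 1" "upper i m r = red r" "upper i m (r - 1) = red r - 1"
    using b lr(2-4) m i unfolding lower_def upper_def red_def by auto
  show "(\<lambda>x y. wvec e (l - 1) r x * cnj (wvec e (l - 1) (r - 1) y)) =
      map_tensor (ins_left i m) (\<lambda>x y. wvec c (red l - 1) (red r) x * cnj (wvec c (red l - 1) (red r - 1) y))"
    unfolding map_tensor_left wvec_outer[OF e1] wvec_outer[OF e2] lu ..
qed

text \<open>One end of a crossing pair cuts the block. Dropping the block coordinate at this end
  does not change the covector, so one of the two coefficients in \<open>overlap_eq_0_iff\<close> is
  1.\<close>

lemma crossing_not_in_divisor:
  assumes lr: "divisor_index N l r" "\<not> (i \<le> l \<and> r \<le> M)" "\<not> ((l \<le> i \<or> M < l) \<and> (r < i \<or> M \<le> r))"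
  shows "brick_of N e \<notin> brick_divisor N l r"
proof -
  interpret E: covec_system N e by (rule systems(3))
  have b: "1 \<le> l" "l < r" "r \<le> N" "l \<noteq> 1 \<or> r \<noteq> N" using lr by (auto simp: divisor_index_bounds)
  have ext: "ext_interval N (l - 1) r" "Suc (l - 1) < r" and l: "Suc (l - 1) = l" using b by (auto simp: ext_interval_def)
  have "\<not> (lcoef e (l - 1) (r - 1) = 0 \<and> rcoef e (Suc (l - 1)) r = 0)"
  proof (cases "i < l \<and> l \<le> M")
    case True
    then have w: "ext_interval N (l - 1) (r - 1)" "i \<le> l - 1" "l - 1 < i + m - 1" "i + m - 1 \<le> r - 1"
      using b lr by (auto simp: ext_interval_def)
    have "lcoef e (l - 1) (r - 1) = wvec e (l - 1) (r - 1) (l - 1)" by (simp add: wvec_def)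
    also have "\<dots> = 1" unfolding wvec_last[OF w] by (simp add: axis_vec_def)
    finally show ?thesis by simp
  next
    case False
    then have r: "l < i" "i \<le> r" "r < M" using b lr by auto
    have e1: "ext_interval N l r" "ext_interval N l (r - 1)" and o: "\<not> (i \<le> l \<and> r < i + m - 1)" "\<not> (i \<le> l \<and> r - 1 < i + m - 1)"
      using b r n m i by (auto simp: ext_interval_def)
    have U: "upper i m (r - 1) = upper i m r" using r i by (auto simp: upper_def)
    have "e l r = e l (r - 1)" unfolding covec_outer[OF e1(1) o(1)] covec_outer[OF e1(2) o(2)] U ..
    then have "rcoef e l r = 1" using E.norm_eq_1[OF e1(2)] by (simp add: rcoef_def)
    then show ?thesis using l by simp
  qed
  then show ?thesis
    using E.in_divisor_iff[OF ext] E.overlap_eq_0_iff[OF ext] unfolding l by blast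
qed

end

context block_points
begin

text \<open>Directions that come from neither factor are determined by the brick, as the composite
  is off their divisors; the others are the normalized tensors computed above. For the vectors
  \<open>v\<close>, the twist in \<open>realize\<close> cancels the scalar of
  \<open>wvec_first\<close> at the first inserted input and the rotation of the phases at the
  remaining ones.\<close>

lemma realize_comp:
  "realize N (pos_comp n m i \<mu> \<nu>, a', g') = Z_comp n m i (realize n (\<mu>, a, g)) (realize m (\<nu>, b, h))"
proof -
  define u1 where "u1 = (\<lambda>l r x y. if divisor_index n l r then wvec c (l - 1) r x * cnj (wvec c (l - 1) (r - 1) y) else 0)"
  define u2 where "u2 = (\<lambda>l r x y. if divisor_index m l r then wvec d (l - 1) r x * cnj (wvec d (l - 1) (r - 1) y) else 0)"
  define u where "u = (\<lambda>l r x y. if divisor_index N l r then wvec e (l - 1) r x * cnj (wvec e (l - 1) (r - 1) y) else 0)"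
  define v1 where "v1 = (\<lambda>k. if k \<in> {1..n} then (\<lambda>j. - cnj (ext_phase n a (k - 1)) * g k * wvec c (k - 1) k j) else 0)"
  define v2 where "v2 = (\<lambda>k. if k \<in> {1..m} then (\<lambda>j. - cnj (ext_phase m b (k - 1)) * h k * wvec d (k - 1) k j) else 0)"
  define v where "v = (\<lambda>k. if k \<in> {1..N} then (\<lambda>j. - cnj (ext_phase N a' (k - 1)) * g' k * wvec e (k - 1) k j) else 0)"
  have r1: "realize n (\<mu>, a, g) = (brick_of n c, u1, v1, c 1 (n - 1))"
    and r2: "realize m (\<nu>, b, h) = (brick_of m d, u2, v2, d 1 (m - 1))"
    and r: "realize N (pos_comp n m i \<mu> \<nu>, a', g') = (brick_of N e, u, v, e 1 (N - 1))"
    unfolding realize_def Let_def prod.case u1_def u2_def u_def v1_def v2_def v_def by (rule refl)+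
  have topN: "(pos_comp n m i \<mu> \<nu>, a', g') \<in> topspace (model_space N)"
    using pos_comp_in_pos_systems[OF \<mu> \<nu>] a'_in g'_in by (simp add: topspace_model_space)
  \<comment> \<open>The left hand side is already known to be a point of the blow-up, so away from a
    divisor its direction is that of the section.\<close>
  from realize_in_Z_points[OF systems(4) topN]
  have sd: "u l r = section_direction (brick_of N e) l r"
    if "divisor_index N l r" "brick_of N e \<notin> brick_divisor N l r" for l r
    unfolding r Z_points_def using that by auto
  have u_eq: "u l r = (\<lambda>x y. wvec e (l - 1) r x * cnj (wvec e (l - 1) (r - 1) y))" if "divisor_index N l r" for l r
    using that by (simp add: u_def)
  define red where "red = (\<lambda>c. if c < i then c else if c \<le> M then i else c - (m - 1))"
  have Z: "Z_comp n m i (realize n (\<mu>, a, g)) (realize m (\<nu>, b, h)) =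
     (brick_of N e,
      \<lambda>l r. if \<not> divisor_index N l r then 0
        else if l = i \<and> r = M then tensor (ins_left i m (v1 i)) (ins_right i m (d 1 (m - 1)))
        else if i \<le> l \<and> r \<le> M then map_tensor (ins_right i m) (u2 (l - i + 1) (r - i + 1))
        else if (l \<le> i \<or> M < l) \<and> (r < i \<or> M \<le> r) then map_tensor (ins_left i m) (u1 (red l) (red r))
        else section_direction (brick_of N e) l r,
      \<lambda>k. if k < i then ins_left i m (v1 k)
        else if k \<le> M then ins_right i m (v2 (k - i + 1))
        else ins_left i m (v1 (k - (m - 1))),
      ins_left i m (c 1 (n - 1)))"
    unfolding r1 r2 Z_comp_def Let_def prod.case brick_of_comp red_def by (rule refl)
  have u_comp: "u l r = (if \<not> divisor_index N l r then 0
        else if l = i \<and> r = M then tensor (ins_left i m (v1 i)) (ins_right i m (d 1 (m - 1)))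
        else if i \<le> l \<and> r \<le> M then map_tensor (ins_right i m) (u2 (l - i + 1) (r - i + 1))
        else if (l \<le> i \<or> M < l) \<and> (r < i \<or> M \<le> r) then map_tensor (ins_left i m) (u1 (red l) (red r))
        else section_direction (brick_of N e) l r)" for l r
  proof (cases "divisor_index N l r")
    case False
    then show ?thesis by (simp add: u_def zero_cmat)
  next
    case lr: True
    consider "l = i \<and> r = M" | "\<not> (l = i \<and> r = M)" "i \<le> l \<and> r \<le> M"
      | "\<not> (i \<le> l \<and> r \<le> M)" "(l \<le> i \<or> M < l) \<and> (r < i \<or> M \<le> r)"
      | "\<not> (i \<le> l \<and> r \<le> M)" "\<not> ((l \<le> i \<or> M < l) \<and> (r < i \<or> M \<le> r))" by blast
    then show ?thesis
    proof cases
      case 1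
      have "v1 i = (\<lambda>j. - cnj (ext_phase n a (i - 1)) * \<gamma> * wvec c (i - 1) i j)" using i by (simp add: v1_def)
      with normal_node show ?thesis unfolding u_eq[OF lr] using 1 lr by simp
    next
      case 2
      have "l < r" using lr by (simp add: divisor_index_bounds)
      then have "divisor_index m (l - i + 1) (r - i + 1)"
        using 2 i by (auto simp: divisor_index_bounds)
      then have "u2 (l - i + 1) (r - i + 1) = (\<lambda>x y. wvec d (l - i + 1 - 1) (r - i + 1) x * cnj (wvec d (l - i + 1 - 1) (r - i + 1 - 1) y))"
        by (simp add: u2_def)
      with normal_right[OF lr 2(1)] 2 show ?thesis
        unfolding u_eq[OF lr] using lr by (simp only: not_True_eq_False if_False if_True simp_thms)
    next
      case 3
      note nl' = normal_left[OF lr 3(1) conjunct1[OF 3(2)] conjunct2[OF 3(2)]]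
      have nl: "(\<lambda>x y. wvec e (l - 1) r x * cnj (wvec e (l - 1) (r - 1) y)) =
          map_tensor (ins_left i m) (\<lambda>x y. wvec c (red l - 1) (red r) x * cnj (wvec c (red l - 1) (red r - 1) y))"
        "divisor_index n (red l) (red r)"
        using nl' by (simp_all only: red_def)
      have ne: "\<not> (l = i \<and> r = M)" using 3(1) by auto
      have "u1 (red l) (red r) = (\<lambda>x y. wvec c (red l - 1) (red r) x * cnj (wvec c (red l - 1) (red r - 1) y))"
        using nl(2) by (simp add: u1_def)
      then show ?thesis unfolding u_eq[OF lr] nl(1)
        using lr unfolding if_not_P[OF ne] if_not_P[OF 3(1)] if_P[OF 3(2)] by simp
    next
      case 4
      have ne: "\<not> (l = i \<and> r = M)" using 4(1) by auto
      show ?thesis unfolding sd[OF lr crossing_not_in_divisor[OF lr 4]]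
        unfolding if_not_P[OF ne] if_not_P[OF 4(1)] if_not_P[OF 4(2)] using lr by simp
    qed
  qed
  have l_scale: "ins_left i m (\<lambda>j. z * w j) = (\<lambda>j. z * ins_left i m w j)" for z w
    by (simp add: ins_left_def fun_eq_iff)
  have r_scale: "ins_right i m (\<lambda>j. z * w j) = (\<lambda>j. z * ins_right i m w j)" for z w
    by (simp add: ins_right_def fun_eq_iff)
  have v_comp: "v k = (if k < i then ins_left i m (v1 k)
        else if k \<le> M then ins_right i m (v2 (k - i + 1))
        else ins_left i m (v1 (k - (m - 1))))" for k
  proof (cases "k \<in> {1..N}")
    case False
    have "ins_left i m 0 = 0" by (simp add: ins_left_def fun_eq_iff)
    moreover have "v1 k = 0" if "k < i" using False that i n m by (auto simp: v1_def)
    moreover have "v1 (k - (m - 1)) = 0" "\<not> k \<le> M" if "\<not> k < i" using False that i n m by (auto simp: v1_def)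
    moreover have "v k = 0" unfolding v_def if_not_P[OF False] by (rule refl)
    ultimately show ?thesis by (cases "k < i") (simp_all only: if_True if_False simp_thms)
  next
    case kN: True
    have ext: "ext_interval N (k - 1) k" "k - 1 < k" using kN systems(4) by (auto simp: ext_interval_def)
    have vk: "v k = (\<lambda>j. - cnj (ext_phase N a' (k - 1)) * g' k * wvec e (k - 1) k j)" using kN by (simp add: v_def)
    consider (less) "k < i" | (first) "k = i" | (inner) "i < k" "k \<le> M" | (greater) "M < k" by linarith
    then show ?thesis
    proof cases
      case less
      have nb: "\<not> (i \<le> k - 1 \<and> k - 1 < i + m - 1)" "\<not> (i \<le> Suc (k - 1) \<and> k < i + m - 1)"
        and lu: "lower i m (k - 1) = k - 1" "upper i m k = k" using less kN by (auto simp: lower_def upper_def)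
      have "g' k = g k" "v1 k = (\<lambda>j. - cnj (ext_phase n a (k - 1)) * g k * wvec c (k - 1) k j)"
        using less kN i by (auto simp: g'_eq v1_def)
      then show ?thesis
        unfolding vk wvec_outer[OF ext nb] ext_phase_not_block[OF nb(1)] lu if_P[OF less] by (simp only: l_scale)
    next
      case first
      have f: "Suc (k - 1) = i" "i \<le> k" "k < i + m - 1" "k + 1 - i = 1" and nb: "\<not> (i \<le> k - 1 \<and> k - 1 < i + m - 1)"
        and lu: "lower i m (k - 1) = i - 1" using first i m by (auto simp: lower_def)
      have gk: "g' k = \<gamma> * h 1" using first kN m by (auto simp: g'_eq)
      have v2k: "v2 (k - i + 1) = (\<lambda>j. h 1 * wvec d 0 1 j)"
        using first m by (simp add: v2_def ext_phase_def)
      \<comment> \<open>The outer twist cancels the scalar of \<open>wvec_first\<close>. What is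
        left is the vector of the inserted point at its first input, where the twist is 1.\<close>
      have "- cnj (ext_phase n a (i - 1)) * (\<gamma> * h 1) * (- ext_phase n a (i - 1) * cnj \<gamma> * w) = h 1 * w" for w
      proof -
        have "- cnj (ext_phase n a (i - 1)) * (\<gamma> * h 1) * (- ext_phase n a (i - 1) * cnj \<gamma> * w) =
            (ext_phase n a (i - 1) * cnj (ext_phase n a (i - 1))) * (\<gamma> * cnj \<gamma>) * (h 1 * w)" by simp
        then show ?thesis unfolding cmod_\<alpha> \<gamma> by simp
      qed
      then have "v k = (\<lambda>j. h 1 * ins_right i m (wvec d 0 1) j)"
        unfolding vk wvec_first[OF f(1-3)] f(4) ext_phase_not_block[OF nb] lu gk by (simp only:)
      moreover have "\<not> k < i" "k \<le> M" using first m by auto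
      ultimately show ?thesis unfolding v2k r_scale by (simp only: if_True if_False)
    next
      case inner
      have f: "i \<le> k - 1" "k - 1 < k" "k \<le> i + m - 1" "k - 1 < i + m - 1" using inner kN m by auto
      have idx: "k - 1 + 1 - i = k - i + 1 - 1" "k + 1 - i = k - i + 1" using inner by auto
      have gk: "g' k = \<gamma> * h (k - i + 1)"
        using inner kN i m by (auto simp: g'_eq Suc_diff_le)
      have v2k: "v2 (k - i + 1) = (\<lambda>j. - cnj (ext_phase m b (k - i + 1 - 1)) * h (k - i + 1) * wvec d (k - i + 1 - 1) (k - i + 1) j)"
        using inner i m by (auto simp: v2_def)
      \<comment> \<open>The twist contains the rotated phase and hence the conjugate of \<gamma>,
        which cancels the factor \<gamma> in \<open>g' k\<close>.\<close>
      have "- cnj (\<gamma> * t) * (\<gamma> * s) * w = - cnj t * s * w" for t s w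
      proof -
        have "- cnj (\<gamma> * t) * (\<gamma> * s) * w = (\<gamma> * cnj \<gamma>) * (- cnj t * s * w)" by simp
        then show ?thesis unfolding \<gamma> by simp
      qed
      then have "v k = (\<lambda>j. - cnj (ext_phase m b (k - i + 1 - 1)) * h (k - i + 1) * ins_right i m (wvec d (k - i + 1 - 1) (k - i + 1)) j)"
        unfolding vk wvec_block[OF f(1-3)] ext_phase_block[OF f(1,4)] idx gk by (simp only:)
      moreover have "\<not> k < i" using inner by auto
      ultimately show ?thesis unfolding v2k r_scale using inner(2) by (simp only: if_True if_False)
    next
      case greater
      have nb: "\<not> (i \<le> k - 1 \<and> k - 1 < i + m - 1)" "\<not> (i \<le> Suc (k - 1) \<and> k < i + m - 1)"
        and lu: "lower i m (k - 1) = k - (m - 1) - 1" "upper i m k = k - (m - 1)" using greater kN m i by (auto simp: lower_def upper_def)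
      have "g' k = g (k - (m - 1))" "v1 (k - (m - 1)) = (\<lambda>j. - cnj (ext_phase n a (k - (m - 1) - 1)) * g (k - (m - 1)) * wvec c (k - (m - 1) - 1) (k - (m - 1)) j)"
        using greater kN i m by (auto simp: g'_eq v1_def)
      moreover have "\<not> k < i" "\<not> k \<le> M" using greater m by auto
      ultimately show ?thesis
        unfolding vk wvec_outer[OF ext nb] ext_phase_not_block[OF nb(1)] lu by (simp only: l_scale if_False)
    qed
  qed
  show ?thesis unfolding Z r top_comp u_comp[abs_def] v_comp[abs_def] ..
qed

end

section \<open>The operad identities for the semidirect product and for the families\<close>

lemma pcomp_semidirect:
  assumes "2 \<le> m" "1 \<le> i"
  shows "pcomp As_S1_semidirect_S1 n m i (a, g) (b, h) =
    (\<lambda>k\<in>{1..<n + m - 1}. if k < i then a k else if k < i + m - 1 then g i * b (k + 1 - i) else a (k - (m - 1)),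
     \<lambda>k\<in>{1..n + m - 1}. if k < i then g k else if k < i + m then g i * h (k + 1 - i) else g (k - (m - 1)))"
proof -
  have "k - i + 1 \<in> {1..<m}" "k - i + 1 = k + 1 - i" if "\<not> k < i" "k < i + m - 1" for k
    using that assms by auto
  then show ?thesis
    by (auto simp: As_S1_semidirect_S1_def semidirect_S1_def As_S1_def diagonal_action_def fun_eq_iff restrict_def Suc_diff_le)
qed

lemma semidirect_assoc:
  assumes l: "2 \<le> l" and m: "2 \<le> m" and n: "2 \<le> n" and i: "i \<in> {1..l}" and j: "j \<in> {1..m}"
  shows "pcomp As_S1_semidirect_S1 (l + m - 1) n (i + j - 1) (pcomp As_S1_semidirect_S1 l m i x y) z =
    pcomp As_S1_semidirect_S1 l (m + n - 1) i x (pcomp As_S1_semidirect_S1 m n j y z)"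
proof -
  obtain a g where x: "x = (a, g)" by (metis prod.exhaust)
  obtain b h where y: "y = (b, h)" by (metis prod.exhaust)
  obtain c f where z: "z = (c, f)" by (metis prod.exhaust)
  \<comment> \<open>Writing arities and positions as successors removes the truncated subtractions,
    so that comparing an index with the bounds of the blocks settles every coordinate.\<close>
  obtain l' where l': "l = Suc (Suc l')"
    using l by (intro that[of "l - 2"]) simp
  obtain m' where m': "m = Suc (Suc m')"
    using m by (intro that[of "m - 2"]) simp
  obtain n' where n': "n = Suc (Suc n')"
    using n by (intro that[of "n - 2"]) simp
  obtain i' where i': "i = Suc i'"
    using i i by (intro that[of "i - 1"]) auto
  obtain j' where j': "j = Suc j'"
    using j i by (intro that[of "j - 1"]) auto
  note nn = l' m' n' i' j'
  have b: "2 \<le> m + n - 1" "1 \<le> i" "1 \<le> j" "1 \<le> i + j - 1" using assms by auto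
  show ?thesis
    unfolding x y z pcomp_semidirect[OF m b(2)] pcomp_semidirect[OF n b(3)] pcomp_semidirect[OF n b(4)] pcomp_semidirect[OF b(1,2)]
    using i j unfolding nn
    by (auto simp: fun_eq_iff restrict_def not_less add_ac)
qed

lemma semidirect_commute:
  assumes l: "2 \<le> l" and m: "2 \<le> m" and n: "2 \<le> n" and i: "i \<in> {1..l}" and k: "k \<in> {i<..l}"
  shows "pcomp As_S1_semidirect_S1 (l + m - 1) n (k + m - 1) (pcomp As_S1_semidirect_S1 l m i x y) z =
    pcomp As_S1_semidirect_S1 (l + n - 1) m i (pcomp As_S1_semidirect_S1 l n k x z) y"
proof -
  obtain a g where x: "x = (a, g)" by (metis prod.exhaust)
  obtain b h where y: "y = (b, h)" by (metis prod.exhaust)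
  obtain c f where z: "z = (c, f)" by (metis prod.exhaust)
  obtain l' where l': "l = Suc (Suc l')"
    using l by (intro that[of "l - 2"]) simp
  obtain m' where m': "m = Suc (Suc m')"
    using m by (intro that[of "m - 2"]) simp
  obtain n' where n': "n = Suc (Suc n')"
    using n by (intro that[of "n - 2"]) simp
  obtain i' where i': "i = Suc i'"
    using i i by (intro that[of "i - 1"]) auto
  obtain k' where k': "k = Suc k'"
    using k i by (intro that[of "k - 1"]) auto
  note nn = l' m' n' i' k'
  have b: "1 \<le> i" "1 \<le> k" "1 \<le> k + m - 1" using assms by auto
  show ?thesis
    unfolding x y z pcomp_semidirect[OF m b(1)] pcomp_semidirect[OF n b(2)] pcomp_semidirect[OF n b(3)]
    using i k unfolding nn
    by (auto simp: fun_eq_iff restrict_def not_less add_ac)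
qed

lemma arg_cong3: "a = a' \<Longrightarrow> b = b' \<Longrightarrow> c = c' \<Longrightarrow> f a b c = f a' b' c'"
  by simp

lemma
  shows pos_comp_outside: "\<not> (1 \<le> p \<and> p \<le> k \<and> k \<le> q \<and> q \<le> n + m - 2) \<Longrightarrow> pos_comp n m i \<mu> \<nu> p q k = 0"
    and pos_comp_inner: "1 \<le> p \<and> p \<le> k \<and> k \<le> q \<and> q \<le> n + m - 2 \<Longrightarrow> i \<le> p \<and> q < i + m - 1 \<Longrightarrow>
      pos_comp n m i \<mu> \<nu> p q k = \<nu> (p + 1 - i) (q + 1 - i) (k + 1 - i)"
    and pos_comp_block: "1 \<le> p \<and> p \<le> k \<and> k \<le> q \<and> q \<le> n + m - 2 \<Longrightarrow> \<not> (i \<le> p \<and> q < i + m - 1) \<Longrightarrow>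
      i \<le> k \<and> k < i + m - 1 \<Longrightarrow> pos_comp n m i \<mu> \<nu> p q k = 0"
    and pos_comp_collapse: "1 \<le> p \<and> p \<le> k \<and> k \<le> q \<and> q \<le> n + m - 2 \<Longrightarrow> \<not> (i \<le> p \<and> q < i + m - 1) \<Longrightarrow>
      \<not> (i \<le> k \<and> k < i + m - 1) \<Longrightarrow> pos_comp n m i \<mu> \<nu> p q k = \<mu> (lower i m p) (upper i m q) (lower i m k)"
  unfolding pos_comp_def by (simp_all only: if_True if_False simp_thms)

context
  fixes i j m n :: nat assumes ij: "1 \<le> i" "1 \<le> j" and n: "2 \<le> n"
begin

lemma lower_shift: "i \<le> p \<Longrightarrow> lower (i + j - 1) n p + 1 - i = lower j n (p + 1 - i)"
  using ij n by (cases "p < i + j - 1"; cases "p < i + j - 1 + n - 1") (auto simp: lower_def)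

lemma upper_shift: "i \<le> q \<Longrightarrow> upper (i + j - 1) n q + 1 - i = upper j n (q + 1 - i)"
  using ij n by (cases "q < i + j - 1"; cases "q < i + j - 1 + n - 1") (auto simp: upper_def)

text \<open>Collapsing the inner block and then the rest of the surrounding block amounts to
  collapsing the large block of \<open>m + n - 2\<close> coordinates at once.\<close>

lemma lower_lower: "j \<le> m \<Longrightarrow> lower i m (lower (i + j - 1) n p) = lower i (m + n - 1) p"
  using ij n by (cases "p < i + j - 1"; cases "p < i + j - 1 + n - 1") (auto simp: lower_def)

lemma upper_upper: "j \<le> m \<Longrightarrow> upper i m (upper (i + j - 1) n q) = upper i (m + n - 1) q"
  using ij n by (cases "q < i + j - 1"; cases "q < i + j - 1 + n - 1") (auto simp: upper_def)

end

text \<open>Disjoint blocks collapse independently. The right block is at \<open>j + m - 1\<close>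
  before the left one is collapsed and at \<open>j\<close> afterwards.\<close>

lemma lower_commute: "2 \<le> m \<Longrightarrow> 2 \<le> n \<Longrightarrow> i < j \<Longrightarrow> lower i m (lower (j + m - 1) n p) = lower j n (lower i m p)"
  by (cases "p < i"; cases "p < i + m - 1"; cases "p < j + m - 1"; cases "p < j + m - 1 + n - 1") (auto simp: lower_def add_ac)

lemma upper_commute: "2 \<le> m \<Longrightarrow> 2 \<le> n \<Longrightarrow> 1 \<le> i \<Longrightarrow> i < j \<Longrightarrow> upper i m (upper (j + m - 1) n q) = upper j n (upper i m q)"
  by (cases "q < i"; cases "q < i + m - 1"; cases "q < j + m - 1"; cases "q < j + m - 1 + n - 1") (auto simp: upper_def add_ac)

text \<open>The blocks are nested: \<open>z\<close> occupies the block at \<open>e\<close> inside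
  the one occupied by the composite of \<open>y\<close> and \<open>z\<close>. The smallest block
  that contains the interval decides which family is evaluated, and on both sides the coordinates of
  a block not containing the interval have weight zero.\<close>

lemma pos_comp_assoc:
  assumes l: "2 \<le> l" and m: "2 \<le> m" and n: "2 \<le> n" and i: "i \<in> {1..l}" and j: "j \<in> {1..m}"
  shows "pos_comp (l + m - 1) n (i + j - 1) (pos_comp l m i x y) z =
    pos_comp l (m + n - 1) i x (pos_comp m n j y z)"
proof (intro ext)
  fix p q k
  define e where "e = i + j - 1"
  have e: "i \<le> e" "e < i + m" "e + 1 = i + j" "1 \<le> e" using i j by (auto simp: e_def)
  let ?R = "1 \<le> p \<and> p \<le> k \<and> k \<le> q \<and> q \<le> l + m - 1 + n - 2"
  have R': "?R \<longleftrightarrow> 1 \<le> p \<and> p \<le> k \<and> k \<le> q \<and> q \<le> l + (m + n - 1) - 2" using l m n by auto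
  let ?I = "e \<le> p \<and> q < e + n - 1" and ?O = "i \<le> p \<and> q < i + (m + n - 1) - 1"
  let ?L = "pos_comp (l + m - 1) n e (pos_comp l m i x y) z p q k"
    and ?S = "pos_comp l (m + n - 1) i x (pos_comp m n j y z) p q k"
  have "?L = ?S"
  proof (cases ?R)
    case False
    then show ?thesis using R' by (metis pos_comp_outside)
  next
    case R: True
    note R2 = R[unfolded R']
    consider ?I | "\<not> ?I" "e \<le> k \<and> k < e + n - 1" | "\<not> ?I" "\<not> (e \<le> k \<and> k < e + n - 1)" by blast
    then show ?thesis
    proof cases
      case 1
      have "?L = z (p + 1 - e) (q + 1 - e) (k + 1 - e)" by (rule pos_comp_inner[OF R 1])
      also have "\<dots> = z (p + 1 - i + 1 - j) (q + 1 - i + 1 - j) (k + 1 - i + 1 - j)"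
        using 1 R e by (intro arg_cong3[where f = z]) auto
      also have "\<dots> = pos_comp m n j y z (p + 1 - i) (q + 1 - i) (k + 1 - i)"
        by (rule pos_comp_inner[symmetric]) (use 1 R e m n i j in auto)
      also have "\<dots> = ?S"
        by (rule pos_comp_inner[symmetric, OF R2]) (use 1 R e m n i j in auto)
      finally show ?thesis .
    next
      case 2
      have L: "?L = 0" by (rule pos_comp_block[OF R 2])
      show ?thesis
      proof (cases ?O)
        case O: True
        have "?S = pos_comp m n j y z (p + 1 - i) (q + 1 - i) (k + 1 - i)" by (rule pos_comp_inner[OF R2 O])
        also have "\<dots> = 0" by (rule pos_comp_block) (use O 2 R e m n i j in auto)
        finally show ?thesis using L by simp
      next
        case False
        have "?S = 0" by (rule pos_comp_block[OF R2 False]) (use 2 R e m n i j in auto)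
        then show ?thesis using L by simp
      qed
    next
      case 3
      let ?p = "lower e n p" and ?q = "upper e n q" and ?k = "lower e n k"
      have L: "?L = pos_comp l m i x y ?p ?q ?k" by (rule pos_comp_collapse[OF R 3])
      have R3: "1 \<le> ?p \<and> ?p \<le> ?k \<and> ?k \<le> ?q \<and> ?q \<le> l + m - 2"
        using R 3 e n i j m l by (auto simp: lower_def upper_def)
      show ?thesis
      proof (cases ?O)
        case O: True
        have "pos_comp l m i x y ?p ?q ?k = y (?p + 1 - i) (?q + 1 - i) (?k + 1 - i)"
          by (rule pos_comp_inner[OF R3]) (use O R 3 e n m j in \<open>auto simp: lower_def upper_def\<close>)
        also have "\<dots> = y (lower j n (p + 1 - i)) (upper j n (q + 1 - i)) (lower j n (k + 1 - i))"
          unfolding e_def using lower_shift[OF _ _ n, of i j] upper_shift[OF _ _ n, of i j] O R i j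
          by (intro arg_cong3[where f = y]) simp_all
        also have "\<dots> = pos_comp m n j y z (p + 1 - i) (q + 1 - i) (k + 1 - i)"
          by (rule pos_comp_collapse[symmetric]) (use O R 3 e n m j in auto)
        also have "\<dots> = ?S" by (rule pos_comp_inner[symmetric, OF R2 O])
        finally show ?thesis using L by simp
      next
        case O: False
        have O': "\<not> (i \<le> ?p \<and> ?q < i + m - 1)" using O R 3 e n m j by (auto simp: lower_def upper_def)
        show ?thesis
        proof (cases "i \<le> k \<and> k < i + (m + n - 1) - 1")
          case True
          have "?S = 0" by (rule pos_comp_block[OF R2 O True])
          moreover have "pos_comp l m i x y ?p ?q ?k = 0"
            by (rule pos_comp_block[OF R3 O']) (use True 3 e n m j in \<open>auto simp: lower_def\<close>)
          ultimately show ?thesis using L by simp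
        next
          case False
          have "pos_comp l m i x y ?p ?q ?k = x (lower i m ?p) (upper i m ?q) (lower i m ?k)"
            by (rule pos_comp_collapse[OF R3 O']) (use False 3 e n m j in \<open>auto simp: lower_def\<close>)
          also have "\<dots> = x (lower i (m + n - 1) p) (upper i (m + n - 1) q) (lower i (m + n - 1) k)"
            unfolding e_def using lower_lower[OF _ _ n, of i j m] upper_upper[OF _ _ n, of i j m] i j
          by (intro arg_cong3[where f = x]) simp_all
          also have "\<dots> = ?S" by (rule pos_comp_collapse[symmetric, OF R2 O False])
          finally show ?thesis using L by simp
        qed
      qed
    qed
  qed
  then show "pos_comp (l + m - 1) n (i + j - 1) (pos_comp l m i x y) z p q k = ?S" unfolding e_def .
qed

text \<open>The blocks are disjoint, so an interval lies in at most one of them. If it lies in one,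
  the other merely shifts it; if it lies in neither, both are collapsed, and the order is irrelevant
  by \<open>lower_commute\<close> and \<open>upper_commute\<close>.\<close>

lemma pos_comp_commute:
  assumes l: "2 \<le> l" and m: "2 \<le> m" and n: "2 \<le> n" and i: "i \<in> {1..l}" and j: "j \<in> {i<..l}"
  shows "pos_comp (l + m - 1) n (j + m - 1) (pos_comp l m i x y) z =
    pos_comp (l + n - 1) m i (pos_comp l n j x z) y"
proof (intro ext)
  fix p q k
  let ?e = "j + m - 1"
  have e: "1 \<le> i" "i < j" "j \<le> l" using i j by auto
  let ?R = "1 \<le> p \<and> p \<le> k \<and> k \<le> q \<and> q \<le> l + m - 1 + n - 2"
  have R': "?R \<longleftrightarrow> 1 \<le> p \<and> p \<le> k \<and> k \<le> q \<and> q \<le> l + n - 1 + m - 2" using l m n by auto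
  let ?I = "?e \<le> p \<and> q < ?e + n - 1" and ?O = "i \<le> p \<and> q < i + m - 1"
  let ?L = "pos_comp (l + m - 1) n ?e (pos_comp l m i x y) z p q k"
    and ?S = "pos_comp (l + n - 1) m i (pos_comp l n j x z) y p q k"
  let ?p = "lower ?e n p" and ?q = "upper ?e n q" and ?k = "lower ?e n k"
  let ?p' = "lower i m p" and ?q' = "upper i m q" and ?k' = "lower i m k"
  show "?L = ?S"
  proof (cases ?R)
    case False
    then show ?thesis using R' by (metis pos_comp_outside)
  next
    case R: True
    note R2 = R[unfolded R']
    consider ?I | ?O | "\<not> ?I" "\<not> ?O" by blast
    then show ?thesis
    proof cases
      case 1
      have "?S = pos_comp l n j x z ?p' ?q' ?k'"
        by (rule pos_comp_collapse[OF R2]) (use 1 R e m in auto)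
      also have "\<dots> = z (?p' + 1 - j) (?q' + 1 - j) (?k' + 1 - j)"
        by (rule pos_comp_inner) (use 1 R e m in \<open>auto simp: lower_def upper_def\<close>)
      also have "\<dots> = z (p + 1 - ?e) (q + 1 - ?e) (k + 1 - ?e)"
        using 1 R e m by (intro arg_cong3[where f = z]) (auto simp: lower_def upper_def)
      also have "\<dots> = ?L" by (rule pos_comp_inner[symmetric, OF R 1])
      finally show ?thesis by simp
    next
      case 2
      have "?L = pos_comp l m i x y ?p ?q ?k"
        by (rule pos_comp_collapse[OF R]) (use 2 R e m in auto)
      also have "\<dots> = y (?p + 1 - i) (?q + 1 - i) (?k + 1 - i)"
        by (rule pos_comp_inner) (use 2 R e m in \<open>auto simp: lower_def upper_def\<close>)
      also have "\<dots> = y (p + 1 - i) (q + 1 - i) (k + 1 - i)"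
        using 2 R e m by (intro arg_cong3[where f = y]) (auto simp: lower_def upper_def)
      also have "\<dots> = ?S" by (rule pos_comp_inner[symmetric, OF R2 2])
      finally show ?thesis .
    next
      case 3
      have R3: "1 \<le> ?p' \<and> ?p' \<le> ?k' \<and> ?k' \<le> ?q' \<and> ?q' \<le> l + n - 2" if "\<not> (i \<le> k \<and> k < i + m - 1)"
        using that R 3 e m n by (auto simp: lower_def upper_def)
      have R4: "1 \<le> ?p \<and> ?p \<le> ?k \<and> ?k \<le> ?q \<and> ?q \<le> l + m - 2" if "\<not> (?e \<le> k \<and> k < ?e + n - 1)"
        using that R 3 e m n by (auto simp: lower_def upper_def)
      have O3: "\<not> (j \<le> ?p' \<and> ?q' < j + n - 1)" and O4: "\<not> (i \<le> ?p \<and> ?q < i + m - 1)"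
        using R 3 e m n by (auto simp: lower_def upper_def)
      consider (z) "?e \<le> k \<and> k < ?e + n - 1" | (y) "i \<le> k \<and> k < i + m - 1"
        | (x) "\<not> (?e \<le> k \<and> k < ?e + n - 1)" "\<not> (i \<le> k \<and> k < i + m - 1)" by blast
      then show ?thesis
      proof cases
        case z
        then have k: "\<not> (i \<le> k \<and> k < i + m - 1)" using e m by auto
        have "?S = pos_comp l n j x z ?p' ?q' ?k'" by (rule pos_comp_collapse[OF R2 3(2) k])
        also have "\<dots> = 0" by (rule pos_comp_block[OF R3[OF k] O3]) (use z e m in \<open>auto simp: lower_def\<close>)
        also have "\<dots> = ?L" by (rule pos_comp_block[symmetric, OF R 3(1) z])
        finally show ?thesis by simp
      next
        case y
        then have k: "\<not> (?e \<le> k \<and> k < ?e + n - 1)" using e m by auto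
        have "?L = pos_comp l m i x y ?p ?q ?k" by (rule pos_comp_collapse[OF R 3(1) k])
        also have "\<dots> = 0" by (rule pos_comp_block[OF R4[OF k] O4]) (use y e m in \<open>auto simp: lower_def\<close>)
        also have "\<dots> = ?S" by (rule pos_comp_block[symmetric, OF R2 3(2) y])
        finally show ?thesis .
      next
        case x
        have "?L = pos_comp l m i x y ?p ?q ?k" by (rule pos_comp_collapse[OF R 3(1) x(1)])
        also have "\<dots> = x (lower i m ?p) (upper i m ?q) (lower i m ?k)"
          by (rule pos_comp_collapse[OF R4[OF x(1)] O4]) (use x e m in \<open>auto simp: lower_def\<close>)
        also have "\<dots> = x (lower j n ?p') (upper j n ?q') (lower j n ?k')"
          using lower_commute[OF m n e(2)] upper_commute[OF m n e(1,2)]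
          by (intro arg_cong3[where f = x]) simp_all
        also have "\<dots> = pos_comp l n j x z ?p' ?q' ?k'"
          by (rule pos_comp_collapse[symmetric, OF R3[OF x(2)] O3]) (use x e m in \<open>auto simp: lower_def\<close>)
        also have "\<dots> = ?S" by (rule pos_comp_collapse[symmetric, OF R2 3(2) x(2)])
        finally show ?thesis .
      qed
    qed
  qed
qed

section \<open>Contractibility of the space of compatible families\<close>

text \<open>
  Extending a compatible family from \<open>{1..N}\<close> to \<open>{1..Suc N}\<close> amounts to choosing the squared last
  entries \<open>S i\<close> on the intervals \<open>{i..Suc N}\<close> with \<open>i \<le> N\<close>; compatibility becomes the equation below, where \<open>M i\<close>
  is \<open>first_weight\<close>. The solutions are totally ordered, so that their sum is a parameter.
\<close>

definition chain :: "(nat \<Rightarrow> real) \<Rightarrow> nat \<Rightarrow> (nat \<Rightarrow> real) \<Rightarrow> bool" where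
  "chain M N S \<longleftrightarrow> (\<forall>i\<in>{1..N}. 0 \<le> S i \<and> S i \<le> 1) \<and>
     (\<forall>i. 1 \<le> i \<and> i < N \<longrightarrow> S i * (1 - S (Suc i)) = M i * (1 - S i) * S (Suc i))"

text \<open>The equation says that the odds \<open>s / (1 - s)\<close> are \<open>M\<close> times
  the odds of \<open>t\<close>, so that larger \<open>s\<close> belong to larger \<open>t\<close>.
  Only for \<open>M = 0\<close> can one of the two stay at an end of the unit interval while the
  other moves.\<close>

lemma chain_step:
  fixes s s' t t' M :: real
  assumes st: "s * (1 - t) = M * (1 - s) * t" "s' * (1 - t') = M * (1 - s') * t'"
    and b: "0 \<le> s" "s \<le> 1" "0 \<le> s'" "s' \<le> 1" "0 \<le> t" "t \<le> 1" "0 \<le> t'" "t' \<le> 1" "0 \<le> M"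
  shows "s < s' \<Longrightarrow> t < t' \<or> t = 1 \<and> t' = 1"
    and "t < t' \<Longrightarrow> s < s' \<or> s = 0 \<and> s' = 0"
proof -
  assume lt: "s < s'"
  show "t < t' \<or> t = 1 \<and> t' = 1"
  proof (rule disjCI)
    assume "\<not> (t = 1 \<and> t' = 1)"
    show "t < t'"
    proof (rule ccontr)
      assume "\<not> t < t'"
      then have tt: "t' \<le> t" by simp
      have 1: "s * (1 - t) \<le> s' * (1 - t)" using lt b by (intro mult_right_mono) auto
      have 2: "s' * (1 - t) \<le> s' * (1 - t')" using tt b by (intro mult_left_mono) auto
      have "M * (1 - s') * t' \<le> M * (1 - s) * t'" using lt b by (intro mult_right_mono mult_left_mono) auto
      also have "\<dots> \<le> M * (1 - s) * t" using tt b by (intro mult_left_mono mult_nonneg_nonneg) auto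
      finally have 3: "s' * (1 - t') \<le> s * (1 - t)" using st by simp
      have "(s' - s) * (1 - t) = 0" using 1 2 3 by (simp add: algebra_simps)
      then have t: "t = 1" using lt by simp
      have "s' * (1 - t') = 0" using 1 2 3 t by simp
      then have "t' = 1" using lt b by auto
      then show False using t \<open>\<not> (t = 1 \<and> t' = 1)\<close> by simp
    qed
  qed
next
  assume lt: "t < t'"
  show "s < s' \<or> s = 0 \<and> s' = 0"
  proof (rule disjCI)
    assume ne: "\<not> (s = 0 \<and> s' = 0)"
    show "s < s'"
    proof (rule ccontr)
      assume "\<not> s < s'"
      then have ss: "s' \<le> s" by simp
      have 1: "s' * (1 - t') \<le> s' * (1 - t)" using lt b by (intro mult_left_mono) auto
      have 2: "s' * (1 - t) \<le> s * (1 - t)" using ss b by (intro mult_right_mono) auto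
      have "M * (1 - s) * t \<le> M * (1 - s) * t'" using lt b by (intro mult_left_mono mult_nonneg_nonneg) auto
      also have "\<dots> \<le> M * (1 - s') * t'" using ss b by (intro mult_right_mono mult_left_mono) auto
      finally have 3: "s * (1 - t) \<le> s' * (1 - t')" using st by simp
      have "s' * (1 - t) = s' * (1 - t')" using 1 2 3 by linarith
      then have "s' * (t' - t) = 0" by (simp add: algebra_simps)
      then have s': "s' = 0" using lt by simp
      then have "s * (1 - t) = 0" using 1 2 3 by simp
      then have "s = 0" using lt b by auto
      then show False using s' ne by simp
    qed
  qed
qed

text \<open>A strict inequality spreads to larger indices by the first part of
  \<open>chain_step\<close> and to smaller ones by the second. At worst it degenerates to equality
  at 1 or at 0, and such an equality persists.\<close>

lemma chain_comparable:
  assumes S: "chain M N S" and S': "chain M N S'" and M: "\<And>i. 0 \<le> M i"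
    and j: "j \<in> {1..N}" "S j < S' j" and i: "i \<in> {1..N}"
  shows "S i \<le> S' i"
proof -
  have b: "0 \<le> S i" "S i \<le> 1" "0 \<le> S' i" "S' i \<le> 1" if "i \<in> {1..N}" for i
    using S S' that by (auto simp: chain_def)
  have e: "S i * (1 - S (Suc i)) = M i * (1 - S i) * S (Suc i)"
    "S' i * (1 - S' (Suc i)) = M i * (1 - S' i) * S' (Suc i)" if "1 \<le> i" "i < N" for i
    using S S' that by (auto simp: chain_def)
  show ?thesis
  proof (cases "j \<le> i")
    case True
    have "i \<le> N \<longrightarrow> S i < S' i \<or> S i = 1 \<and> S' i = 1"
      using True
    proof (induction i rule: dec_induct)
      case base
      then show ?case using j by simp
    next
      case (step k)
      show ?case
      proof
        assume k: "Suc k \<le> N"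
        then have k1: "1 \<le> k" "k < N" "k \<in> {1..N}" "Suc k \<in> {1..N}" using step j by auto
        from step k consider "S k < S' k" | "S k = 1" "S' k = 1" by auto
        then show "S (Suc k) < S' (Suc k) \<or> S (Suc k) = 1 \<and> S' (Suc k) = 1"
        proof cases
          case 1
          then show ?thesis by (rule chain_step(1)[OF e[OF k1(1,2)] b[OF k1(3)] b[OF k1(4)] M])
        next
          case 2
          then show ?thesis using e[OF k1(1,2)] by simp
        qed
      qed
    qed
    then show ?thesis using i by auto
  next
    case False
    then have "i \<le> j" by simp
    then have "1 \<le> i \<longrightarrow> S i < S' i \<or> S i = 0 \<and> S' i = 0"
    proof (induction i rule: inc_induct)
      case base
      then show ?case using j by simp
    next
      case (step k)
      show ?case
      proof
        assume k: "1 \<le> k"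
        then have k1: "1 \<le> k" "k < N" "k \<in> {1..N}" "Suc k \<in> {1..N}" using step j by auto
        from step k consider "S (Suc k) < S' (Suc k)" | "S (Suc k) = 0" "S' (Suc k) = 0" by auto
        then show "S k < S' k \<or> S k = 0 \<and> S' k = 0"
        proof cases
          case 1
          then show ?thesis by (rule chain_step(2)[OF e[OF k1(1,2)] b[OF k1(3)] b[OF k1(4)] M])
        next
          case 2
          then show ?thesis using e[OF k1(1,2)] by simp
        qed
      qed
    qed
    then show ?thesis using i by auto
  qed
qed

text \<open>Two solutions that differ somewhere are comparable at every index, so their sums
  differ.\<close>

lemma chain_unique:
  assumes S: "chain M N S" and S': "chain M N S'" and M: "\<And>i. 0 \<le> M i"
    and sum: "(\<Sum>i=1..N. S i) = (\<Sum>i=1..N. S' i)" and i: "i \<in> {1..N}"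
  shows "S i = S' i"
proof (rule ccontr)
  assume "S i \<noteq> S' i"
  then consider "S i < S' i" | "S' i < S i" by linarith
  then show False
  proof cases
    case 1
    have "(\<Sum>i=1..N. S i) < (\<Sum>i=1..N. S' i)"
      using chain_comparable[OF S S' M i 1] 1 i by (intro sum_strict_mono_ex1) auto
    then show False using sum by simp
  next
    case 2
    have "(\<Sum>i=1..N. S' i) < (\<Sum>i=1..N. S i)"
      using chain_comparable[OF S' S M i 2] 2 i by (intro sum_strict_mono_ex1) auto
    then show False using sum by simp
  qed
qed

text \<open>The path joins the solutions 0 and 1 so that every intermediate sum is attained by
  continuity. In the induction a new last entry has to be added along the whole path.\<close>

lemma chain_path:
  assumes M: "\<And>i. 0 \<le> M i"
  shows "\<exists>\<gamma>. (\<forall>i. continuous_on {0..1::real} (\<lambda>t. \<gamma> t i)) \<and> (\<forall>t\<in>{0..1}. chain M N (\<gamma> t)) \<and>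
    (\<forall>i\<in>{1..N}. \<gamma> 0 i = 0 \<and> \<gamma> 1 i = (1::real))"
proof (induction N)
  case 0
  show ?case by (intro exI[of _ "\<lambda>_ _. 0"]) (auto simp: chain_def)
next
  case (Suc N)
  then obtain \<gamma> where c: "\<And>i. continuous_on {0..1::real} (\<lambda>t. \<gamma> t i)"
    and ch: "\<And>t. t \<in> {0..1} \<Longrightarrow> chain M N (\<gamma> t)"
    and ends: "\<And>i. i \<in> {1..N} \<Longrightarrow> \<gamma> 0 i = 0" "\<And>i. i \<in> {1..N} \<Longrightarrow> \<gamma> 1 i = 1" by metis
  have extend: "chain M (Suc N) (S(Suc N := x))"
    if "chain M N S" "0 \<le> x" "x \<le> 1" "1 \<le> N \<Longrightarrow> S N * (1 - x) = M N * (1 - S N) * x" for S x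
    using that by (auto simp: chain_def less_Suc_eq le_Suc_eq)
  show ?case
  proof (cases "N = 0 \<or> M N = 0")
    case True
    \<comment> \<open>For \<open>M N = 0\<close> the equation reads
      \<open>S N * (1 - S (Suc N)) = 0\<close>. The new entry first moves from 0 to 1 while the old
      path waits at 0; then the old path runs with the new entry fixed at 1. For
      \<open>N = 0\<close> there is no equation, and the same path serves.\<close>
    define \<delta> where "\<delta> t = (\<gamma> (max 0 (2 * t - 1)))(Suc N := min 1 (2 * t))" for t
    have "continuous_on {0..1} (\<lambda>t. \<delta> t i)" for i
    proof (cases "i = Suc N")
      case True
      then show ?thesis by (simp add: \<delta>_def) (intro continuous_intros)
    next
      case False
      have "continuous_on {0..1} (\<lambda>t. \<gamma> (max 0 (2 * t - 1)) i)"
        by (rule continuous_on_compose2[OF c[of i]]) (auto intro!: continuous_intros)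
      then show ?thesis using False by (simp add: \<delta>_def)
    qed
    moreover have "chain M (Suc N) (\<delta> t)" if t: "t \<in> {0..1}" for t
      unfolding \<delta>_def
    proof (rule extend)
      show "chain M N (\<gamma> (max 0 (2 * t - 1)))" using t by (intro ch) auto
      show "\<gamma> (max 0 (2 * t - 1)) N * (1 - min 1 (2 * t)) = M N * (1 - \<gamma> (max 0 (2 * t - 1)) N) * min 1 (2 * t)" if "1 \<le> N"
      proof (cases "2 * t \<le> 1")
        case True
        then show ?thesis using that \<open>N = 0 \<or> M N = 0\<close> ends(1)[of N] by (simp add: max_def)
      next
        case False
        then show ?thesis using that \<open>N = 0 \<or> M N = 0\<close> by simp
      qed
    qed (use t in auto)
    moreover have "\<delta> 0 i = 0 \<and> \<delta> 1 i = 1" if "i \<in> {1..Suc N}" for i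
      using that ends[of i] by (auto simp: \<delta>_def le_Suc_eq)
    ultimately show ?thesis by blast
  next
    case False
    then have N: "1 \<le> N" and MN: "0 < M N" using M[of N] by auto
    \<comment> \<open>Solving the chain equation for the new entry gives the quotient of
      \<open>\<gamma> t N\<close> by this denominator, which is positive because \<open>M N\<close>
      is.\<close>
    define D where "D t = \<gamma> t N + M N * (1 - \<gamma> t N)" for t
    have b: "0 \<le> \<gamma> t N" "\<gamma> t N \<le> 1" if "t \<in> {0..1}" for t
      using ch[OF that] N by (auto simp: chain_def)
    have D: "0 < D t" if "t \<in> {0..1}" for t
    proof (cases "\<gamma> t N = 0")
      case True
      then show ?thesis using MN by (simp add: D_def)
    next
      case False
      then have "0 < \<gamma> t N" "0 \<le> M N * (1 - \<gamma> t N)" using b[OF that] MN by auto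
      then show ?thesis unfolding D_def by linarith
    qed
    define \<delta> where "\<delta> t = (\<gamma> t)(Suc N := \<gamma> t N / D t)" for t
    have "continuous_on {0..1} (\<lambda>t. \<delta> t i)" for i
    proof (cases "i = Suc N")
      case True
      have "continuous_on {0..1} (\<lambda>t. \<gamma> t N / D t)"
        using D unfolding D_def by (intro continuous_intros c) force
      then show ?thesis using True by (simp add: \<delta>_def)
    next
      case False
      then show ?thesis using c[of i] by (simp add: \<delta>_def)
    qed
    moreover have "chain M (Suc N) (\<delta> t)" if t: "t \<in> {0..1}" for t
      unfolding \<delta>_def
    proof (rule extend[OF ch[OF t]])
      show "0 \<le> \<gamma> t N / D t" using b[OF t] D[OF t] by simp
      have "\<gamma> t N \<le> D t" using b[OF t] MN by (simp add: D_def)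
      then show "\<gamma> t N / D t \<le> 1" using D[OF t] by simp
      have "1 - \<gamma> t N / D t = M N * (1 - \<gamma> t N) / D t" using D[OF t] by (simp add: field_simps D_def)
      then show "\<gamma> t N * (1 - \<gamma> t N / D t) = M N * (1 - \<gamma> t N) * (\<gamma> t N / D t)" by simp
    qed
    moreover have "\<delta> 0 i = 0 \<and> \<delta> 1 i = 1" if "i \<in> {1..Suc N}" for i
      using that ends[of i] ends[of N] N by (auto simp: \<delta>_def le_Suc_eq D_def)
    ultimately show ?thesis by blast
  qed
qed

lemma chain_exists:
  assumes M: "\<And>i. 0 \<le> M i" and \<tau>: "0 \<le> \<tau>" "\<tau> \<le> real N"
  shows "\<exists>S. chain M N S \<and> (\<Sum>i=1..N. S i) = \<tau>"
proof -
  obtain \<gamma> where c: "\<And>i. continuous_on {0..1::real} (\<lambda>t. \<gamma> t i)"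
    and ch: "\<And>t. t \<in> {0..1} \<Longrightarrow> chain M N (\<gamma> t)"
    and ends: "\<And>i. i \<in> {1..N} \<Longrightarrow> \<gamma> 0 i = 0" "\<And>i. i \<in> {1..N} \<Longrightarrow> \<gamma> 1 i = 1"
    using chain_path[of M N] M by metis
  have "\<exists>t\<ge>0. t \<le> 1 \<and> (\<Sum>i=1..N. \<gamma> t i) = \<tau>"
  proof (rule IVT')
    show "continuous_on {0..1} (\<lambda>t. \<Sum>i=1..N. \<gamma> t i)" by (intro continuous_intros c)
  qed (use \<tau> ends in auto)
  then show ?thesis using ch by (metis atLeastAtMost_iff)
qed

section \<open>Adding one coordinate to a family\<close>

definition last_row :: "nat \<Rightarrow> (nat \<Rightarrow> nat \<Rightarrow> nat \<Rightarrow> real) \<Rightarrow> nat \<Rightarrow> real" where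
  "last_row N \<mu> i = (\<mu> i (Suc N) (Suc N))\<^sup>2"

text \<open>The squared norm of the row on \<open>{i..N}\<close> without its first entry. For
  \<open>i < N\<close> this is the square of its factor over the row on
  \<open>{Suc i..N}\<close>.\<close>

definition first_weight :: "nat \<Rightarrow> (nat \<Rightarrow> nat \<Rightarrow> nat \<Rightarrow> real) \<Rightarrow> nat \<Rightarrow> real" where
  "first_weight N \<mu> i = 1 - (\<mu> i N i)\<^sup>2"

definition forget_last :: "nat \<Rightarrow> (nat \<Rightarrow> nat \<Rightarrow> nat \<Rightarrow> real) \<Rightarrow> nat \<Rightarrow> nat \<Rightarrow> nat \<Rightarrow> real" where
  "forget_last N \<mu> = (\<lambda>p q k. if q \<le> N then \<mu> p q k else 0)"

lemma forget_last_in: 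
  assumes \<mu>: "\<mu> \<in> pos_systems (Suc N)" shows "forget_last N \<mu> \<in> pos_systems N"
proof (rule pos_systemsI)
  fix p q assume pq: "1 \<le> p" "p < q" "q \<le> N"
  then show "\<exists>z. \<forall>k\<in>{Suc p..q}. forget_last N \<mu> p q k = z * forget_last N \<mu> (Suc p) q k"
    using pos_left[OF \<mu>, of p q] by (auto simp: forget_last_def)
  show "\<exists>z. \<forall>k\<in>{p..q-1}. forget_last N \<mu> p q k = z * forget_last N \<mu> p (q - 1) k"
    using pos_right[OF \<mu>, of p q] pq by (auto simp: forget_last_def)
qed (use pos_nonneg[OF \<mu>] pos_zero[OF \<mu>] pos_unit[OF \<mu>] in \<open>auto simp: forget_last_def\<close>)

context
  fixes N \<mu> assumes \<mu>: "\<mu> \<in> pos_systems (Suc N)"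
begin

lemma last_row_bounds: "0 \<le> last_row N \<mu> i" "last_row N \<mu> i \<le> 1"
  using pos_nonneg[OF \<mu>] pos_le_1[OF \<mu>] by (auto simp: last_row_def power_le_one)

text \<open>Without its last entry the row on \<open>{i..Suc N}\<close> is a multiple of the row on
  \<open>{i..N}\<close>. Comparing norms gives the square of the factor.\<close>

lemma row_squares:
  assumes "1 \<le> i" "i \<le> k" "k \<le> N"
  shows "(\<mu> i (Suc N) k)\<^sup>2 = (1 - last_row N \<mu> i) * (\<mu> i N k)\<^sup>2"
proof -
  obtain z where z: "\<forall>k\<in>{i..N}. \<mu> i (Suc N) k = z * \<mu> i N k"
    using pos_right[OF \<mu>, of i "Suc N"] assms by auto
  have "1 = (\<Sum>k=i..N. (\<mu> i (Suc N) k)\<^sup>2) + last_row N \<mu> i"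
    using pos_unit[OF \<mu>, of i "Suc N"] assms by (simp add: last_row_def)
  also have "(\<Sum>k=i..N. (\<mu> i (Suc N) k)\<^sup>2) = z\<^sup>2 * (\<Sum>k=i..N. (\<mu> i N k)\<^sup>2)"
    unfolding sum_distrib_left using z by (intro sum.cong) (simp_all add: power_mult_distrib)
  also have "(\<Sum>k=i..N. (\<mu> i N k)\<^sup>2) = 1" using pos_unit[OF \<mu>, of i N] assms by simp
  finally have "z\<^sup>2 = 1 - last_row N \<mu> i" by simp
  then show ?thesis using z assms by (simp add: power_mult_distrib)
qed

text \<open>The squared norm of the part \<open>{Suc i..N}\<close> of the row on
  \<open>{i..Suc N}\<close> is computed through the row on \<open>{Suc i..Suc N}\<close> and through
  the row on \<open>{i..N}\<close>. The last entries supply the relation that eliminates the factor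
  \<open>y\<close>.\<close>

lemma chain_last_row: "chain (first_weight N \<mu>) N (last_row N \<mu>)"
  unfolding chain_def
proof (intro conjI ballI allI impI)
  fix i assume i: "1 \<le> i \<and> i < N"
  obtain y where y: "\<forall>k\<in>{Suc i..Suc N}. \<mu> i (Suc N) k = y * \<mu> (Suc i) (Suc N) k"
    using pos_left[OF \<mu>, of i "Suc N"] i by auto
  have 1: "last_row N \<mu> i = y\<^sup>2 * last_row N \<mu> (Suc i)"
    using y i by (simp add: last_row_def power_mult_distrib)
  have "(\<Sum>k=Suc i..N. (\<mu> i (Suc N) k)\<^sup>2) = y\<^sup>2 * (\<Sum>k=Suc i..N. (\<mu> (Suc i) (Suc N) k)\<^sup>2)"
    unfolding sum_distrib_left using y by (intro sum.cong) (simp_all add: power_mult_distrib)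
  also have "(\<Sum>k=Suc i..N. (\<mu> (Suc i) (Suc N) k)\<^sup>2) = 1 - last_row N \<mu> (Suc i)"
    using pos_unit[OF \<mu>, of "Suc i" "Suc N"] i by (simp add: last_row_def)
  finally have 2: "(\<Sum>k=Suc i..N. (\<mu> i (Suc N) k)\<^sup>2) = y\<^sup>2 * (1 - last_row N \<mu> (Suc i))" .
  have "(\<Sum>k=Suc i..N. (\<mu> i (Suc N) k)\<^sup>2) = (1 - last_row N \<mu> i) * (\<Sum>k=Suc i..N. (\<mu> i N k)\<^sup>2)"
    unfolding sum_distrib_left using row_squares i by (intro sum.cong) simp_all
  also have "(\<Sum>k=Suc i..N. (\<mu> i N k)\<^sup>2) = first_weight N \<mu> i"
    using pos_unit[OF \<mu>, of i N] i by (simp add: sum_atLeast_Suc first_weight_def)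
  finally have 3: "y\<^sup>2 * (1 - last_row N \<mu> (Suc i)) = (1 - last_row N \<mu> i) * first_weight N \<mu> i"
    using 2 by simp
  have "last_row N \<mu> i * (1 - last_row N \<mu> (Suc i)) = last_row N \<mu> (Suc i) * (y\<^sup>2 * (1 - last_row N \<mu> (Suc i)))"
    using 1 by simp
  then show "last_row N \<mu> i * (1 - last_row N \<mu> (Suc i)) = first_weight N \<mu> i * (1 - last_row N \<mu> i) * last_row N \<mu> (Suc i)"
    unfolding 3 by simp
qed (use last_row_bounds in auto)

end

lemma first_weight_nonneg:
  assumes "\<mu> \<in> pos_systems K" shows "0 \<le> first_weight N \<mu> i"
  using pos_nonneg[OF assms] pos_le_1[OF assms] by (simp add: first_weight_def power_le_one)

text \<open>The squares of the new entries are determined by \<open>row_squares\<close>, and the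
  entries are nonnegative.\<close>

lemma pos_systems_ext:
  assumes \<mu>: "\<mu> \<in> pos_systems (Suc N)" and \<nu>: "\<nu> \<in> pos_systems (Suc N)"
    and f: "forget_last N \<mu> = forget_last N \<nu>" and s: "\<And>i. i \<in> {1..N} \<Longrightarrow> last_row N \<mu> i = last_row N \<nu> i"
  shows "\<mu> = \<nu>"
proof (intro ext)
  fix p q k
  have low: "\<mu> p q k = \<nu> p q k" if "q \<le> N" for p q k
    using fun_cong[OF fun_cong[OF fun_cong[OF f, of p], of q], of k] that by (simp add: forget_last_def)
  show "\<mu> p q k = \<nu> p q k"
  proof (cases "1 \<le> p \<and> p \<le> k \<and> k \<le> q \<and> q = Suc N")
    case False
    then show ?thesis using low[of q p k] pos_zero[OF \<mu>, of p k q] pos_zero[OF \<nu>, of p k q] by fastforce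
  next
    case True
    have "(\<mu> p q k)\<^sup>2 = (\<nu> p q k)\<^sup>2"
    proof (cases "p = Suc N")
      case True
      then have "k = Suc N" "q = Suc N" using \<open>1 \<le> p \<and> p \<le> k \<and> k \<le> q \<and> q = Suc N\<close> by auto
      then show ?thesis using True pos_single[OF \<mu>, of "Suc N"] pos_single[OF \<nu>, of "Suc N"] by simp
    next
      case False
      then have p: "p \<in> {1..N}" using True by auto
      show ?thesis
      proof (cases "k = Suc N")
        case kN: True
        then show ?thesis using s[OF p] True by (simp add: last_row_def)
      next
        case False
        then have k: "1 \<le> p" "p \<le> k" "k \<le> N" and q: "q = Suc N" using True by auto
        show ?thesis
          unfolding q row_squares[OF \<mu> k] row_squares[OF \<nu> k] s[OF p] using low by simp
      qed
    qed
    then show ?thesis using pos_nonneg[OF \<mu>, of p q k] pos_nonneg[OF \<nu>, of p q k] by (simp add: power2_eq_iff_nonneg)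
  qed
qed

text \<open>By \<open>row_squares\<close> the new row has to be the old one scaled by
  \<open>sqrt (1 - S p)\<close>, followed by \<open>sqrt (S p)\<close>. Compatibility on the right
  then holds by construction, and compatibility on the left is the chain equation.\<close>

lemma pos_systems_extend:
  assumes \<mu>: "\<mu> \<in> pos_systems N" and S: "chain (first_weight N \<mu>) N S"
  shows "\<exists>\<nu>\<in>pos_systems (Suc N). forget_last N \<nu> = \<mu> \<and> (\<forall>i\<in>{1..N}. last_row N \<nu> i = S i)"
proof -
  define \<nu> where "\<nu> p q k = (if q \<le> N then \<mu> p q k else if q = Suc N \<and> 1 \<le> p \<and> p \<le> N then
      (if p \<le> k \<and> k \<le> N then sqrt (1 - S p) * \<mu> p N k else if k = Suc N then sqrt (S p) else 0)
      else if q = Suc N \<and> p = Suc N \<and> k = Suc N then 1 else 0)" for p q k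
  have b: "0 \<le> S i" "S i \<le> 1" if "1 \<le> i" "i \<le> N" for i using S that by (auto simp: chain_def)
  have "\<nu> \<in> pos_systems (Suc N)"
  proof (rule pos_systemsI)
    show "0 \<le> \<nu> p q k" for p q k using pos_nonneg[OF \<mu>] b by (auto simp: \<nu>_def)
    show "\<nu> p q k = 0" if "\<not> (1 \<le> p \<and> p \<le> k \<and> k \<le> q \<and> q \<le> Suc N)" for p q k
      using that pos_zero[OF \<mu>, of p k q] by (auto simp: \<nu>_def)
    show "(\<Sum>k=p..q. (\<nu> p q k)\<^sup>2) = 1" if pq: "1 \<le> p" "p \<le> q" "q \<le> Suc N" for p q
    proof -
      consider "q \<le> N" | "q = Suc N" "p = Suc N" | "q = Suc N" "p \<le> N" using pq by linarith
      then show ?thesis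
      proof cases
        case 1
        then show ?thesis using pos_unit[OF \<mu>, of p q] pq by (simp add: \<nu>_def)
      next
        case 2
        then show ?thesis by (simp add: \<nu>_def)
      next
        case 3
        have "(\<Sum>k=p..N. (\<nu> p (Suc N) k)\<^sup>2) = (1 - S p) * (\<Sum>k=p..N. (\<mu> p N k)\<^sup>2)"
          unfolding sum_distrib_left using 3 pq b[of p] by (intro sum.cong) (auto simp: \<nu>_def power_mult_distrib)
        then show ?thesis using 3 pq b[of p] pos_unit[OF \<mu>, of p N] by (simp add: \<nu>_def)
      qed
    qed
    fix p q assume pq: "1 \<le> p" "p < q" "q \<le> Suc N"
    show "\<exists>z. \<forall>k\<in>{p..q-1}. \<nu> p q k = z * \<nu> p (q - 1) k"
    proof (cases "q \<le> N")
      case True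
      then show ?thesis using pos_right[OF \<mu>, of p q] pq by (auto simp: \<nu>_def)
    next
      case False
      then have "q = Suc N" using pq by simp
      then show ?thesis using pq by (intro exI[of _ "sqrt (1 - S p)"]) (auto simp: \<nu>_def)
    qed
    show "\<exists>z. \<forall>k\<in>{Suc p..q}. \<nu> p q k = z * \<nu> (Suc p) q k"
    proof -
      consider "q \<le> N" | "q = Suc N" "p = N" | "q = Suc N" "p < N" using pq by linarith
      then show ?thesis
      proof cases
        case 1
        then show ?thesis using pos_left[OF \<mu>, of p q] pq by (auto simp: \<nu>_def)
      next
        case 2
        then show ?thesis using pq by (intro exI[of _ "sqrt (S p)"]) (auto simp: \<nu>_def)
      next
        case 3
        obtain c where c: "c \<ge> 0" "\<forall>k\<in>{Suc p..N}. \<mu> p N k = c * \<mu> (Suc p) N k"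
          using pos_left[OF \<mu>, of p N] 3 pq by auto
        have "first_weight N \<mu> p = (\<Sum>k=Suc p..N. (\<mu> p N k)\<^sup>2)"
          using pos_unit[OF \<mu>, of p N] 3 pq by (simp add: sum_atLeast_Suc first_weight_def)
        also have "\<dots> = c\<^sup>2 * (\<Sum>k=Suc p..N. (\<mu> (Suc p) N k)\<^sup>2)"
          unfolding sum_distrib_left using c by (intro sum.cong) (simp_all add: power_mult_distrib)
        also have "\<dots> = c\<^sup>2" using pos_unit[OF \<mu>, of "Suc p" N] 3 by simp
        finally have fw: "first_weight N \<mu> p = c\<^sup>2" .
        define s t where "s = S p" and "t = S (Suc p)"
        have st: "0 \<le> s" "s \<le> 1" "0 \<le> t" "t \<le> 1" using b[of p] b[of "Suc p"] 3 pq by (auto simp: s_def t_def)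
        have "s * (1 - t) = c\<^sup>2 * (1 - s) * t" using S 3 pq fw by (simp add: chain_def s_def t_def)
        then have "sqrt (s * (1 - t)) = sqrt (c\<^sup>2 * (1 - s) * t)" by simp
        then have key: "sqrt s * sqrt (1 - t) = c * sqrt (1 - s) * sqrt t"
          using c(1) by (simp add: real_sqrt_mult)
        have sq: "sqrt t * sqrt t = t" "sqrt (1 - t) * sqrt (1 - t) = 1 - t" using st by auto
        \<comment> \<open>The pairs \<open>(sqrt s, c * sqrt (1 - s))\<close> and
          \<open>(sqrt t, sqrt (1 - t))\<close> have a vanishing determinant by \<open>key\<close>.
          As the second has norm one, the factor between them is their inner product.\<close>
        define z where "z = sqrt s * sqrt t + c * sqrt (1 - s) * sqrt (1 - t)"
        have "z * sqrt t = sqrt s * (sqrt t * sqrt t) + (c * sqrt (1 - s) * sqrt t) * sqrt (1 - t)"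
          by (simp add: z_def algebra_simps)
        also have "\<dots> = sqrt s * t + sqrt s * (sqrt (1 - t) * sqrt (1 - t))"
          unfolding key[symmetric] sq(1) by simp
        also have "\<dots> = sqrt s" unfolding sq by (simp add: algebra_simps)
        finally have z1: "sqrt s = z * sqrt t" by simp
        have "z * sqrt (1 - t) = (sqrt s * sqrt (1 - t)) * sqrt t + c * sqrt (1 - s) * (sqrt (1 - t) * sqrt (1 - t))"
          by (simp add: z_def algebra_simps)
        also have "\<dots> = c * sqrt (1 - s) * (sqrt t * sqrt t) + c * sqrt (1 - s) * (1 - t)"
          unfolding key sq(2) by simp
        also have "\<dots> = c * sqrt (1 - s)" unfolding sq by (simp add: algebra_simps)
        finally have z2: "sqrt (1 - s) * c = z * sqrt (1 - t)" by simp
        show ?thesis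
        proof (intro exI ballI)
          fix k assume k: "k \<in> {Suc p..q}"
          show "\<nu> p q k = z * \<nu> (Suc p) q k"
          proof (cases "k = Suc N")
            case True
            then show ?thesis using 3 pq z1 by (simp add: \<nu>_def s_def t_def)
          next
            case False
            then have kk: "Suc p \<le> k" "k \<le> N" using k 3 by auto
            then have "\<mu> p N k = c * \<mu> (Suc p) N k" using c(2) by simp
            then have "sqrt (1 - s) * \<mu> p N k = z * (sqrt (1 - t) * \<mu> (Suc p) N k)"
              using z2 by (simp add: mult.assoc[symmetric])
            then show ?thesis using 3 pq kk False by (simp add: \<nu>_def s_def t_def)
          qed
        qed
      qed
    qed
  qed
  moreover have "forget_last N \<nu> = \<mu>"
    using pos_zero[OF \<mu>] by (auto simp: forget_last_def \<nu>_def fun_eq_iff)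
  moreover have "last_row N \<nu> i = S i" if "i \<in> {1..N}" for i
    using that b[of i] by (simp add: last_row_def \<nu>_def)
  ultimately show ?thesis by blast
qed

lemma pos_systems_nonempty: "pos_systems N \<noteq> {}"
proof (induction N)
  case 0
  have "(\<lambda>p q k. 0) \<in> pos_systems 0" by (simp add: pos_systems_def)
  then show ?case by blast
next
  case (Suc N)
  then obtain \<mu> where \<mu>: "\<mu> \<in> pos_systems N" by blast
  obtain S where "chain (first_weight N \<mu>) N S"
    using chain_exists[of "first_weight N \<mu>" 0 N] first_weight_nonneg[OF \<mu>] by auto
  then show ?case using pos_systems_extend[OF \<mu>] by blast
qed

text \<open>Over a fixed family on \<open>{1..N}\<close> the extensions are the chains, and a chain
  is determined by its sum, which takes every value in \<open>{0..real N}\<close>. The continuous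
  dependence of the chain on the family and on the sum follows from compactness.\<close>

lemma homeomorphic_pos_systems_Suc:
  "top_of_set (pos_systems (Suc N)) homeomorphic_space
    prod_topology (top_of_set (pos_systems N)) (top_of_set {0..real N})"
proof -
  define \<Psi> where "\<Psi> \<mu> = (forget_last N \<mu>, \<Sum>i=1..N. last_row N \<mu> i)" for \<mu>
  have fw: "first_weight N (forget_last N \<mu>) = first_weight N \<mu>" for \<mu>
    by (simp add: fun_eq_iff first_weight_def forget_last_def)
  have "homeomorphic_map (top_of_set (pos_systems (Suc N))) (top_of_set (pos_systems N \<times> {0..real N})) \<Psi>"
  proof (rule continuous_imp_homeomorphic_map)
    have c: "continuous_on (pos_systems (Suc N)) (\<lambda>\<mu>. \<mu> p q k)" for p q k
      by (rule continuous_on_product_then_coordinatewise[OF continuous_on_product_then_coordinatewise[OF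
          continuous_on_product_then_coordinatewise[OF continuous_on_id]]])
    have "continuous_on (pos_systems (Suc N)) (\<lambda>\<mu>. forget_last N \<mu> p q k)" for p q k
      using c by (cases "q \<le> N") (simp_all add: forget_last_def)
    then have "continuous_on (pos_systems (Suc N)) (forget_last N)"
      by (rule continuous_on_coordinatewise_then_product[OF continuous_on_coordinatewise_then_product[OF
            continuous_on_coordinatewise_then_product]])
    moreover have "continuous_on (pos_systems (Suc N)) (\<lambda>\<mu>. \<Sum>i=1..N. last_row N \<mu> i)"
      unfolding last_row_def by (intro continuous_intros c)
    ultimately have "continuous_on (pos_systems (Suc N)) \<Psi>"
      unfolding \<Psi>_def by (rule continuous_on_Pair)
    moreover have into: "\<Psi> \<mu> \<in> pos_systems N \<times> {0..real N}" if "\<mu> \<in> pos_systems (Suc N)" for \<mu>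
    proof -
      have "(\<Sum>i=1..N. last_row N \<mu> i) \<le> (\<Sum>i=1..N. 1)" using last_row_bounds[OF that] by (intro sum_mono)
      then show ?thesis
        using forget_last_in[OF that] last_row_bounds[OF that] by (auto simp: \<Psi>_def intro!: sum_nonneg)
    qed
    ultimately show "continuous_map (top_of_set (pos_systems (Suc N))) (top_of_set (pos_systems N \<times> {0..real N})) \<Psi>"
      by auto
    show "\<Psi> ` topspace (top_of_set (pos_systems (Suc N))) = topspace (top_of_set (pos_systems N \<times> {0..real N}))"
    proof
      show "\<Psi> ` topspace (top_of_set (pos_systems (Suc N))) \<subseteq> topspace (top_of_set (pos_systems N \<times> {0..real N}))"
        unfolding topspace_euclidean_subtopology using into by (intro image_subsetI)
      show "topspace (top_of_set (pos_systems N \<times> {0..real N})) \<subseteq> \<Psi> ` topspace (top_of_set (pos_systems (Suc N)))"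
      proof clarsimp
        fix \<mu> \<tau> assume \<mu>: "\<mu> \<in> pos_systems N" and \<tau>: "0 \<le> \<tau>" "\<tau> \<le> real N"
        obtain S where S: "chain (first_weight N \<mu>) N S" "(\<Sum>i=1..N. S i) = \<tau>"
          using chain_exists[of "first_weight N \<mu>" \<tau> N] first_weight_nonneg[OF \<mu>] \<tau> by blast
        from pos_systems_extend[OF \<mu> S(1)] obtain \<nu> where
          \<nu>: "\<nu> \<in> pos_systems (Suc N)" "forget_last N \<nu> = \<mu>" "\<forall>i\<in>{1..N}. last_row N \<nu> i = S i" by blast
        then have "\<Psi> \<nu> = (\<mu>, \<tau>)" using S(2) by (simp add: \<Psi>_def)
        then show "(\<mu>, \<tau>) \<in> \<Psi> ` pos_systems (Suc N)" using \<nu>(1) by force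
      qed
    qed
    show "inj_on \<Psi> (topspace (top_of_set (pos_systems (Suc N))))"
    proof (rule inj_onI, simp)
      fix \<mu> \<nu> assume \<mu>: "\<mu> \<in> pos_systems (Suc N)" and \<nu>: "\<nu> \<in> pos_systems (Suc N)" and eq: "\<Psi> \<mu> = \<Psi> \<nu>"
      have f: "forget_last N \<mu> = forget_last N \<nu>" and s: "(\<Sum>i=1..N. last_row N \<mu> i) = (\<Sum>i=1..N. last_row N \<nu> i)"
        using eq by (auto simp: \<Psi>_def)
      have "first_weight N \<mu> = first_weight N \<nu>" using fw[of \<mu>] fw[of \<nu>] f by simp
      with chain_last_row[OF \<nu>] have "chain (first_weight N \<mu>) N (last_row N \<nu>)" by simp
      with chain_unique[OF chain_last_row[OF \<mu>] _ _ s] first_weight_nonneg[OF \<mu>]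
      show "\<mu> = \<nu>" by (intro pos_systems_ext[OF \<mu> \<nu> f]) blast
    qed
  qed (auto simp: compact_space_subtopology compact_pos_systems Hausdorff_space_subtopology Hausdorff_space_euclidean)
  then show ?thesis
    unfolding prod_topology_subtopology_eu by (rule homeomorphic_map_imp_homeomorphic_space)
qed

lemma contractible_pos_systems: "contractible_space (top_of_set (pos_systems N))"
proof (induction N)
  case 0
  have "pos_systems 0 = {\<lambda>p q k. 0}"
    using pos_zero[of _ 0] by (auto simp: pos_systems_def fun_eq_iff)
  then show ?case by (simp add: contractible_space_top_of_set)
next
  case (Suc N)
  have "contractible_space (top_of_set {0..real N})"
    by (simp add: contractible_space_top_of_set convex_imp_contractible)
  with Suc have "contractible_space (prod_topology (top_of_set (pos_systems N)) (top_of_set {0..real N}))"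
    unfolding contractible_space_prod_topology by blast
  then show ?case using homeomorphic_space_contractibility[OF homeomorphic_pos_systems_Suc] by blast
qed

section \<open>The homotopy equivalence\<close>

definition model_comp :: "nat \<Rightarrow> nat \<Rightarrow> nat \<Rightarrow>
    (nat \<Rightarrow> nat \<Rightarrow> nat \<Rightarrow> real) \<times> (nat \<Rightarrow> complex) \<times> (nat \<Rightarrow> complex) \<Rightarrow>
    (nat \<Rightarrow> nat \<Rightarrow> nat \<Rightarrow> real) \<times> (nat \<Rightarrow> complex) \<times> (nat \<Rightarrow> complex) \<Rightarrow>
    (nat \<Rightarrow> nat \<Rightarrow> nat \<Rightarrow> real) \<times> (nat \<Rightarrow> complex) \<times> (nat \<Rightarrow> complex)" where
  "model_comp n m i x y =
    (pos_comp n m i (fst x) (fst y), pcomp As_S1_semidirect_S1 n m i (snd x) (snd y))"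

lemma realize_model_comp:
  assumes "2 \<le> n" "2 \<le> m" "i \<in> {1..n}" "x \<in> topspace (model_space n)" "y \<in> topspace (model_space m)"
  shows "model_comp n m i x y \<in> topspace (model_space (n + m - 1))"
    "realize (n + m - 1) (model_comp n m i x y) = Z_comp n m i (realize n x) (realize m y)"
proof -
  obtain \<mu> a g where x: "x = (\<mu>, a, g)" by (metis prod.exhaust)
  obtain \<nu> b h where y: "y = (\<nu>, b, h)" by (metis prod.exhaust)
  interpret block_points n m i \<mu> \<nu> a b g h
    by unfold_locales (use assms in \<open>auto simp: x y topspace_model_space\<close>)
  have eq: "model_comp n m i x y = (pos_comp n m i \<mu> \<nu>, a', g')"
    by (simp add: model_comp_def x y a'_def g'_def)
  show "model_comp n m i x y \<in> topspace (model_space (n + m - 1))"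
    unfolding eq using pos_comp_in_pos_systems[OF \<mu> \<nu>] a'_in g'_in by (simp add: topspace_model_space)
  show "realize (n + m - 1) (model_comp n m i x y) = Z_comp n m i (realize n x) (realize m y)"
    unfolding eq unfolding x y by (rule realize_comp)
qed

section \<open>Continuity and the operad identities in product coordinates\<close>

lemma continuous_map_circle_mult:
  assumes "continuous_map X circle f" "continuous_map X circle g"
  shows "continuous_map X circle (\<lambda>x. f x * g x)"
proof -
  have "continuous_map X euclidean f" "continuous_map X euclidean g"
    using assms unfolding circle_def by (auto intro: continuous_map_into_fulltopology)
  then have "continuous_map X euclidean (\<lambda>x. f x * g x)" by (rule continuous_map_mult)
  moreover have "f x * g x \<in> sphere 0 1" if "x \<in> topspace X" for x
  proof -
    have "f x \<in> sphere 0 1" "g x \<in> sphere 0 1"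
      using assms[THEN continuous_map_image_subset_topspace] that by auto
    then show ?thesis by (simp add: norm_mult)
  qed
  ultimately show ?thesis unfolding circle_def by (auto simp: continuous_map_in_subtopology)
qed

lemma continuous_map_restrict:
  assumes "\<And>k. k \<in> J \<Longrightarrow> continuous_map X circle (\<lambda>w. f w k)"
  shows "continuous_map X (product_topology (\<lambda>_. circle) J) (\<lambda>w. \<lambda>k\<in>J. f w k)"
  unfolding continuous_map_componentwise using assms by auto

lemma continuous_map_semidirect:
  assumes n: "2 \<le> n" and m: "2 \<le> m" and i: "i \<in> {1..n}"
  shows "continuous_map (prod_topology (component As_S1_semidirect_S1 n) (component As_S1_semidirect_S1 m))
    (component As_S1_semidirect_S1 (n + m - 1)) (\<lambda>(x, y). pcomp As_S1_semidirect_S1 n m i x y)"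
proof -
  let ?X = "prod_topology (component As_S1_semidirect_S1 n) (component As_S1_semidirect_S1 m)"
  have c1: "continuous_map ?X (component As_S1_semidirect_S1 n) fst" "continuous_map ?X (component As_S1_semidirect_S1 m) snd"
    by (rule continuous_map_fst continuous_map_snd)+
  have P: "continuous_map ?X (product_topology (\<lambda>_. circle) {1..<n}) (\<lambda>w. fst (fst w))"
    "continuous_map ?X (product_topology (\<lambda>_. circle) {1..n}) (\<lambda>w. snd (fst w))"
    "continuous_map ?X (product_topology (\<lambda>_. circle) {1..<m}) (\<lambda>w. fst (snd w))"
    "continuous_map ?X (product_topology (\<lambda>_. circle) {1..m}) (\<lambda>w. snd (snd w))"
    using continuous_map_compose[OF c1(1)[unfolded component_As_S1_semidirect_S1] continuous_map_fst]
      continuous_map_compose[OF c1(1)[unfolded component_As_S1_semidirect_S1] continuous_map_snd]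
      continuous_map_compose[OF c1(2)[unfolded component_As_S1_semidirect_S1] continuous_map_fst]
      continuous_map_compose[OF c1(2)[unfolded component_As_S1_semidirect_S1] continuous_map_snd]
    by (simp_all add: o_def component_As_S1_semidirect_S1)
  have C: "k \<in> {1..<n} \<Longrightarrow> continuous_map ?X circle (\<lambda>w. fst (fst w) k)"
    "k \<in> {1..n} \<Longrightarrow> continuous_map ?X circle (\<lambda>w. snd (fst w) k)"
    "k \<in> {1..<m} \<Longrightarrow> continuous_map ?X circle (\<lambda>w. fst (snd w) k)"
    "k \<in> {1..m} \<Longrightarrow> continuous_map ?X circle (\<lambda>w. snd (snd w) k)" for k
    using P by (auto dest: continuous_map_product_then_coordinatewise(1))
  have i1: "1 \<le> i" using i by simp
  have "(\<lambda>(x, y). pcomp As_S1_semidirect_S1 n m i x y) = (\<lambda>w.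
    (\<lambda>k\<in>{1..<n + m - 1}. if k < i then fst (fst w) k else if k < i + m - 1 then snd (fst w) i * fst (snd w) (k + 1 - i) else fst (fst w) (k - (m - 1)),
     \<lambda>k\<in>{1..n + m - 1}. if k < i then snd (fst w) k else if k < i + m then snd (fst w) i * snd (snd w) (k + 1 - i) else snd (fst w) (k - (m - 1))))"
    using pcomp_semidirect[OF m i1] by (auto simp: fun_eq_iff split: prod.split)
  moreover have "continuous_map ?X circle (\<lambda>w. if k < i then fst (fst w) k else if k < i + m - 1 then snd (fst w) i * fst (snd w) (k + 1 - i) else fst (fst w) (k - (m - 1)))"
    if "k \<in> {1..<n + m - 1}" for k
  proof -
    consider "k < i" | "\<not> k < i" "k < i + m - 1" | "\<not> k < i" "\<not> k < i + m - 1" by blast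
    then show ?thesis
    proof cases
      case 1
      then show ?thesis using C(1)[of k] that i by simp
    next
      case 2
      then have "k + 1 - i \<in> {1..<m}" by auto
      from continuous_map_circle_mult[OF C(2)[OF i] C(3)[OF this]] show ?thesis
        using 2 by (simp only: if_True if_False)
    next
      case 3
      then have "k - (m - 1) \<in> {1..<n}" using that i m by auto
      from C(1)[OF this] show ?thesis using 3 by (simp only: if_False)
    qed
  qed
  moreover have "continuous_map ?X circle (\<lambda>w. if k < i then snd (fst w) k else if k < i + m then snd (fst w) i * snd (snd w) (k + 1 - i) else snd (fst w) (k - (m - 1)))"
    if "k \<in> {1..n + m - 1}" for k
  proof -
    consider "k < i" | "\<not> k < i" "k < i + m" | "\<not> k < i" "\<not> k < i + m" by blast
    then show ?thesis
    proof cases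
      case 1
      then show ?thesis using C(2)[of k] that i by simp
    next
      case 2
      then have "k + 1 - i \<in> {1..m}" by auto
      from continuous_map_circle_mult[OF C(2)[OF i] C(4)[OF this]] show ?thesis
        using 2 by (simp only: if_True if_False)
    next
      case 3
      then have "k - (m - 1) \<in> {1..n}" using that i m by auto
      from C(2)[OF this] show ?thesis using 3 by (simp only: if_False)
    qed
  qed
  ultimately show ?thesis
    unfolding component_As_S1_semidirect_S1[of "n + m - 1"]
    by (simp only:) (intro continuous_map_pairedI continuous_map_restrict, blast+)
qed

lemma ns_top_operad_semidirect: "ns_top_operad As_S1_semidirect_S1"
  unfolding ns_top_operad_def
  using continuous_map_semidirect semidirect_assoc semidirect_commute by blast

lemma continuous_map_pos_comp:
  assumes n: "2 \<le> n" and m: "2 \<le> m" and i: "i \<in> {1..n}"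
  shows "continuous_map (prod_topology (top_of_set (pos_systems (n - 1))) (top_of_set (pos_systems (m - 1))))
    (top_of_set (pos_systems (n + m - 1 - 1))) (\<lambda>w. pos_comp n m i (fst w) (snd w))"
proof -
  let ?X = "prod_topology (top_of_set (pos_systems (n - 1))) (top_of_set (pos_systems (m - 1)))"
  interpret block n m i using assms by unfold_locales auto
  have "continuous_map ?X euclidean fst" "continuous_map ?X euclidean snd"
    using continuous_map_into_fulltopology[OF continuous_map_fst] continuous_map_into_fulltopology[OF continuous_map_snd] by blast+
  then have "continuous_map ?X euclidean (\<lambda>w. fst w p q k)" "continuous_map ?X euclidean (\<lambda>w. snd w p q k)" for p q k
    by (simp_all only: continuous_map_fun_iff)
  then have "continuous_map ?X euclidean (\<lambda>w. pos_comp n m i (fst w) (snd w) p q k)" for p q k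
    unfolding pos_comp_def
    by (cases "\<not> (1 \<le> p \<and> p \<le> k \<and> k \<le> q \<and> q \<le> n + m - 2)"; cases "i \<le> p \<and> q < i + m - 1"; cases "i \<le> k \<and> k < i + m - 1")
      (simp_all only: if_True if_False simp_thms continuous_map_const topspace_euclidean UNIV_I)
  then have "continuous_map ?X euclidean (\<lambda>w. pos_comp n m i (fst w) (snd w))"
    by (simp only: continuous_map_fun_iff simp_thms)
  then show ?thesis
    using pos_comp_in_pos_systems by (auto simp: continuous_map_in_subtopology)
qed

lemma continuous_map_model_comp:
  assumes n: "2 \<le> n" and m: "2 \<le> m" and i: "i \<in> {1..n}"
  shows "continuous_map (prod_topology (model_space n) (model_space m)) (model_space (n + m - 1))
    (\<lambda>w. model_comp n m i (fst w) (snd w))"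
proof -
  let ?X = "prod_topology (model_space n) (model_space m)"
  have c: "continuous_map ?X (model_space n) fst" "continuous_map ?X (model_space m) snd"
    by (rule continuous_map_fst continuous_map_snd)+
  note c1 = continuous_map_compose[OF c(1)[unfolded model_space_def] continuous_map_fst]
    continuous_map_compose[OF c(2)[unfolded model_space_def] continuous_map_fst]
  note c2 = continuous_map_compose[OF c(1)[unfolded model_space_def] continuous_map_snd]
    continuous_map_compose[OF c(2)[unfolded model_space_def] continuous_map_snd]
  show ?thesis
    using continuous_map_compose[OF continuous_map_pairedI[OF c1] continuous_map_pos_comp[OF assms]]
      continuous_map_compose[OF continuous_map_pairedI[OF c2] continuous_map_semidirect[OF assms]]
    unfolding model_comp_def model_space_def by (intro continuous_map_pairedI) (simp_all add: o_def)
qed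

lemma model_comp_assoc:
  assumes "2 \<le> l" "2 \<le> m" "2 \<le> n" "i \<in> {1..l}" "j \<in> {1..m}"
  shows "model_comp (l + m - 1) n (i + j - 1) (model_comp l m i x y) z =
    model_comp l (m + n - 1) i x (model_comp m n j y z)"
  using pos_comp_assoc[OF assms] semidirect_assoc[OF assms] by (simp add: model_comp_def)

lemma model_comp_commute:
  assumes "2 \<le> l" "2 \<le> m" "2 \<le> n" "i \<in> {1..l}" "k \<in> {i<..l}"
  shows "model_comp (l + m - 1) n (k + m - 1) (model_comp l m i x y) z =
    model_comp (l + n - 1) m i (model_comp l n k x z) y"
  using pos_comp_commute[OF assms] semidirect_commute[OF assms] by (simp add: model_comp_def)

section \<open>Transport to the blow-up and the projection to the tori\<close>

context
  fixes G :: "nat \<Rightarrow> zpoint \<Rightarrow> (nat \<Rightarrow> nat \<Rightarrow> nat \<Rightarrow> real) \<times> (nat \<Rightarrow> complex) \<times> (nat \<Rightarrow> complex)"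
  assumes G: "\<And>n. 2 \<le> n \<Longrightarrow> homeomorphic_maps (model_space n) (Z_space n) (realize n) (G n)"
begin

lemma G_continuous: "2 \<le> n \<Longrightarrow> continuous_map (Z_space n) (model_space n) (G n)"
  and realize_G: "2 \<le> n \<Longrightarrow> z \<in> topspace (Z_space n) \<Longrightarrow> realize n (G n z) = z"
  and G_realize: "2 \<le> n \<Longrightarrow> x \<in> topspace (model_space n) \<Longrightarrow> G n (realize n x) = x"
  using G[of n] by (auto simp: homeomorphic_maps_def)

lemma G_in: "2 \<le> n \<Longrightarrow> z \<in> topspace (Z_space n) \<Longrightarrow> G n z \<in> topspace (model_space n)"
  using continuous_map_image_subset_topspace[OF G_continuous] by blast

lemma realize_in: "2 \<le> n \<Longrightarrow> x \<in> topspace (model_space n) \<Longrightarrow> realize n x \<in> topspace (Z_space n)"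
  using realize_in_Z_points by (simp add: topspace_Z_space)

text \<open>Conjugation by the homeomorphism expresses the composition through the one in product
  coordinates, from which it inherits continuity and the operad identities.\<close>

lemma Z_comp_eq:
  assumes "2 \<le> n" "2 \<le> m" "i \<in> {1..n}" "z \<in> topspace (Z_space n)" "w \<in> topspace (Z_space m)"
  shows "Z_comp n m i z w = realize (n + m - 1) (model_comp n m i (G n z) (G m w))"
    "Z_comp n m i z w \<in> topspace (Z_space (n + m - 1))"
    "G (n + m - 1) (Z_comp n m i z w) = model_comp n m i (G n z) (G m w)"
proof -
  have N: "2 \<le> n + m - 1" using assms by simp
  note r = realize_model_comp[OF assms(1-3) G_in[OF assms(1,4)] G_in[OF assms(2,5)]]
  show eq: "Z_comp n m i z w = realize (n + m - 1) (model_comp n m i (G n z) (G m w))"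
    using r(2) realize_G assms by simp
  show "Z_comp n m i z w \<in> topspace (Z_space (n + m - 1))" unfolding eq by (rule realize_in[OF N r(1)])
  show "G (n + m - 1) (Z_comp n m i z w) = model_comp n m i (G n z) (G m w)" unfolding eq by (rule G_realize[OF N r(1)])
qed

lemma continuous_map_Z_comp:
  assumes n: "2 \<le> n" and m: "2 \<le> m" and i: "i \<in> {1..n}"
  shows "continuous_map (prod_topology (Z_space n) (Z_space m)) (Z_space (n + m - 1)) (\<lambda>(z, w). Z_comp n m i z w)"
proof (rule continuous_map_eq)
  have N: "2 \<le> n + m - 1" using n m by simp
  have "continuous_map (prod_topology (Z_space n) (Z_space m)) (prod_topology (model_space n) (model_space m))
      (\<lambda>(z, w). (G n z, G m w))"
    using G_continuous n m by (simp add: continuous_map_prod_top)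
  from continuous_map_compose[OF continuous_map_compose[OF this continuous_map_model_comp[OF assms]] continuous_map_realize[OF N]]
  show "continuous_map (prod_topology (Z_space n) (Z_space m)) (Z_space (n + m - 1))
      (\<lambda>(z, w). realize (n + m - 1) (model_comp n m i (G n z) (G m w)))"
    by (simp only: o_def case_prod_unfold fst_conv snd_conv)
qed (use Z_comp_eq(1)[OF assms] in auto)

lemma ns_top_operad_Z: "ns_top_operad Z_operad"
proof -
  have N: "2 \<le> n + m - 1" if "2 \<le> n" "2 \<le> m" for n m :: nat using that by simp
  have inj: "z = z'" if "2 \<le> n" "z \<in> topspace (Z_space n)" "z' \<in> topspace (Z_space n)" "G n z = G n z'" for n z z'
    using realize_G that by metis
  have assoc: "Z_comp (l + m - 1) n (i + j - 1) (Z_comp l m i x y) z = Z_comp l (m + n - 1) i x (Z_comp m n j y z)"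
    if h: "2 \<le> l" "2 \<le> m" "2 \<le> n" "x \<in> topspace (Z_space l)" "y \<in> topspace (Z_space m)" "z \<in> topspace (Z_space n)"
      "i \<in> {1..l}" "j \<in> {1..m}" for l m n i j x y z
  proof -
    note 1 = Z_comp_eq[OF h(1,2,7,4,5)] and 2 = Z_comp_eq[OF h(2,3,8,5,6)]
    have ij: "i + j - 1 \<in> {1..l + m - 1}" using h(7,8) by auto
    note L = Z_comp_eq[OF N[OF h(1,2)] h(3) ij 1(2) h(6)] and R = Z_comp_eq[OF h(1) N[OF h(2,3)] h(7,4) 2(2)]
    \<comment> \<open>The two composites are formed in the same arity, written in two ways.\<close>
    have "l + m - 1 + n - 1 = l + (m + n - 1) - 1" using h by simp
    then show ?thesis
      unfolding L(1) R(1) 1(3) 2(3) model_comp_assoc[OF h(1,2,3,7,8)] by simp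
  qed
  have commute: "Z_comp (l + m - 1) n (k + m - 1) (Z_comp l m i x y) z = Z_comp (l + n - 1) m i (Z_comp l n k x z) y"
    if h: "2 \<le> l" "2 \<le> m" "2 \<le> n" "x \<in> topspace (Z_space l)" "y \<in> topspace (Z_space m)" "z \<in> topspace (Z_space n)"
      "i \<in> {1..l}" "k \<in> {i<..l}" for l m n i k x y z
  proof -
    have k: "k \<in> {1..l}" using h(7,8) by auto
    note 1 = Z_comp_eq[OF h(1,2,7,4,5)] and 2 = Z_comp_eq[OF h(1,3) k h(4,6)]
    have ij: "k + m - 1 \<in> {1..l + m - 1}" "i \<in> {1..l + n - 1}" using h by auto
    note L = Z_comp_eq[OF N[OF h(1,2)] h(3) ij(1) 1(2) h(6)] and R = Z_comp_eq[OF N[OF h(1,3)] h(2) ij(2) 2(2) h(5)]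
    have "l + m - 1 + n - 1 = l + n - 1 + m - 1" using h by simp
    then show ?thesis
      unfolding L(1) R(1) 1(3) 2(3) model_comp_commute[OF h(1,2,3,7,8)] by simp
  qed
  show ?thesis
    unfolding ns_top_operad_def Z_operad_def ns_operad.simps
    by (intro conjI allI impI ballI; (rule continuous_map_Z_comp | rule assoc | rule commute); assumption)
qed

text \<open>The torus part of a composite depends only on the torus parts of the factors, so
  forgetting the families respects compositions.\<close>

lemma ns_operad_morphism_G: "ns_operad_morphism Z_operad As_S1_semidirect_S1 (\<lambda>n z. snd (G n z))"
  unfolding ns_operad_morphism_def Z_operad_def ns_operad.simps
proof (intro conjI allI impI ballI)
  fix n :: nat assume "2 \<le> n"
  from continuous_map_compose[OF G_continuous[OF this, unfolded model_space_def] continuous_map_snd]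
  show "continuous_map (Z_space n) (component As_S1_semidirect_S1 n) (\<lambda>z. snd (G n z))" by (simp add: o_def)
next
  fix n m i :: nat and x y
  assume "2 \<le> n" "2 \<le> m" "i \<in> {1..n}" "x \<in> topspace (Z_space n)" "y \<in> topspace (Z_space m)"
  from Z_comp_eq(3)[OF this]
  show "snd (G (n + m - 1) (Z_comp n m i x y)) = pcomp As_S1_semidirect_S1 n m i (snd (G n x)) (snd (G m y))"
    by (simp add: model_comp_def)
qed

lemma homotopy_equivalence_map_G:
  assumes n: "2 \<le> n"
  shows "homotopy_equivalence_map (Z_space n) (component As_S1_semidirect_S1 n) (\<lambda>z. snd (G n z))"
proof -
  let ?K = "top_of_set (pos_systems (n - 1))" and ?T = "component As_S1_semidirect_S1 n"
  obtain \<mu> where contr: "homotopic_with (\<lambda>_. True) ?K ?K id (\<lambda>_. \<mu>)"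
    using contractible_pos_systems[of "n - 1"] unfolding contractible_space_def by blast
  \<comment> \<open>The contraction ends in a constant map, whose value lies in the space because
    the space is not empty.\<close>
  have \<mu>: "\<mu> \<in> pos_systems (n - 1)"
    using homotopic_with_imp_continuous_maps[OF contr, THEN conjunct2, THEN continuous_map_image_subset_topspace]
      pos_systems_nonempty[of "n - 1"] by auto
  have M: "model_space n = prod_topology ?K ?T" by (simp add: model_space_def)
  have sec: "continuous_map ?T (model_space n) (\<lambda>t. (\<mu>, t))"
    unfolding M using \<mu> by (intro continuous_map_pairedI) (auto simp: continuous_map_const)
  note fc = ns_operad_morphism_G[unfolded ns_operad_morphism_def Z_operad_def ns_operad.simps, THEN conjunct1, rule_format, OF n]
  have gc: "continuous_map ?T (Z_space n) (\<lambda>t. realize n (\<mu>, t))"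
    using continuous_map_compose[OF sec continuous_map_realize[OF n]] by (simp add: o_def)
  have "homotopic_with (\<lambda>_. True) (prod_topology ?K ?T) (prod_topology ?K ?T)
      (\<lambda>z. (id (fst z), id (snd z))) (\<lambda>z. ((\<lambda>_. \<mu>) (fst z), id (snd z)))"
    by (rule homotopic_with_prod_topology[OF contr, where q = "\<lambda>_. True"]) auto
  then have h: "homotopic_with (\<lambda>_. True) (model_space n) (model_space n) id (\<lambda>z. (\<mu>, snd z))"
    by (simp add: M id_def)
  have "homotopic_with (\<lambda>_. True) (model_space n) (Z_space n) (realize n \<circ> id) (realize n \<circ> (\<lambda>z. (\<mu>, snd z)))"
    by (rule homotopic_with_compose_continuous_map_left[OF h continuous_map_realize[OF n]]) auto
  then have "homotopic_with (\<lambda>_. True) (Z_space n) (Z_space n)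
      ((realize n \<circ> id) \<circ> G n) ((realize n \<circ> (\<lambda>z. (\<mu>, snd z))) \<circ> G n)"
    by (rule homotopic_with_compose_continuous_map_right[OF _ G_continuous[OF n]]) auto
  then have "homotopic_with (\<lambda>_. True) (Z_space n) (Z_space n) id ((\<lambda>t. realize n (\<mu>, t)) \<circ> (\<lambda>z. snd (G n z)))"
    by (rule homotopic_with_eq) (auto simp: realize_G[OF n])
  then have 1: "homotopic_with (\<lambda>_. True) (Z_space n) (Z_space n) ((\<lambda>t. realize n (\<mu>, t)) \<circ> (\<lambda>z. snd (G n z))) id"
    by (rule homotopic_with_symD)
  have "((\<lambda>z. snd (G n z)) \<circ> (\<lambda>t. realize n (\<mu>, t))) t = id t" if "t \<in> topspace ?T" for t
    using G_realize[OF n, of "(\<mu>, t)"] \<mu> that by (simp add: M)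
  then have 2: "homotopic_with (\<lambda>_. True) ?T ?T ((\<lambda>z. snd (G n z)) \<circ> (\<lambda>t. realize n (\<mu>, t))) id"
    using continuous_map_compose[OF gc fc] by (intro homotopic_with_equal) auto
  show ?thesis unfolding homotopy_equivalence_map_def using fc gc 1 2 by blast
qed

end

theorem proposition7p4p2:
  shows "homotopy_equivalent_ns_operads Z_operad As_S1_semidirect_S1"
proof -
  have "\<forall>n. \<exists>g. 2 \<le> n \<longrightarrow> homeomorphic_maps (model_space n) (Z_space n) (realize n) g"
    using homeomorphic_map_realize homeomorphic_map_maps by blast
  then obtain G where G: "\<And>n. 2 \<le> n \<Longrightarrow> homeomorphic_maps (model_space n) (Z_space n) (realize n) (G n)"
    by metis
  have "component Z_operad n = Z_space n" for n by (simp add: Z_operad_def)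
  then have "ns_operad_weq Z_operad As_S1_semidirect_S1"
    unfolding ns_operad_weq_def
    using ns_top_operad_Z[OF G] ns_top_operad_semidirect ns_operad_morphism_G[OF G] homotopy_equivalence_map_G[OF G]
    by metis
  \<comment> \<open>The zigzag consists of this one morphism.\<close>
  then have "ns_operad_weq_step (Inl Z_operad) (Inr As_S1_semidirect_S1)" by simp
  then show ?thesis
    unfolding homotopy_equivalent_ns_operads_def
    using ns_top_operad_Z[OF G] ns_top_operad_semidirect by (simp add: r_into_equivclp)
qed

end
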